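(* Let $A$ be a non-degenerately based $\mathrm{D}^{\mathrm{fr}_V}_V$-algebra in $G$-spaces that is $G$-connected, and let $H\subset G$ be a subgroup. Then $$\int_{G/H\times V}A\simeq\mathrm{Map}_*(G/H_+,A).$$ Therefore $\Big(\displaystyle\int_{G/H\times V}A\Big)^G\simeq A^H$.
   Context: Throughout, $G$ is a finite group and $V$ is an $n$-dimensional orthogonal $G$-representation. $\mathrm{Map}_*$ is the space of nonequivariant based maps with $G$ acting by conjugation; $G/H_+$ is $G/H$ with a disjoint base point. The first $\simeq$ is weak $G$-equivalence (weak equivalence on all fixed point spaces). A $G$-space $X$ is $G$-connected if $X^K$ is connected for all $K\subset G$. "Non-degenerately based" means the structure map $\mathscr{D}_V^{\mathrm{fr}_V}(0)=*\to A$ is a non-degenerate base point. $V$-framed embeddings. A smooth $G$-manifold $M$ is $V$-framed if it has a $G$-equivariant trivialization $\mathrm{T}M\cong M\times V$, equivalently a $G$-equivariant vector bundle map (fiberwise linear isomorphism) $\phi_M:\mathrm{T}M\to V$ with $V$ a bundle over a point. $V$, $\amalg_kV$ and $G/H\times V$ have canonical $V$-framings. $\mathrm{Hom}(E_1,E_2)$ is the space of nonequivariant vector bundle maps with conjugation $G$-action. An element of the $G$-space $\mathrm{Emb}^{\mathrm{fr}_V}(M,N)$ is a pair $(f,\alpha)$ of a smooth embedding $f:M\to N$ and a Moore path $\alpha$ in $\mathrm{Hom}(\mathrm{T}M,V)$ from $\phi_M$ to $\phi_N\circ df$ (with locally constant length). Composition is $(g,\beta)\circ(f,\alpha)=(g\circ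 f,\alpha\text{ followed by }\beta\circ df)$. Factorization homology. Put $\mathscr{D}_M^{\mathrm{fr}_V}(k)=\mathrm{Emb}^{\mathrm{fr}_V}(\amalg_kV,M)$. Then $\mathscr{D}_V^{\mathrm{fr}_V}$ is a reduced $G$-operad and $\mathscr{D}_M^{\mathrm{fr}_V}$ a right module over it. For a based $G$-space $X$, $\mathrm{D}_M^{\mathrm{fr}_V}(X)=\big(\coprod_{k\ge0}\mathscr{D}_M^{\mathrm{fr}_V}(k)\times_{\Sigma_k}X^k\big)/\sim$, where $\sim$ forgets any copy of $V$ labelled by the base point. $\mathrm{D}_V^{\mathrm{fr}_V}$ is a monad and $\mathrm{D}_M^{\mathrm{fr}_V}$ is a right module over it. $\int_MA=\mathrm{B}(\mathrm{D}_M^{\mathrm{fr}_V},\mathrm{D}_V^{\mathrm{fr}_V},A)$ is the realization of the two-sided monadic bar construction, with $q$-simplices $\mathrm{D}_M^{\mathrm{fr}_V}(\mathrm{D}_V^{\mathrm{fr}_V})^qA$. *)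

theory Defs
  imports
    "HOL-Algebra.Group_Action"
    "HOL-Algebra.Left_Coset"
    "HOL-Analysis.Analysis"
    "HOL-Homology.Homology"
begin

section \<open>Compactly generated weak Hausdorff spaces\<close>

text \<open>
  Every space lives in the category of compactly generated weak Hausdorff spaces.  The test sets
  are the compact \<^emph>\<open>Hausdorff\<close> subspaces; the library's \<^const>\<open>kification\<close> tests on all compact
  subspaces and gives a different notion on non-Hausdorff spaces (for instance on the one-point
  compactification of the rationals).  In a weak Hausdorff space the image of a map out of a
  compact Hausdorff space is a compact Hausdorff subspace, so testing on subspaces is the same as
  testing on maps.
\<close>

definition kify :: "'a topology \<Rightarrow> 'a topology" where
  "kify X = topology (\<lambda>U. U \<subseteq> topspace X \<and>
     (\<forall>C. compactin X C \<and> Hausdorff_space (subtopology X C) \<longrightarrow>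
          openin (subtopology X C) (C \<inter> U)))"

text \<open>
  In the next definition the restriction of the test spaces \<open>K\<close> to the type \<^typ>\<open>'a set set\<close> loses
  nothing.  If \<open>K\<close> is any compact Hausdorff space, choose a subset \<open>S\<close> of \<open>K\<close> that \<open>u\<close> maps
  bijectively onto \<open>u ` K\<close>; the closure of \<open>S\<close> is compact Hausdorff, has the same image as \<open>K\<close>, and
  has at most \<open>2 ^ 2 ^ |S|\<close> points.
\<close>

definition weak_Hausdorff :: "'a topology \<Rightarrow> bool" where
  "weak_Hausdorff X \<longleftrightarrow>
     (\<forall>(K :: 'a set set topology) u. compact_space K \<and> Hausdorff_space K \<and> continuous_map K X u
        \<longrightarrow> closedin X (u ` topspace K))"

definition CGWH :: "'a topology \<Rightarrow> bool" where
  "CGWH X \<longleftrightarrow> kify X = X \<and> weak_Hausdorff X"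

definition kprod :: "'a topology \<Rightarrow> 'b topology \<Rightarrow> ('a \<times> 'b) topology" where
  "kprod X Y = kify (prod_topology X Y)"

definition kpower :: "'a topology \<Rightarrow> nat \<Rightarrow> (nat \<Rightarrow> 'a) topology" where
  "kpower X k = kify (product_topology (\<lambda>_. X) {..<k})"

definition map_space :: "'a topology \<Rightarrow> 'b topology \<Rightarrow> ('a \<Rightarrow> 'b) topology" where
  "map_space X Y = kify (topology_generated_by
     {{f \<in> extensional (topspace X). continuous_map X Y f \<and> f ` K \<subseteq> U} | K U.
        compactin X K \<and> openin Y U})"

definition final_topology :: "'a topology \<Rightarrow> ('a \<Rightarrow> 'b) \<Rightarrow> 'b topology" where
  "final_topology X f =
     topology (\<lambda>U. U \<subseteq> f ` topspace X \<and> openin X {x \<in> topspace X. f x \<in> U})"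

lemma openin_kify:
  "openin (kify X) U \<longleftrightarrow> U \<subseteq> topspace X \<and>
     (\<forall>C. compactin X C \<and> Hausdorff_space (subtopology X C) \<longrightarrow> openin (subtopology X C) (C \<inter> U))"
proof -
  have "istopology (\<lambda>U. U \<subseteq> topspace X \<and>
     (\<forall>C. compactin X C \<and> Hausdorff_space (subtopology X C) \<longrightarrow>
          openin (subtopology X C) (C \<inter> U)))"
    unfolding istopology_def
  proof (intro conjI strip)
    fix S T :: "'a set" and C
    assume S: "S \<subseteq> topspace X \<and> (\<forall>C. compactin X C \<and> Hausdorff_space (subtopology X C) \<longrightarrow>
          openin (subtopology X C) (C \<inter> S))"
      and T: "T \<subseteq> topspace X \<and> (\<forall>C. compactin X C \<and> Hausdorff_space (subtopology X C) \<longrightarrow>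
          openin (subtopology X C) (C \<inter> T))"
    show "S \<inter> T \<subseteq> topspace X" using S by blast
    assume "compactin X C \<and> Hausdorff_space (subtopology X C)"
    then have "openin (subtopology X C) ((C \<inter> S) \<inter> (C \<inter> T))" using S T by blast
    then show "openin (subtopology X C) (C \<inter> (S \<inter> T))"
      by (simp add: Int_ac)
  next
    fix \<K> :: "'a set set" and C
    assume K: "\<forall>U\<in>\<K>. U \<subseteq> topspace X \<and>
      (\<forall>C. compactin X C \<and> Hausdorff_space (subtopology X C) \<longrightarrow>
          openin (subtopology X C) (C \<inter> U))"
    then show "\<Union>\<K> \<subseteq> topspace X" by blast
    assume "compactin X C \<and> Hausdorff_space (subtopology X C)"
    with K show "openin (subtopology X C) (C \<inter> \<Union>\<K>)" unfolding Int_Union by blast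
  qed
  then show ?thesis by (simp add: kify_def topology_inverse')
qed

lemma openin_final_topology:
  "openin (final_topology X f) U \<longleftrightarrow>
     U \<subseteq> f ` topspace X \<and> openin X {x \<in> topspace X. f x \<in> U}"
proof -
  have 1: "{x \<in> topspace X. f x \<in> S \<inter> T} =
      {x \<in> topspace X. f x \<in> S} \<inter> {x \<in> topspace X. f x \<in> T}" for S T by blast
  have 2: "{x \<in> topspace X. f x \<in> \<Union>\<K>} = (\<Union>S\<in>\<K>. {x \<in> topspace X. f x \<in> S})" for \<K> by blast
  have "istopology (\<lambda>U. U \<subseteq> f ` topspace X \<and> openin X {x \<in> topspace X. f x \<in> U})"
    unfolding istopology_def 1 2 by blast
  then show ?thesis by (simp add: final_topology_def topology_inverse')
qed

text \<open>
  A quotient space is carried by a chosen representative of each class rather than by the classes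
  themselves, so that the quotient has the same type as the original space.  \<open>R\<close> is a generating
  relation; the equivalence relation is \<^term>\<open>equiv_hull R\<close>.
\<close>

definition equiv_hull :: "('a \<times> 'a) set \<Rightarrow> ('a \<times> 'a) set" where
  "equiv_hull R = (R \<union> R\<inverse>)\<^sup>*"

definition class_rep :: "('a \<times> 'a) set \<Rightarrow> 'a \<Rightarrow> 'a" where
  "class_rep R x = (SOME y. y \<in> equiv_hull R `` {x})"

definition quotient_space :: "'a topology \<Rightarrow> ('a \<times> 'a) set \<Rightarrow> 'a topology" where
  "quotient_space X R = final_topology X (class_rep R)"


section \<open>G-spaces and weak equivalences\<close>

definition G_space :: "('g, 'm) monoid_scheme \<Rightarrow> 'a topology \<Rightarrow> ('g \<Rightarrow> 'a \<Rightarrow> 'a) \<Rightarrow> bool" where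
  "G_space G X act \<longleftrightarrow>
     group_action G (topspace X) (\<lambda>g. restrict (act g) (topspace X)) \<and>
     (\<forall>g\<in>carrier G. continuous_map X X (act g))"

definition fixed_points :: "'g set \<Rightarrow> 'a topology \<Rightarrow> ('g \<Rightarrow> 'a \<Rightarrow> 'a) \<Rightarrow> 'a topology" where
  "fixed_points K X act = subtopology X {x \<in> topspace X. \<forall>g\<in>K. act g x = x}"

definition equivariant_on ::
    "('g, 'm) monoid_scheme \<Rightarrow> 'a set \<Rightarrow> ('g \<Rightarrow> 'a \<Rightarrow> 'a) \<Rightarrow> ('g \<Rightarrow> 'b \<Rightarrow> 'b) \<Rightarrow> ('a \<Rightarrow> 'b) \<Rightarrow> bool" where
  "equivariant_on G S actX actY f \<longleftrightarrow> (\<forall>g\<in>carrier G. \<forall>x\<in>S. f (actX g x) = actY g (f x))"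

definition cube :: "nat \<Rightarrow> (nat \<Rightarrow> real) topology" where
  "cube n = product_topology (\<lambda>_. top_of_set {0..1}) {..<n}"

definition cube_boundary :: "nat \<Rightarrow> (nat \<Rightarrow> real) set" where
  "cube_boundary n = {t \<in> topspace (cube n). \<exists>i<n. t i = 0 \<or> t i = 1}"

text \<open>
  \<^term>\<open>cube_boundary 0\<close> is empty, so \<open>homotopy_set 0 X x\<close> is the set of path components of \<open>X\<close>
  whatever \<open>x\<close> is.
\<close>

definition cube_maps :: "nat \<Rightarrow> 'a topology \<Rightarrow> 'a \<Rightarrow> ((nat \<Rightarrow> real) \<Rightarrow> 'a) set" where
  "cube_maps n X x = {\<alpha>. continuous_map (cube n) X \<alpha> \<and> \<alpha> ` cube_boundary n \<subseteq> {x}}"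

definition cube_homotopic ::
    "nat \<Rightarrow> 'a topology \<Rightarrow> 'a \<Rightarrow> (((nat \<Rightarrow> real) \<Rightarrow> 'a) \<times> ((nat \<Rightarrow> real) \<Rightarrow> 'a)) set" where
  "cube_homotopic n X x = {(\<alpha>, \<beta>). \<alpha> \<in> cube_maps n X x \<and> \<beta> \<in> cube_maps n X x \<and>
     homotopic_with (\<lambda>\<gamma>. \<gamma> ` cube_boundary n \<subseteq> {x}) (cube n) X \<alpha> \<beta>}"

definition homotopy_set :: "nat \<Rightarrow> 'a topology \<Rightarrow> 'a \<Rightarrow> ((nat \<Rightarrow> real) \<Rightarrow> 'a) set set" where
  "homotopy_set n X x = cube_maps n X x // cube_homotopic n X x"

definition homotopy_set_map ::
    "nat \<Rightarrow> 'b topology \<Rightarrow> ('a \<Rightarrow> 'b) \<Rightarrow> 'a \<Rightarrow> ((nat \<Rightarrow> real) \<Rightarrow> 'a) set \<Rightarrow> ((nat \<Rightarrow> real) \<Rightarrow> 'b) set"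
  where "homotopy_set_map n Y f x c = (\<Union>\<alpha>\<in>c. cube_homotopic n Y (f x) `` {f \<circ> \<alpha>})"

text \<open>For \<open>n \<ge> 1\<close> the induced map is a homomorphism, so bijective means isomorphism.\<close>

definition weak_equivalence :: "'a topology \<Rightarrow> 'b topology \<Rightarrow> ('a \<Rightarrow> 'b) \<Rightarrow> bool" where
  "weak_equivalence X Y f \<longleftrightarrow> continuous_map X Y f \<and>
     (\<forall>n x. n = 0 \<or> x \<in> topspace X \<longrightarrow>
        bij_betw (homotopy_set_map n Y f x) (homotopy_set n X x) (homotopy_set n Y (f x)))"

definition weak_G_equivalence ::
    "('g, 'm) monoid_scheme \<Rightarrow> 'a topology \<Rightarrow> ('g \<Rightarrow> 'a \<Rightarrow> 'a) \<Rightarrow> 'b topology \<Rightarrow> ('g \<Rightarrow> 'b \<Rightarrow> 'b)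
      \<Rightarrow> ('a \<Rightarrow> 'b) \<Rightarrow> bool" where
  "weak_G_equivalence G X actX Y actY f \<longleftrightarrow>
     continuous_map X Y f \<and> equivariant_on G (topspace X) actX actY f \<and>
     (\<forall>K. subgroup K G \<longrightarrow> weak_equivalence (fixed_points K X actX) (fixed_points K Y actY) f)"

text \<open>
  Two spaces are weakly equivalent if they are connected by a zigzag of weak equivalences.  Since a
  zigzag cannot range over all types, we ask for a span \<open>X \<leftarrow> Z \<rightarrow> Y\<close>, where the points of \<open>Z\<close>
  have the type of the points \<open>(p, \<sigma>, t)\<close> of the realization of the singular complex of \<open>X\<close>.
  This excludes nothing: \<open>|Sing X| \<rightarrow> X\<close> is a natural weak equivalence from a \<open>G\<close>-CW complex, so
  by the equivariant Whitehead theorem it lifts along every zigzag from \<open>X\<close> to \<open>Y\<close>.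
\<close>

type_synonym 'a sing_point = "nat \<times> ((nat \<Rightarrow> real) \<Rightarrow> 'a) \<times> (nat \<Rightarrow> real)"

definition weakly_equivalent :: "'a topology \<Rightarrow> 'b topology \<Rightarrow> bool" where
  "weakly_equivalent X Y \<longleftrightarrow>
     (\<exists>(Z :: 'a sing_point topology) p q. weak_equivalence Z X p \<and> weak_equivalence Z Y q)"

definition weakly_G_equivalent ::
    "('g, 'm) monoid_scheme \<Rightarrow> 'a topology \<Rightarrow> ('g \<Rightarrow> 'a \<Rightarrow> 'a) \<Rightarrow> 'b topology \<Rightarrow> ('g \<Rightarrow> 'b \<Rightarrow> 'b)
      \<Rightarrow> bool" where
  "weakly_G_equivalent G X actX Y actY \<longleftrightarrow>
     (\<exists>(Z :: 'a sing_point topology) actZ p q. G_space G Z actZ \<and>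
        weak_G_equivalence G Z actZ X actX p \<and> weak_G_equivalence G Z actZ Y actY q)"

definition G_connected :: "('g, 'm) monoid_scheme \<Rightarrow> 'a topology \<Rightarrow> ('g \<Rightarrow> 'a \<Rightarrow> 'a) \<Rightarrow> bool" where
  "G_connected G X act \<longleftrightarrow> (\<forall>K. subgroup K G \<longrightarrow> connected_space (fixed_points K X act))"

text \<open>The pair \<open>(X, a)\<close> is an equivariant NDR pair.\<close>

definition nondegenerate_base ::
    "('g, 'm) monoid_scheme \<Rightarrow> 'a topology \<Rightarrow> ('g \<Rightarrow> 'a \<Rightarrow> 'a) \<Rightarrow> 'a \<Rightarrow> bool" where
  "nondegenerate_base G X act a \<longleftrightarrow>
     a \<in> topspace X \<and> (\<forall>g\<in>carrier G. act g a = a) \<and>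
     (\<exists>(u :: 'a \<Rightarrow> real) h.
        continuous_map X (top_of_set {0..1}) u \<and>
        {x \<in> topspace X. u x = 0} = {a} \<and>
        (\<forall>g\<in>carrier G. \<forall>x\<in>topspace X. u (act g x) = u x) \<and>
        continuous_map (prod_topology X (top_of_set {0..1::real})) X h \<and>
        (\<forall>g\<in>carrier G. \<forall>x\<in>topspace X. \<forall>t\<in>{0..1}. h (act g x, t) = act g (h (x, t))) \<and>
        (\<forall>x\<in>topspace X. h (x, 0) = x) \<and>
        (\<forall>t\<in>{0..1}. h (a, t) = a) \<and>
        (\<forall>x\<in>topspace X. u x < 1 \<longrightarrow> h (x, 1) = a))"


section \<open>Framed embeddings\<close>

text \<open>
  The representation is a linear subspace \<open>V\<close> of some Euclidean space, so that \<open>V = 0\<close> is included.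
\<close>

definition orthogonal_rep ::
    "('g, 'm) monoid_scheme \<Rightarrow> 'v::euclidean_space set \<Rightarrow> ('g \<Rightarrow> 'v \<Rightarrow> 'v) \<Rightarrow> bool" where
  "orthogonal_rep G V \<rho> \<longleftrightarrow> subspace V \<and> group_action G V (\<lambda>g. restrict (\<rho> g) V) \<and>
     (\<forall>g\<in>carrier G. \<exists>T. orthogonal_transformation T \<and> (\<forall>v\<in>V. \<rho> g v = T v))"

text \<open>
  The manifolds that occur are \<open>V\<close>, \<open>\<amalg>\<^sub>k V\<close> and \<open>G/H \<times> V\<close>, all of the form \<open>I \<times> V\<close> with \<open>I\<close> a
  finite discrete \<open>G\<close>-set: \<open>I = {()}\<close>, \<open>I = {..<k}\<close> with trivial action, and \<open>I = G/H\<close>.  The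
  tangent bundle of \<open>I \<times> V\<close> is \<open>(I \<times> V) \<times> V\<close>, and the canonical framing is the second projection.
\<close>

definition mfd :: "'v::euclidean_space set \<Rightarrow> 'i set \<Rightarrow> ('i \<times> 'v) topology" where
  "mfd V I = prod_topology (discrete_topology I) (top_of_set V)"

definition tangent :: "'v::euclidean_space set \<Rightarrow> 'i set \<Rightarrow> (('i \<times> 'v) \<times> 'v) topology" where
  "tangent V I = prod_topology (mfd V I) (top_of_set V)"

definition framing :: "'v::euclidean_space set \<Rightarrow> 'i set \<Rightarrow> ('i \<times> 'v) \<times> 'v \<Rightarrow> 'v" where
  "framing V I = restrict snd ((I \<times> V) \<times> V)"

definition dir_deriv :: "'v::euclidean_space \<Rightarrow> ('v \<Rightarrow> 'v) \<Rightarrow> 'v \<Rightarrow> 'v" where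
  "dir_deriv v f x = vector_derivative (\<lambda>t. f (x + t *\<^sub>R v)) (at 0)"

text \<open>\<open>fold dir_deriv vs f\<close> is the iterated directional derivative of \<open>f\<close> along the list \<open>vs\<close>.\<close>

definition smooth_on_subspace :: "'v::euclidean_space set \<Rightarrow> ('v \<Rightarrow> 'v) \<Rightarrow> bool" where
  "smooth_on_subspace V f \<longleftrightarrow> (\<forall>vs\<in>lists V. continuous_on V (fold dir_deriv vs f) \<and>
     (\<forall>x\<in>V. \<forall>v\<in>V. (\<lambda>t. fold dir_deriv vs f (x + t *\<^sub>R v)) differentiable (at (0::real))))"

definition differential ::
    "('i \<times> 'v::euclidean_space \<Rightarrow> 'j \<times> 'v) \<Rightarrow> ('i \<times> 'v) \<times> 'v \<Rightarrow> ('j \<times> 'v) \<times> 'v" where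
  "differential f = (\<lambda>((i, x), w). (f (i, x), dir_deriv w (\<lambda>y. snd (f (i, y))) x))"

definition smooth_embedding ::
    "'v::euclidean_space set \<Rightarrow> 'i set \<Rightarrow> 'j set \<Rightarrow> ('i \<times> 'v \<Rightarrow> 'j \<times> 'v) \<Rightarrow> bool" where
  "smooth_embedding V I J f \<longleftrightarrow>
     embedding_map (mfd V I) (mfd V J) f \<and> continuous_map (mfd V I) (mfd V J) f \<and>
     (\<forall>i\<in>I. smooth_on_subspace V (\<lambda>x. snd (f (i, x)))) \<and>
     (\<forall>i\<in>I. \<forall>x\<in>V. inj_on (\<lambda>w. snd (differential f ((i, x), w))) V)"

text \<open>
  The compact-open \<open>C\<^sup>\<infinity>\<close> topology: all iterated derivatives converge uniformly on compact sets.
\<close>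

definition emb_space ::
    "'v::euclidean_space set \<Rightarrow> 'i set \<Rightarrow> 'j set \<Rightarrow> ('i \<times> 'v \<Rightarrow> 'j \<times> 'v) topology" where
  "emb_space V I J = kify (pullback_topology
     {f \<in> extensional (I \<times> V). smooth_embedding V I J f}
     (\<lambda>f. (f, \<lambda>vs\<in>lists V. \<lambda>(i, x)\<in>I \<times> V. fold dir_deriv vs (\<lambda>y. snd (f (i, y))) x))
     (prod_topology (map_space (mfd V I) (mfd V J))
        (product_topology (\<lambda>_. map_space (mfd V I) (top_of_set V)) (lists V))))"

text \<open>Bundle maps, fibrewise linear isomorphisms, from the tangent bundle of \<open>I \<times> V\<close> to \<open>V\<close>.\<close>

definition hom_space ::
    "'v::euclidean_space set \<Rightarrow> 'i set \<Rightarrow> (('i \<times> 'v) \<times> 'v \<Rightarrow> 'v) topology" where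
  "hom_space V I = subtopology (map_space (tangent V I) (top_of_set V))
     {T. \<forall>m\<in>I \<times> V. \<exists>L. linear L \<and> (\<forall>w\<in>V. T (m, w) = L w) \<and> bij_betw L V V}"

text \<open>
  A framed embedding is a triple \<open>(f, l, \<alpha>)\<close>: the embedding, the length of the Moore path over each
  component \<open>{i} \<times> V\<close> of the source, and the Moore path, defined for all times \<open>t \<ge> 0\<close> and constant
  over \<open>{i} \<times> V\<close> from time \<open>l i\<close> on.
\<close>

type_synonym ('i, 'v, 'j) fr_emb =
  "('i \<times> 'v \<Rightarrow> 'j \<times> 'v) \<times> ('i \<Rightarrow> real) \<times> (real \<Rightarrow> ('i \<times> 'v) \<times> 'v \<Rightarrow> 'v)"

definition fr_emb_space ::
    "'v::euclidean_space set \<Rightarrow> 'i set \<Rightarrow> 'j set \<Rightarrow> ('i, 'v, 'j) fr_emb topology" where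
  "fr_emb_space V I J = kify (subtopology
     (prod_topology (emb_space V I J)
        (prod_topology (product_topology (\<lambda>_. top_of_set {0..}) I)
           (map_space (top_of_set {0..}) (hom_space V I))))
     {(f, l, \<alpha>). \<alpha> 0 = framing V I \<and>
        (\<forall>i\<in>I. \<forall>t\<ge>l i. \<forall>x\<in>V. \<forall>w\<in>V.
            \<alpha> t ((i, x), w) = framing V J (differential f ((i, x), w)))})"

definition fr_emb_comp ::
    "'v::euclidean_space set \<Rightarrow> 'i set \<Rightarrow> ('j, 'v, 'k) fr_emb \<Rightarrow> ('i, 'v, 'j) fr_emb
      \<Rightarrow> ('i, 'v, 'k) fr_emb" where
  "fr_emb_comp V I = (\<lambda>(g, m, \<beta>) (f, l, \<alpha>).
     (restrict (g \<circ> f) (I \<times> V),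
      \<lambda>i\<in>I. l i + m (fst (f (i, 0))),
      \<lambda>t\<in>{0..}. \<lambda>((i, x), w)\<in>(I \<times> V) \<times> V.
        if t \<le> l i then \<alpha> t ((i, x), w) else \<beta> (t - l i) (differential f ((i, x), w))))"

definition fr_emb_id :: "'v::euclidean_space set \<Rightarrow> (nat, 'v, unit) fr_emb" where
  "fr_emb_id V = (\<lambda>(i, x)\<in>{..<1} \<times> V. ((), x), \<lambda>i\<in>{..<1}. 0, \<lambda>t\<in>{0..}. framing V {..<1})"

text \<open>
  The action of \<open>g\<close> by conjugation, for a source \<open>I \<times> V\<close> with \<open>G\<close> acting trivially on \<open>I\<close>
  (only \<open>\<amalg>\<^sub>k V\<close> occurs as a source) and a target \<open>J \<times> V\<close> with the action \<open>actJ\<close> on \<open>J\<close>.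
\<close>

definition fr_emb_conj ::
    "('g, 'm) monoid_scheme \<Rightarrow> 'v::euclidean_space set \<Rightarrow> ('g \<Rightarrow> 'v \<Rightarrow> 'v) \<Rightarrow> 'i set
      \<Rightarrow> ('g \<Rightarrow> 'j \<Rightarrow> 'j) \<Rightarrow> 'g \<Rightarrow> ('i, 'v, 'j) fr_emb \<Rightarrow> ('i, 'v, 'j) fr_emb" where
  "fr_emb_conj G V \<rho> I actJ g = (\<lambda>(f, l, \<alpha>).
     (\<lambda>(i, x)\<in>I \<times> V. map_prod (actJ g) (\<rho> g) (f (i, \<rho> (inv\<^bsub>G\<^esub> g) x)),
      l,
      \<lambda>t\<in>{0..}. \<lambda>((i, x), w)\<in>(I \<times> V) \<times> V. \<rho> g (\<alpha> t ((i, \<rho> (inv\<^bsub>G\<^esub> g) x), \<rho> (inv\<^bsub>G\<^esub> g) w))))"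

text \<open>
  The disjoint union \<open>\<amalg>\<^sub>i e\<^sub>i : \<amalg>\<^sub>i \<amalg>\<^bsub>j i\<^esub> V \<rightarrow> \<amalg>\<^sub>k V\<close> of \<open>e\<^sub>i : \<amalg>\<^bsub>j i\<^esub> V \<rightarrow> V\<close>, \<open>i < k\<close>.  The copies of \<open>V\<close> in
  the source are numbered consecutively, \<open>p = (\<Sum>i'<i. j i') + r\<close> being the \<open>r\<close>-th one of block \<open>i\<close>.
\<close>

definition block :: "(nat \<Rightarrow> nat) \<Rightarrow> nat \<Rightarrow> nat" where
  "block j p = (LEAST i. p < (\<Sum>i'\<le>i. j i'))"

definition in_block :: "(nat \<Rightarrow> nat) \<Rightarrow> nat \<Rightarrow> nat" where
  "in_block j p = p - (\<Sum>i'<block j p. j i')"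

definition fr_emb_sum ::
    "'v::euclidean_space set \<Rightarrow> nat \<Rightarrow> (nat \<Rightarrow> nat) \<Rightarrow> (nat \<Rightarrow> (nat, 'v, unit) fr_emb)
      \<Rightarrow> (nat, 'v, nat) fr_emb" where
  "fr_emb_sum V k j e = (let N = (\<Sum>i<k. j i) in
     (\<lambda>(p, x)\<in>{..<N} \<times> V. (block j p, snd (fst (e (block j p)) (in_block j p, x))),
      \<lambda>p\<in>{..<N}. fst (snd (e (block j p))) (in_block j p),
      \<lambda>t\<in>{0..}. \<lambda>((p, x), w)\<in>({..<N} \<times> V) \<times> V.
        snd (snd (e (block j p))) t ((in_block j p, x), w)))"

text \<open>Precomposition with the map \<open>\<amalg>\<^sub>l V \<rightarrow> \<amalg>\<^sub>k V\<close> induced by an injection \<open>s : {..<l} \<rightarrow> {..<k}\<close>.\<close>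

definition fr_emb_reindex ::
    "'v::euclidean_space set \<Rightarrow> nat \<Rightarrow> (nat \<Rightarrow> nat) \<Rightarrow> (nat, 'v, 'j) fr_emb \<Rightarrow> (nat, 'v, 'j) fr_emb"
  where
  "fr_emb_reindex V l s = (\<lambda>(f, m, \<alpha>).
     (\<lambda>(p, x)\<in>{..<l} \<times> V. f (s p, x),
      \<lambda>p\<in>{..<l}. m (s p),
      \<lambda>t\<in>{0..}. \<lambda>((p, x), w)\<in>({..<l} \<times> V) \<times> V. \<alpha> t ((s p, x), w)))"


section \<open>The monad and its modules\<close>

text \<open>
  In the following \<open>J\<close> is the index set of the manifold \<open>M = J \<times> V\<close>, and \<open>X\<close> is a space with base
  point \<open>b\<close>.  The monad is the case \<open>J = {()}\<close>.  A point of the coproduct of the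
  \<open>\<D>\<^sub>M(k) \<times> X\<^sup>k\<close> is a triple \<open>(k, e, x)\<close>.
\<close>

type_synonym ('v, 'j, 'x) D_point = "nat \<times> (nat, 'v, 'j) fr_emb \<times> (nat \<Rightarrow> 'x)"

definition D_pre ::
    "'v::euclidean_space set \<Rightarrow> 'j set \<Rightarrow> 'x topology \<Rightarrow> ('v, 'j, 'x) D_point topology" where
  "D_pre V J X = sum_topology (\<lambda>k. kprod (fr_emb_space V {..<k} J) (kpower X k)) UNIV"

text \<open>
  Taking \<open>l = k\<close> and \<open>s\<close> a permutation gives the orbits under the symmetric group; taking
  \<open>l = k - 1\<close> and \<open>s\<close> the map that omits one value forgets a copy labelled by the base point.
\<close>

definition D_rel ::
    "'v::euclidean_space set \<Rightarrow> 'j set \<Rightarrow> 'x \<Rightarrow> 'x topology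
      \<Rightarrow> (('v, 'j, 'x) D_point \<times> ('v, 'j, 'x) D_point) set" where
  "D_rel V J b X =
     {((k, e, x), (l, fr_emb_reindex V l s e, restrict (x \<circ> s) {..<l})) | k e x l s.
        (k, e, x) \<in> topspace (D_pre V J X) \<and> inj_on s {..<l} \<and> s ` {..<l} \<subseteq> {..<k} \<and>
        (\<forall>i \<in> {..<k} - s ` {..<l}. x i = b)}"

definition D_space ::
    "'v::euclidean_space set \<Rightarrow> 'j set \<Rightarrow> 'x \<Rightarrow> 'x topology \<Rightarrow> ('v, 'j, 'x) D_point topology" where
  "D_space V J b X = quotient_space (D_pre V J X) (D_rel V J b X)"

abbreviation D_class ::
    "'v::euclidean_space set \<Rightarrow> 'j set \<Rightarrow> 'x \<Rightarrow> 'x topology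
      \<Rightarrow> ('v, 'j, 'x) D_point \<Rightarrow> ('v, 'j, 'x) D_point" where
  "D_class V J b X \<equiv> class_rep (D_rel V J b X)"

text \<open>The point of \<open>D\<^sub>M X\<close> with no copy of \<open>V\<close>, i.e. the image of \<open>\<D>\<^sub>M(0)\<close>.\<close>

definition D_base ::
    "'v::euclidean_space set \<Rightarrow> 'j set \<Rightarrow> 'x \<Rightarrow> 'x topology \<Rightarrow> ('v, 'j, 'x) D_point" where
  "D_base V J b X = D_class V J b X
     (0, (restrict undefined {}, restrict undefined {}, \<lambda>t\<in>{0..}. framing V {}),
      restrict undefined {})"

definition D_map ::
    "'v::euclidean_space set \<Rightarrow> 'j set \<Rightarrow> 'y \<Rightarrow> 'y topology \<Rightarrow> ('x \<Rightarrow> 'y)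
      \<Rightarrow> ('v, 'j, 'x) D_point \<Rightarrow> ('v, 'j, 'y) D_point" where
  "D_map V J c Y h = (\<lambda>(k, e, x). D_class V J c Y (k, e, restrict (h \<circ> x) {..<k}))"

definition D_conj ::
    "('g, 'm) monoid_scheme \<Rightarrow> 'v::euclidean_space set \<Rightarrow> ('g \<Rightarrow> 'v \<Rightarrow> 'v) \<Rightarrow> 'j set
      \<Rightarrow> ('g \<Rightarrow> 'j \<Rightarrow> 'j) \<Rightarrow> 'x \<Rightarrow> 'x topology \<Rightarrow> ('g \<Rightarrow> 'x \<Rightarrow> 'x)
      \<Rightarrow> 'g \<Rightarrow> ('v, 'j, 'x) D_point \<Rightarrow> ('v, 'j, 'x) D_point" where
  "D_conj G V \<rho> J actJ b X actX g = (\<lambda>(k, e, x).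
     D_class V J b X (k, fr_emb_conj G V \<rho> {..<k} actJ g e, restrict (actX g \<circ> x) {..<k}))"

definition D_unit ::
    "'v::euclidean_space set \<Rightarrow> 'x \<Rightarrow> 'x topology \<Rightarrow> 'x \<Rightarrow> ('v, unit, 'x) D_point" where
  "D_unit V b X x = D_class V {()} b X (1, fr_emb_id V, \<lambda>i\<in>{..<1}. x)"

text \<open>The right module structure \<open>D\<^sub>M D\<^sub>V X \<rightarrow> D\<^sub>M X\<close>; for \<open>M = V\<close> this is the monad product.\<close>

definition D_mult ::
    "'v::euclidean_space set \<Rightarrow> 'j set \<Rightarrow> 'x \<Rightarrow> 'x topology
      \<Rightarrow> ('v, 'j, ('v, unit, 'x) D_point) D_point \<Rightarrow> ('v, 'j, 'x) D_point" where
  "D_mult V J b X = (\<lambda>(k, e, y).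
     let j = (\<lambda>i. fst (y i)); N = (\<Sum>i<k. j i) in
     D_class V J b X
       (N, fr_emb_comp V {..<N} e (fr_emb_sum V k j (\<lambda>i. fst (snd (y i)))),
        \<lambda>p\<in>{..<N}. snd (snd (y (block j p))) (in_block j p)))"

definition D_algebra ::
    "('g, 'm) monoid_scheme \<Rightarrow> 'v::euclidean_space set \<Rightarrow> ('g \<Rightarrow> 'v \<Rightarrow> 'v) \<Rightarrow> 'a \<Rightarrow> 'a topology
      \<Rightarrow> ('g \<Rightarrow> 'a \<Rightarrow> 'a) \<Rightarrow> (('v, unit, 'a) D_point \<Rightarrow> 'a) \<Rightarrow> bool" where
  "D_algebra G V \<rho> a A act \<theta> \<longleftrightarrow>
     a \<in> topspace A \<and> (\<forall>g\<in>carrier G. act g a = a) \<and> \<theta> (D_base V {()} a A) = a \<and>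
     continuous_map (D_space V {()} a A) A \<theta> \<and>
     equivariant_on G (topspace (D_space V {()} a A)) (D_conj G V \<rho> {()} (\<lambda>_ j. j) a A act) act \<theta> \<and>
     (\<forall>x\<in>topspace A. \<theta> (D_unit V a A x) = x) \<and>
     (\<forall>z\<in>topspace (D_space V {()} (D_base V {()} a A) (D_space V {()} a A)).
        \<theta> (D_mult V {()} a A z) = \<theta> (D_map V {()} a A \<theta> z))"


section \<open>Iterates of the monad\<close>

text \<open>The iterates \<open>D\<^sub>V\<^sup>q A\<close>, of different types, are transported to a single type of trees.\<close>

datatype ('v, 'a) tree =
  Leaf (un_Leaf: 'a) | Node (un_Node: "nat \<times> (nat, 'v, unit) fr_emb \<times> (nat \<Rightarrow> ('v, 'a) tree)")

primrec iter_space ::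
    "'v::euclidean_space set \<Rightarrow> 'a \<Rightarrow> 'a topology \<Rightarrow> nat \<Rightarrow> ('v, 'a) tree \<times> ('v, 'a) tree topology"
  where
  "iter_space V a A 0 = (Leaf a, final_topology A Leaf)"
| "iter_space V a A (Suc q) = (let (b, T) = iter_space V a A q in
     (Node (D_base V {()} b T), final_topology (D_space V {()} b T) Node))"

abbreviation iter_base :: "'v::euclidean_space set \<Rightarrow> 'a \<Rightarrow> 'a topology \<Rightarrow> nat \<Rightarrow> ('v, 'a) tree" where
  "iter_base V a A q \<equiv> fst (iter_space V a A q)"

abbreviation iter_top ::
    "'v::euclidean_space set \<Rightarrow> 'a \<Rightarrow> 'a topology \<Rightarrow> nat \<Rightarrow> ('v, 'a) tree topology" where
  "iter_top V a A q \<equiv> snd (iter_space V a A q)"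

primrec iter_act ::
    "('g, 'm) monoid_scheme \<Rightarrow> 'v::euclidean_space set \<Rightarrow> ('g \<Rightarrow> 'v \<Rightarrow> 'v) \<Rightarrow> 'a \<Rightarrow> 'a topology
      \<Rightarrow> ('g \<Rightarrow> 'a \<Rightarrow> 'a) \<Rightarrow> nat \<Rightarrow> 'g \<Rightarrow> ('v, 'a) tree \<Rightarrow> ('v, 'a) tree" where
  "iter_act G V \<rho> a A act 0 = (\<lambda>g z. Leaf (act g (un_Leaf z)))"
| "iter_act G V \<rho> a A act (Suc q) = (\<lambda>g z.
     Node (D_conj G V \<rho> {()} (\<lambda>_ j. j) (iter_base V a A q) (iter_top V a A q)
             (iter_act G V \<rho> a A act q) g (un_Node z)))"

text \<open>The product \<open>D\<^sub>M D\<^sub>V (D\<^sub>V\<^sup>q A) \<rightarrow> D\<^sub>M (D\<^sub>V\<^sup>q A)\<close>.\<close>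

definition iter_mult ::
    "'v::euclidean_space set \<Rightarrow> 'j set \<Rightarrow> 'a \<Rightarrow> 'a topology \<Rightarrow> nat
      \<Rightarrow> ('v, 'j, ('v, 'a) tree) D_point \<Rightarrow> ('v, 'j, ('v, 'a) tree) D_point" where
  "iter_mult V J a A q = (\<lambda>(k, e, y).
     D_mult V J (iter_base V a A q) (iter_top V a A q) (k, e, un_Node \<circ> y))"

text \<open>
  \<open>iter_face V a A \<theta> q i : D\<^sub>V\<^bsup>q+1\<^esup> A \<rightarrow> D\<^sub>V\<^sup>q A\<close> for \<open>i \<le> q\<close> is \<open>D\<^sub>V\<^sup>i\<close> applied to the monad product
  (if \<open>i < q\<close>) or to the algebra structure map (if \<open>i = q\<close>).
\<close>

primrec iter_face ::
    "'v::euclidean_space set \<Rightarrow> 'a \<Rightarrow> 'a topology \<Rightarrow> (('v, unit, 'a) D_point \<Rightarrow> 'a) \<Rightarrow> nat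
      \<Rightarrow> nat \<Rightarrow> ('v, 'a) tree \<Rightarrow> ('v, 'a) tree" where
  "iter_face V a A \<theta> 0 = (\<lambda>i z. Leaf (\<theta> (D_map V {()} a A un_Leaf (un_Node z))))"
| "iter_face V a A \<theta> (Suc q) = (\<lambda>i z. case i of
       0 \<Rightarrow> Node (iter_mult V {()} a A q (un_Node z))
     | Suc i' \<Rightarrow> Node (D_map V {()} (iter_base V a A q) (iter_top V a A q)
                        (iter_face V a A \<theta> q i') (un_Node z)))"

text \<open>\<open>iter_degen V a A q i : D\<^sub>V\<^sup>q A \<rightarrow> D\<^sub>V\<^bsup>q+1\<^esup> A\<close> for \<open>i \<le> q\<close> is \<open>D\<^sub>V\<^sup>i\<close> applied to the unit.\<close>

definition iter_unit ::
    "'v::euclidean_space set \<Rightarrow> 'a \<Rightarrow> 'a topology \<Rightarrow> nat \<Rightarrow> ('v, 'a) tree \<Rightarrow> ('v, 'a) tree" where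
  "iter_unit V a A q z = Node (D_unit V (iter_base V a A q) (iter_top V a A q) z)"

primrec iter_degen ::
    "'v::euclidean_space set \<Rightarrow> 'a \<Rightarrow> 'a topology \<Rightarrow> nat \<Rightarrow> nat \<Rightarrow> ('v, 'a) tree \<Rightarrow> ('v, 'a) tree" where
  "iter_degen V a A 0 = (\<lambda>i. iter_unit V a A 0)"
| "iter_degen V a A (Suc q) = (\<lambda>i z. case i of
       0 \<Rightarrow> iter_unit V a A (Suc q) z
     | Suc i' \<Rightarrow> Node (D_map V {()} (iter_base V a A (Suc q)) (iter_top V a A (Suc q))
                        (iter_degen V a A q i') (un_Node z)))"


section \<open>Geometric realization and factorization homology\<close>

definition simplex_space :: "nat \<Rightarrow> (nat \<Rightarrow> real) topology" where
  "simplex_space q = subtopology (powertop_real UNIV) (standard_simplex q)"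

definition simplex_degen :: "nat \<Rightarrow> (nat \<Rightarrow> real) \<Rightarrow> nat \<Rightarrow> real" where
  "simplex_degen i u =
     (\<lambda>j. if j < i then u j else if j = i then u i + u (Suc i) else u (Suc j))"

text \<open>
  The realization of a simplicial space with \<open>q\<close>-simplices \<open>X q\<close>, faces
  \<open>d q i : X (q + 1) \<rightarrow> X q\<close>, \<open>i \<le> q + 1\<close>, and degeneracies \<open>s q i : X q \<rightarrow> X (q + 1)\<close>, \<open>i \<le> q\<close>.
\<close>

definition realization_pre :: "(nat \<Rightarrow> 'x topology) \<Rightarrow> (nat \<times> 'x \<times> (nat \<Rightarrow> real)) topology" where
  "realization_pre X = sum_topology (\<lambda>q. kprod (X q) (simplex_space q)) UNIV"

definition realization_rel ::
    "(nat \<Rightarrow> 'x topology) \<Rightarrow> (nat \<Rightarrow> nat \<Rightarrow> 'x \<Rightarrow> 'x) \<Rightarrow> (nat \<Rightarrow> nat \<Rightarrow> 'x \<Rightarrow> 'x)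
      \<Rightarrow> ((nat \<times> 'x \<times> (nat \<Rightarrow> real)) \<times> (nat \<times> 'x \<times> (nat \<Rightarrow> real))) set" where
  "realization_rel X d s =
     {((q, d q i x, u), (Suc q, x, simplical_face i u)) | q i x u.
        i \<le> Suc q \<and> x \<in> topspace (X (Suc q)) \<and> u \<in> standard_simplex q} \<union>
     {((Suc q, s q i x, u), (q, x, simplex_degen i u)) | q i x u.
        i \<le> q \<and> x \<in> topspace (X q) \<and> u \<in> standard_simplex (Suc q)}"

definition bar_simplices ::
    "'v::euclidean_space set \<Rightarrow> 'j set \<Rightarrow> 'a \<Rightarrow> 'a topology \<Rightarrow> nat
      \<Rightarrow> ('v, 'j, ('v, 'a) tree) D_point topology" where
  "bar_simplices V J a A q = D_space V J (iter_base V a A q) (iter_top V a A q)"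

definition bar_face ::
    "'v::euclidean_space set \<Rightarrow> 'j set \<Rightarrow> 'a \<Rightarrow> 'a topology \<Rightarrow> (('v, unit, 'a) D_point \<Rightarrow> 'a)
      \<Rightarrow> nat \<Rightarrow> nat \<Rightarrow> ('v, 'j, ('v, 'a) tree) D_point \<Rightarrow> ('v, 'j, ('v, 'a) tree) D_point" where
  "bar_face V J a A \<theta> q i = (case i of
       0 \<Rightarrow> iter_mult V J a A q
     | Suc i' \<Rightarrow> D_map V J (iter_base V a A q) (iter_top V a A q) (iter_face V a A \<theta> q i'))"

definition bar_degen ::
    "'v::euclidean_space set \<Rightarrow> 'j set \<Rightarrow> 'a \<Rightarrow> 'a topology
      \<Rightarrow> nat \<Rightarrow> nat \<Rightarrow> ('v, 'j, ('v, 'a) tree) D_point \<Rightarrow> ('v, 'j, ('v, 'a) tree) D_point" where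
  "bar_degen V J a A q i =
     D_map V J (iter_base V a A (Suc q)) (iter_top V a A (Suc q)) (iter_degen V a A q i)"

abbreviation bar_rel ::
    "'v::euclidean_space set \<Rightarrow> 'j set \<Rightarrow> 'a \<Rightarrow> 'a topology \<Rightarrow> (('v, unit, 'a) D_point \<Rightarrow> 'a)
      \<Rightarrow> ((nat \<times> ('v, 'j, ('v, 'a) tree) D_point \<times> (nat \<Rightarrow> real)) \<times>
          (nat \<times> ('v, 'j, ('v, 'a) tree) D_point \<times> (nat \<Rightarrow> real))) set" where
  "bar_rel V J a A \<theta> \<equiv>
     realization_rel (bar_simplices V J a A) (bar_face V J a A \<theta>) (bar_degen V J a A)"

definition fact_homology ::
    "'v::euclidean_space set \<Rightarrow> 'j set \<Rightarrow> 'a \<Rightarrow> 'a topology \<Rightarrow> (('v, unit, 'a) D_point \<Rightarrow> 'a)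
      \<Rightarrow> (nat \<times> ('v, 'j, ('v, 'a) tree) D_point \<times> (nat \<Rightarrow> real)) topology" where
  "fact_homology V J a A \<theta> =
     quotient_space (realization_pre (bar_simplices V J a A)) (bar_rel V J a A \<theta>)"

definition fact_homology_act ::
    "('g, 'm) monoid_scheme \<Rightarrow> 'v::euclidean_space set \<Rightarrow> ('g \<Rightarrow> 'v \<Rightarrow> 'v) \<Rightarrow> 'j set
      \<Rightarrow> ('g \<Rightarrow> 'j \<Rightarrow> 'j) \<Rightarrow> 'a \<Rightarrow> 'a topology \<Rightarrow> ('g \<Rightarrow> 'a \<Rightarrow> 'a)
      \<Rightarrow> (('v, unit, 'a) D_point \<Rightarrow> 'a) \<Rightarrow> 'g
      \<Rightarrow> (nat \<times> ('v, 'j, ('v, 'a) tree) D_point \<times> (nat \<Rightarrow> real))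
      \<Rightarrow> (nat \<times> ('v, 'j, ('v, 'a) tree) D_point \<times> (nat \<Rightarrow> real))" where
  "fact_homology_act G V \<rho> J actJ a A act \<theta> g = (\<lambda>(q, z, u).
     class_rep (bar_rel V J a A \<theta>)
       (q, D_conj G V \<rho> J actJ (iter_base V a A q) (iter_top V a A q)
             (iter_act G V \<rho> a A act q) g z, u))"


section \<open>Based maps out of an orbit\<close>

definition orbit_act :: "('g, 'm) monoid_scheme \<Rightarrow> 'g \<Rightarrow> 'g set \<Rightarrow> 'g set" where
  "orbit_act G g c = g <#\<^bsub>G\<^esub> c"

text \<open>\<open>G/H\<^sub>+\<close> is \<open>G/H\<close> with the disjoint base point \<^const>\<open>None\<close>.\<close>

definition orbit_plus :: "('g, 'm) monoid_scheme \<Rightarrow> 'g set \<Rightarrow> 'g set option topology" where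
  "orbit_plus G H = discrete_topology (insert None (Some ` (lcosets\<^bsub>G\<^esub> H)))"

definition based_maps ::
    "'p topology \<Rightarrow> 'p \<Rightarrow> 'a topology \<Rightarrow> 'a \<Rightarrow> ('p \<Rightarrow> 'a) topology" where
  "based_maps P p A a = subtopology (map_space P A) {f. f p = a}"

definition map_conj ::
    "('g, 'm) monoid_scheme \<Rightarrow> 'p topology \<Rightarrow> ('g \<Rightarrow> 'p \<Rightarrow> 'p) \<Rightarrow> ('g \<Rightarrow> 'a \<Rightarrow> 'a)
      \<Rightarrow> 'g \<Rightarrow> ('p \<Rightarrow> 'a) \<Rightarrow> 'p \<Rightarrow> 'a" where
  "map_conj G P actP act g f = (\<lambda>p\<in>topspace P. act g (f (actP (inv\<^bsub>G\<^esub> g) p)))"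

end

theory Submission
  imports Defs
begin

text \<open>
  The manifold \<open>M = G/H \<times> V\<close> is a disjoint union of copies of \<open>V\<close>, indexed by the finite set
  \<open>J = G/H\<close>, so that based maps out of \<open>G/H\<^sub>+\<close> are families of points of \<open>A\<close> indexed by \<open>J\<close>.  The
  bar construction of \<open>M\<close> contracts onto these families because it has an extra degeneracy, as the
  bar construction of \<open>V\<close> itself has.

  A configuration in \<open>M\<close> is stripped into one configuration in \<open>V\<close> for each \<open>j\<close>: \<open>strip j\<close> keeps the
  copies of \<open>V\<close> that land in \<open>{j} \<times> V\<close>.  Conversely \<open>glue\<close> labels the standard embedding of
  \<open>J \<times> V\<close> by a family.  The extra degeneracy \<open>bar_extra\<close> sends \<open>z\<close> in \<open>D\<^sub>M D\<^sub>V\<^sup>q A\<close> to the gluing of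
  the \<open>strip j z\<close>, a point of \<open>D\<^sub>M D\<^sub>V\<^bsup>q+1\<^esup> A\<close>, and \<open>bar_unit\<close> glues a family of points of \<open>A\<close>.  Together with the
  augmentation \<open>bar_ev\<close>, which evaluates all the \<open>strip j z\<close> in \<open>A\<close>, they satisfy the usual
  identities (\<open>bar_face_0_extra\<close>, \<open>bar_face_Suc_extra\<close>, \<open>bar_face_1_extra\<close>, \<open>bar_degen_extra\<close>,
  \<open>bar_extra_unit\<close>).  Hence
  \<open>h\<^sub>s[q, z, t] = [q + 1, bar_extra z, (s, (1 - s) t)]\<close> is a strong deformation retraction of the
  realization onto the image of \<open>real_unit\<close>, with retraction \<open>real_ev\<close>.  All these maps are
  equivariant, so that \<open>real_unit\<close> is a weak equivalence on the fixed points of every subgroup.  On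
  the fixed points of \<open>G\<close>, evaluation at the coset \<open>H\<close> is a homeomorphism onto \<open>A\<^sup>H\<close>, because \<open>G\<close>
  acts transitively on \<open>J\<close> with stabilizer \<open>H\<close>.

  Two further points need work.  The identities hold in \<open>D\<^sub>M X\<close>, whose points are chosen
  representatives of equivalence classes.  They are proved by comparing configurations: a point of
  \<open>D\<^sub>M X\<close> is determined by the set of its components with their labels, for the labels other than
  the base point (\<open>D_space_eqI\<close>), and the operations are computed on these sets.  For this, a
  framed embedding is described by its components (\<open>mem_fr_emb_space_iff\<close>, \<open>fr_emb_eqI\<close>).

  The other point is continuity in the category of compactly generated spaces.  A map that is
  continuous for the ordinary product topology lifts to the compactly generated one if images of
  compact Hausdorff spaces in the target are Hausdorff (\<open>k_Hausdorff\<close>, \<open>continuous_map_into_kify\<close>).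
  The spaces \<open>D\<^sub>M X\<close> inherit this property from \<open>X\<close> if the base point of \<open>X\<close> is the zero set of a
  continuous function (\<open>k_Hausdorff_D_space\<close>), and the base point of \<open>D\<^sub>M X\<close> is again such a zero
  set (\<open>D_space_weight\<close>), so that the argument applies to the iterates.
\<close>


section \<open>Strong deformation retracts are weak equivalences\<close>

lemma cube_homotopic_equiv: "equiv (cube_maps n X x) (cube_homotopic n X x)"
proof (rule equivI)
  show "cube_homotopic n X x \<subseteq> cube_maps n X x \<times> cube_maps n X x"
    by (auto simp: cube_homotopic_def)
  show "refl_on (cube_maps n X x) (cube_homotopic n X x)"
    by (auto simp: refl_on_def cube_homotopic_def cube_maps_def)
  show "sym (cube_homotopic n X x)"
    by (auto simp: sym_def cube_homotopic_def intro: homotopic_with_symD)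
  show "trans (cube_homotopic n X x)"
    by (rule transI) (auto simp: cube_homotopic_def intro: homotopic_with_trans)
qed

lemma cube_homotopic_compose:
  assumes "(\<alpha>, \<beta>) \<in> cube_homotopic n X x" and g: "continuous_map X Y g"
    and "n = 0 \<or> g x = y"
  shows "(g \<circ> \<alpha>, g \<circ> \<beta>) \<in> cube_homotopic n Y y"
proof -
  have bd: "(g \<circ> \<gamma>) ` cube_boundary n \<subseteq> {y}" if "\<gamma> ` cube_boundary n \<subseteq> {x}" for \<gamma>
    using that assms(3) by (auto simp: cube_boundary_def)
  have "homotopic_with (\<lambda>\<gamma>. \<gamma> ` cube_boundary n \<subseteq> {y}) (cube n) Y (g \<circ> \<alpha>) (g \<circ> \<beta>)"
    using assms(1) g bd unfolding cube_homotopic_def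
    by (intro homotopic_with_compose_continuous_map_left
          [where p = "\<lambda>\<gamma>. \<gamma> ` cube_boundary n \<subseteq> {x}"]) auto
  then show ?thesis
    using assms(1) bd g
    by (auto simp: cube_homotopic_def cube_maps_def intro: continuous_map_compose)
qed

lemma homotopy_set_map_class:
  assumes "\<alpha> \<in> cube_maps n X x" and "continuous_map X Y f"
  shows "homotopy_set_map n Y f x (cube_homotopic n X x `` {\<alpha>}) = cube_homotopic n Y (f x) `` {f \<circ> \<alpha>}"
proof -
  have "(f \<circ> \<alpha>, f \<circ> \<beta>) \<in> cube_homotopic n Y (f x)" if "(\<alpha>, \<beta>) \<in> cube_homotopic n X x" for \<beta>
    using cube_homotopic_compose[OF that assms(2)] by simp
  then have "cube_homotopic n Y (f x) `` {f \<circ> \<beta>} = cube_homotopic n Y (f x) `` {f \<circ> \<alpha>}"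
    if "(\<alpha>, \<beta>) \<in> cube_homotopic n X x" for \<beta>
    using that equiv_class_eq[OF cube_homotopic_equiv] by metis
  moreover have "(\<alpha>, \<alpha>) \<in> cube_homotopic n X x"
    using assms(1) cube_homotopic_equiv by (metis equiv_class_self Image_singleton_iff)
  ultimately show ?thesis unfolding homotopy_set_map_def by blast
qed

lemma weak_equivalence_deformation_retract:
  assumes f: "continuous_map Z X f" and r: "continuous_map X Z r"
    and rf: "\<And>z. z \<in> topspace Z \<Longrightarrow> r (f z) = z"
    and h: "continuous_map (prod_topology (top_of_set {0..1::real}) X) X h"
    and h0: "\<And>x. x \<in> topspace X \<Longrightarrow> h (0, x) = x"
    and h1: "\<And>x. x \<in> topspace X \<Longrightarrow> h (1, x) = f (r x)"
    and hf: "\<And>t z. t \<in> {0..1} \<Longrightarrow> z \<in> topspace Z \<Longrightarrow> h (t, f z) = f z"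
  shows "weak_equivalence Z X f"
  unfolding weak_equivalence_def
proof (intro conjI f allI impI)
  \<comment> \<open>For \<open>n = 0\<close> the base point is arbitrary, but then the boundary of the cube is empty.\<close>
  fix n :: nat and x assume nx: "n = 0 \<or> x \<in> topspace Z"
  let ?EZ = "cube_homotopic n Z x" and ?EX = "cube_homotopic n X (f x)"
  let ?m = "homotopy_set_map n X f x"
  have eqZ: "equiv (cube_maps n Z x) ?EZ" and eqX: "equiv (cube_maps n X (f x)) ?EX"
    by (rule cube_homotopic_equiv)+
  have fm: "f \<circ> \<alpha> \<in> cube_maps n X (f x)" if "\<alpha> \<in> cube_maps n Z x" for \<alpha>
    using that f by (auto simp: cube_maps_def intro: continuous_map_compose)
  have rm: "r \<circ> \<alpha> \<in> cube_maps n Z x" if "\<alpha> \<in> cube_maps n X (f x)" for \<alpha>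
    using that r nx rf
    by (auto simp: cube_maps_def image_subset_iff cube_boundary_def intro: continuous_map_compose)
  have inj: "(\<alpha>, \<beta>) \<in> ?EZ"
    if a: "\<alpha> \<in> cube_maps n Z x" and b: "\<beta> \<in> cube_maps n Z x" and ab: "(f \<circ> \<alpha>, f \<circ> \<beta>) \<in> ?EX" for \<alpha> \<beta>
  proof -
    have 1: "(r \<circ> (f \<circ> \<alpha>), r \<circ> (f \<circ> \<beta>)) \<in> ?EZ"
      using cube_homotopic_compose[OF ab r] nx rf by blast
    have 2: "(\<gamma>, r \<circ> (f \<circ> \<gamma>)) \<in> ?EZ" if g: "\<gamma> \<in> cube_maps n Z x" for \<gamma>
    proof -
      have "homotopic_with (\<lambda>\<gamma>. \<gamma> ` cube_boundary n \<subseteq> {x}) (cube n) Z \<gamma> (r \<circ> (f \<circ> \<gamma>))"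
      proof (rule homotopic_with_equal)
        show "\<gamma> ` cube_boundary n \<subseteq> {x}" "continuous_map (cube n) Z \<gamma>"
          using g by (auto simp: cube_maps_def)
        show "(r \<circ> (f \<circ> \<gamma>)) ` cube_boundary n \<subseteq> {x}"
          using rm[OF fm[OF g]] by (auto simp: cube_maps_def)
        show "\<And>t. t \<in> topspace (cube n) \<Longrightarrow> \<gamma> t = (r \<circ> (f \<circ> \<gamma>)) t"
          using g rf by (simp add: cube_maps_def continuous_map_def Pi_iff)
      qed
      then show ?thesis using g rm[OF fm[OF g]] by (simp add: cube_homotopic_def)
    qed
    show ?thesis
      using 1 2[OF a] 2[OF b] eqZ unfolding equiv_def by (meson symD transD)
  qed
  have surj: "(f \<circ> (r \<circ> \<alpha>), \<alpha>) \<in> ?EX" if a: "\<alpha> \<in> cube_maps n X (f x)" for \<alpha>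
  proof -
    have ca: "continuous_map (cube n) X \<alpha>" and ba: "\<alpha> ` cube_boundary n \<subseteq> {f x}"
      using a by (auto simp: cube_maps_def)
    have "continuous_map (prod_topology (top_of_set {0..1::real}) (cube n))
            (prod_topology (top_of_set {0..1}) X) (\<lambda>(t, c). (t, \<alpha> c))"
      using ca by (simp add: continuous_map_prod_top)
    from continuous_map_compose[OF this h]
    have ch: "continuous_map (prod_topology (top_of_set {0..1::real}) (cube n)) X (\<lambda>(t, c). h (t, \<alpha> c))"
      by (simp add: o_def case_prod_unfold)
    have "homotopic_with (\<lambda>\<gamma>. \<gamma> ` cube_boundary n \<subseteq> {f x}) (cube n) X \<alpha> (f \<circ> (r \<circ> \<alpha>))"
    proof (subst homotopic_with, goal_cases)
      case 2
      show "(\<exists>h. continuous_map (prod_topology (top_of_set {0..1::real}) (cube n)) X h \<and>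
              (\<forall>x\<in>topspace (cube n). h (0, x) = \<alpha> x) \<and>
              (\<forall>x\<in>topspace (cube n). h (1, x) = (f \<circ> (r \<circ> \<alpha>)) x) \<and>
              (\<forall>t\<in>{0..1}. (\<lambda>y. h (t, y)) ` cube_boundary n \<subseteq> {f x}))"
      proof (intro exI[of _ "\<lambda>(t, c). h (t, \<alpha> c)"] conjI ballI ch)
        fix c assume "c \<in> topspace (cube n)"
        then have "\<alpha> c \<in> topspace X" using ca by (auto simp: continuous_map_def)
        then show "(case (0, c) of (t, c) \<Rightarrow> h (t, \<alpha> c)) = \<alpha> c"
          "(case (1, c) of (t, c) \<Rightarrow> h (t, \<alpha> c)) = (f \<circ> (r \<circ> \<alpha>)) c"
          by (auto simp: h0 h1)
      next
        fix t :: real assume t: "t \<in> {0..1}"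
        show "(\<lambda>y. case (t, y) of (t, c) \<Rightarrow> h (t, \<alpha> c)) ` cube_boundary n \<subseteq> {f x}"
        proof (cases "n = 0")
          case True
          then show ?thesis by (simp add: cube_boundary_def)
        next
          case False
          then have "x \<in> topspace Z" using nx by simp
          then have "h (t, f x) = f x" using hf t by blast
          then show ?thesis using ba by auto
        qed
      qed
    qed (auto simp: cube_boundary_def image_subset_iff)
    then show ?thesis
      using a fm[OF rm[OF a]] by (auto simp: cube_homotopic_def intro: homotopic_with_symD)
  qed
  show "bij_betw ?m (homotopy_set n Z x) (homotopy_set n X (f x))"
    unfolding bij_betw_def
  proof (intro conjI)
    show "inj_on ?m (homotopy_set n Z x)"
    proof (rule inj_onI)
      fix c d assume "c \<in> homotopy_set n Z x" "d \<in> homotopy_set n Z x" and e: "?m c = ?m d"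
      then obtain \<alpha> \<beta> where a: "\<alpha> \<in> cube_maps n Z x" "c = ?EZ `` {\<alpha>}"
        and b: "\<beta> \<in> cube_maps n Z x" "d = ?EZ `` {\<beta>}"
        unfolding homotopy_set_def by (auto elim!: quotientE)
      have "?EX `` {f \<circ> \<alpha>} = ?EX `` {f \<circ> \<beta>}"
        using e a b homotopy_set_map_class[OF _ f] by metis
      then have "(f \<circ> \<alpha>, f \<circ> \<beta>) \<in> ?EX"
        using eqX fm[OF b(1)] by (metis eq_equiv_class)
      then show "c = d" using inj a b eqZ by (metis equiv_class_eq)
    qed
    show "?m ` homotopy_set n Z x = homotopy_set n X (f x)"
    proof (intro equalityI subsetI)
      fix d assume "d \<in> ?m ` homotopy_set n Z x"
      then obtain \<alpha> where "\<alpha> \<in> cube_maps n Z x" "d = ?m (?EZ `` {\<alpha>})"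
        unfolding homotopy_set_def by (auto elim!: quotientE)
      then show "d \<in> homotopy_set n X (f x)"
        using homotopy_set_map_class[OF _ f] fm by (metis homotopy_set_def quotientI)
    next
      fix d assume "d \<in> homotopy_set n X (f x)"
      then obtain \<alpha> where a: "\<alpha> \<in> cube_maps n X (f x)" "d = ?EX `` {\<alpha>}"
        unfolding homotopy_set_def by (auto elim!: quotientE)
      then have "d = ?m (?EZ `` {r \<circ> \<alpha>})"
        using homotopy_set_map_class[OF rm f] surj eqX by (metis equiv_class_eq)
      then show "d \<in> ?m ` homotopy_set n Z x"
        unfolding homotopy_set_def using rm[OF a(1)] by (simp add: quotientI)
    qed
  qed
qed


section \<open>Compactly generated topologies\<close>

lemma topspace_kify [simp]: "topspace (kify X) = topspace X"
proof -
  have "openin (kify X) (topspace X)"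
    by (auto simp: openin_kify) (metis compactin_subset_topspace inf.absorb_iff1 openin_topspace
        topspace_subtopology_subset openin_subtopology_refl)
  then show ?thesis
    by (metis openin_kify openin_subset openin_topspace subset_antisym)
qed

lemma openin_kify_if_openin: "openin X U \<Longrightarrow> openin (kify X) U"
  by (auto simp: openin_kify openin_subset openin_subtopology_Int2)

lemma continuous_map_from_kify: "continuous_map X Y f \<Longrightarrow> continuous_map (kify X) Y f"
  by (auto simp: continuous_map_def intro: openin_kify_if_openin)

lemma subtopology_kify_compact:
  assumes "compactin X C" and "Hausdorff_space (subtopology X C)"
  shows "subtopology (kify X) C = subtopology X C"
proof (rule topology_eq[THEN iffD2], intro allI iffI)
  fix S assume "openin (subtopology (kify X) C) S"
  then obtain U where "openin (kify X) U" "S = U \<inter> C" by (auto simp: openin_subtopology)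
  then show "openin (subtopology X C) S"
    using assms by (auto simp: openin_kify Int_commute)
next
  fix S assume "openin (subtopology X C) S"
  then show "openin (subtopology (kify X) C) S"
    using openin_kify_if_openin by (auto simp: openin_subtopology)
qed

lemma Hausdorff_space_kify: "Hausdorff_space X \<Longrightarrow> Hausdorff_space (kify X)"
  unfolding Hausdorff_space_def topspace_kify by (metis openin_kify_if_openin)

lemma kify_locally_compact_Hausdorff:
  assumes "locally_compact_space X" and "Hausdorff_space X"
  shows "kify X = X"
proof (rule topology_eq[THEN iffD2], intro allI iffI openin_kify_if_openin)
  fix U assume U: "openin (kify X) U"
  show "openin X U"
  proof (subst openin_subopen, intro ballI)
    fix x assume x: "x \<in> U"
    then have "x \<in> topspace X" using U by (auto simp: openin_kify)
    then obtain M N where MN: "openin X M" "compactin X N" "x \<in> M" "M \<subseteq> N"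
      using assms(1) by (auto simp: locally_compact_space_def)
    then have "openin (subtopology X N) (N \<inter> U)"
      using U assms(2) by (auto simp: openin_kify Hausdorff_space_subtopology)
    then obtain T where "openin X T" "N \<inter> U = T \<inter> N" by (auto simp: openin_subtopology)
    then show "\<exists>T. openin X T \<and> x \<in> T \<and> T \<subseteq> U"
      using MN x by (intro exI[of _ "T \<inter> M"]) auto
  qed
qed

lemma topspace_final_topology [simp]: "topspace (final_topology X f) = f ` topspace X"
proof (rule subset_antisym)
  show "topspace (final_topology X f) \<subseteq> f ` topspace X"
    using openin_topspace[of "final_topology X f"] unfolding openin_final_topology by simp
  have "{x \<in> topspace X. f x \<in> f ` topspace X} = topspace X" by auto
  then have "openin (final_topology X f) (f ` topspace X)"
    by (simp add: openin_final_topology)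
  then show "f ` topspace X \<subseteq> topspace (final_topology X f)" by (rule openin_subset)
qed

lemma quotient_map_final_topology: "quotient_map X (final_topology X f) f"
  by (auto simp: quotient_map_def openin_final_topology)

lemma homeomorphic_map_final_topology:
  "inj_on f (topspace X) \<Longrightarrow> homeomorphic_map X (final_topology X f) f"
  by (simp add: homeomorphic_map_def quotient_map_final_topology)

lemma continuous_map_final_topology: "continuous_map X (final_topology X f) f"
  by (simp add: quotient_imp_continuous_map quotient_map_final_topology)

lemma continuous_map_from_final_topology:
  "continuous_map X Y (g \<circ> f) \<Longrightarrow> continuous_map (final_topology X f) Y g"
  by (metis continuous_compose_quotient_map_eq quotient_map_final_topology)

text \<open>
  Images of compact Hausdorff spaces are Hausdorff subspaces.  This follows from weak Hausdorff, and
  it is what makes the passage to compactly generated topologies functorial.  The type of the test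
  spaces is no restriction: the closure of a section of a test map out of any compact Hausdorff
  space embeds into \<open>'a set set\<close>, as a point is determined by the traces of its neighbourhoods.
\<close>

definition k_Hausdorff :: "'a topology \<Rightarrow> bool" where
  "k_Hausdorff X \<longleftrightarrow> (\<forall>(K :: 'a set set topology) u. compact_space K \<and> Hausdorff_space K \<and>
     continuous_map K X u \<longrightarrow> Hausdorff_space (subtopology X (u ` topspace K)))"

lemma small_compact_test:
  fixes K :: "'k topology" and X :: "'a topology"
  assumes "compact_space K" "Hausdorff_space K" "continuous_map K X u"
  shows "\<exists>(K' :: 'a set set topology) u'. compact_space K' \<and> Hausdorff_space K' \<and>
    continuous_map K' X u' \<and> u' ` topspace K' = u ` topspace K"
proof -
  define S where "S = inv_into (topspace K) u ` (u ` topspace K)"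
  have SK: "S \<subseteq> topspace K" unfolding S_def by (auto intro: inv_into_into)
  have "u (inv_into (topspace K) u y) = y" if "y \<in> u ` topspace K" for y
    using that by (rule f_inv_into_f)
  then have uS: "u ` S = u ` topspace K" unfolding S_def image_image by simp
  have inj: "inj_on u S" unfolding S_def by (rule inj_onI) (auto simp: f_inv_into_f)
  define L where "L = K closure_of S"
  define code where "code k = {u ` (N \<inter> S) | N. openin K N \<and> k \<in> N}" for k
  have SL: "S \<subseteq> L" "L \<subseteq> topspace K"
    unfolding L_def using SK by (auto simp: closure_of_subset closure_of_subset_topspace)
  have injcode: "inj_on code L"
  proof (rule inj_onI, rule ccontr)
    fix k l assume kl: "k \<in> L" "l \<in> L" "code k = code l" "k \<noteq> l"
    then have "k \<in> topspace K" "l \<in> topspace K" using SL by auto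
    then obtain N M where NM: "openin K N" "openin K M" "k \<in> N" "l \<in> M" "disjnt N M"
      using assms(2) kl(4) unfolding Hausdorff_space_def by blast
    then have "u ` (N \<inter> S) \<in> code l" using kl(3) by (auto simp: code_def)
    then obtain P where P: "u ` (N \<inter> S) = u ` (P \<inter> S)" "openin K P" "l \<in> P"
      by (auto simp: code_def)
    then have NP: "N \<inter> S = P \<inter> S" using inj by (metis Int_lower2 inj_on_image_eq_iff)
    have "openin K (P \<inter> M)" "l \<in> P \<inter> M" using P NM by auto
    then obtain s where "s \<in> S" "s \<in> P \<inter> M"
      using kl(2) unfolding L_def in_closure_of by blast
    then show False using NP NM(5) by (auto simp: disjnt_def)
  qed
  define K' where "K' = final_topology (subtopology K L) code"
  have tL: "topspace (subtopology K L) = L" using SL by auto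
  have hom: "homeomorphic_map (subtopology K L) K' code"
    unfolding K'_def using injcode tL by (intro homeomorphic_map_final_topology) auto
  have "closedin K L" unfolding L_def by simp
  then have cL: "compact_space (subtopology K L)"
    using assms(1) closedin_compact_space compactin_subspace by blast
  have hL: "Hausdorff_space (subtopology K L)"
    using assms(2) by (simp add: Hausdorff_space_subtopology)
  have hs: "subtopology K L homeomorphic_space K'"
    using hom homeomorphic_map_imp_homeomorphic_space by blast
  define u' where "u' = u \<circ> inv_into L code"
  have u'code: "u' (code k) = u k" if "k \<in> L" for k
    using that injcode by (simp add: u'_def)
  have "continuous_map (subtopology K L) X (u' \<circ> code)"
    by (rule continuous_map_eq[OF continuous_map_from_subtopology[OF assms(3)]])
       (use tL u'code in auto)
  then have "continuous_map K' X u'"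
    unfolding K'_def by (rule continuous_map_from_final_topology)
  moreover have "u' ` topspace K' = u ` L"
    unfolding K'_def topspace_final_topology tL image_image using u'code by simp
  moreover have "u ` L = u ` topspace K" using SL uS by blast
  ultimately show ?thesis
    using cL hL hs homeomorphic_compact_space homeomorphic_Hausdorff_space by metis
qed

lemma k_HausdorffD:
  assumes "k_Hausdorff X" "compact_space K" "Hausdorff_space K" "continuous_map K X u"
  shows "Hausdorff_space (subtopology X (u ` topspace K))"
  using small_compact_test[OF assms(2-4)] assms(1) unfolding k_Hausdorff_def by metis

lemma Hausdorff_imp_k_Hausdorff: "Hausdorff_space X \<Longrightarrow> k_Hausdorff X"
  by (simp add: k_Hausdorff_def Hausdorff_space_subtopology)

lemma weak_Hausdorff_imp_k_Hausdorff:
  assumes "weak_Hausdorff X"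
  shows "k_Hausdorff X"
  unfolding k_Hausdorff_def
proof (intro allI impI, elim conjE)
  fix K :: "'a set set topology" and u
  assume K: "compact_space K" "Hausdorff_space K" and u: "continuous_map K X u"
  have closed: "closedin X (u ` F)" if F: "closedin K F" for F
  proof -
    have "topspace (subtopology K F) = F" using F by (meson closedin_subset topspace_subtopology_subset)
    moreover have "compact_space (subtopology K F)" "Hausdorff_space (subtopology K F)"
      "continuous_map (subtopology K F) X u"
      using K F u closedin_compact_space compactin_subspace
      by (auto simp: Hausdorff_space_subtopology continuous_map_from_subtopology)
    ultimately have "closedin X (u ` topspace (subtopology K F))"
      using assms unfolding weak_Hausdorff_def by blast
    then show ?thesis using \<open>topspace (subtopology K F) = F\<close> by simp
  qed
  have normal: "normal_space K" using K by (simp add: compact_Hausdorff_or_regular_imp_normal_space)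
  show "Hausdorff_space (subtopology X (u ` topspace K))"
    unfolding Hausdorff_space_def
  proof (intro allI impI, elim conjE)
    fix x y assume xy: "x \<in> topspace (subtopology X (u ` topspace K))"
      "y \<in> topspace (subtopology X (u ` topspace K))" "x \<noteq> y"
    have fib: "closedin K {k \<in> topspace K. u k = z}" if zz: "z \<in> u ` topspace K" for z
    proof -
      obtain k where k: "k \<in> topspace K" "z = u k" using zz by auto
      have "closedin X (u ` {k})" using K(2) k by (intro closed) (simp add: closedin_Hausdorff_singleton)
      then have "closedin X {z}" using k by simp
      then have "closedin K {k \<in> topspace K. u k \<in> {z}}" by (rule closedin_continuous_map_preimage[OF u])
      then show ?thesis by simp
    qed
    have "disjnt {k \<in> topspace K. u k = x} {k \<in> topspace K. u k = y}"
      using xy(3) by (auto simp: disjnt_def)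
    then obtain N M where NM: "openin K N" "openin K M" "{k \<in> topspace K. u k = x} \<subseteq> N"
      "{k \<in> topspace K. u k = y} \<subseteq> M" "disjnt N M"
      using normal fib xy unfolding normal_space_def by (metis (no_types, lifting) IntD2 topspace_subtopology)
    let ?A = "topspace X - u ` (topspace K - N)" and ?B = "topspace X - u ` (topspace K - M)"
    have "openin X ?A" "openin X ?B" using closed NM(1,2) by (auto intro!: openin_diff)
    then have "openin (subtopology X (u ` topspace K)) (u ` topspace K \<inter> ?A)"
      "openin (subtopology X (u ` topspace K)) (u ` topspace K \<inter> ?B)"
      by (auto simp: openin_subtopology_Int2)
    moreover have "x \<in> u ` topspace K \<inter> ?A" "y \<in> u ` topspace K \<inter> ?B"
      using xy NM(3,4) by auto
    moreover have "disjnt (u ` topspace K \<inter> ?A) (u ` topspace K \<inter> ?B)"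
      using NM(5) by (auto simp: disjnt_def)
    ultimately show "\<exists>U V. openin (subtopology X (u ` topspace K)) U \<and>
      openin (subtopology X (u ` topspace K)) V \<and> x \<in> U \<and> y \<in> V \<and> disjnt U V" by blast
  qed
qed

lemma Hausdorff_space_separating_maps:
  assumes "\<And>x y. x \<in> topspace X \<Longrightarrow> y \<in> topspace X \<Longrightarrow> x \<noteq> y \<Longrightarrow>
    \<exists>U V. openin X U \<and> openin X V \<and> x \<in> U \<and> y \<in> V \<and> U \<inter> V \<inter> topspace X = {}"
  shows "Hausdorff_space X"
  unfolding Hausdorff_space_def
proof (intro allI impI, elim conjE)
  fix x y assume "x \<in> topspace X" "y \<in> topspace X" "x \<noteq> y"
  then obtain U V where "openin X U" "openin X V" "x \<in> U" "y \<in> V" "U \<inter> V \<inter> topspace X = {}"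
    using assms[of x y] by metis
  then show "\<exists>U V. openin X U \<and> openin X V \<and> x \<in> U \<and> y \<in> V \<and> disjnt U V"
    unfolding disjnt_def by (metis inf.absorb1 inf_assoc openin_subset inf_commute)
qed

lemma Hausdorff_space_separate:
  assumes "continuous_map X Y f" "Hausdorff_space Y" "x \<in> topspace X" "y \<in> topspace X" "f x \<noteq> f y"
  shows "\<exists>U V. openin X U \<and> openin X V \<and> x \<in> U \<and> y \<in> V \<and> U \<inter> V \<inter> topspace X = {}"
proof -
  have "f x \<in> topspace Y" "f y \<in> topspace Y"
    using assms by (auto simp: continuous_map_def)
  then obtain U V where UV: "openin Y U" "openin Y V" "f x \<in> U" "f y \<in> V" "disjnt U V"
    using assms(2,5) unfolding Hausdorff_space_def by metis
  show ?thesis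
  proof (intro exI conjI)
    show "openin X {x \<in> topspace X. f x \<in> U}" "openin X {x \<in> topspace X. f x \<in> V}"
      using UV assms(1) by (auto intro: openin_continuous_map_preimage)
  qed (use UV assms in \<open>auto simp: disjnt_def\<close>)
qed

lemma k_Hausdorff_injection:
  assumes "k_Hausdorff Y" and f: "continuous_map X Y f" and "inj_on f (topspace X)"
  shows "k_Hausdorff X"
  unfolding k_Hausdorff_def
proof (intro allI impI, elim conjE)
  fix K :: "'b set set topology" and u
  assume K: "compact_space K" "Hausdorff_space K" and u: "continuous_map K X u"
  have "continuous_map K Y (f \<circ> u)" using u f by (rule continuous_map_compose)
  then have H: "Hausdorff_space (subtopology Y ((f \<circ> u) ` topspace K))"
    by (rule k_HausdorffD[OF assms(1) K])
  have us: "u ` topspace K \<subseteq> topspace X" using u by (auto simp: continuous_map_def)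
  have c: "continuous_map (subtopology X (u ` topspace K)) (subtopology Y ((f \<circ> u) ` topspace K)) f"
    using f by (auto simp: continuous_map_in_subtopology continuous_map_from_subtopology)
  show "Hausdorff_space (subtopology X (u ` topspace K))"
    by (rule Hausdorff_space_injective_preimage[OF H c])
       (use assms(3) us in \<open>auto intro: inj_on_subset\<close>)
qed

lemma k_Hausdorff_product:
  assumes "\<And>i. i \<in> I \<Longrightarrow> k_Hausdorff (X i)"
  shows "k_Hausdorff (product_topology X I)"
  unfolding k_Hausdorff_def
proof (intro allI impI, elim conjE)
  fix K :: "('a \<Rightarrow> 'b) set set topology" and u
  assume K: "compact_space K" "Hausdorff_space K" and u: "continuous_map K (product_topology X I) u"
  let ?S = "subtopology (product_topology X I) (u ` topspace K)"
  show "Hausdorff_space ?S"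
  proof (rule Hausdorff_space_separating_maps)
    fix x y assume xy: "x \<in> topspace ?S" "y \<in> topspace ?S" "x \<noteq> y"
    then have "x \<in> extensional I" "y \<in> extensional I" by (auto simp: PiE_def)
    then obtain i where i: "i \<in> I" "x i \<noteq> y i" using xy(3) by (metis extensionalityI)
    have "continuous_map K (X i) (\<lambda>k. u k i)"
      using u i continuous_map_componentwise by fastforce
    then have H: "Hausdorff_space (subtopology (X i) ((\<lambda>k. u k i) ` topspace K))"
      by (rule k_HausdorffD[OF assms[OF i(1)] K])
    have "continuous_map ?S (subtopology (X i) ((\<lambda>k. u k i) ` topspace K)) (\<lambda>f. f i)"
      using i by (auto simp: continuous_map_in_subtopology
          intro!: continuous_map_from_subtopology continuous_map_product_projection)
    from Hausdorff_space_separate[OF this H xy(1,2)] i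
    show "\<exists>U V. openin ?S U \<and> openin ?S V \<and> x \<in> U \<and> y \<in> V \<and> U \<inter> V \<inter> topspace ?S = {}" by blast
  qed
qed

lemma k_Hausdorff_prod:
  assumes "k_Hausdorff X" "k_Hausdorff Y"
  shows "k_Hausdorff (prod_topology X Y)"
  unfolding k_Hausdorff_def
proof (intro allI impI, elim conjE)
  fix K :: "('a \<times> 'b) set set topology" and u
  assume K: "compact_space K" "Hausdorff_space K" and u: "continuous_map K (prod_topology X Y) u"
  let ?S = "subtopology (prod_topology X Y) (u ` topspace K)"
  have c1: "continuous_map K X (fst \<circ> u)" and c2: "continuous_map K Y (snd \<circ> u)"
    using u by (auto simp: continuous_map_pairwise)
  have H1: "Hausdorff_space (subtopology X ((fst \<circ> u) ` topspace K))"
    by (rule k_HausdorffD[OF assms(1) K c1])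
  have H2: "Hausdorff_space (subtopology Y ((snd \<circ> u) ` topspace K))"
    by (rule k_HausdorffD[OF assms(2) K c2])
  have m1: "continuous_map ?S (subtopology X ((fst \<circ> u) ` topspace K)) fst"
    by (auto simp: continuous_map_in_subtopology continuous_map_fst continuous_map_from_subtopology)
  have m2: "continuous_map ?S (subtopology Y ((snd \<circ> u) ` topspace K)) snd"
    by (auto simp: continuous_map_in_subtopology continuous_map_snd continuous_map_from_subtopology)
  show "Hausdorff_space ?S"
  proof (rule Hausdorff_space_separating_maps)
    fix x y assume xy: "x \<in> topspace ?S" "y \<in> topspace ?S" "x \<noteq> y"
    then consider "fst x \<noteq> fst y" | "snd x \<noteq> snd y" by (metis prod.collapse)
    then show "\<exists>U V. openin ?S U \<and> openin ?S V \<and> x \<in> U \<and> y \<in> V \<and> U \<inter> V \<inter> topspace ?S = {}"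
      using Hausdorff_space_separate[OF m1 H1 xy(1,2)] Hausdorff_space_separate[OF m2 H2 xy(1,2)]
      by cases blast+
  qed
qed

lemma k_Hausdorff_kify: "k_Hausdorff X \<Longrightarrow> k_Hausdorff (kify X)"
  by (rule k_Hausdorff_injection[where f = id])
     (auto intro: continuous_map_from_kify)

text \<open>
  A map into a \<^const>\<open>k_Hausdorff\<close> space stays continuous when both topologies are made compactly
  generated, because it maps test sets to test sets.  The closed set \<open>P\<close> allows for maps that are
  given separately on the pieces of a partition.
\<close>

lemma openin_kify_preimage:
  assumes f: "continuous_map (subtopology X C) Z f" and Z: "k_Hausdorff Z"
    and C: "compactin X C" "Hausdorff_space (subtopology X C)" and U: "openin (kify Z) U"
  shows "openin (subtopology X C) {x \<in> C. f x \<in> U}"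
proof -
  have tC: "topspace (subtopology X C) = C"
    using C(1) by (meson compactin_subset_topspace topspace_subtopology_subset)
  have cC: "compact_space (subtopology X C)" using C(1) by (simp add: compactin_subspace)
  have "compactin Z (f ` C)" using image_compactin f cC tC by (metis compact_space_def)
  moreover have "Hausdorff_space (subtopology Z (f ` C))"
    using k_HausdorffD[OF Z cC C(2) f] tC by simp
  ultimately have "openin (subtopology Z (f ` C)) (f ` C \<inter> U)"
    using U by (simp add: openin_kify)
  moreover have "continuous_map (subtopology X C) (subtopology Z (f ` C)) f"
    using f tC by (simp add: continuous_map_in_subtopology)
  ultimately have "openin (subtopology X C) {x \<in> topspace (subtopology X C). f x \<in> f ` C \<inter> U}"
    using openin_continuous_map_preimage by blast
  moreover have "{x \<in> topspace (subtopology X C). f x \<in> f ` C \<inter> U} = {x \<in> C. f x \<in> U}"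
    using tC by auto
  ultimately show ?thesis by simp
qed

lemma continuous_map_into_kify_closed:
  assumes f: "continuous_map (subtopology (kify X) P) Z f" and Z: "k_Hausdorff Z"
    and P: "closedin (kify X) P"
  shows "continuous_map (subtopology (kify X) P) (kify Z) f"
  unfolding continuous_map_def
proof (intro conjI allI impI)
  have PX: "P \<subseteq> topspace X" using closedin_subset[OF P] by simp
  then have tP: "topspace (subtopology (kify X) P) = P" by (simp add: inf_absorb2)
  show "f \<in> topspace (subtopology (kify X) P) \<rightarrow> topspace (kify Z)"
    using f by (auto simp: continuous_map_def)
  fix U assume U: "openin (kify Z) U"
  let ?O = "{x \<in> topspace X. x \<notin> P \<or> f x \<in> U}"
  have "openin (kify X) ?O"
    unfolding openin_kify
  proof (intro conjI allI impI)
    fix C assume C: "compactin X C \<and> Hausdorff_space (subtopology X C)"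
    have k: "subtopology (kify X) C = subtopology X C" using C subtopology_kify_compact by blast
    have tC: "topspace (subtopology X C) = C" using C by (simp add: compactin_subset_topspace inf_absorb2)
    have cl: "closedin (subtopology X C) (C \<inter> P)"
      using P k by (metis closedin_subtopology_Int_closed inf_commute)
    then have "compactin (subtopology X C) (C \<inter> P)"
      using C by (meson closedin_compact_space compactin_subspace)
    then have cCP: "compactin X (C \<inter> P)" by (simp add: compactin_subtopology)
    have hCP: "Hausdorff_space (subtopology X (C \<inter> P))"
      using C by (metis Hausdorff_space_subtopology subtopology_subtopology)
    have "subtopology (subtopology (kify X) P) (C \<inter> P) = subtopology X (C \<inter> P)"
      by (metis (no_types) cCP hCP inf.right_idem inf_commute subtopology_kify_compact subtopology_subtopology)
    then have "continuous_map (subtopology X (C \<inter> P)) Z f"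
      using continuous_map_from_subtopology[OF f] by metis
    from openin_kify_preimage[OF this Z cCP hCP U]
    have "closedin (subtopology X (C \<inter> P)) (C \<inter> P - {x \<in> C \<inter> P. f x \<in> U})"
      using closedin_diff[OF closedin_topspace, of "subtopology X (C \<inter> P)"] compactin_subset_topspace[OF cCP]
      by (simp add: inf_absorb2)
    then have "closedin (subtopology (subtopology X C) (C \<inter> P)) (C \<inter> P - {x \<in> C \<inter> P. f x \<in> U})"
      by (simp add: subtopology_subtopology)
    then have "closedin (subtopology X C) (C \<inter> P - {x \<in> C \<inter> P. f x \<in> U})"
      by (rule closedin_trans_full[OF _ cl])
    then have "openin (subtopology X C) (C - (C \<inter> P - {x \<in> C \<inter> P. f x \<in> U}))"
      using tC by (metis openin_closedin_eq openin_diff openin_topspace)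
    moreover have "C \<inter> ?O = C - (C \<inter> P - {x \<in> C \<inter> P. f x \<in> U})"
      using compactin_subset_topspace[of X C] C by auto
    ultimately show "openin (subtopology X C) (C \<inter> ?O)" by simp
  qed auto
  moreover have "{x \<in> topspace (subtopology (kify X) P). f x \<in> U} = ?O \<inter> P"
    unfolding tP using PX by auto
  ultimately show "openin (subtopology (kify X) P) {x \<in> topspace (subtopology (kify X) P). f x \<in> U}"
    by (auto simp: openin_subtopology)
qed

lemma continuous_map_into_kify:
  assumes "continuous_map (kify X) Z f" "k_Hausdorff Z"
  shows "continuous_map (kify X) (kify Z) f"
proof -
  have "subtopology (kify X) (topspace X) = kify X" by (metis subtopology_topspace topspace_kify)
  moreover have "closedin (kify X) (topspace X)"
    by (metis closedin_topspace topspace_kify)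
  ultimately show ?thesis
    using continuous_map_into_kify_closed[of X "topspace X" Z f] assms by simp
qed

text \<open>
  By the tube lemma, a map on \<open>kify X \<times> L\<close> with \<open>L\<close> compact Hausdorff can be tested on the products of
  the test sets with \<open>L\<close>.
\<close>

lemma continuous_map_prod_kify_compact:
  assumes L: "compact_space L" "Hausdorff_space L"
    and C: "\<And>C. compactin X C \<Longrightarrow> Hausdorff_space (subtopology X C) \<Longrightarrow>
        continuous_map (prod_topology (subtopology X C) L) Z f"
    and func: "f \<in> topspace X \<times> topspace L \<rightarrow> topspace Z"
  shows "continuous_map (prod_topology (kify X) L) Z f"
  unfolding continuous_map_def
proof (intro conjI allI impI)
  show "f \<in> topspace (prod_topology (kify X) L) \<rightarrow> topspace Z" using func by simp
  fix U assume U: "openin Z U"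
  let ?W = "{x \<in> topspace (prod_topology (kify X) L). f x \<in> U}"
  have W: "?W = {x \<in> topspace X \<times> topspace L. f x \<in> U}" by simp
  have WC: "openin (prod_topology (subtopology X C) L) {x \<in> C \<times> topspace L. f x \<in> U}"
    if "compactin X C" "Hausdorff_space (subtopology X C)" for C
    using openin_continuous_map_preimage[OF C[OF that] U] that(1)
    by (simp add: compactin_subset_topspace inf_absorb2)
  show "openin (prod_topology (kify X) L) ?W"
    unfolding openin_prod_topology_alt
  proof (intro allI impI)
    fix x s assume xs: "(x, s) \<in> ?W"
    then have x: "x \<in> topspace X" and s: "s \<in> topspace L" and fU: "f (x, s) \<in> U" by auto
    have "openin (prod_topology (subtopology X {x}) L) {y \<in> {x} \<times> topspace L. f y \<in> U}"
      by (rule WC) (use x in \<open>auto simp: Hausdorff_space_def\<close>)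
    moreover have "(x, s) \<in> {y \<in> {x} \<times> topspace L. f y \<in> U}" using s fU by simp
    ultimately obtain A B where AB: "openin (subtopology X {x}) A" "openin L B" "x \<in> A" "s \<in> B"
      "A \<times> B \<subseteq> {y \<in> {x} \<times> topspace L. f y \<in> U}"
      unfolding openin_prod_topology_alt by meson
    have "neighbourhood_base_of (compactin L) L"
      using L compact_imp_locally_compact_space locally_compact_space_neighbourhood_base[of L] by blast
    then obtain O' N where ON: "openin L O'" "compactin L N" "s \<in> O'" "O' \<subseteq> N" "N \<subseteq> B"
      using AB(2,4) unfolding neighbourhood_base_of by metis
    let ?U = "{y \<in> topspace X. {y} \<times> N \<subseteq> ?W}"
    have "openin (kify X) ?U"
      unfolding openin_kify
    proof (intro conjI allI impI)
      fix C assume CC: "compactin X C \<and> Hausdorff_space (subtopology X C)"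
      have tC: "topspace (subtopology X C) = C"
        using CC by (simp add: compactin_subset_topspace inf_absorb2)
      show "openin (subtopology X C) (C \<inter> ?U)"
      proof (subst openin_subopen, intro ballI)
        fix y assume y: "y \<in> C \<inter> ?U"
        have "\<exists>T V. openin (subtopology X C) T \<and> openin L V \<and> y \<in> T \<and> N \<subseteq> V \<and>
          T \<times> V \<subseteq> {x \<in> C \<times> topspace L. f x \<in> U}"
          by (rule tube_lemma_right[OF WC]) (use CC ON y tC in auto)
        then obtain T V where TV: "openin (subtopology X C) T" "openin L V" "y \<in> T" "N \<subseteq> V"
          "T \<times> V \<subseteq> {x \<in> C \<times> topspace L. f x \<in> U}" by blast
        have "T \<subseteq> C \<inter> ?U"
          using TV(4,5) openin_subset[OF TV(1)] tC CC compactin_subset_topspace by fastforce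
        then show "\<exists>T. openin (subtopology X C) T \<and> y \<in> T \<and> T \<subseteq> C \<inter> ?U"
          using TV(1,3) by blast
      qed
    qed auto
    moreover have "x \<in> ?U" using x ON AB openin_subset[OF AB(2)] by auto
    moreover have "?U \<times> O' \<subseteq> ?W" using ON(4) by auto
    ultimately show "\<exists>U V. openin (kify X) U \<and> openin L V \<and> x \<in> U \<and> s \<in> V \<and> U \<times> V \<subseteq> ?W"
      using ON(1,3) by blast
  qed
qed


section \<open>Spaces of maps\<close>

text \<open>The compact-open topology, before it is made compactly generated.\<close>

definition compact_open :: "'a topology \<Rightarrow> 'b topology \<Rightarrow> ('a \<Rightarrow> 'b) topology" where
  "compact_open X Y = topology_generated_by
     {{f \<in> extensional (topspace X). continuous_map X Y f \<and> f ` K \<subseteq> U} | K U.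
        compactin X K \<and> openin Y U}"

lemma map_space_eq: "map_space X Y = kify (compact_open X Y)"
  by (simp add: map_space_def compact_open_def)

lemma topspace_compact_open:
  "topspace (compact_open X Y) = {f \<in> extensional (topspace X). continuous_map X Y f}"
proof -
  have "{f \<in> extensional (topspace X). continuous_map X Y f} \<in>
    {{f \<in> extensional (topspace X). continuous_map X Y f \<and> f ` K \<subseteq> U} | K U. compactin X K \<and> openin Y U}"
    by (rule CollectI, rule exI[of _ "{}"], rule exI[of _ "{}"]) auto
  then show ?thesis unfolding compact_open_def topology_generated_by_topspace by blast
qed

lemma topspace_map_space:
  "topspace (map_space X Y) = {f \<in> extensional (topspace X). continuous_map X Y f}"
  by (simp add: map_space_eq topspace_compact_open)

lemma openin_compact_open:
  assumes "compactin X K" "openin Y U"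
  shows "openin (compact_open X Y) {f \<in> extensional (topspace X). continuous_map X Y f \<and> f ` K \<subseteq> U}"
  unfolding compact_open_def by (rule topology_generated_by_Basis) (use assms in blast)

lemma continuous_map_into_compact_open:
  assumes "\<And>s. s \<in> topspace S \<Longrightarrow> F s \<in> extensional (topspace X) \<and> continuous_map X Y (F s)"
    and "\<And>K U. compactin X K \<Longrightarrow> openin Y U \<Longrightarrow> openin S {s \<in> topspace S. F s ` K \<subseteq> U}"
  shows "continuous_map S (compact_open X Y) F"
  unfolding compact_open_def
proof (rule continuous_on_generated_topo)
  fix W assume "W \<in> {{f \<in> extensional (topspace X). continuous_map X Y f \<and> f ` K \<subseteq> U} | K U.
    compactin X K \<and> openin Y U}"
  then obtain K U where KU: "compactin X K" "openin Y U"
    and W: "W = {f \<in> extensional (topspace X). continuous_map X Y f \<and> f ` K \<subseteq> U}" by blast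
  have "F -` W \<inter> topspace S = {s \<in> topspace S. F s ` K \<subseteq> U}" using assms(1) W by auto
  then show "openin S (F -` W \<inter> topspace S)" using assms(2)[OF KU] by simp
next
  have "F ` topspace S \<subseteq> topspace (compact_open X Y)"
    using assms(1) by (auto simp: topspace_compact_open)
  then show "F ` topspace S \<subseteq> \<Union> {{f \<in> extensional (topspace X). continuous_map X Y f \<and> f ` K \<subseteq> U} | K U.
    compactin X K \<and> openin Y U}"
    unfolding compact_open_def topology_generated_by_topspace .
qed

lemma continuous_map_compact_open_eval:
  assumes "x \<in> topspace X"
  shows "continuous_map (compact_open X Y) Y (\<lambda>f. f x)"
  unfolding continuous_map_def
proof (intro conjI allI impI)
  show "(\<lambda>f. f x) \<in> topspace (compact_open X Y) \<rightarrow> topspace Y"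
    using assms by (auto simp: topspace_compact_open continuous_map_def)
  fix U assume "openin Y U"
  then have "openin (compact_open X Y) {f \<in> extensional (topspace X). continuous_map X Y f \<and> f ` {x} \<subseteq> U}"
    using assms by (intro openin_compact_open) auto
  moreover have "{f \<in> extensional (topspace X). continuous_map X Y f \<and> f ` {x} \<subseteq> U} =
    {f \<in> topspace (compact_open X Y). f x \<in> U}"
    by (auto simp: topspace_compact_open)
  ultimately show "openin (compact_open X Y) {f \<in> topspace (compact_open X Y). f x \<in> U}" by simp
qed

lemma continuous_map_map_space_eval:
  "x \<in> topspace X \<Longrightarrow> continuous_map (map_space X Y) Y (\<lambda>f. f x)"
  by (simp add: map_space_eq continuous_map_from_kify continuous_map_compact_open_eval)

lemma Hausdorff_space_compact_open:
  assumes "Hausdorff_space Y"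
  shows "Hausdorff_space (compact_open X Y)"
proof (rule Hausdorff_space_separating_maps)
  fix f g assume fg: "f \<in> topspace (compact_open X Y)" "g \<in> topspace (compact_open X Y)" "f \<noteq> g"
  then obtain x where "x \<in> topspace X" "f x \<noteq> g x"
    by (metis (mono_tags, lifting) extensionalityI mem_Collect_eq topspace_compact_open)
  then show "\<exists>U V. openin (compact_open X Y) U \<and> openin (compact_open X Y) V \<and> f \<in> U \<and> g \<in> V \<and>
      U \<inter> V \<inter> topspace (compact_open X Y) = {}"
    using Hausdorff_space_separate[OF continuous_map_compact_open_eval assms fg(1,2)] by blast
qed

lemma Hausdorff_space_map_space: "Hausdorff_space Y \<Longrightarrow> Hausdorff_space (map_space X Y)"
  by (simp add: map_space_eq Hausdorff_space_kify Hausdorff_space_compact_open)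

lemma continuous_map_compact_open_compose:
  assumes \<phi>: "continuous_map X' X \<phi>" and \<psi>: "continuous_map Y Y' \<psi>"
  shows "continuous_map (compact_open X Y) (compact_open X' Y')
           (\<lambda>f. \<lambda>x\<in>topspace X'. \<psi> (f (\<phi> x)))"
proof (rule continuous_map_into_compact_open)
  fix f assume "f \<in> topspace (compact_open X Y)"
  then have "continuous_map X' Y' (\<psi> \<circ> f \<circ> \<phi>)"
    using \<phi> \<psi> by (auto simp: topspace_compact_open intro!: continuous_map_compose)
  then have "continuous_map X' Y' (\<lambda>x\<in>topspace X'. \<psi> (f (\<phi> x)))"
    by (rule continuous_map_eq) simp
  then show "(\<lambda>x\<in>topspace X'. \<psi> (f (\<phi> x))) \<in> extensional (topspace X') \<and>
    continuous_map X' Y' (\<lambda>x\<in>topspace X'. \<psi> (f (\<phi> x)))" by simp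
next
  fix K U assume K: "compactin X' K" and U: "openin Y' U"
  have "openin (compact_open X Y) {f \<in> extensional (topspace X). continuous_map X Y f \<and>
      f ` (\<phi> ` K) \<subseteq> {y \<in> topspace Y. \<psi> y \<in> U}}"
    by (intro openin_compact_open image_compactin[OF K \<phi>] openin_continuous_map_preimage[OF \<psi> U])
  moreover have "{f \<in> extensional (topspace X). continuous_map X Y f \<and>
      f ` (\<phi> ` K) \<subseteq> {y \<in> topspace Y. \<psi> y \<in> U}} =
    {f \<in> topspace (compact_open X Y). (\<lambda>x\<in>topspace X'. \<psi> (f (\<phi> x))) ` K \<subseteq> U}"
    using compactin_subset_topspace[OF K] \<phi>
    by (auto simp: topspace_compact_open image_subset_iff continuous_map_def Pi_iff subset_iff)
  ultimately show "openin (compact_open X Y)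
      {f \<in> topspace (compact_open X Y). (\<lambda>x\<in>topspace X'. \<psi> (f (\<phi> x))) ` K \<subseteq> U}" by simp
qed

lemma continuous_map_map_space_compose:
  assumes "continuous_map X' X \<phi>" "continuous_map Y Y' \<psi>" "Hausdorff_space Y'"
  shows "continuous_map (map_space X Y) (map_space X' Y') (\<lambda>f. \<lambda>x\<in>topspace X'. \<psi> (f (\<phi> x)))"
  unfolding map_space_eq
  by (intro continuous_map_into_kify continuous_map_from_kify continuous_map_compact_open_compose
      Hausdorff_imp_k_Hausdorff Hausdorff_space_compact_open assms)

lemma continuous_map_compact_open_curry:
  assumes F: "continuous_map (prod_topology S X) Y F"
  shows "continuous_map S (compact_open X Y) (\<lambda>s. \<lambda>x\<in>topspace X. F (s, x))"
proof (rule continuous_map_into_compact_open)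
  fix s assume s: "s \<in> topspace S"
  have "continuous_map X (prod_topology S X) (\<lambda>x. (s, x))"
    using s by (simp add: continuous_map_pairwise o_def)
  from continuous_map_compose[OF this F]
  have "continuous_map X Y (\<lambda>x\<in>topspace X. F (s, x))"
    by (rule continuous_map_eq) simp
  then show "(\<lambda>x\<in>topspace X. F (s, x)) \<in> extensional (topspace X) \<and>
    continuous_map X Y (\<lambda>x\<in>topspace X. F (s, x))" by simp
next
  fix K U assume K: "compactin X K" and U: "openin Y U"
  let ?W = "{x \<in> topspace (prod_topology S X). F x \<in> U}"
  have W: "openin (prod_topology S X) ?W" by (rule openin_continuous_map_preimage[OF F U])
  show "openin S {s \<in> topspace S. (\<lambda>x\<in>topspace X. F (s, x)) ` K \<subseteq> U}"
  proof (subst openin_subopen, intro ballI)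
    fix s assume s: "s \<in> {s \<in> topspace S. (\<lambda>x\<in>topspace X. F (s, x)) ` K \<subseteq> U}"
    have sK: "{s} \<times> K \<subseteq> ?W" using s compactin_subset_topspace[OF K] by (fastforce simp: image_subset_iff)
    have "s \<in> topspace S" using s by simp
    then obtain T V where TV: "openin S T" "openin X V" "s \<in> T" "K \<subseteq> V" "T \<times> V \<subseteq> ?W"
      using tube_lemma_right[OF W K _ sK] by blast
    have "T \<subseteq> {s \<in> topspace S. (\<lambda>x\<in>topspace X. F (s, x)) ` K \<subseteq> U}"
    proof
      fix t assume t: "t \<in> T"
      have "F (t, x) \<in> U \<and> x \<in> topspace X" if "x \<in> K" for x
      proof -
        have "(t, x) \<in> ?W" using TV(4,5) t that by blast
        then show ?thesis by simp
      qed
      then show "t \<in> {s \<in> topspace S. (\<lambda>x\<in>topspace X. F (s, x)) ` K \<subseteq> U}"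
        using t openin_subset[OF TV(1)] by auto
    qed
    then show "\<exists>T. openin S T \<and> s \<in> T \<and> T \<subseteq> {s \<in> topspace S. (\<lambda>x\<in>topspace X. F (s, x)) ` K \<subseteq> U}"
      using TV(1,3) by blast
  qed
qed

lemma continuous_map_compact_open_uncurry:
  assumes F: "continuous_map S (compact_open X Y) F"
    and X: "locally_compact_space X" "Hausdorff_space X"
  shows "continuous_map (prod_topology S X) Y (\<lambda>(s, x). F s x)"
  unfolding continuous_map_def
proof (intro conjI allI impI)
  have Fs: "continuous_map X Y (F s)" if "s \<in> topspace S" for s
  proof -
    have "F s \<in> topspace (compact_open X Y)" using F that by (auto simp: continuous_map_def)
    then show ?thesis by (simp add: topspace_compact_open)
  qed
  then show "(\<lambda>(s, x). F s x) \<in> topspace (prod_topology S X) \<rightarrow> topspace Y"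
    by (auto simp: continuous_map_def Pi_iff)
  fix U assume U: "openin Y U"
  show "openin (prod_topology S X) {z \<in> topspace (prod_topology S X). (\<lambda>(s, x). F s x) z \<in> U}"
    unfolding openin_prod_topology_alt
  proof (intro allI impI)
    fix s x assume "(s, x) \<in> {z \<in> topspace (prod_topology S X). (\<lambda>(s, x). F s x) z \<in> U}"
    then have s: "s \<in> topspace S" and x: "x \<in> topspace X" and U': "F s x \<in> U" by auto
    have "openin X {y \<in> topspace X. F s y \<in> U}" by (rule openin_continuous_map_preimage[OF Fs[OF s] U])
    \<comment> \<open>Local compactness provides a compact neighbourhood that \<open>F s\<close> maps into \<open>U\<close>.\<close>
    moreover have "neighbourhood_base_of (compactin X) X"
      using X locally_compact_space_neighbourhood_base by blast
    ultimately obtain M N where MN: "openin X M" "compactin X N" "x \<in> M" "M \<subseteq> N"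
      "N \<subseteq> {y \<in> topspace X. F s y \<in> U}"
      using x U' unfolding neighbourhood_base_of by (metis (mono_tags, lifting) mem_Collect_eq)
    let ?B = "{f \<in> extensional (topspace X). continuous_map X Y f \<and> f ` N \<subseteq> U}"
    have "openin S {s \<in> topspace S. F s \<in> ?B}"
      by (rule openin_continuous_map_preimage[OF F openin_compact_open[OF MN(2) U]])
    moreover have "F s \<in> ?B"
      using MN(5) F s by (auto simp: continuous_map_def topspace_compact_open Pi_iff)
    moreover have "{s \<in> topspace S. F s \<in> ?B} \<times> M \<subseteq>
      {z \<in> topspace (prod_topology S X). (\<lambda>(s, x). F s x) z \<in> U}"
      using MN(4) openin_subset[OF MN(1)] by auto
    ultimately show "\<exists>A B. openin S A \<and> openin X B \<and> s \<in> A \<and> x \<in> B \<and> A \<times> B \<subseteq>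
      {z \<in> topspace (prod_topology S X). (\<lambda>(s, x). F s x) z \<in> U}"
      using MN(1,3) s by blast
  qed
qed


section \<open>Smooth maps on a linear subspace\<close>

lemma dir_deriv_cong:
  assumes "subspace V" "x \<in> V" "v \<in> V" "\<And>y. y \<in> V \<Longrightarrow> f y = g y"
  shows "dir_deriv v f x = dir_deriv v g x"
proof -
  have "f (x + t *\<^sub>R v) = g (x + t *\<^sub>R v)" for t
    by (intro assms(4) subspace_add subspace_scale assms)
  then show ?thesis by (simp add: dir_deriv_def)
qed

lemma fold_dir_deriv_cong:
  assumes "subspace V" "vs \<in> lists V" "\<And>y. y \<in> V \<Longrightarrow> f y = g y" "x \<in> V"
  shows "fold dir_deriv vs f x = fold dir_deriv vs g x"
  using assms(2-4)
proof (induction vs arbitrary: f g)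
  case (Cons v vs)
  have "fold dir_deriv vs (dir_deriv v f) x = fold dir_deriv vs (dir_deriv v g) x"
  proof (rule Cons.IH)
    show "x \<in> V" by (rule Cons.prems(2))
    show "dir_deriv v f y = dir_deriv v g y" if "y \<in> V" for y
      by (rule dir_deriv_cong[OF assms(1) that Cons.hyps(1) Cons.prems(1)])
  qed
  then show ?case by simp
qed simp

lemma smooth_on_subspaceD:
  assumes "smooth_on_subspace V f"
  shows "continuous_on V f"
    and "x \<in> V \<Longrightarrow> v \<in> V \<Longrightarrow> (\<lambda>t. f (x + t *\<^sub>R v)) differentiable (at (0::real))"
    and "v \<in> V \<Longrightarrow> smooth_on_subspace V (dir_deriv v f)"
proof -
  show "continuous_on V f"
    using bspec[OF assms[unfolded smooth_on_subspace_def], of "[]"] by simp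
  show "x \<in> V \<Longrightarrow> v \<in> V \<Longrightarrow> (\<lambda>t. f (x + t *\<^sub>R v)) differentiable (at (0::real))"
    using bspec[OF assms[unfolded smooth_on_subspace_def], of "[]"] by simp
  assume v: "v \<in> V"
  show "smooth_on_subspace V (dir_deriv v f)"
    unfolding smooth_on_subspace_def
  proof
    fix vs assume "vs \<in> lists V"
    then have "v # vs \<in> lists V" using v by simp
    then show "continuous_on V (fold dir_deriv vs (dir_deriv v f)) \<and>
      (\<forall>x\<in>V. \<forall>w\<in>V. (\<lambda>t. fold dir_deriv vs (dir_deriv v f) (x + t *\<^sub>R w)) differentiable (at (0::real)))"
      using bspec[OF assms[unfolded smooth_on_subspace_def], of "v # vs"] by simp
  qed
qed

lemma smooth_on_subspace_coinduct:
  assumes "P f"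
    and "\<And>f. P f \<Longrightarrow> continuous_on V f \<and>
      (\<forall>x\<in>V. \<forall>v\<in>V. (\<lambda>t. f (x + t *\<^sub>R v)) differentiable (at (0::real))) \<and> (\<forall>v\<in>V. P (dir_deriv v f))"
  shows "smooth_on_subspace V f"
  unfolding smooth_on_subspace_def
proof
  fix vs assume "vs \<in> lists V"
  then show "continuous_on V (fold dir_deriv vs f) \<and>
      (\<forall>x\<in>V. \<forall>v\<in>V. (\<lambda>t. fold dir_deriv vs f (x + t *\<^sub>R v)) differentiable (at (0::real)))"
    using assms(1)
  proof (induction vs arbitrary: f)
    case Nil
    then show ?case using assms(2) by simp
  next
    case (Cons v vs)
    then have "P (dir_deriv v f)" using assms(2) by simp
    then show ?case using Cons by simp
  qed
qed

lemma has_vector_derivative_dir_deriv: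
  assumes "(\<lambda>t. f (x + t *\<^sub>R v)) differentiable (at (0::real))"
  shows "((\<lambda>t. f (x + t *\<^sub>R v)) has_vector_derivative dir_deriv v f x) (at 0)"
  using assms unfolding dir_deriv_def by (simp add: vector_derivative_works[symmetric])

lemma has_vector_derivative_dir_deriv_at:
  assumes V: "subspace V" "x \<in> V" "v \<in> V"
    and "\<And>x. x \<in> V \<Longrightarrow> (\<lambda>t. f (x + t *\<^sub>R v)) differentiable (at (0::real))"
  shows "((\<lambda>s. f (x + s *\<^sub>R v)) has_vector_derivative dir_deriv v f (x + t *\<^sub>R v)) (at t)"
proof -
  have 1: "((\<lambda>s. s - t) has_vector_derivative 1) (at t)"
    by (auto intro!: derivative_eq_intros)
  have "x + t *\<^sub>R v \<in> V" using V by (simp add: subspace_add subspace_scale)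
  then have "((\<lambda>s. f ((x + t *\<^sub>R v) + s *\<^sub>R v)) has_vector_derivative dir_deriv v f (x + t *\<^sub>R v)) (at (t - t))"
    using has_vector_derivative_dir_deriv[OF assms(4)] by simp
  from vector_diff_chain_at[OF 1 this]
  have "((\<lambda>s. f (x + t *\<^sub>R v + (s - t) *\<^sub>R v)) has_vector_derivative dir_deriv v f (x + t *\<^sub>R v)) (at t)"
    by (simp add: o_def)
  moreover have "x + t *\<^sub>R v + (s - t) *\<^sub>R v = x + s *\<^sub>R v" for s by (simp add: algebra_simps)
  ultimately show ?thesis by simp
qed

text \<open>
  A map with continuous directional derivatives is Frechet differentiable: add the basis vectors
  one at a time and apply the mean value inequality in each direction.
\<close>

lemma frechet_estimate:
  fixes g :: "'v::euclidean_space \<Rightarrow> 'v"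
  assumes V: "subspace V" and y: "y \<in> V"
    and diff: "\<And>x v. x \<in> V \<Longrightarrow> v \<in> V \<Longrightarrow> (\<lambda>t. g (x + t *\<^sub>R v)) differentiable (at (0::real))"
    and cont: "\<And>v. v \<in> V \<Longrightarrow> continuous_on V (dir_deriv v g)"
    and "finite S" "S \<subseteq> V" and "e > 0"
  shows "\<exists>d>0. \<forall>c. (\<forall>b\<in>S. \<bar>c b\<bar> < d) \<longrightarrow>
    norm (g (y + (\<Sum>b\<in>S. c b *\<^sub>R b)) - g y - (\<Sum>b\<in>S. c b *\<^sub>R dir_deriv b g y)) \<le> e * (\<Sum>b\<in>S. \<bar>c b\<bar>)"
  using assms(5,6)
proof (induction S rule: finite_induct)
  case empty
  then show ?case by (intro exI[of _ 1]) simp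
next
  case (insert b S)
  then have b: "b \<in> V" and SV: "S \<subseteq> V" by auto
  obtain d1 where d1: "d1 > 0" "\<And>c. (\<forall>b\<in>S. \<bar>c b\<bar> < d1) \<Longrightarrow>
    norm (g (y + (\<Sum>b\<in>S. c b *\<^sub>R b)) - g y - (\<Sum>b\<in>S. c b *\<^sub>R dir_deriv b g y)) \<le> e * (\<Sum>b\<in>S. \<bar>c b\<bar>)"
    using insert.IH[OF SV] by blast
  obtain d2 where d2: "d2 > 0" "\<And>z. z \<in> V \<Longrightarrow> dist z y < d2 \<Longrightarrow> dist (dir_deriv b g z) (dir_deriv b g y) < e"
    using cont[OF b] y \<open>e > 0\<close> unfolding continuous_on_iff by metis
  define N where "N = 1 + (\<Sum>b\<in>insert b S. norm b)"
  have N: "N > 0" unfolding N_def by (smt (verit) norm_ge_zero sum_nonneg)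
  define d where "d = min d1 (d2 / N)"
  have "d > 0" using d1 d2 N by (simp add: d_def)
  moreover have "norm (g (y + (\<Sum>b\<in>insert b S. c b *\<^sub>R b)) - g y -
      (\<Sum>b\<in>insert b S. c b *\<^sub>R dir_deriv b g y)) \<le> e * (\<Sum>b\<in>insert b S. \<bar>c b\<bar>)"
    if c: "\<forall>b\<in>insert b S. \<bar>c b\<bar> < d" for c
  proof -
    define z where "z = y + (\<Sum>b\<in>S. c b *\<^sub>R b)"
    have z: "z \<in> V" unfolding z_def
      using V y SV by (intro subspace_add subspace_sum subspace_scale) auto
    let ?I = "{- \<bar>c b\<bar>..\<bar>c b\<bar>}"
    define \<phi> where "\<phi> s = g (z + s *\<^sub>R b) - s *\<^sub>R dir_deriv b g y" for s
    define \<phi>' where "\<phi>' s = dir_deriv b g (z + s *\<^sub>R b) - dir_deriv b g y" for s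
    have der: "(\<phi> has_derivative (\<lambda>h. h *\<^sub>R \<phi>' s)) (at s within ?I)" for s
    proof -
      have "(\<phi> has_vector_derivative \<phi>' s) (at s)"
        unfolding \<phi>_def \<phi>'_def
      proof (rule has_vector_derivative_diff)
        show "((\<lambda>s. g (z + s *\<^sub>R b)) has_vector_derivative dir_deriv b g (z + s *\<^sub>R b)) (at s)"
          by (rule has_vector_derivative_dir_deriv_at[OF V z b diff[OF _ b]])
        show "((\<lambda>s. s *\<^sub>R dir_deriv b g y) has_vector_derivative dir_deriv b g y) (at s)"
          using has_vector_derivative_scaleR[OF DERIV_ident has_vector_derivative_const[of "dir_deriv b g y"], of s]
          by simp
      qed
      then show ?thesis
        using has_vector_derivative_at_within has_vector_derivative_def by blast
    qed
    have small: "norm (\<phi>' s) \<le> e" if s: "s \<in> ?I" for s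
    proof -
      have "norm (z + s *\<^sub>R b - y) \<le> norm (\<Sum>b\<in>S. c b *\<^sub>R b) + norm (s *\<^sub>R b)"
        using norm_triangle_ineq[of "\<Sum>b\<in>S. c b *\<^sub>R b" "s *\<^sub>R b"] by (simp add: z_def)
      also have "\<dots> \<le> (\<Sum>b\<in>S. \<bar>c b\<bar> * norm b) + \<bar>c b\<bar> * norm b"
        using s by (intro add_mono order_trans[OF norm_sum] sum_mono) (auto intro: mult_right_mono)
      also have "\<dots> = (\<Sum>b\<in>insert b S. \<bar>c b\<bar> * norm b)" using insert.hyps by simp
      also have "\<dots> \<le> (\<Sum>b\<in>insert b S. (d2 / N) * norm b)"
        using c by (intro sum_mono mult_right_mono) (auto simp: d_def less_imp_le)
      also have "\<dots> = (d2 / N) * (N - 1)" by (simp add: N_def sum_distrib_left)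
      also have "\<dots> < d2" using d2(1) N by (simp add: field_simps)
      finally have "dist (z + s *\<^sub>R b) y < d2" by (simp add: dist_norm)
      moreover have "z + s *\<^sub>R b \<in> V" using V z b by (simp add: subspace_add subspace_scale)
      ultimately show ?thesis using d2(2) by (auto simp: \<phi>'_def dist_norm less_imp_le)
    qed
    have "norm (\<phi> (c b) - \<phi> 0) \<le> e * norm (c b - 0)"
    proof (rule differentiable_bound[where S = ?I])
      show "onorm (\<lambda>h. h *\<^sub>R \<phi>' s) \<le> e" if "s \<in> ?I" for s
        using small[OF that] \<open>e > 0\<close>
        by (intro onorm_bound) (auto simp: mult.commute[of e] intro!: mult_left_mono)
    qed (auto intro: der)
    then have 1: "norm (g (z + c b *\<^sub>R b) - c b *\<^sub>R dir_deriv b g y - g z) \<le> e * \<bar>c b\<bar>"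
      by (simp add: \<phi>_def)
    have 2: "norm (g z - g y - (\<Sum>b\<in>S. c b *\<^sub>R dir_deriv b g y)) \<le> e * (\<Sum>b\<in>S. \<bar>c b\<bar>)"
      unfolding z_def by (rule d1(2)) (use c in \<open>auto simp: d_def\<close>)
    have "g (y + (\<Sum>b\<in>insert b S. c b *\<^sub>R b)) - g y - (\<Sum>b\<in>insert b S. c b *\<^sub>R dir_deriv b g y) =
      (g (z + c b *\<^sub>R b) - c b *\<^sub>R dir_deriv b g y - g z) + (g z - g y - (\<Sum>b\<in>S. c b *\<^sub>R dir_deriv b g y))"
      using insert.hyps by (simp add: z_def algebra_simps)
    then have "norm (g (y + (\<Sum>b\<in>insert b S. c b *\<^sub>R b)) - g y - (\<Sum>b\<in>insert b S. c b *\<^sub>R dir_deriv b g y))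
      \<le> e * \<bar>c b\<bar> + e * (\<Sum>b\<in>S. \<bar>c b\<bar>)"
      using norm_triangle_mono[OF 1 2] by (simp only:)
    then show ?thesis using insert.hyps by (simp add: distrib_left)
  qed
  ultimately show ?case by blast
qed

lemma orthonormal_basis_subspace_expansion:
  fixes V :: "'v::euclidean_space set"
  assumes "subspace V"
  obtains B where "finite B" "B \<subseteq> V" "\<forall>b\<in>B. norm b = 1"
    "\<forall>x\<in>V. (\<Sum>b\<in>B. (x \<bullet> b) *\<^sub>R b) = x"
proof -
  obtain B where B: "B \<subseteq> V" "pairwise orthogonal B" "\<And>x. x \<in> B \<Longrightarrow> norm x = 1"
     "independent B" "span B = V"
    using orthonormal_basis_subspace[OF assms] by metis
  have fin: "finite B" using B(4) by (rule independent_imp_finite)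
  have "(\<Sum>b\<in>B. (x \<bullet> b) *\<^sub>R b) = x" if "x \<in> V" for x
    using orthonormal_basis_expand[OF B(2,3) _ fin] that B(5) by simp
  then show ?thesis using that[of B] fin B by blast
qed

text \<open>The set \<open>B\<close> is an orthonormal basis of \<open>V\<close>.\<close>

lemma has_derivative_dir_deriv:
  fixes g :: "'v::euclidean_space \<Rightarrow> 'v"
  assumes V: "subspace V" and y: "y \<in> V"
    and diff: "\<And>x v. x \<in> V \<Longrightarrow> v \<in> V \<Longrightarrow> (\<lambda>t. g (x + t *\<^sub>R v)) differentiable (at (0::real))"
    and cont: "\<And>v. v \<in> V \<Longrightarrow> continuous_on V (dir_deriv v g)"
    and B: "finite B" "B \<subseteq> V" "\<forall>b\<in>B. norm b = 1"
      "\<forall>x\<in>V. (\<Sum>b\<in>B. (x \<bullet> b) *\<^sub>R b) = x"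
  shows "(g has_derivative (\<lambda>h. \<Sum>b\<in>B. (h \<bullet> b) *\<^sub>R dir_deriv b g y)) (at y within V)"
  unfolding has_derivative_within_alt
proof (intro conjI allI impI)
  show "bounded_linear (\<lambda>h. \<Sum>b\<in>B. (h \<bullet> b) *\<^sub>R dir_deriv b g y)"
    by (intro bounded_linear_sum bounded_linear_scaleR_const bounded_linear_inner_left)
  fix e :: real assume "0 < e"
  define e' where "e' = e / (1 + card B)"
  have e': "e' > 0" using \<open>0 < e\<close> by (simp add: e'_def)
  from frechet_estimate[OF V y diff cont B(1,2) e']
  obtain d where d: "d > 0" "\<And>c. (\<forall>b\<in>B. \<bar>c b\<bar> < d) \<Longrightarrow>
    norm (g (y + (\<Sum>b\<in>B. c b *\<^sub>R b)) - g y - (\<Sum>b\<in>B. c b *\<^sub>R dir_deriv b g y)) \<le> e' * (\<Sum>b\<in>B. \<bar>c b\<bar>)"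
    by blast
  show "\<exists>d>0. \<forall>z\<in>V. norm (z - y) < d \<longrightarrow>
    norm (g z - g y - (\<Sum>b\<in>B. ((z - y) \<bullet> b) *\<^sub>R dir_deriv b g y)) \<le> e * norm (z - y)"
  proof (intro exI[of _ d] conjI ballI impI d(1))
    fix z assume z: "z \<in> V" "norm (z - y) < d"
    have le: "\<bar>(z - y) \<bullet> b\<bar> \<le> norm (z - y)" if "b \<in> B" for b
      using Cauchy_Schwarz_ineq2[of "z - y" b] bspec[OF B(3) that] by simp
    have zy: "z - y \<in> V" using V z y by (simp add: subspace_diff)
    have "norm (g (y + (\<Sum>b\<in>B. ((z - y) \<bullet> b) *\<^sub>R b)) - g y - (\<Sum>b\<in>B. ((z - y) \<bullet> b) *\<^sub>R dir_deriv b g y))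
      \<le> e' * (\<Sum>b\<in>B. \<bar>(z - y) \<bullet> b\<bar>)"
      by (rule d(2)) (use le z(2) in force)
    also have "\<dots> \<le> e' * (\<Sum>b\<in>B. norm (z - y))"
      using le e' by (intro mult_left_mono sum_mono) auto
    also have "\<dots> \<le> e * norm (z - y)"
    proof -
      have "e' * card B \<le> e" using \<open>0 < e\<close> by (simp add: e'_def field_simps)
      then show ?thesis using mult_right_mono[of "e' * card B" e "norm (z - y)"] by (simp add: mult.assoc)
    qed
    finally show "norm (g z - g y - (\<Sum>b\<in>B. ((z - y) \<bullet> b) *\<^sub>R dir_deriv b g y)) \<le> e * norm (z - y)"
      using bspec[OF B(4) zy] by simp
  qed
qed

lemma has_vector_derivative_compose_subspace:
  fixes g :: "'v::euclidean_space \<Rightarrow> 'v" and \<gamma> :: "real \<Rightarrow> 'v"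
  assumes "subspace V" and smooth: "smooth_on_subspace V g"
    and B: "finite B" "B \<subseteq> V" "\<forall>b\<in>B. norm b = 1"
      "\<forall>x\<in>V. (\<Sum>b\<in>B. (x \<bullet> b) *\<^sub>R b) = x"
    and \<gamma>: "(\<gamma> has_vector_derivative w) (at t)" "\<And>s. \<gamma> s \<in> V"
  shows "((\<lambda>s. g (\<gamma> s)) has_vector_derivative (\<Sum>b\<in>B. (w \<bullet> b) *\<^sub>R dir_deriv b g (\<gamma> t))) (at t)"
proof -
  have "(g has_derivative (\<lambda>h. \<Sum>b\<in>B. (h \<bullet> b) *\<^sub>R dir_deriv b g (\<gamma> t))) (at (\<gamma> t) within V)"
    by (rule has_derivative_dir_deriv[OF assms(1) \<gamma>(2) _ _ B])
       (auto intro: smooth_on_subspaceD[OF smooth] smooth_on_subspaceD(1)[OF smooth_on_subspaceD(3)[OF smooth]])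
  then have "(g has_derivative (\<lambda>h. \<Sum>b\<in>B. (h \<bullet> b) *\<^sub>R dir_deriv b g (\<gamma> t))) (at (\<gamma> t) within range \<gamma>)"
    by (rule has_derivative_subset) (use \<gamma>(2) in auto)
  from vector_derivative_diff_chain_within[OF \<gamma>(1) this] show ?thesis by (simp add: o_def)
qed

lemma dir_deriv_mem_subspace:
  fixes f :: "'v::euclidean_space \<Rightarrow> 'v"
  assumes V: "subspace V" and smooth: "smooth_on_subspace V f" and f: "f ` V \<subseteq> V" and xv: "x \<in> V" "v \<in> V"
  shows "dir_deriv v f x \<in> V"
proof -
  have "((\<lambda>t. f (x + t *\<^sub>R v)) has_vector_derivative dir_deriv v f x) (at 0)"
    by (intro has_vector_derivative_dir_deriv smooth_on_subspaceD[OF smooth] xv)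
  then have "((\<lambda>t. (f (x + t *\<^sub>R v) - f x) /\<^sub>R t) \<longlongrightarrow> dir_deriv v f x) (at 0)"
    unfolding has_vector_derivative_def has_derivative_at' LIM_eq
  proof (elim conjE, intro allI impI)
    fix e :: real assume "e > 0"
    assume "\<forall>e>0. \<exists>d>0. \<forall>t. 0 < norm (t - 0) \<and> norm (t - 0) < d \<longrightarrow>
      norm (f (x + t *\<^sub>R v) - f (x + 0 *\<^sub>R v) - (t - 0) *\<^sub>R dir_deriv v f x) / norm (t - 0) < e"
    then obtain d where d: "d > 0" "\<And>t. 0 < norm (t - 0) \<Longrightarrow> norm (t - 0) < d \<Longrightarrow>
      norm (f (x + t *\<^sub>R v) - f (x + 0 *\<^sub>R v) - (t - 0) *\<^sub>R dir_deriv v f x) / norm (t - 0) < e"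
      using \<open>e > 0\<close> by blast
    have "norm ((f (x + t *\<^sub>R v) - f x) /\<^sub>R t - dir_deriv v f x) < e" if "t \<noteq> 0" "norm (t - 0) < d" for t
    proof -
      have "(f (x + t *\<^sub>R v) - f x) /\<^sub>R t - dir_deriv v f x = (f (x + t *\<^sub>R v) - f x - t *\<^sub>R dir_deriv v f x) /\<^sub>R t"
        using that by (simp add: scaleR_diff_right)
      then show ?thesis using d(2)[of t] that by (simp add: divide_inverse mult.commute)
    qed
    then show "\<exists>d>0. \<forall>t. t \<noteq> 0 \<and> norm (t - 0) < d \<longrightarrow>
      norm ((f (x + t *\<^sub>R v) - f x) /\<^sub>R t - dir_deriv v f x) < e"
      using d(1) by blast
  qed
  moreover have "(f (x + t *\<^sub>R v) - f x) /\<^sub>R t \<in> V" for t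
    using V f xv by (intro subspace_scale subspace_diff) (auto simp: subspace_add subspace_scale image_subset_iff)
  ultimately show ?thesis
    using closed_subspace[OF V] Lim_in_closed_set[of V "\<lambda>t. (f (x + t *\<^sub>R v) - f x) /\<^sub>R t" "at 0"]
    by simp
qed

lemma fold_dir_deriv_mem_subspace:
  fixes f :: "'v::euclidean_space \<Rightarrow> 'v"
  assumes V: "subspace V" and "smooth_on_subspace V f" and "f ` V \<subseteq> V" and "vs \<in> lists V"
  shows "fold dir_deriv vs f ` V \<subseteq> V"
  using assms(2-4)
proof (induction vs arbitrary: f)
  case (Cons v vs)
  then have "dir_deriv v f ` V \<subseteq> V" using dir_deriv_mem_subspace[OF V] by auto
  moreover have "smooth_on_subspace V (dir_deriv v f)" using Cons smooth_on_subspaceD(3) by auto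
  ultimately show ?case using Cons by simp
qed simp

lemma has_vector_derivative_compose_smooth:
  fixes f g :: "'v::euclidean_space \<Rightarrow> 'v"
  assumes V: "subspace V" and g: "smooth_on_subspace V g" and f: "smooth_on_subspace V f" "f ` V \<subseteq> V"
    and B: "finite B" "B \<subseteq> V" "\<forall>b\<in>B. norm b = 1"
      "\<forall>x\<in>V. (\<Sum>b\<in>B. (x \<bullet> b) *\<^sub>R b) = x"
    and xv: "x \<in> V" "v \<in> V"
  shows "((\<lambda>t. g (f (x + t *\<^sub>R v))) has_vector_derivative
           (\<Sum>b\<in>B. (dir_deriv v f x \<bullet> b) *\<^sub>R dir_deriv b g (f x))) (at 0)"
  using has_vector_derivative_compose_subspace[OF V g B, of "\<lambda>t. f (x + t *\<^sub>R v)" "dir_deriv v f x" 0]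
    has_vector_derivative_dir_deriv[OF smooth_on_subspaceD(2)[OF f(1) xv]] V f(2) xv
  by (simp add: image_subset_iff subspace_add subspace_scale)

lemma dir_deriv_linear_combination:
  fixes g :: "'v::euclidean_space \<Rightarrow> 'v"
  assumes V: "subspace V" and g: "smooth_on_subspace V g"
    and B: "finite B" "B \<subseteq> V" "\<forall>b\<in>B. norm b = 1"
      "\<forall>x\<in>V. (\<Sum>b\<in>B. (x \<bullet> b) *\<^sub>R b) = x"
    and "y \<in> V" "w \<in> V"
  shows "dir_deriv w g y = (\<Sum>b\<in>B. (w \<bullet> b) *\<^sub>R dir_deriv b g y)"
proof -
  have "((\<lambda>t. y + t *\<^sub>R w) has_vector_derivative w) (at 0)"
    by (auto intro!: derivative_eq_intros)
  from has_vector_derivative_compose_subspace[OF V g B this] show ?thesis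
    unfolding dir_deriv_def using V assms(7,8)
    by (simp add: subspace_add subspace_scale vector_derivative_at)
qed

text \<open>The chain rule.\<close>

lemma dir_deriv_compose:
  fixes f g :: "'v::euclidean_space \<Rightarrow> 'v"
  assumes V: "subspace V" and g: "smooth_on_subspace V g" and f: "smooth_on_subspace V f" "f ` V \<subseteq> V"
    and xv: "x \<in> V" "v \<in> V"
  shows "dir_deriv v (\<lambda>y. g (f y)) x = dir_deriv (dir_deriv v f x) g (f x)"
proof -
  obtain B where B: "finite B" "B \<subseteq> V" "\<forall>b\<in>B. norm b = 1"
    "\<forall>x\<in>V. (\<Sum>b\<in>B. (x \<bullet> b) *\<^sub>R b) = x"
    using orthonormal_basis_subspace_expansion[OF V] by blast
  have "dir_deriv v (\<lambda>y. g (f y)) x = (\<Sum>b\<in>B. (dir_deriv v f x \<bullet> b) *\<^sub>R dir_deriv b g (f x))"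
    using has_vector_derivative_compose_smooth[OF V g f B xv]
    by (subst dir_deriv_def) (rule vector_derivative_at)
  also have "\<dots> = dir_deriv (dir_deriv v f x) g (f x)"
    by (rule dir_deriv_linear_combination[OF V g B, symmetric])
       (use f(2) xv dir_deriv_mem_subspace[OF V f xv] in auto)
  finally show ?thesis .
qed

text \<open>
  The algebra generated by smooth maps and their composites is closed under directional
  derivatives, by the chain rule and the product rule.
\<close>

inductive smooth_algebra :: "'v::euclidean_space set \<Rightarrow> ('v \<Rightarrow> 'v) \<Rightarrow> bool" for V where
  compose: "smooth_on_subspace V g \<Longrightarrow> smooth_on_subspace V f \<Longrightarrow> f ` V \<subseteq> V \<Longrightarrow> smooth_algebra V (\<lambda>x. g (f x))"
| smooth: "smooth_on_subspace V f \<Longrightarrow> smooth_algebra V f"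
| zero: "smooth_algebra V (\<lambda>x. 0)"
| add: "smooth_algebra V f \<Longrightarrow> smooth_algebra V g \<Longrightarrow> smooth_algebra V (\<lambda>x. f x + g x)"
| prod: "smooth_algebra V f \<Longrightarrow> smooth_algebra V g \<Longrightarrow> smooth_algebra V (\<lambda>x. (f x \<bullet> b) *\<^sub>R g x)"
| cong: "smooth_algebra V f \<Longrightarrow> (\<And>x. x \<in> V \<Longrightarrow> f x = g x) \<Longrightarrow> smooth_algebra V g"

lemma smooth_algebra_sum:
  "finite B \<Longrightarrow> (\<And>b. b \<in> B \<Longrightarrow> smooth_algebra V (F b)) \<Longrightarrow> smooth_algebra V (\<lambda>x. \<Sum>b\<in>B. F b x)"
proof (induction B rule: finite_induct)
  case (insert b B)
  then have "smooth_algebra V (\<lambda>x. F b x + (\<Sum>b\<in>B. F b x))" by (intro smooth_algebra.add) auto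
  then show ?case using insert.hyps by simp
qed (simp add: smooth_algebra.zero)

lemma smooth_algebra_derivative:
  fixes V :: "'v::euclidean_space set"
  assumes V: "subspace V" and "smooth_algebra V F"
  shows "continuous_on V F \<and>
      (\<forall>x\<in>V. \<forall>v\<in>V. (\<lambda>t. F (x + t *\<^sub>R v)) differentiable (at (0::real))) \<and>
      (\<forall>v\<in>V. smooth_algebra V (dir_deriv v F))"
  using assms(2)
proof (induction rule: smooth_algebra.induct)
  case (compose g f)
  obtain B where B: "finite B" "B \<subseteq> V" "\<forall>b\<in>B. norm b = 1"
    "\<forall>x\<in>V. (\<Sum>b\<in>B. (x \<bullet> b) *\<^sub>R b) = x"
    using orthonormal_basis_subspace_expansion[OF V] by blast
  note der = has_vector_derivative_compose_smooth[OF V compose B]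
  have "continuous_on V (\<lambda>x. g (f x))"
    using compose by (intro continuous_on_compose2[of V g V f]) (auto intro: smooth_on_subspaceD)
  moreover have "(\<lambda>t. g (f (x + t *\<^sub>R v))) differentiable (at (0::real))" if "x \<in> V" "v \<in> V" for x v
    using der[OF that] by (rule differentiableI_vector)
  moreover have "smooth_algebra V (dir_deriv v (\<lambda>x. g (f x)))" if v: "v \<in> V" for v
  proof (rule smooth_algebra.cong)
    show "smooth_algebra V (\<lambda>x. \<Sum>b\<in>B. (dir_deriv v f x \<bullet> b) *\<^sub>R dir_deriv b g (f x))"
      using B(1,2) compose v
      by (intro smooth_algebra_sum smooth_algebra.prod smooth_algebra.compose[of V "dir_deriv _ g"]
          smooth_algebra.smooth smooth_on_subspaceD(3)) auto
    show "(\<Sum>b\<in>B. (dir_deriv v f x \<bullet> b) *\<^sub>R dir_deriv b g (f x)) = dir_deriv v (\<lambda>x. g (f x)) x"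
      if "x \<in> V" for x
      using der[OF that v] by (subst (2) dir_deriv_def) (rule vector_derivative_at[symmetric])
  qed
  ultimately show ?case by blast
next
  case (smooth f)
  then show ?case by (auto intro: smooth_on_subspaceD smooth_algebra.smooth)
next
  case zero
  have "dir_deriv v (\<lambda>x. 0) = (\<lambda>x. 0)" for v :: 'v by (rule ext) (simp add: dir_deriv_def)
  then show ?case by (simp add: smooth_algebra.zero)
next
  case (add f g)
  have der: "((\<lambda>t. f (x + t *\<^sub>R v) + g (x + t *\<^sub>R v)) has_vector_derivative
      dir_deriv v f x + dir_deriv v g x) (at 0)" if "x \<in> V" "v \<in> V" for x v
    using add.IH that by (intro has_vector_derivative_add has_vector_derivative_dir_deriv) auto
  have "smooth_algebra V (dir_deriv v (\<lambda>x. f x + g x))" if v: "v \<in> V" for v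
  proof (rule smooth_algebra.cong)
    show "smooth_algebra V (\<lambda>x. dir_deriv v f x + dir_deriv v g x)"
      using add.IH v by (intro smooth_algebra.add) auto
    show "dir_deriv v f x + dir_deriv v g x = dir_deriv v (\<lambda>x. f x + g x) x" if "x \<in> V" for x
      using der[OF that v] by (subst (3) dir_deriv_def) (rule vector_derivative_at[symmetric])
  qed
  then show ?case
    using add.IH der by (auto intro: continuous_on_add differentiableI_vector)
next
  case (prod f g b)
  have der: "((\<lambda>t. (f (x + t *\<^sub>R v) \<bullet> b) *\<^sub>R g (x + t *\<^sub>R v)) has_vector_derivative
      (f x \<bullet> b) *\<^sub>R dir_deriv v g x + (dir_deriv v f x \<bullet> b) *\<^sub>R g x) (at 0)" if "x \<in> V" "v \<in> V" for x v
  proof -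
    have f': "((\<lambda>t. f (x + t *\<^sub>R v)) has_vector_derivative dir_deriv v f x) (at 0)"
      and g': "((\<lambda>t. g (x + t *\<^sub>R v)) has_vector_derivative dir_deriv v g x) (at 0)"
      using prod.IH that by (auto intro!: has_vector_derivative_dir_deriv)
    have "((\<lambda>t. f (x + t *\<^sub>R v) \<bullet> b) has_real_derivative dir_deriv v f x \<bullet> b) (at 0)"
      using bounded_linear.has_vector_derivative[OF bounded_linear_inner_left f']
      by (simp add: has_real_derivative_iff_has_vector_derivative)
    from has_vector_derivative_scaleR[OF this g'] show ?thesis by simp
  qed
  have "smooth_algebra V (dir_deriv v (\<lambda>x. (f x \<bullet> b) *\<^sub>R g x))" if v: "v \<in> V" for v
  proof (rule smooth_algebra.cong)
    show "smooth_algebra V (\<lambda>x. (f x \<bullet> b) *\<^sub>R dir_deriv v g x + (dir_deriv v f x \<bullet> b) *\<^sub>R g x)"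
      using prod v by (intro smooth_algebra.add smooth_algebra.prod) auto
    show "(f x \<bullet> b) *\<^sub>R dir_deriv v g x + (dir_deriv v f x \<bullet> b) *\<^sub>R g x = dir_deriv v (\<lambda>x. (f x \<bullet> b) *\<^sub>R g x) x"
      if "x \<in> V" for x
      using der[OF that v] by (subst (3) dir_deriv_def) (rule vector_derivative_at[symmetric])
  qed
  then show ?case
    using prod.IH der by (auto intro!: continuous_on_scaleR continuous_on_inner continuous_on_const differentiableI_vector)
next
  case (cong f g)
  have "dir_deriv v f x = dir_deriv v g x" if "x \<in> V" "v \<in> V" for x v
    using dir_deriv_cong[OF V that] cong by blast
  moreover have "(\<lambda>t. f (x + t *\<^sub>R v)) = (\<lambda>t. g (x + t *\<^sub>R v))" if "x \<in> V" "v \<in> V" for x v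
    by (rule ext, rule cong.hyps) (intro subspace_add subspace_scale V that)
  moreover have "continuous_on V g"
    using cong.IH cong.hyps(2) continuous_on_cong[OF refl, of V f g] by blast
  ultimately show ?case using cong.IH by (auto intro: smooth_algebra.cong)
qed

lemma smooth_on_subspace_compose:
  assumes "subspace V" "smooth_on_subspace V g" "smooth_on_subspace V f" "f ` V \<subseteq> V"
  shows "smooth_on_subspace V (\<lambda>x. g (f x))"
  by (rule smooth_on_subspace_coinduct[of "smooth_algebra V"])
     (use assms smooth_algebra_derivative in \<open>auto intro: smooth_algebra.compose\<close>)

lemma smooth_on_subspace_cong:
  assumes "subspace V" "smooth_on_subspace V f" "\<And>x. x \<in> V \<Longrightarrow> f x = g x"
  shows "smooth_on_subspace V g"
  by (rule smooth_on_subspace_coinduct[of "smooth_algebra V"])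
     (use assms smooth_algebra_derivative in \<open>auto intro: smooth_algebra.cong smooth_algebra.smooth\<close>)

lemma dir_deriv_linear_map: "linear T \<Longrightarrow> dir_deriv v T x = T v"
  for T :: "'v::euclidean_space \<Rightarrow> 'v"
  unfolding dir_deriv_def
  by (rule vector_derivative_at) (auto simp: linear_add linear_cmul intro!: derivative_eq_intros)

lemma smooth_on_subspace_linear:
  fixes T :: "'v::euclidean_space \<Rightarrow> 'v"
  assumes "linear T"
  shows "smooth_on_subspace V T"
proof (rule smooth_on_subspace_coinduct[of "\<lambda>f. linear f \<or> (\<exists>c. f = (\<lambda>x. c))"])
  fix f :: "'v \<Rightarrow> 'v" assume f: "linear f \<or> (\<exists>c. f = (\<lambda>x. c))"
  have "(\<lambda>t. f (x + t *\<^sub>R v)) differentiable at 0" if "linear f" for x v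
    using that by (auto simp: linear_add linear_cmul intro!: derivative_intros differentiableI_vector[of _ "f v"]
        derivative_eq_intros)
  moreover have "dir_deriv v f = (\<lambda>x. f v)" if "linear f" for v
    using dir_deriv_linear_map[OF that] by blast
  moreover have "dir_deriv v (\<lambda>x. c) = (\<lambda>x. 0)" for v c :: 'v by (rule ext) (simp add: dir_deriv_def)
  ultimately show "continuous_on V f \<and>
      (\<forall>x\<in>V. \<forall>v\<in>V. (\<lambda>t. f (x + t *\<^sub>R v)) differentiable at 0) \<and>
      (\<forall>v\<in>V. linear (dir_deriv v f) \<or> (\<exists>c. dir_deriv v f = (\<lambda>x. c)))"
    using f by (auto simp: linear_continuous_on linear_conv_bounded_linear)
qed (use assms in simp)


section \<open>Framed embeddings by components\<close>

lemma topspace_mfd [simp]: "topspace (mfd V I) = I \<times> V"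
  by (simp add: mfd_def)

lemma topspace_tangent [simp]: "topspace (tangent V I) = (I \<times> V) \<times> V"
  by (simp add: tangent_def)

lemma continuous_map_discrete_prod_iff:
  "continuous_map (prod_topology (discrete_topology I) X) Y F \<longleftrightarrow> (\<forall>i\<in>I. continuous_map X Y (\<lambda>x. F (i, x)))"
proof
  assume F: "continuous_map (prod_topology (discrete_topology I) X) Y F"
  show "\<forall>i\<in>I. continuous_map X Y (\<lambda>x. F (i, x))"
  proof
    fix i assume i: "i \<in> I"
    then have "continuous_map X (prod_topology (discrete_topology I) X) (\<lambda>x. (i, x))"
      by (simp add: continuous_map_pairwise o_def)
    from continuous_map_compose[OF this F] show "continuous_map X Y (\<lambda>x. F (i, x))"
      by (simp add: o_def)
  qed
next
  assume F: "\<forall>i\<in>I. continuous_map X Y (\<lambda>x. F (i, x))"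
  show "continuous_map (prod_topology (discrete_topology I) X) Y F"
    unfolding continuous_map_def
  proof (intro conjI allI impI)
    show "F \<in> topspace (prod_topology (discrete_topology I) X) \<rightarrow> topspace Y"
      using F by (auto simp: continuous_map_def Pi_iff)
    fix U assume U: "openin Y U"
    show "openin (prod_topology (discrete_topology I) X)
        {z \<in> topspace (prod_topology (discrete_topology I) X). F z \<in> U}"
      unfolding openin_prod_topology_alt
    proof (intro allI impI)
      fix i x assume ix: "(i, x) \<in> {z \<in> topspace (prod_topology (discrete_topology I) X). F z \<in> U}"
      have "openin X {x \<in> topspace X. F (i, x) \<in> U}"
        using F U ix by (auto intro: openin_continuous_map_preimage)
      then show "\<exists>A B. openin (discrete_topology I) A \<and> openin X B \<and> i \<in> A \<and> x \<in> B \<and>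
          A \<times> B \<subseteq> {z \<in> topspace (prod_topology (discrete_topology I) X). F z \<in> U}"
        using ix by (intro exI[of _ "{i}"] exI[of _ "{x \<in> topspace X. F (i, x) \<in> U}"]) auto
    qed
  qed
qed

lemma Hausdorff_space_mfd: "Hausdorff_space (mfd V I)"
  by (simp add: mfd_def Hausdorff_space_prod_topology Hausdorff_space_subtopology)

lemma Hausdorff_space_tangent: "Hausdorff_space (tangent V I)"
  by (simp add: tangent_def Hausdorff_space_prod_topology Hausdorff_space_subtopology Hausdorff_space_mfd)

lemma locally_compact_space_tangent:
  assumes "subspace V"
  shows "locally_compact_space (tangent V I)"
proof -
  have "locally_compact_space (top_of_set V)"
    using closed_subspace[OF assms] locally_compact_space_closed_subset locally_compact_space_euclidean
    by (metis closed_closedin)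
  then show ?thesis
    unfolding tangent_def mfd_def by (simp add: locally_compact_space_prod_topology locally_compact_space_discrete_topology)
qed

lemma kify_nonneg_reals: "kify (top_of_set {0::real..}) = top_of_set {0..}"
proof (rule kify_locally_compact_Hausdorff)
  show "locally_compact_space (top_of_set {0::real..})"
    by (rule locally_compact_space_closed_subset)
       (simp_all add: locally_compact_space_euclidean closed_closedin[symmetric])
qed (simp add: Hausdorff_space_subtopology)

lemma Hausdorff_space_hom_space: "Hausdorff_space (hom_space V I)"
  by (simp add: hom_space_def Hausdorff_space_subtopology Hausdorff_space_map_space)

lemma topspace_hom_space:
  "topspace (hom_space V I) = {T \<in> extensional ((I \<times> V) \<times> V).
     continuous_map (tangent V I) (top_of_set V) T \<and>
     (\<forall>m\<in>I \<times> V. \<exists>L. linear L \<and> (\<forall>w\<in>V. T (m, w) = L w) \<and> bij_betw L V V)}"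
  by (auto simp: hom_space_def topspace_map_space)

text \<open>
  A Moore path of bundle maps is the same as a family of maps that are jointly continuous in time,
  position and direction, one for each component of the source.
\<close>

lemma moore_path_iff:
  fixes \<alpha> :: "real \<Rightarrow> ('i \<times> 'v::euclidean_space) \<times> 'v \<Rightarrow> 'v"
  assumes V: "subspace V" and ext: "\<alpha> \<in> extensional {0..}"
  shows "continuous_map (top_of_set {0..}) (hom_space V I) \<alpha> \<longleftrightarrow>
    (\<forall>t\<ge>0. \<alpha> t \<in> extensional ((I \<times> V) \<times> V)) \<and>
    (\<forall>i\<in>I. continuous_on ({0..} \<times> V \<times> V) (\<lambda>(t, x, w). \<alpha> t ((i, x), w))) \<and>
    (\<forall>i\<in>I. \<forall>t\<ge>0. \<forall>x\<in>V. \<exists>L. linear L \<and> (\<forall>w\<in>V. \<alpha> t ((i, x), w) = L w) \<and> bij_betw L V V)"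
    (is "?l \<longleftrightarrow> ?e \<and> ?c \<and> ?b")
proof
  assume l: ?l
  then have "\<alpha> t \<in> topspace (hom_space V I)" if "t \<ge> 0" for t
    using that by (auto simp: continuous_map_def)
  then have eb: "?e \<and> ?b" by (fastforce simp: topspace_hom_space)
  have "continuous_map (top_of_set {0..}) (map_space (tangent V I) (top_of_set V)) \<alpha>"
    using l unfolding hom_space_def by (rule continuous_map_into_fulltopology)
  then have "continuous_map (top_of_set {0..}) (compact_open (tangent V I) (top_of_set V)) \<alpha>"
    using continuous_map_compose[OF _ continuous_map_from_kify[OF continuous_map_id]]
    unfolding map_space_eq by fastforce
  from continuous_map_compact_open_uncurry[OF this locally_compact_space_tangent[OF V] Hausdorff_space_tangent]
  have unc: "continuous_map (prod_topology (top_of_set {0..}) (tangent V I)) (top_of_set V) (\<lambda>(t, m). \<alpha> t m)" .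
  have ?c
  proof
    fix i assume i: "i \<in> I"
    have "continuous_map (prod_topology (top_of_set {0::real..}) (prod_topology (top_of_set V) (top_of_set V)))
      (prod_topology (top_of_set {0..}) (tangent V I)) (\<lambda>(t, x, w). (t, (i, x), w))"
      unfolding tangent_def mfd_def case_prod_unfold
      using i by (auto simp: continuous_map_pairwise o_def continuous_map_in_subtopology intro!: continuous_intros)
    from continuous_map_compose[OF this unc]
    have "continuous_map (top_of_set ({0..} \<times> V \<times> V)) (top_of_set V) (\<lambda>(t, x, w). \<alpha> t ((i, x), w))"
      by (simp add: o_def case_prod_unfold)
    then show "continuous_on ({0..} \<times> V \<times> V) (\<lambda>(t, x, w). \<alpha> t ((i, x), w))"
      using continuous_map_into_fulltopology by fastforce
  qed
  then show "?e \<and> ?c \<and> ?b" using eb by blast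
next
  assume r: "?e \<and> ?c \<and> ?b"
  have inV: "\<alpha> t ((i, x), w) \<in> V" if "i \<in> I" "t \<ge> 0" "x \<in> V" "w \<in> V" for i t x w
    using r that by (metis bij_betwE)
  have 1: "continuous_map (prod_topology (discrete_topology I) (top_of_set ({0..} \<times> V \<times> V))) (top_of_set V)
    (\<lambda>(i, t, x, w). \<alpha> t ((i, x), w))"
    unfolding continuous_map_discrete_prod_iff
    using r inV by (auto simp: continuous_map_in_subtopology)
  have 2: "continuous_map (prod_topology (top_of_set {0::real..}) (tangent V I))
     (prod_topology (discrete_topology I) (prod_topology (top_of_set {0..}) (prod_topology (top_of_set V) (top_of_set V))))
     (\<lambda>(t, (i, x), w). (i, t, x, w))"
    unfolding tangent_def mfd_def case_prod_unfold continuous_map_pairwise o_def fst_conv snd_conv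
    by (intro conjI continuous_map_fst continuous_map_snd
          continuous_map_compose[OF continuous_map_snd continuous_map_snd, unfolded o_def]
          continuous_map_compose[OF continuous_map_snd continuous_map_compose[OF continuous_map_fst continuous_map_snd], unfolded o_def]
          continuous_map_compose[OF continuous_map_snd continuous_map_compose[OF continuous_map_fst continuous_map_fst], unfolded o_def])
  have "continuous_map (prod_topology (top_of_set {0::real..}) (tangent V I)) (top_of_set V) (\<lambda>(t, m). \<alpha> t m)"
    by (rule continuous_map_eq[OF continuous_map_compose[OF 2 1[folded prod_topology_subtopology_eu]]]) auto
  from continuous_map_compact_open_curry[OF this]
  have "continuous_map (top_of_set {0..}) (compact_open (tangent V I) (top_of_set V))
      (\<lambda>t. \<lambda>m\<in>topspace (tangent V I). \<alpha> t m)" by simp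
  then have "continuous_map (top_of_set {0..}) (compact_open (tangent V I) (top_of_set V)) \<alpha>"
    by (rule continuous_map_eq) (use r in \<open>auto simp: extensional_restrict\<close>)
  then have "continuous_map (top_of_set {0..}) (map_space (tangent V I) (top_of_set V)) \<alpha>"
    unfolding map_space_eq
    using continuous_map_into_kify[of "top_of_set {0..}"] kify_nonneg_reals
    by (metis Hausdorff_imp_k_Hausdorff Hausdorff_space_compact_open Hausdorff_space_subtopology Hausdorff_space_euclidean)
  then show ?l
    unfolding hom_space_def using r by (auto simp: continuous_map_in_subtopology)
qed

lemma topspace_emb_space:
  assumes V: "subspace V"
  shows "topspace (emb_space V I J) = {f \<in> extensional (I \<times> V). smooth_embedding V I J f}"
proof -
  have "(\<lambda>(i, x)\<in>I \<times> V. fold dir_deriv vs (\<lambda>y. snd (f (i, y))) x) \<in> topspace (map_space (mfd V I) (top_of_set V))"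
    if f: "smooth_embedding V I J f" and vs: "vs \<in> lists V" for f vs
  proof -
    have fm: "snd (f (i, x)) \<in> V" if "i \<in> I" "x \<in> V" for i x
    proof -
      have "f (i, x) \<in> J \<times> V"
        using f that unfolding smooth_embedding_def continuous_map_def by auto
      then show ?thesis by auto
    qed
    have "continuous_map (top_of_set V) (top_of_set V) (fold dir_deriv vs (\<lambda>y. snd (f (i, y))))"
      if i: "i \<in> I" for i
    proof -
      have s: "smooth_on_subspace V (\<lambda>y. snd (f (i, y)))" using f i by (simp add: smooth_embedding_def)
      then have "continuous_on V (fold dir_deriv vs (\<lambda>y. snd (f (i, y))))"
        using vs by (simp add: smooth_on_subspace_def)
      moreover have "fold dir_deriv vs (\<lambda>y. snd (f (i, y))) ` V \<subseteq> V"
        by (rule fold_dir_deriv_mem_subspace[OF V s _ vs]) (use fm i in auto)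
      ultimately show ?thesis by (auto simp: continuous_map_in_subtopology)
    qed
    then have "continuous_map (mfd V I) (top_of_set V) (\<lambda>(i, x). fold dir_deriv vs (\<lambda>y. snd (f (i, y))) x)"
      unfolding mfd_def continuous_map_discrete_prod_iff by simp
    then have "continuous_map (mfd V I) (top_of_set V) (\<lambda>(i, x)\<in>I \<times> V. fold dir_deriv vs (\<lambda>y. snd (f (i, y))) x)"
      by (rule continuous_map_eq) auto
    then show ?thesis by (auto simp: topspace_map_space)
  qed
  then show ?thesis
    unfolding emb_space_def topspace_kify topspace_pullback_topology
    by (auto simp: topspace_map_space smooth_embedding_def)
qed

text \<open>
  The restriction of a framed embedding to one copy of \<open>V\<close>: the embedding, the length of the Moore
  path, and the Moore path.
\<close>

type_synonym ('v, 'j) fr_comp = "('v \<Rightarrow> 'j \<times> 'v) \<times> real \<times> (real \<Rightarrow> 'v \<times> 'v \<Rightarrow> 'v)"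

definition component :: "'v::euclidean_space set \<Rightarrow> ('i, 'v, 'j) fr_emb \<Rightarrow> 'i \<Rightarrow> ('v, 'j) fr_comp" where
  "component V = (\<lambda>(f, l, \<alpha>) i.
     (\<lambda>x\<in>V. f (i, x), l i, \<lambda>t\<in>{0..}. \<lambda>(x, w)\<in>V \<times> V. \<alpha> t ((i, x), w)))"

text \<open>
  The conditions on one component of a framed embedding into \<open>J \<times> V\<close> that do not involve the other
  components.  Injectivity and disjointness are left to \<^const>\<open>embedding_map\<close>; the derivative is
  invertible because it is the end point of the Moore path.
\<close>

definition framed :: "'v::euclidean_space set \<Rightarrow> 'j set \<Rightarrow> ('v, 'j) fr_comp \<Rightarrow> bool" where
  "framed V J = (\<lambda>(f, l, \<alpha>).
     f \<in> extensional V \<and> fst (f 0) \<in> J \<and> (\<forall>x\<in>V. fst (f x) = fst (f 0)) \<and> (\<forall>x\<in>V. snd (f x) \<in> V) \<and>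
     smooth_on_subspace V (\<lambda>x. snd (f x)) \<and> 0 \<le> l \<and>
     \<alpha> \<in> extensional {0..} \<and> (\<forall>t\<ge>0. \<alpha> t \<in> extensional (V \<times> V)) \<and>
     continuous_on ({0..} \<times> V \<times> V) (\<lambda>(t, x, w). \<alpha> t (x, w)) \<and>
     (\<forall>t\<ge>0. \<forall>x\<in>V. \<exists>L. linear L \<and> (\<forall>w\<in>V. \<alpha> t (x, w) = L w) \<and> bij_betw L V V) \<and>
     (\<forall>x\<in>V. \<forall>w\<in>V. \<alpha> 0 (x, w) = w) \<and>
     (\<forall>t\<ge>l. \<forall>x\<in>V. \<forall>w\<in>V. \<alpha> t (x, w) = dir_deriv w (\<lambda>y. snd (f y)) x))"

lemma framed_restrict_iff:
  assumes V: "subspace V"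
  shows "framed V J (restrict h V, l, \<lambda>t\<in>{0..}. restrict (\<gamma> t) (V \<times> V)) \<longleftrightarrow>
    fst (h 0) \<in> J \<and> (\<forall>x\<in>V. fst (h x) = fst (h 0)) \<and> (\<forall>x\<in>V. snd (h x) \<in> V) \<and>
    smooth_on_subspace V (\<lambda>x. snd (h x)) \<and> 0 \<le> l \<and>
    continuous_on ({0..} \<times> V \<times> V) (\<lambda>(t, x, w). \<gamma> t (x, w)) \<and>
    (\<forall>t\<ge>0. \<forall>x\<in>V. \<exists>L. linear L \<and> (\<forall>w\<in>V. \<gamma> t (x, w) = L w) \<and> bij_betw L V V) \<and>
    (\<forall>x\<in>V. \<forall>w\<in>V. \<gamma> 0 (x, w) = w) \<and>
    (\<forall>t\<ge>l. \<forall>x\<in>V. \<forall>w\<in>V. \<gamma> t (x, w) = dir_deriv w (\<lambda>y. snd (h y)) x)"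
proof -
  let ?\<gamma> = "\<lambda>t\<in>{0..}. restrict (\<gamma> t) (V \<times> V)"
  have 0: "0 \<in> V" using V by (rule subspace_0)
  have sm: "smooth_on_subspace V (\<lambda>x. snd (restrict h V x)) \<longleftrightarrow> smooth_on_subspace V (\<lambda>x. snd (h x))"
    by (auto elim!: smooth_on_subspace_cong[OF V])
  have co: "continuous_on ({0..} \<times> V \<times> V) (\<lambda>(t, x, w). ?\<gamma> t (x, w)) \<longleftrightarrow>
      continuous_on ({0..} \<times> V \<times> V) (\<lambda>(t, x, w). \<gamma> t (x, w))"
    by (rule continuous_on_cong) auto
  have dd: "(\<forall>t\<ge>l. \<forall>x\<in>V. \<forall>w\<in>V. ?\<gamma> t (x, w) = dir_deriv w (\<lambda>y. snd (restrict h V y)) x) \<longleftrightarrow>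
      (\<forall>t\<ge>l. \<forall>x\<in>V. \<forall>w\<in>V. \<gamma> t (x, w) = dir_deriv w (\<lambda>y. snd (h y)) x)" if "0 \<le> l"
  proof -
    have "dir_deriv w (\<lambda>y. snd (restrict h V y)) x = dir_deriv w (\<lambda>y. snd (h y)) x" if "x \<in> V" "w \<in> V" for x w
      by (rule dir_deriv_cong[OF V that]) simp
    moreover have "?\<gamma> t = restrict (\<gamma> t) (V \<times> V)" if "l \<le> t" for t using that \<open>0 \<le> l\<close> by simp
    ultimately show ?thesis by simp
  qed
  show ?thesis
    unfolding framed_def prod.case sm co using 0 dd by (cases "0 \<le> l") simp_all
qed

lemmas framed_restrictI = framed_restrict_iff[THEN iffD2, OF _ conjI[OF _ conjI[OF _ conjI[OF _ conjI[OF _ conjI[OF _ conjI[OF _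
  conjI[OF _ conjI]]]]]]], rule_format]

lemma framed_component_iff:
  assumes V: "subspace V"
  shows "framed V J (component V (f, l, \<alpha>) i) \<longleftrightarrow>
    fst (f (i, 0)) \<in> J \<and> (\<forall>x\<in>V. fst (f (i, x)) = fst (f (i, 0))) \<and> (\<forall>x\<in>V. snd (f (i, x)) \<in> V) \<and>
    smooth_on_subspace V (\<lambda>x. snd (f (i, x))) \<and> 0 \<le> l i \<and>
    continuous_on ({0..} \<times> V \<times> V) (\<lambda>(t, x, w). \<alpha> t ((i, x), w)) \<and>
    (\<forall>t\<ge>0. \<forall>x\<in>V. \<exists>L. linear L \<and> (\<forall>w\<in>V. \<alpha> t ((i, x), w) = L w) \<and> bij_betw L V V) \<and>
    (\<forall>x\<in>V. \<forall>w\<in>V. \<alpha> 0 ((i, x), w) = w) \<and>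
    (\<forall>t\<ge>l i. \<forall>x\<in>V. \<forall>w\<in>V. \<alpha> t ((i, x), w) = dir_deriv w (\<lambda>y. snd (f (i, y))) x)"
  unfolding component_def prod.case framed_restrict_iff[OF V] prod.case ..

text \<open>
  A framed embedding is a family of framed components that form a topological embedding.
\<close>

lemma mem_fr_emb_space_iff:
  assumes V: "subspace V"
  shows "(f, l, \<alpha>) \<in> topspace (fr_emb_space V I J) \<longleftrightarrow>
    f \<in> extensional (I \<times> V) \<and> l \<in> extensional I \<and> \<alpha> \<in> extensional {0..} \<and>
    (\<forall>t\<ge>0. \<alpha> t \<in> extensional ((I \<times> V) \<times> V)) \<and> embedding_map (mfd V I) (mfd V J) f \<and>
    (\<forall>i\<in>I. framed V J (component V (f, l, \<alpha>) i))"
    (is "?l \<longleftrightarrow> ?r")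
proof -
  have 0: "0 \<in> V" using V by (rule subspace_0)
  have L: "?l \<longleftrightarrow> f \<in> extensional (I \<times> V) \<and> smooth_embedding V I J f \<and> l \<in> I \<rightarrow>\<^sub>E {0..} \<and>
    \<alpha> \<in> extensional {0..} \<and> continuous_map (top_of_set {0..}) (hom_space V I) \<alpha> \<and>
    \<alpha> 0 = framing V I \<and> (\<forall>i\<in>I. \<forall>t\<ge>l i. \<forall>x\<in>V. \<forall>w\<in>V.
            \<alpha> t ((i, x), w) = framing V J (differential f ((i, x), w)))"
    by (auto simp: fr_emb_space_def topspace_emb_space[OF V] topspace_map_space)
  have fr: "framing V J (differential f ((i, x), w)) = dir_deriv w (\<lambda>y. snd (f (i, y))) x"
    if "smooth_on_subspace V (\<lambda>y. snd (f (i, y)))" "f (i, x) \<in> J \<times> V" "\<forall>x\<in>V. snd (f (i, x)) \<in> V" "x \<in> V" "w \<in> V" for i x w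
    using that dir_deriv_mem_subspace[OF V that(1) _ that(4,5)]
    by (auto simp: framing_def differential_def restrict_def)
  show ?thesis
  proof
    assume l: ?l
    note l' = l[unfolded L]
    have emb: "embedding_map (mfd V I) (mfd V J) f" and cont: "continuous_map (mfd V I) (mfd V J) f"
      and sm: "\<And>i. i \<in> I \<Longrightarrow> smooth_on_subspace V (\<lambda>x. snd (f (i, x)))"
      using l' by (auto simp: smooth_embedding_def)
    have fm: "f (i, x) \<in> J \<times> V" if "i \<in> I" "x \<in> V" for i x
      using cont that unfolding continuous_map_def by auto
    have al: "\<alpha> \<in> extensional {0..}" using l' by blast
    note mp = moore_path_iff[OF V al, of I, THEN iffD1, OF conjunct1[OF conjunct2[OF conjunct2[OF conjunct2[OF conjunct2[OF l']]]]]]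
    have const: "fst (f (i, x)) = fst (f (i, 0))" if i: "i \<in> I" and x: "x \<in> V" for i x
    proof -
      have "continuous_map (top_of_set V) (discrete_topology J) (\<lambda>x. fst (f (i, x)))"
        using cont i unfolding mfd_def continuous_map_discrete_prod_iff continuous_map_pairwise o_def by blast
      moreover have "connected_space (top_of_set V)"
        using convex_connected[OF subspace_imp_convex[OF V]] by (simp add: connected_space_subtopology)
      ultimately have "connectedin (discrete_topology J) ((\<lambda>x. fst (f (i, x))) ` V)"
        using connectedin_continuous_map_image connectedin_topspace by fastforce
      then show ?thesis using x 0 by (auto simp: connectedin_discrete_topology)
    qed
    have "framed V J (component V (f, l, \<alpha>) i)" if i: "i \<in> I" for i
    proof -
      have "\<forall>x\<in>V. snd (f (i, x)) \<in> V" using fm[OF i] by (metis mem_Times_iff)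
      moreover have "fst (f (i, 0)) \<in> J" using fm[OF i 0] by auto
      moreover have "l i \<ge> 0" using l' i by auto
      moreover have "\<forall>x\<in>V. \<forall>w\<in>V. \<alpha> 0 ((i, x), w) = w" using l' i by (auto simp: framing_def)
      moreover have "\<forall>t\<ge>l i. \<forall>x\<in>V. \<forall>w\<in>V. \<alpha> t ((i, x), w) = dir_deriv w (\<lambda>y. snd (f (i, y))) x"
        using l' i fr[OF sm[OF i] fm[OF i]] calculation(1) by auto
      moreover have "\<forall>x\<in>V. fst (f (i, x)) = fst (f (i, 0))" using const[OF i] by blast
      moreover have "continuous_on ({0..} \<times> V \<times> V) (\<lambda>(t, x, w). \<alpha> t ((i, x), w))" using mp i by blast
      moreover have "\<forall>t\<ge>0. \<forall>x\<in>V. \<exists>L. linear L \<and> (\<forall>w\<in>V. \<alpha> t ((i, x), w) = L w) \<and> bij_betw L V V"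
        using mp i by blast
      ultimately show ?thesis
        unfolding framed_component_iff[OF V] using sm[OF i] by blast
    qed
    then show ?r using l' emb mp by (auto simp: PiE_def)
  next
    assume r: ?r
    have fd: "i \<in> I \<Longrightarrow> framed V J (component V (f, l, \<alpha>) i)" for i using r by blast
    note fd' = fd[unfolded framed_component_iff[OF V]]
    have cont: "continuous_map (mfd V I) (mfd V J) f"
      using r by (meson continuous_map_in_subtopology embedding_map_def homeomorphic_imp_continuous_map)
    have fm: "f (i, x) \<in> J \<times> V" if "i \<in> I" "x \<in> V" for i x
      using cont that unfolding continuous_map_def by auto
    have sV: "\<forall>x\<in>V. snd (f (i, x)) \<in> V" if "i \<in> I" for i
      using fm[OF that] by (metis mem_Times_iff)
    have sm: "smooth_on_subspace V (\<lambda>x. snd (f (i, x)))" and l0: "0 \<le> l i"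
      and co: "continuous_on ({0..} \<times> V \<times> V) (\<lambda>(t, x, w). \<alpha> t ((i, x), w))" if "i \<in> I" for i
      using fd'[OF that] by blast+
    have lin: "\<exists>L. linear L \<and> (\<forall>w\<in>V. \<alpha> t ((i, x), w) = L w) \<and> bij_betw L V V"
      if "i \<in> I" "t \<ge> 0" "x \<in> V" for i t x
      using fd'[OF that(1)] that(2,3) by blast
    have en: "\<alpha> t ((i, x), w) = dir_deriv w (\<lambda>y. snd (f (i, y))) x"
      if "i \<in> I" "t \<ge> l i" "x \<in> V" "w \<in> V" for i t x w
      using fd'[OF that(1)] that(2-4) by blast
    have "\<alpha> 0 ((i, x), w) = w" if "i \<in> I" "x \<in> V" "w \<in> V" for i x w
      using fd'[OF that(1)] that(2,3) by blast
    then have "\<alpha> 0 = framing V I"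
      unfolding framing_def by (intro extensionalityI[of _ "(I \<times> V) \<times> V"]) (use r in auto)
    moreover have "inj_on (\<lambda>w. snd (differential f ((i, x), w))) V" if i: "i \<in> I" and x: "x \<in> V" for i x
    proof -
      obtain L where "\<forall>w\<in>V. \<alpha> (l i) ((i, x), w) = L w" "bij_betw L V V"
        using lin[OF i l0[OF i] x] by blast
      then show ?thesis
        using en[OF i order_refl x] by (auto simp: inj_on_def bij_betw_def differential_def)
    qed
    moreover have "continuous_map (top_of_set {0..}) (hom_space V I) \<alpha>"
      using r lin co by (subst moore_path_iff[OF V]) auto
    ultimately show ?l
      unfolding L using r cont sm l0 en fr[OF sm fm sV]
      by (auto simp: smooth_embedding_def PiE_def)
  qed
qed

lemma fr_emb_eqI:
  assumes V: "subspace V" and e: "e \<in> topspace (fr_emb_space V I J)" and e': "e' \<in> topspace (fr_emb_space V I J)"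
    and eq: "\<And>i. i \<in> I \<Longrightarrow> component V e i = component V e' i"
  shows "e = e'"
proof -
  obtain f l \<alpha> f' l' \<alpha>' where d: "e = (f, l, \<alpha>)" "e' = (f', l', \<alpha>')" by (metis prod.collapse)
  note m = e[unfolded d mem_fr_emb_space_iff[OF V]] and m' = e'[unfolded d mem_fr_emb_space_iff[OF V]]
  have c1: "(\<lambda>x\<in>V. f (i, x)) = (\<lambda>x\<in>V. f' (i, x))" and c2: "l i = l' i"
    and c3: "(\<lambda>t\<in>{0..}. \<lambda>(x, w)\<in>V \<times> V. \<alpha> t ((i, x), w)) = (\<lambda>t\<in>{0..}. \<lambda>(x, w)\<in>V \<times> V. \<alpha>' t ((i, x), w))"
    if "i \<in> I" for i
    using eq[OF that] by (auto simp: d component_def)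
  have "f = f'"
  proof (rule extensionalityI[of _ "I \<times> V"])
    fix z assume "z \<in> I \<times> V"
    then show "f z = f' z" using fun_cong[OF c1, of "fst z" "snd z"] by auto
  qed (use m m' in auto)
  moreover have "l = l'"
    by (rule extensionalityI[of _ I]) (use m m' c2 in auto)
  moreover have "\<alpha> = \<alpha>'"
  proof (rule extensionalityI[of _ "{0..}"])
    fix t :: real assume t: "t \<in> {0..}"
    show "\<alpha> t = \<alpha>' t"
    proof (rule extensionalityI[of _ "(I \<times> V) \<times> V"])
      fix z assume z: "z \<in> (I \<times> V) \<times> V"
      then obtain i x w where iz: "z = ((i, x), w)" "i \<in> I" "x \<in> V" "w \<in> V" by auto
      show "\<alpha> t z = \<alpha>' t z"
        using fun_cong[OF fun_cong[OF c3[OF iz(2)], of t], of "(x, w)"] t iz by simp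
    qed (use m m' t in auto)
  qed (use m m' in auto)
  ultimately show ?thesis by (simp add: d)
qed


section \<open>Operations on framed embeddings\<close>

text \<open>
  The operations on framed embeddings, for one component.  The target of a component is the index
  of the copy of \<open>V\<close> that contains its image; there is only one, as \<open>V\<close> is connected.
\<close>

definition comp_target :: "('v::euclidean_space, 'j) fr_comp \<Rightarrow> 'j" where
  "comp_target = (\<lambda>(f, l, \<alpha>). fst (f 0))"

text \<open>The inclusion of the copy of \<open>V\<close> with index \<open>j\<close>, with the constant path of length \<open>0\<close>.\<close>

definition comp_std :: "'v::euclidean_space set \<Rightarrow> 'j \<Rightarrow> ('v, 'j) fr_comp" where
  "comp_std V j = (\<lambda>x\<in>V. (j, x), 0, \<lambda>t\<in>{0..}. \<lambda>(x, w)\<in>V \<times> V. w)"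

definition comp_compose :: "'v::euclidean_space set \<Rightarrow> ('v, 'j) fr_comp \<Rightarrow> ('v, 'k) fr_comp \<Rightarrow> ('v, 'j) fr_comp" where
  "comp_compose V = (\<lambda>(g, m, \<beta>) (f, l, \<alpha>).
     (\<lambda>x\<in>V. g (snd (f x)), l + m, \<lambda>t\<in>{0..}. \<lambda>(x, w)\<in>V \<times> V.
        if t \<le> l then \<alpha> t (x, w) else \<beta> (t - l) (snd (f x), dir_deriv w (\<lambda>y. snd (f y)) x)))"

text \<open>
  The map \<open>\<phi>\<close> (and \<open>a\<close> in \<open>comp_conj\<close> below) is applied to the index of the target.
\<close>

definition comp_relabel :: "'v::euclidean_space set \<Rightarrow> ('j \<Rightarrow> 'k) \<Rightarrow> ('v, 'j) fr_comp \<Rightarrow> ('v, 'k) fr_comp" where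
  "comp_relabel V \<phi> = (\<lambda>(f, l, \<alpha>). (\<lambda>x\<in>V. (\<phi> (fst (f x)), snd (f x)), l, \<alpha>))"

definition comp_conj :: "('v::euclidean_space \<Rightarrow> 'v) \<Rightarrow> ('v \<Rightarrow> 'v) \<Rightarrow> 'v set \<Rightarrow> ('j \<Rightarrow> 'k) \<Rightarrow> ('v, 'j) fr_comp \<Rightarrow> ('v, 'k) fr_comp" where
  "comp_conj T T' V a = (\<lambda>(f, l, \<alpha>).
     (\<lambda>x\<in>V. map_prod a T (f (T' x)), l,
      \<lambda>t\<in>{0..}. \<lambda>(x, w)\<in>V \<times> V. T (\<alpha> t (T' x, T' w))))"

lemma framed_comp_std:
  assumes V: "subspace V" and "j \<in> J"
  shows "framed V J (comp_std V j)"
  unfolding comp_std_def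
proof (rule framed_restrictI[OF V])
  show "smooth_on_subspace V (\<lambda>x. snd (j, x))"
    using smooth_on_subspace_linear[OF linear_id, of V] by (simp add: id_def)
  show "continuous_on ({0..} \<times> V \<times> V) (\<lambda>(t, x, w). case (x, w) of (x, w) \<Rightarrow> w)"
    by (auto simp: case_prod_unfold intro!: continuous_intros)
  show "\<exists>L. linear L \<and> (\<forall>w\<in>V. (case (x, w) of (x, w) \<Rightarrow> w) = L w) \<and> bij_betw L V V" for x :: 'a
    by (rule exI[of _ id]) (simp add: linear_id)
  show "(case (x, w) of (x, w) \<Rightarrow> w) = dir_deriv w (\<lambda>y. snd (j, y)) x" for x w
    using dir_deriv_linear_map[OF linear_id, of w x] by (simp add: id_def)
qed (use assms in auto)

lemma framed_relabel:
  assumes V: "subspace V" and c: "framed V J c" and "\<phi> (comp_target c) \<in> K"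
  shows "framed V K (comp_relabel V \<phi> c)"
proof -
  obtain f l \<alpha> where d: "c = (f, l, \<alpha>)" by (metis prod.collapse)
  note c' = c[unfolded d framed_def prod.case]
  have ext: "\<alpha> \<in> extensional {0..}" "\<And>t. 0 \<le> t \<Longrightarrow> \<alpha> t \<in> extensional (V \<times> V)" using c' by blast+
  have "(\<lambda>t\<in>{0..}. restrict (\<alpha> t) (V \<times> V)) = \<alpha>"
    by (rule extensionalityI[of _ "{0..}"]) (use ext in \<open>auto simp: extensional_restrict\<close>)
  moreover have "framed V K (\<lambda>x\<in>V. (\<phi> (fst (f x)), snd (f x)), l, \<lambda>t\<in>{0..}. restrict (\<alpha> t) (V \<times> V))"
  proof (rule framed_restrictI[OF V])
    show "fst (\<phi> (fst (f 0)), snd (f 0)) \<in> K" using assms(3) by (simp add: comp_target_def d)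
    show "fst (\<phi> (fst (f x)), snd (f x)) = fst (\<phi> (fst (f 0)), snd (f 0))" if "x \<in> V" for x
      using c' that by (metis fst_conv)
  qed (insert c', unfold snd_conv, blast+)
  ultimately show ?thesis by (simp add: comp_relabel_def d)
qed

lemma framed_compose:
  assumes V: "subspace V" and c: "framed V J c" and c': "framed V K c'"
  shows "framed V J (comp_compose V c c')"
proof -
  obtain g m \<beta> f l \<alpha> where d: "c = (g, m, \<beta>)" "c' = (f, l, \<alpha>)" by (metis prod.collapse)
  have c1: "g \<in> extensional V" "fst (g 0) \<in> J" "\<And>x. x \<in> V \<Longrightarrow> fst (g x) = fst (g 0)" "\<And>x. x \<in> V \<Longrightarrow> snd (g x) \<in> V"
     "smooth_on_subspace V (\<lambda>x. snd (g x))" "0 \<le> m" "continuous_on ({0..} \<times> V \<times> V) (\<lambda>(t, x, w). \<beta> t (x, w))"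
     and cl: "\<And>t x. t \<ge> 0 \<Longrightarrow> x \<in> V \<Longrightarrow> \<exists>L. linear L \<and> (\<forall>w\<in>V. \<beta> t (x, w) = L w) \<and> bij_betw L V V"
     and c0: "\<And>x w. x \<in> V \<Longrightarrow> w \<in> V \<Longrightarrow> \<beta> 0 (x, w) = w"
     and ce: "\<And>t x w. t \<ge> m \<Longrightarrow> x \<in> V \<Longrightarrow> w \<in> V \<Longrightarrow> \<beta> t (x, w) = dir_deriv w (\<lambda>y. snd (g y)) x"
    using c by (auto simp: framed_def d)
  have c2: "\<And>x. x \<in> V \<Longrightarrow> snd (f x) \<in> V" "smooth_on_subspace V (\<lambda>x. snd (f x))" "0 \<le> l"
     "continuous_on ({0..} \<times> V \<times> V) (\<lambda>(t, x, w). \<alpha> t (x, w))"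
     and dl: "\<And>t x. t \<ge> 0 \<Longrightarrow> x \<in> V \<Longrightarrow> \<exists>L. linear L \<and> (\<forall>w\<in>V. \<alpha> t (x, w) = L w) \<and> bij_betw L V V"
     and d0: "\<And>x w. x \<in> V \<Longrightarrow> w \<in> V \<Longrightarrow> \<alpha> 0 (x, w) = w"
     and de: "\<And>t x w. t \<ge> l \<Longrightarrow> x \<in> V \<Longrightarrow> w \<in> V \<Longrightarrow> \<alpha> t (x, w) = dir_deriv w (\<lambda>y. snd (f y)) x"
    using c' by (auto simp: framed_def d)
  have 0: "0 \<in> V" using V by (rule subspace_0)
  have dV: "dir_deriv w (\<lambda>y. snd (f y)) x \<in> V" if "x \<in> V" "w \<in> V" for x w
    by (rule dir_deriv_mem_subspace[OF V c2(2)]) (use c2(1) that in auto)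
  have smh: "smooth_on_subspace V (\<lambda>x. snd (g (snd (f x))))"
    by (rule smooth_on_subspace_compose[OF V c1(5) c2(2)]) (use c2(1) in auto)
  have dh: "dir_deriv w (\<lambda>y. snd (g (snd (f y)))) x = dir_deriv (dir_deriv w (\<lambda>y. snd (f y)) x) (\<lambda>y. snd (g y)) (snd (f x))"
    if "x \<in> V" "w \<in> V" for x w
    by (rule dir_deriv_compose[OF V c1(5) c2(2) _ that]) (use c2(1) in auto)
  let ?\<gamma> = "\<lambda>t (x, w). if t \<le> l then \<alpha> t (x, w) else \<beta> (t - l) (snd (f x), dir_deriv w (\<lambda>y. snd (f y)) x)"
  \<comment> \<open>The derivative is jointly continuous, as it is the value of the Moore path at time \<open>l\<close>.\<close>
  have df: "continuous_on (V \<times> V) (\<lambda>(x, w). dir_deriv w (\<lambda>y. snd (f y)) x)"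
  proof -
    have "continuous_on (V \<times> V) (\<lambda>z. (\<lambda>(t, x, w). \<alpha> t (x, w)) (l, z))"
      by (rule continuous_on_compose2[OF c2(4)]) (use c2(3) in \<open>auto intro!: continuous_intros\<close>)
    then show ?thesis
      by (rule continuous_on_eq) (use de in auto)
  qed
  have cf: "continuous_on V (\<lambda>x. snd (f x))" by (rule smooth_on_subspaceD(1)[OF c2(2)])
  have "continuous_on ({0..} \<times> V \<times> V) (\<lambda>z. if fst z \<le> l then \<alpha> (fst z) (snd z)
       else \<beta> (fst z - l) (snd (f (fst (snd z))), (\<lambda>(x, w). dir_deriv w (\<lambda>y. snd (f y)) x) (snd z)))"
  proof (rule continuous_on_cases_le)
    show "continuous_on {z \<in> {0..} \<times> V \<times> V. fst z \<le> l} (\<lambda>z. \<alpha> (fst z) (snd z))"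
      by (rule continuous_on_subset[OF continuous_on_eq[OF c2(4)]]) auto
    have "continuous_on {z \<in> {0..} \<times> V \<times> V. l \<le> fst z} (\<lambda>z. (\<lambda>(t, x, w). \<beta> t (x, w))
           (fst z - l, snd (f (fst (snd z))), (\<lambda>(x, w). dir_deriv w (\<lambda>y. snd (f y)) x) (snd z)))"
      by (rule continuous_on_compose2[OF c1(7)])
         (auto intro!: continuous_intros continuous_on_compose2[OF cf] continuous_on_compose2[OF df] c2(1) dV)
    then show "continuous_on {z \<in> {0..} \<times> V \<times> V. l \<le> fst z}
        (\<lambda>z. \<beta> (fst z - l) (snd (f (fst (snd z))), (\<lambda>(x, w). dir_deriv w (\<lambda>y. snd (f y)) x) (snd z)))" by simp
    show "continuous_on ({0..} \<times> V \<times> V) (fst :: real \<times> 'a \<times> 'a \<Rightarrow> real)" by (intro continuous_intros)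
    show "\<alpha> (fst z) (snd z) = \<beta> (fst z - l) (snd (f (fst (snd z))), (\<lambda>(x, w). dir_deriv w (\<lambda>y. snd (f y)) x) (snd z))"
      if "z \<in> {0..} \<times> V \<times> V" "fst z = l" for z
      using that de[of l] c0 dV c2(1) by auto
  qed
  then have cont: "continuous_on ({0..} \<times> V \<times> V) (\<lambda>(t, x, w). ?\<gamma> t (x, w))"
    by (rule continuous_on_eq) (clarsimp simp del: split_paired_All)
  have lin: "\<exists>L. linear L \<and> (\<forall>w\<in>V. ?\<gamma> t (x, w) = L w) \<and> bij_betw L V V" if t: "t \<ge> 0" and x: "x \<in> V" for t x
  proof (cases "t \<le> l")
    case True
    then show ?thesis using dl[OF t x] by auto
  next
    case False
    obtain L where L: "linear L" "\<forall>w\<in>V. \<beta> (t - l) (snd (f x), w) = L w" "bij_betw L V V"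
      using cl[of "t - l" "snd (f x)"] False c2(1)[OF x] by auto
    obtain M where M: "linear M" "\<forall>w\<in>V. \<alpha> l (x, w) = M w" "bij_betw M V V"
      using dl[OF c2(3) x] by blast
    have "?\<gamma> t (x, w) = (L \<circ> M) w" if w: "w \<in> V" for w
      using False de[OF order_refl x w] M(2) L(2) w dV[OF x w] by simp
    moreover have "linear (L \<circ> M)" using M(1) L(1) by (rule linear_compose)
    moreover have "bij_betw (L \<circ> M) V V" using M(3) L(3) by (rule bij_betw_trans)
    ultimately show ?thesis by blast
  qed
  have en: "?\<gamma> t (x, w) = dir_deriv w (\<lambda>y. snd (g (snd (f y)))) x"
    if "l + m \<le> t" "x \<in> V" "w \<in> V" for t x w
  proof (cases "t \<le> l")
    case True
    then have "t = l" "m = 0" using that(1) c1(6) by auto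
    then show ?thesis
      using dh[OF that(2,3)] ce[of 0 "snd (f x)"] c0 c2(1)[OF that(2)] dV[OF that(2,3)] de[of t x w] that by simp
  next
    case False
    then show ?thesis
      using that dh[OF that(2,3)] ce[of "t - l" "snd (f x)"] c2(1)[OF that(2)] dV[OF that(2,3)] by simp
  qed
  show ?thesis
    unfolding comp_compose_def d prod.case
  proof (rule framed_restrictI[OF V _ _ _ smh _ cont lin _ en])
    show "fst (g (snd (f 0))) \<in> J" using c1(3)[OF c2(1)[OF 0]] c1(2) by simp
    show "fst (g (snd (f x))) = fst (g (snd (f 0)))" "snd (g (snd (f x))) \<in> V" if "x \<in> V" for x
      using c1(3)[OF c2(1)[OF that]] c1(3)[OF c2(1)[OF 0]] c1(4)[OF c2(1)[OF that]] by simp_all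
    show "0 \<le> l + m" using c1(6) c2(3) by simp
    show "?\<gamma> 0 (x, w) = w" if "x \<in> V" "w \<in> V" for x w
      using d0[OF that] c2(3) by simp
  qed
qed

text \<open>A linear automorphism of a subspace and its inverse, given by maps that are specified on the subspace only.\<close>

definition linear_inverses :: "'v::euclidean_space set \<Rightarrow> ('v \<Rightarrow> 'v) \<Rightarrow> ('v \<Rightarrow> 'v) \<Rightarrow> bool" where
  "linear_inverses V T T' \<longleftrightarrow> (\<exists>S S'. linear S \<and> linear S' \<and>
     (\<forall>x\<in>V. T x = S x \<and> T' x = S' x \<and> T x \<in> V \<and> T' x \<in> V \<and> T (T' x) = x \<and> T' (T x) = x))"

lemma linear_inversesD:
  assumes "linear_inverses V T T'" "x \<in> V"
  shows "T x \<in> V" "T' x \<in> V" "T (T' x) = x" "T' (T x) = x"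
  using assms unfolding linear_inverses_def by auto

lemma linear_inverses_0:
  assumes "linear_inverses V T T'" "subspace V"
  shows "T' 0 = 0"
  using assms subspace_0[of V] linear_0 unfolding linear_inverses_def by metis

lemma framed_conj:
  fixes V :: "'v::euclidean_space set"
  assumes V: "subspace V" and c: "framed V J c" and a: "a (comp_target c) \<in> K"
    and inv: "linear_inverses V T T'"
  shows "framed V K (comp_conj T T' V a c)"
proof -
  obtain S S' where S: "linear S" "\<And>x. x \<in> V \<Longrightarrow> T x = S x" "linear S'" "\<And>x. x \<in> V \<Longrightarrow> T' x = S' x"
    using inv unfolding linear_inverses_def by blast
  note T = linear_inversesD[OF inv]
  obtain f l \<alpha> where d: "c = (f, l, \<alpha>)" by (metis prod.collapse)
  have c1: "f \<in> extensional V" "fst (f 0) \<in> J" "\<And>x. x \<in> V \<Longrightarrow> fst (f x) = fst (f 0)" "\<And>x. x \<in> V \<Longrightarrow> snd (f x) \<in> V"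
     "smooth_on_subspace V (\<lambda>x. snd (f x))" "0 \<le> l" "continuous_on ({0..} \<times> V \<times> V) (\<lambda>(t, x, w). \<alpha> t (x, w))"
     and cl: "\<And>t x. t \<ge> 0 \<Longrightarrow> x \<in> V \<Longrightarrow> \<exists>L. linear L \<and> (\<forall>w\<in>V. \<alpha> t (x, w) = L w) \<and> bij_betw L V V"
     and c0: "\<And>x w. x \<in> V \<Longrightarrow> w \<in> V \<Longrightarrow> \<alpha> 0 (x, w) = w"
     and ce: "\<And>t x w. t \<ge> l \<Longrightarrow> x \<in> V \<Longrightarrow> w \<in> V \<Longrightarrow> \<alpha> t (x, w) = dir_deriv w (\<lambda>y. snd (f y)) x"
    using c by (auto simp: framed_def d)
  have 0: "0 \<in> V" using V by (rule subspace_0)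
  have T'0: "T' 0 = 0" "T 0 = 0" using S 0 by (auto simp: linear_0)
  have bT: "bij_betw S V V"
    by (rule bij_betw_byWitness[where f' = S']) (use T S in auto)
  have bT': "bij_betw S' V V"
    by (rule bij_betw_byWitness[where f' = S]) (use T S in auto)
  let ?h = "\<lambda>x. map_prod a T (f (T' x))"
  have e1: "snd (?h x) = S (snd (f (S' x)))" if "x \<in> V" for x
    using that S T c1(4) by (simp add: snd_map_prod)
  have sS': "smooth_on_subspace V S'" and sS: "smooth_on_subspace V S"
    using S by (auto intro: smooth_on_subspace_linear)
  have im: "S' ` V \<subseteq> V" "(\<lambda>x. snd (f x)) ` V \<subseteq> V" using bT' c1(4) by (auto simp: bij_betw_def)
  have s1: "smooth_on_subspace V (\<lambda>x. snd (f (S' x)))"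
    by (rule smooth_on_subspace_compose[OF V c1(5) sS' im(1)])
  have im2: "(\<lambda>x. snd (f (S' x))) ` V \<subseteq> V" using im by auto
  have sm: "smooth_on_subspace V (\<lambda>x. snd (?h x))"
    by (rule smooth_on_subspace_cong[OF V smooth_on_subspace_compose[OF V sS s1 im2]]) (use e1 in simp)
  have dd: "dir_deriv w (\<lambda>y. snd (?h y)) x = T (dir_deriv (T' w) (\<lambda>y. snd (f y)) (T' x))"
    if x: "x \<in> V" and w: "w \<in> V" for x w
  proof -
    have "dir_deriv w (\<lambda>y. snd (?h y)) x = dir_deriv w (\<lambda>y. S (snd (f (S' y)))) x"
      by (rule dir_deriv_cong[OF V x w]) (use e1 in simp)
    also have "\<dots> = S (dir_deriv w (\<lambda>y. snd (f (S' y))) x)"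
      using dir_deriv_compose[OF V sS s1 im2 x w] dir_deriv_linear_map[OF S(1)] by simp
    also have "dir_deriv w (\<lambda>y. snd (f (S' y))) x = dir_deriv (S' w) (\<lambda>y. snd (f y)) (S' x)"
      using dir_deriv_compose[OF V c1(5) sS' im(1) x w] dir_deriv_linear_map[OF S(3)] by simp
    also have "S (dir_deriv (S' w) (\<lambda>y. snd (f y)) (S' x)) = T (dir_deriv (T' w) (\<lambda>y. snd (f y)) (T' x))"
    proof -
      have "dir_deriv (S' w) (\<lambda>y. snd (f y)) (S' x) \<in> V"
        by (rule dir_deriv_mem_subspace[OF V c1(5) im(2)]) (use im(1) x w in auto)
      then show ?thesis using S x w by simp
    qed
    finally show ?thesis .
  qed
  let ?\<gamma> = "\<lambda>t (x, w). T (\<alpha> t (T' x, T' w))"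
  have aV: "\<alpha> t (x, w) \<in> V" if "t \<ge> 0" "x \<in> V" "w \<in> V" for t x w
    using cl[OF that(1,2)] that(3) by (metis bij_betwE)
  have cont: "continuous_on ({0..} \<times> V \<times> V) (\<lambda>(t, x, w). ?\<gamma> t (x, w))"
  proof -
    have "continuous_on ({0..} \<times> V \<times> V) (\<lambda>z. S ((\<lambda>(t, x, w). \<alpha> t (x, w)) (fst z, S' (fst (snd z)), S' (snd (snd z)))))"
      using S im(1) by (intro linear_continuous_on_compose[where g = S] continuous_on_compose2[OF c1(7)]
          continuous_intros linear_continuous_on_compose[where g = S']) auto
    then show ?thesis
      by (rule continuous_on_eq) (use S T aV in auto)
  qed
  have lin: "\<exists>L. linear L \<and> (\<forall>w\<in>V. ?\<gamma> t (x, w) = L w) \<and> bij_betw L V V"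
    if t: "t \<ge> 0" and x: "x \<in> V" for t x
  proof -
    obtain L where L: "linear L" "\<forall>w\<in>V. \<alpha> t (T' x, w) = L w" "bij_betw L V V"
      using cl[OF t T(2)[OF x]] by blast
    have "T (\<alpha> t (T' x, T' w)) = (S \<circ> (L \<circ> S')) w" if w: "w \<in> V" for w
      using L S T w aV[OF t T(2)[OF x] T(2)[OF w]] by simp
    moreover have "linear (S \<circ> (L \<circ> S'))" using S L by (intro linear_compose)
    moreover have "bij_betw (S \<circ> (L \<circ> S')) V V" using bT bT' L by (intro bij_betw_trans)
    ultimately show ?thesis using t x by (intro exI[of _ "S \<circ> (L \<circ> S')"]) auto
  qed
  show ?thesis
    unfolding comp_conj_def d prod.case
  proof (rule framed_restrictI[OF V _ _ _ sm _ cont lin])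
    show "(case (x, w) of (x, w) \<Rightarrow> T (\<alpha> t (T' x, T' w))) = dir_deriv w (\<lambda>y. snd (?h y)) x"
      if "l \<le> t" "x \<in> V" "w \<in> V" for t x w
      using ce[OF that(1) T(2)[OF that(2)] T(2)[OF that(3)]] dd[OF that(2,3)] by simp
    show "fst (?h 0) \<in> K" using a T'0 by (simp add: comp_target_def d fst_map_prod)
    show "fst (?h x) = fst (?h 0)" "snd (?h x) \<in> V" if "x \<in> V" for x
      using c1(3)[OF T(2)[OF that]] c1(4)[OF T(2)[OF that]] T(1) T'0 by (simp_all add: fst_map_prod snd_map_prod)
    show "0 \<le> l" by (rule c1(6))
    show "?\<gamma> 0 (x, w) = w" if "x \<in> V" "w \<in> V" for x w
      using c0[OF T(2)[OF that(1)] T(2)[OF that(2)]] T(3)[OF that(2)] by simp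
  qed
qed


lemma embedding_map_left_inverse:
  assumes f: "continuous_map X Y f" and g: "continuous_map (subtopology Y (f ` topspace X)) X g"
    and "\<And>x. x \<in> topspace X \<Longrightarrow> g (f x) = x"
  shows "embedding_map X Y f"
proof -
  have "homeomorphic_maps X (subtopology Y (f ` topspace X)) f g"
    using assms by (auto simp: homeomorphic_maps_def continuous_map_in_subtopology)
  then show ?thesis unfolding embedding_map_def by (rule homeomorphic_maps_imp_map)
qed

lemma continuous_map_subtopology_discrete_prod:
  fixes I :: "'i set" and X :: "'x topology"
  assumes "\<And>i. i \<in> I \<Longrightarrow> continuous_map (subtopology X {x. (i, x) \<in> S}) Y (\<lambda>x. G (i, x))"
  shows "continuous_map (subtopology (prod_topology (discrete_topology I) X) S) Y G"
  unfolding continuous_map_def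
proof (intro conjI allI impI)
  show "G \<in> topspace (subtopology (prod_topology (discrete_topology I) X) S) \<rightarrow> topspace Y"
    using assms by (fastforce simp: continuous_map_def Pi_iff)
  fix U assume U: "openin Y U"
  have "\<exists>T. openin X T \<and> {x \<in> topspace X \<inter> {x. (i, x) \<in> S}. G (i, x) \<in> U} = T \<inter> {x. (i, x) \<in> S}" if "i \<in> I" for i
    using openin_continuous_map_preimage[OF assms[OF that] U] by (simp add: openin_subtopology)
  then have "\<forall>i\<in>I. \<exists>T. openin X T \<and> {x \<in> topspace X \<inter> {x. (i, x) \<in> S}. G (i, x) \<in> U} = T \<inter> {x. (i, x) \<in> S}"
    by blast
  from bchoice[OF this] obtain T where T: "\<And>i. i \<in> I \<Longrightarrow> openin X (T i)"
    "\<And>i. i \<in> I \<Longrightarrow> {x \<in> topspace X \<inter> {x. (i, x) \<in> S}. G (i, x) \<in> U} = T i \<inter> {x. (i, x) \<in> S}" by blast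
  have "openin (prod_topology (discrete_topology I) X) (\<Union>i\<in>I. {i} \<times> T i)"
    using T(1) by (intro openin_Union) (auto simp: openin_prod_Times_iff)
  moreover have "{z \<in> topspace (subtopology (prod_topology (discrete_topology I) X) S). G z \<in> U} = (\<Union>i\<in>I. {i} \<times> T i) \<inter> S"
  proof (rule Set.set_eqI)
    fix z :: "'i \<times> 'x"
    obtain i x where z: "z = (i, x)" by (cases z)
    show "z \<in> {z \<in> topspace (subtopology (prod_topology (discrete_topology I) X) S). G z \<in> U} \<longleftrightarrow> z \<in> (\<Union>i\<in>I. {i} \<times> T i) \<inter> S"
    proof (cases "i \<in> I")
      case True
      have "x \<in> {x \<in> topspace X \<inter> {x. (i, x) \<in> S}. G (i, x) \<in> U} \<longleftrightarrow> x \<in> T i \<inter> {x. (i, x) \<in> S}"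
        using T(2)[OF True] by blast
      then show ?thesis using True by (auto simp: z)
    qed (auto simp: z)
  qed
  ultimately show "openin (subtopology (prod_topology (discrete_topology I) X) S)
      {z \<in> topspace (subtopology (prod_topology (discrete_topology I) X) S). G z \<in> U}"
    by (auto simp: openin_subtopology)
qed

lemma embedding_map_mfd:
  assumes s: "inj_on s I'" "s ` I' \<subseteq> I"
    and T: "continuous_on V T" "continuous_on V T'" "T ` V \<subseteq> V" "T' ` V \<subseteq> V" "\<And>x. x \<in> V \<Longrightarrow> T' (T x) = x"
  shows "embedding_map (mfd V I') (mfd V I) (\<lambda>(i, x). (s i, T x))"
proof (rule embedding_map_left_inverse[where g = "\<lambda>(i, x). (inv_into I' s i, T' x)"])
  show "continuous_map (mfd V I') (mfd V I) (\<lambda>(i, x). (s i, T x))"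
    using s T unfolding mfd_def continuous_map_discrete_prod_iff
    by (auto simp: continuous_map_pairwise o_def continuous_map_in_subtopology)
  show "continuous_map (subtopology (mfd V I) ((\<lambda>(i, x). (s i, T x)) ` topspace (mfd V I'))) (mfd V I')
     (\<lambda>(i, x). (inv_into I' s i, T' x))"
    unfolding mfd_def
  proof (rule continuous_map_subtopology_discrete_prod)
    fix i assume "i \<in> I"
    let ?S = "(\<lambda>(i, x). (s i, T x)) ` topspace (prod_topology (discrete_topology I') (top_of_set V))"
    show "continuous_map (subtopology (top_of_set V) {x. (i, x) \<in> ?S})
      (prod_topology (discrete_topology I') (top_of_set V)) (\<lambda>x. case (i, x) of (i, x) \<Rightarrow> (inv_into I' s i, T' x))"
    proof (cases "i \<in> s ` I'")
      case True
      then have "inv_into I' s i \<in> I'" by (rule inv_into_into)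
      then show ?thesis using T
        by (auto simp: continuous_map_pairwise o_def continuous_map_in_subtopology subtopology_subtopology
            intro: continuous_on_subset)
    next
      case False
      then have "{x. (i, x) \<in> ?S} = {}" by auto
      then show ?thesis by (simp add: continuous_map_on_empty)
    qed
  qed
qed (use assms in auto)

lemma subtopology_mfd: "J0 \<subseteq> J \<Longrightarrow> subtopology (mfd V J) (J0 \<times> V) = mfd V J0"
  by (simp add: mfd_def subtopology_Times subtopology_subtopology inf_absorb2)

text \<open>
  Precomposition with the map of index sets \<open>s\<close>, and relabelling of the targets by \<open>\<phi>\<close>.  The case
  \<open>\<phi> = id\<close> is \<^const>\<open>fr_emb_reindex\<close>.
\<close>

definition fr_emb_transfer ::
    "'v::euclidean_space set \<Rightarrow> 'h set \<Rightarrow> ('h \<Rightarrow> 'i) \<Rightarrow> ('j \<Rightarrow> 'k) \<Rightarrow> ('i, 'v, 'j) fr_emb \<Rightarrow> ('h, 'v, 'k) fr_emb" where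
  "fr_emb_transfer V I' s \<phi> = (\<lambda>(f, m, \<alpha>).
     (\<lambda>(p, x)\<in>I' \<times> V. (\<phi> (fst (f (s p, x))), snd (f (s p, x))), \<lambda>p\<in>I'. m (s p),
      \<lambda>t\<in>{0..}. \<lambda>((p, x), w)\<in>(I' \<times> V) \<times> V. \<alpha> t ((s p, x), w)))"

lemma fr_emb_reindex_eq: "fr_emb_reindex V l s e = fr_emb_transfer V {..<l} s id e"
  by (cases e) (auto simp: fr_emb_reindex_def fr_emb_transfer_def)

lemma component_transfer:
  "p \<in> I' \<Longrightarrow> component V (fr_emb_transfer V I' s \<phi> e) p = comp_relabel V \<phi> (component V e (s p))"
  by (cases e) (auto simp: component_def fr_emb_transfer_def comp_relabel_def fun_eq_iff restrict_def)

lemma comp_target_component: "subspace V \<Longrightarrow> comp_target (component V e i) = fst (fst e (i, 0))"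
  by (cases e) (simp add: component_def comp_target_def subspace_0)

lemma fr_emb_target:
  assumes V: "subspace V" and e: "(f, l, \<alpha>) \<in> topspace (fr_emb_space V I J)" and "i \<in> I" "x \<in> V"
  shows "f (i, x) = (fst (f (i, 0)), snd (f (i, x)))" "fst (f (i, 0)) \<in> J" "snd (f (i, x)) \<in> V"
  using e assms(3,4) unfolding mem_fr_emb_space_iff[OF V] framed_component_iff[OF V]
  by (auto simp: prod_eq_iff)

lemma fr_emb_framed:
  assumes V: "subspace V" and e: "e \<in> topspace (fr_emb_space V I J)" and "i \<in> I"
  shows "framed V J (component V e i)"
  using e assms(3) by (cases e) (simp add: mem_fr_emb_space_iff[OF V])

lemma fr_emb_transfer_mem:
  assumes V: "subspace V" and e: "e \<in> topspace (fr_emb_space V I J)"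
    and s: "inj_on s I'" "s ` I' \<subseteq> I" and \<phi>: "J0 \<subseteq> J" "inj_on \<phi> J0" "\<phi> ` J0 \<subseteq> J'"
    and tgt: "\<And>p. p \<in> I' \<Longrightarrow> comp_target (component V e (s p)) \<in> J0"
  shows "fr_emb_transfer V I' s \<phi> e \<in> topspace (fr_emb_space V I' J')"
proof -
  obtain f l \<alpha> where d: "e = (f, l, \<alpha>)" by (metis prod.collapse)
  have emb: "embedding_map (mfd V I) (mfd V J) f" using e by (simp add: d mem_fr_emb_space_iff[OF V])
  have fr: "framed V J' (component V (fr_emb_transfer V I' s \<phi> e) p)" if p: "p \<in> I'" for p
  proof -
    have "framed V J (component V e (s p))" by (rule fr_emb_framed[OF V e]) (use s p in auto)
    then show ?thesis
      unfolding component_transfer[OF p] by (rule framed_relabel[OF V]) (use tgt[OF p] \<phi> in auto)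
  qed
  have "embedding_map (mfd V I') (mfd V J) (f \<circ> (\<lambda>(p, x). (s p, x)))"
    by (rule embedding_map_compose[OF embedding_map_mfd[OF s] emb]) auto
  moreover have "(f \<circ> (\<lambda>(p, x). (s p, x))) ` topspace (mfd V I') \<subseteq> J0 \<times> V"
  proof
    fix z assume "z \<in> (f \<circ> (\<lambda>(p, x). (s p, x))) ` topspace (mfd V I')"
    then obtain p x where px: "p \<in> I'" "x \<in> V" and z: "z = f (s p, x)" by auto
    then have "s p \<in> I" using s by auto
    from fr_emb_target[OF V e[unfolded d] this px(2)] tgt[OF px(1)]
    show "z \<in> J0 \<times> V" unfolding comp_target_component[OF V] d z by (metis SigmaI fst_conv)
  qed
  ultimately have "embedding_map (mfd V I') (mfd V J0) (f \<circ> (\<lambda>(p, x). (s p, x)))"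
    using embedding_map_in_subtopology subtopology_mfd[OF \<phi>(1)] by metis
  then have "embedding_map (mfd V I') (mfd V J') ((\<lambda>(j, x). (\<phi> j, x)) \<circ> (f \<circ> (\<lambda>(p, x). (s p, x))))"
    by (rule embedding_map_compose) (rule embedding_map_mfd[OF \<phi>(2,3)], auto)
  then have "embedding_map (mfd V I') (mfd V J') (fst (fr_emb_transfer V I' s \<phi> e))"
    by (rule embedding_map_eq) (auto simp: d fr_emb_transfer_def case_prod_unfold)
  then show ?thesis
    using fr by (simp add: d fr_emb_transfer_def mem_fr_emb_space_iff[OF V])
qed

lemma component_comp:
  assumes V: "subspace V" and e: "e \<in> topspace (fr_emb_space V I J)" and i: "i \<in> I"
  shows "component V (fr_emb_comp V I e' e) i =
    comp_compose V (component V e' (comp_target (component V e i))) (component V e i)"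
proof -
  obtain f l \<alpha> g m \<beta> where d: "e = (f, l, \<alpha>)" "e' = (g, m, \<beta>)" by (metis prod.collapse)
  note tg = fr_emb_target[OF V e[unfolded d] i]
  have sm: "smooth_on_subspace V (\<lambda>x. snd (f (i, x)))"
    using e i unfolding d mem_fr_emb_space_iff[OF V] framed_component_iff[OF V] by blast
  have dd: "dir_deriv w (\<lambda>y. snd ((\<lambda>x\<in>V. f (i, x)) y)) x = dir_deriv w (\<lambda>y. snd (f (i, y))) x"
    if "x \<in> V" "w \<in> V" for x w
    by (rule dir_deriv_cong[OF V that]) simp
  have dV: "dir_deriv w (\<lambda>y. snd (f (i, y))) x \<in> V" if "x \<in> V" "w \<in> V" for x w
    by (rule dir_deriv_mem_subspace[OF V sm _ that]) (use tg in auto)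
  have 0: "0 \<in> V" using V by (rule subspace_0)
  have E1: "(\<lambda>x\<in>V. restrict (g \<circ> f) (I \<times> V) (i, x)) = (\<lambda>x\<in>V. (\<lambda>x\<in>V. g (fst (f (i, 0)), x)) (snd ((\<lambda>x\<in>V. f (i, x)) x)))"
  proof (rule restrict_ext)
    fix x assume x: "x \<in> V"
    show "restrict (g \<circ> f) (I \<times> V) (i, x) = (\<lambda>x\<in>V. g (fst (f (i, 0)), x)) (snd ((\<lambda>x\<in>V. f (i, x)) x))"
      using tg[OF x] x i by (metis (no_types, lifting) SigmaI comp_apply restrict_apply')
  qed
  have E2: "(\<lambda>(x, w)\<in>V \<times> V. (\<lambda>((i, x), w)\<in>(I \<times> V) \<times> V.
        if t \<le> l i then \<alpha> t ((i, x), w) else \<beta> (t - l i) (differential f ((i, x), w))) ((i, x), w)) =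
     (\<lambda>(x, w)\<in>V \<times> V. if t \<le> l i then (\<lambda>t\<in>{0..}. \<lambda>(x, w)\<in>V \<times> V. \<alpha> t ((i, x), w)) t (x, w)
        else (\<lambda>t\<in>{0..}. \<lambda>(x, w)\<in>V \<times> V. \<beta> t ((fst (f (i, 0)), x), w)) (t - l i)
          (snd ((\<lambda>x\<in>V. f (i, x)) x), dir_deriv w (\<lambda>y. snd ((\<lambda>x\<in>V. f (i, x)) y)) x))" if t: "t \<in> {0..}" for t
  proof (rule restrict_ext)
    fix z assume z: "z \<in> V \<times> V"
    then obtain x w where z': "z = (x, w)" "x \<in> V" "w \<in> V" by auto
    show "(case z of (x, w) \<Rightarrow> (\<lambda>((i, x), w)\<in>(I \<times> V) \<times> V.
        if t \<le> l i then \<alpha> t ((i, x), w) else \<beta> (t - l i) (differential f ((i, x), w))) ((i, x), w)) =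
      (case z of (x, w) \<Rightarrow> if t \<le> l i then (\<lambda>t\<in>{0..}. \<lambda>(x, w)\<in>V \<times> V. \<alpha> t ((i, x), w)) t (x, w)
        else (\<lambda>t\<in>{0..}. \<lambda>(x, w)\<in>V \<times> V. \<beta> t ((fst (f (i, 0)), x), w)) (t - l i)
          (snd ((\<lambda>x\<in>V. f (i, x)) x), dir_deriv w (\<lambda>y. snd ((\<lambda>x\<in>V. f (i, x)) y)) x))"
    proof (cases "t \<le> l i")
      case True
      then show ?thesis using t z' i by simp
    next
      case False
      have "differential f ((i, x), w) = ((fst (f (i, 0)), snd (f (i, x))), dir_deriv w (\<lambda>y. snd (f (i, y))) x)"
        using tg(1)[OF z'(2)] by (simp add: differential_def)
      then show ?thesis
        using False z' i dd[OF z'(2,3)] dV[OF z'(2,3)] tg(3)[OF z'(2)] by simp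
    qed
  qed
  have X: "fst ((\<lambda>x\<in>V. f (i, x)) 0) = fst (f (i, 0))" using 0 by simp
  show ?thesis
    unfolding d component_def fr_emb_comp_def comp_compose_def comp_target_def prod.case X prod.inject
    apply (intro conjI)
    subgoal by (rule E1)
    subgoal using i by simp
    subgoal
      apply (rule restrict_ext)
      subgoal premises t for t using E2[OF t] unfolding restrict_apply'[OF t] .
      done
    done
qed

lemma fr_emb_comp_mem:
  assumes V: "subspace V" and e: "e \<in> topspace (fr_emb_space V I J)" and e': "e' \<in> topspace (fr_emb_space V J K)"
  shows "fr_emb_comp V I e' e \<in> topspace (fr_emb_space V I K)"
proof -
  obtain f l \<alpha> g m \<beta> where d: "e = (f, l, \<alpha>)" "e' = (g, m, \<beta>)" by (metis prod.collapse)
  have "framed V K (component V (fr_emb_comp V I e' e) i)" if i: "i \<in> I" for i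
  proof -
    have "comp_target (component V e i) \<in> J"
      using fr_emb_target(2)[OF V e[unfolded d] i subspace_0[OF V]] by (simp add: comp_target_component[OF V] d)
    then show ?thesis
      unfolding component_comp[OF V e i]
      by (rule framed_compose[OF V fr_emb_framed[OF V e'] fr_emb_framed[OF V e i]])
  qed
  moreover have "embedding_map (mfd V I) (mfd V K) (restrict (g \<circ> f) (I \<times> V))"
    by (rule embedding_map_eq[OF embedding_map_compose[of _ "mfd V J"]])
       (use e e' in \<open>auto simp: d mem_fr_emb_space_iff[OF V]\<close>)
  ultimately show ?thesis
    by (auto simp: d fr_emb_comp_def mem_fr_emb_space_iff[OF V])
qed

text \<open>The position of the \<open>r\<close>-th copy of block \<open>i\<close>.\<close>

definition block_index :: "(nat \<Rightarrow> nat) \<Rightarrow> nat \<Rightarrow> nat \<Rightarrow> nat" where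
  "block_index j i r = (\<Sum>i'<i. j i') + r"

lemma block_index:
  assumes "r < j i"
  shows "block j (block_index j i r) = i" "in_block j (block_index j i r) = r"
proof -
  show b: "block j (block_index j i r) = i"
    unfolding block_def
  proof (rule Least_equality)
    show "block_index j i r < (\<Sum>i'\<le>i. j i')"
      using assms by (simp add: block_index_def lessThan_Suc_atMost[symmetric])
    fix y assume y: "block_index j i r < (\<Sum>i'\<le>y. j i')"
    show "i \<le> y"
    proof (rule ccontr)
      assume "\<not> i \<le> y"
      then have "(\<Sum>i'\<le>y. j i') \<le> (\<Sum>i'<i. j i')" by (intro sum_mono2) auto
      then show False using y by (simp add: block_index_def)
    qed
  qed
  show "in_block j (block_index j i r) = r" by (simp add: in_block_def b) (simp add: block_index_def)
qed

lemma block_index_less: "i < k \<Longrightarrow> r < j i \<Longrightarrow> block_index j i r < (\<Sum>i<k. j i)"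
proof -
  assume "i < k" "r < j i"
  then have "block_index j i r < (\<Sum>i'<Suc i. j i')" by (simp add: block_index_def)
  also have "\<dots> \<le> (\<Sum>i<k. j i)" using \<open>i < k\<close> by (intro sum_mono2) auto
  finally show ?thesis .
qed

lemma block_less:
  assumes "p < (\<Sum>i<k. j i)"
  shows "block j p < k" "in_block j p < j (block j p)" "block_index j (block j p) (in_block j p) = p"
proof -
  have k: "k > 0" using assms by (cases k) auto
  then have "p < (\<Sum>i'\<le>k - 1. j i')" using assms by (simp add: lessThan_Suc_atMost[symmetric])
  then have le: "block j p \<le> k - 1" and lt: "p < (\<Sum>i'\<le>block j p. j i')"
    unfolding block_def by (rule Least_le, rule LeastI)
  show "block j p < k" using le k by simp
  have ge: "(\<Sum>i'<block j p. j i') \<le> p"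
  proof (cases "block j p")
    case (Suc b)
    then have "\<not> p < (\<Sum>i'\<le>b. j i')" unfolding block_def by (metis lessI not_less_Least)
    then show ?thesis using Suc by (simp add: lessThan_Suc_atMost)
  qed simp
  show "in_block j p < j (block j p)"
    using lt ge by (simp add: in_block_def lessThan_Suc_atMost[symmetric])
  show "block_index j (block j p) (in_block j p) = p" using ge by (simp add: block_index_def in_block_def)
qed

lemma component_sum:
  assumes "p < (\<Sum>i<k. j i)"
  shows "component V (fr_emb_sum V k j e) p =
    comp_relabel V (\<lambda>_. block j p) (component V (e (block j p)) (in_block j p))"
  using assms
  by (cases "e (block j p)")
     (auto simp: fr_emb_sum_def Let_def component_def comp_relabel_def fun_eq_iff restrict_def)

lemma fr_emb_sum_mem:
  assumes V: "subspace V" and e: "\<And>i. i < k \<Longrightarrow> e i \<in> topspace (fr_emb_space V {..<j i} {()})"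
  shows "fr_emb_sum V k j e \<in> topspace (fr_emb_space V {..<\<Sum>i<k. j i} {..<k})"
proof -
  let ?N = "\<Sum>i<k. j i"
  have fr: "framed V {..<k} (component V (fr_emb_sum V k j e) p)" if p: "p < ?N" for p
    unfolding component_sum[OF p]
    by (rule framed_relabel[OF V fr_emb_framed[OF V e]]) (use block_less[OF p] in auto)
  define f where "f i = fst (e i)" for i
  have emb: "embedding_map (mfd V {..<j i}) (mfd V {()}) (f i)" if "i < k" for i
    using e[OF that] by (cases "e i") (simp add: f_def mem_fr_emb_space_iff[OF V])
  then have "\<forall>i<k. \<exists>g. homeomorphic_maps (mfd V {..<j i}) (subtopology (mfd V {()}) (f i ` topspace (mfd V {..<j i}))) (f i) g"
    unfolding embedding_map_def homeomorphic_map_maps by blast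
  then obtain g where g: "\<And>i. i < k \<Longrightarrow>
    homeomorphic_maps (mfd V {..<j i}) (subtopology (mfd V {()}) (f i ` topspace (mfd V {..<j i}))) (f i) (g i)"
    by metis
  have fi: "f i (r, x) = ((), snd (f i (r, x)))" "snd (f i (r, x)) \<in> V" if "i < k" "r < j i" "x \<in> V" for i r x
    using fr_emb_target[OF V, of "f i" "fst (snd (e i))" "snd (snd (e i))" "{..<j i}" "{()}" r x] e[OF that(1)] that
    by (simp_all add: f_def)
  let ?F = "\<lambda>(p, x). (block j p, snd (f (block j p) (in_block j p, x)))"
  let ?G = "\<lambda>(i, v). (block_index j i (fst (g i ((), v))), snd (g i ((), v)))"
  have "embedding_map (mfd V {..<?N}) (mfd V {..<k}) ?F"
  proof (rule embedding_map_left_inverse[where g = ?G])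
    show "continuous_map (mfd V {..<?N}) (mfd V {..<k}) ?F"
      unfolding mfd_def continuous_map_discrete_prod_iff
    proof
      fix p assume p: "p \<in> {..<?N}"
      let ?b = "block j p" and ?r = "in_block j p"
      have b: "?b < k" "?r < j ?b" using block_less p by auto
      have "continuous_map (mfd V {..<j ?b}) (mfd V {()}) (f ?b)"
        using emb[OF b(1)] by (meson continuous_map_in_subtopology embedding_map_def homeomorphic_imp_continuous_map)
      then have "continuous_map (top_of_set V) (top_of_set V) (\<lambda>x. snd (f ?b (?r, x)))"
        using b(2) unfolding mfd_def continuous_map_discrete_prod_iff continuous_map_pairwise o_def by blast
      then show "continuous_map (top_of_set V) (prod_topology (discrete_topology {..<k}) (top_of_set V)) (\<lambda>x. ?F (p, x))"
        using b by (simp add: continuous_map_pairwise o_def)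
    qed
    show "?G (?F z) = z" if z: "z \<in> topspace (mfd V {..<?N})" for z
    proof -
      obtain p x where px: "z = (p, x)" "p < ?N" "x \<in> V" using z by auto
      note b = block_less[OF px(2)]
      have "g (block j p) (f (block j p) (in_block j p, x)) = (in_block j p, x)"
        using g[OF b(1)] b(2) px(3) by (simp add: homeomorphic_maps_def)
      then have "g (block j p) ((), snd (f (block j p) (in_block j p, x))) = (in_block j p, x)"
        using fi(1)[OF b(1,2) px(3)] by simp
      then show ?thesis using b(3) by (simp add: px(1))
    qed
    show "continuous_map (subtopology (mfd V {..<k}) (?F ` topspace (mfd V {..<?N}))) (mfd V {..<?N}) ?G"
      unfolding mfd_def[of V "{..<k}"]
    proof (rule continuous_map_subtopology_discrete_prod)
      fix i assume "i \<in> {..<k}"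
      then have i: "i < k" by simp
      let ?S = "{v. (i, v) \<in> ?F ` topspace (mfd V {..<?N})}"
      let ?I = "f i ` topspace (mfd V {..<j i})"
      have sub: "((), v) \<in> ?I" if "v \<in> ?S" for v
      proof -
        from that obtain z where z: "z \<in> topspace (mfd V {..<?N})" "(i, v) = ?F z" by blast
        define p x where "p = fst z" and "x = snd z"
        have px: "p < ?N" "x \<in> V" "i = block j p" "v = snd (f i (in_block j p, x))"
          using z by (auto simp: p_def x_def)
        have r: "in_block j p < j i" using block_less(2)[OF px(1)] px(3) by simp
        have "((), v) = f i (in_block j p, x)" using fi(1)[OF i r px(2)] px(4) by simp
        moreover have "(in_block j p, x) \<in> topspace (mfd V {..<j i})" using r px(2) by simp
        ultimately show ?thesis by (rule image_eqI)
      qed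
      have "continuous_map (subtopology (top_of_set V) ?S) (subtopology (mfd V {()}) ?I) (\<lambda>v. ((), v))"
        unfolding continuous_map_in_subtopology mfd_def[of V "{()}"]
        using sub by (auto simp: continuous_map_pairwise o_def continuous_map_from_subtopology)
      moreover have "continuous_map (subtopology (mfd V {()}) ?I) (mfd V {..<j i}) (g i)"
        using g[OF i] by (simp add: homeomorphic_maps_def)
      ultimately have 1: "continuous_map (subtopology (top_of_set V) ?S) (mfd V {..<j i}) (g i \<circ> (\<lambda>v. ((), v)))"
        by (rule continuous_map_compose)
      have 2: "continuous_map (mfd V {..<j i}) (mfd V {..<?N}) (\<lambda>(r, x). (block_index j i r, x))"
        unfolding mfd_def continuous_map_discrete_prod_iff
        using block_index_less[OF i] by (auto simp: continuous_map_pairwise o_def)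
      show "continuous_map (subtopology (top_of_set V) ?S) (mfd V {..<?N}) (\<lambda>v. ?G (i, v))"
        using continuous_map_compose[OF 1 2] by (simp add: o_def case_prod_unfold)
    qed
  qed
  then have "embedding_map (mfd V {..<?N}) (mfd V {..<k}) (fst (fr_emb_sum V k j e))"
    by (rule embedding_map_eq) (auto simp: fr_emb_sum_def f_def)
  then show ?thesis
    using fr by (auto simp: fr_emb_sum_def Let_def mem_fr_emb_space_iff[OF V])
qed

lemma component_conj:
  "i \<in> I \<Longrightarrow> (\<And>x. x \<in> V \<Longrightarrow> \<rho> (inv\<^bsub>G\<^esub> g) x \<in> V) \<Longrightarrow>
    component V (fr_emb_conj G V \<rho> I actJ g e) i = comp_conj (\<rho> g) (\<rho> (inv\<^bsub>G\<^esub> g)) V (actJ g) (component V e i)"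
  by (cases e) (auto simp: component_def fr_emb_conj_def comp_conj_def fun_eq_iff restrict_def)

text \<open>The standard embedding of \<open>I \<times> V\<close> along a map \<open>s\<close> of the index sets, with constant paths.\<close>

definition fr_emb_std :: "'v::euclidean_space set \<Rightarrow> 'i set \<Rightarrow> ('i \<Rightarrow> 'j) \<Rightarrow> ('i, 'v, 'j) fr_emb" where
  "fr_emb_std V I s = (\<lambda>(i, x)\<in>I \<times> V. (s i, x), \<lambda>i\<in>I. 0, \<lambda>t\<in>{0..}. framing V I)"

lemma fr_emb_id_eq: "fr_emb_id V = fr_emb_std V {..<1} (\<lambda>_. ())"
  by (simp add: fr_emb_id_def fr_emb_std_def)

lemma component_std: "i \<in> I \<Longrightarrow> component V (fr_emb_std V I s) i = comp_std V (s i)"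
  by (auto simp: component_def fr_emb_std_def comp_std_def framing_def fun_eq_iff restrict_def)

lemma fr_emb_std_mem:
  assumes V: "subspace V" and s: "inj_on s I" "s ` I \<subseteq> J"
  shows "fr_emb_std V I s \<in> topspace (fr_emb_space V I J)"
proof -
  have "embedding_map (mfd V I) (mfd V J) (\<lambda>(i, x). (s i, x))"
    by (rule embedding_map_mfd[OF s]) auto
  then have "embedding_map (mfd V I) (mfd V J) (\<lambda>(i, x)\<in>I \<times> V. (s i, x))"
    by (rule embedding_map_eq) auto
  moreover have "framed V J (component V (fr_emb_std V I s) i)" if "i \<in> I" for i
    unfolding component_std[OF that] by (rule framed_comp_std[OF V]) (use s that in auto)
  ultimately show ?thesis
    unfolding fr_emb_std_def by (simp add: mem_fr_emb_space_iff[OF V] framing_def)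
qed

lemma fr_emb_conj_mem:
  assumes V: "subspace V" and e: "e \<in> topspace (fr_emb_space V I J)"
    and inv: "linear_inverses V (\<rho> g) (\<rho> (inv\<^bsub>G\<^esub> g))"
    and a: "inj_on (actJ g) J" "actJ g ` J \<subseteq> K"
  shows "fr_emb_conj G V \<rho> I actJ g e \<in> topspace (fr_emb_space V I K)"
proof -
  obtain S S' where S: "linear S" "\<And>x. x \<in> V \<Longrightarrow> \<rho> g x = S x" "linear S'" "\<And>x. x \<in> V \<Longrightarrow> \<rho> (inv\<^bsub>G\<^esub> g) x = S' x"
    using inv unfolding linear_inverses_def by blast
  have T: "S x \<in> V" "S' x \<in> V" "S (S' x) = x" "S' (S x) = x" if x: "x \<in> V" for x
    using linear_inversesD[OF inv x] S(2,4)[OF x] S(2)[OF linear_inversesD(2)[OF inv x]]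
      S(4)[OF linear_inversesD(1)[OF inv x]] by simp_all
  obtain f l \<alpha> where d: "e = (f, l, \<alpha>)" by (metis prod.collapse)
  have co: "continuous_on V S" "continuous_on V S'"
    using S by (auto simp: linear_continuous_on linear_conv_bounded_linear)
  have "framed V K (component V (fr_emb_conj G V \<rho> I actJ g e) i)" if i: "i \<in> I" for i
  proof -
    have "comp_target (component V e i) \<in> J"
      using fr_emb_target(2)[OF V e[unfolded d] i subspace_0[OF V]] by (simp add: comp_target_component[OF V] d)
    then have "framed V K (comp_conj (\<rho> g) (\<rho> (inv\<^bsub>G\<^esub> g)) V (actJ g) (component V e i))"
      by (intro framed_conj[OF V fr_emb_framed[OF V e i] _ inv]) (use a in auto)
    then show ?thesis using component_conj[OF i, of V \<rho> G g actJ e] S T by simp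
  qed
  moreover have "embedding_map (mfd V I) (mfd V K) (\<lambda>(i, x)\<in>I \<times> V. map_prod (actJ g) (\<rho> g) (f (i, \<rho> (inv\<^bsub>G\<^esub> g) x)))"
  proof -
    have "embedding_map (mfd V I) (mfd V I) (\<lambda>(i, x). (id i, S' x))"
      by (rule embedding_map_mfd[where T' = S]) (use co T in auto)
    moreover have "embedding_map (mfd V I) (mfd V J) f" using e by (simp add: d mem_fr_emb_space_iff[OF V])
    moreover have "embedding_map (mfd V J) (mfd V K) (\<lambda>(j, x). (actJ g j, S x))"
      by (rule embedding_map_mfd[where T' = S']) (use co T a in auto)
    ultimately have "embedding_map (mfd V I) (mfd V K) ((\<lambda>(j, x). (actJ g j, S x)) \<circ> (f \<circ> (\<lambda>(i, x). (id i, S' x))))"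
      by (intro embedding_map_compose)
    then show ?thesis
    proof (rule embedding_map_eq)
      fix z assume "z \<in> topspace (mfd V I)"
      then obtain i x where z: "z = (i, x)" "i \<in> I" "x \<in> V" by auto
      then have "f (i, S' x) = (fst (f (i, 0)), snd (f (i, S' x)))" "snd (f (i, S' x)) \<in> V"
        using fr_emb_target[OF V e[unfolded d] z(2) T(2)] by auto
      then have "(actJ g (fst (f (i, S' x))), S (snd (f (i, S' x)))) = map_prod (actJ g) (\<rho> g) (f (i, S' x))"
        using S(2) by (simp add: map_prod_def case_prod_unfold)
      then show "((\<lambda>(j, x). (actJ g j, S x)) \<circ> (f \<circ> (\<lambda>(i, x). (id i, S' x)))) z =
        (\<lambda>(i, x)\<in>I \<times> V. map_prod (actJ g) (\<rho> g) (f (i, \<rho> (inv\<^bsub>G\<^esub> g) x))) z"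
        using z S(4) by (simp add: case_prod_unfold)
    qed
  qed
  ultimately show ?thesis
    using e by (auto simp: d fr_emb_conj_def mem_fr_emb_space_iff[OF V])
qed


section \<open>Continuity on spaces of framed embeddings\<close>

lemma Hausdorff_space_emb_space: "Hausdorff_space (emb_space V I J)"
proof -
  let ?F = "\<lambda>f. (f, \<lambda>vs\<in>lists V. \<lambda>(i, x)\<in>I \<times> V. fold dir_deriv vs (\<lambda>y. snd (f (i, y))) x)"
  let ?T = "prod_topology (map_space (mfd V I) (mfd V J))
        (product_topology (\<lambda>_. map_space (mfd V I) (top_of_set V)) (lists V))"
  have H: "Hausdorff_space ?T"
    by (simp add: Hausdorff_space_prod_topology Hausdorff_space_product_topology Hausdorff_space_map_space
        Hausdorff_space_mfd Hausdorff_space_subtopology)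
  have "continuous_map (pullback_topology {f \<in> extensional (I \<times> V). smooth_embedding V I J f} ?F ?T) ?T (id \<circ> ?F)"
    by (rule continuous_map_pullback[OF continuous_map_id])
  then have "Hausdorff_space (pullback_topology {f \<in> extensional (I \<times> V). smooth_embedding V I J f} ?F ?T)"
    by (rule Hausdorff_space_injective_preimage[OF H]) (auto intro!: inj_onI)
  then show ?thesis unfolding emb_space_def by (rule Hausdorff_space_kify)
qed

lemma Hausdorff_space_fr_emb_space: "Hausdorff_space (fr_emb_space V I J)"
  unfolding fr_emb_space_def
  by (intro Hausdorff_space_kify Hausdorff_space_subtopology)
     (simp add: Hausdorff_space_prod_topology Hausdorff_space_product_topology Hausdorff_space_map_space
        Hausdorff_space_emb_space Hausdorff_space_hom_space Hausdorff_space_subtopology)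

lemma continuous_map_fr_emb_space_parts:
  "continuous_map (fr_emb_space V I J) (emb_space V I J) fst"
  "continuous_map (fr_emb_space V I J) (product_topology (\<lambda>_. top_of_set {0..}) I) (\<lambda>e. fst (snd e))"
  "continuous_map (fr_emb_space V I J) (map_space (top_of_set {0..}) (hom_space V I)) (\<lambda>e. snd (snd e))"
  unfolding fr_emb_space_def
  by (intro continuous_map_from_kify continuous_map_from_subtopology continuous_map_fst
      continuous_map_compose[OF continuous_map_snd continuous_map_fst, unfolded o_def]
      continuous_map_compose[OF continuous_map_snd continuous_map_snd, unfolded o_def])+

lemma continuous_map_emb_space_parts:
  "continuous_map (emb_space V I J) (map_space (mfd V I) (mfd V J)) (\<lambda>f. f)"
  "vs \<in> lists V \<Longrightarrow> continuous_map (emb_space V I J) (map_space (mfd V I) (top_of_set V))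
     (\<lambda>f. \<lambda>(i, x)\<in>I \<times> V. fold dir_deriv vs (\<lambda>y. snd (f (i, y))) x)"
proof -
  let ?A = "{f \<in> extensional (I \<times> V). smooth_embedding V I J f}"
  let ?F = "\<lambda>f. (f, \<lambda>vs\<in>lists V. \<lambda>(i, x)\<in>I \<times> V. fold dir_deriv vs (\<lambda>y. snd (f (i, y))) x)"
  let ?T = "prod_topology (map_space (mfd V I) (mfd V J))
        (product_topology (\<lambda>_. map_space (mfd V I) (top_of_set V)) (lists V))"
  have "continuous_map (pullback_topology ?A ?F ?T) (map_space (mfd V I) (mfd V J)) (fst \<circ> ?F)"
    by (rule continuous_map_pullback) (rule continuous_map_fst)
  then show "continuous_map (emb_space V I J) (map_space (mfd V I) (mfd V J)) (\<lambda>f. f)"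
    unfolding emb_space_def by (intro continuous_map_from_kify) (simp add: o_def)
  assume vs: "vs \<in> lists V"
  have "continuous_map ?T (map_space (mfd V I) (top_of_set V)) ((\<lambda>d. d vs) \<circ> snd)"
    by (rule continuous_map_compose[OF continuous_map_snd continuous_map_product_projection[OF vs]])
  from continuous_map_pullback[OF this, of ?A ?F]
  have "continuous_map (pullback_topology ?A ?F ?T) (map_space (mfd V I) (top_of_set V)) (((\<lambda>d. d vs) \<circ> snd) \<circ> ?F)" .
  then show "continuous_map (emb_space V I J) (map_space (mfd V I) (top_of_set V))
     (\<lambda>f. \<lambda>(i, x)\<in>I \<times> V. fold dir_deriv vs (\<lambda>y. snd (f (i, y))) x)"
    unfolding emb_space_def using vs by (intro continuous_map_from_kify) (simp add: o_def)
qed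

lemma continuous_map_fr_emb_eval:
  "i \<in> I \<Longrightarrow> x \<in> V \<Longrightarrow> continuous_map (fr_emb_space V I J) (mfd V J) (\<lambda>e. fst e (i, x))"
  "i \<in> I \<Longrightarrow> continuous_map (fr_emb_space V I J) (top_of_set {0..}) (\<lambda>e. fst (snd e) i)"
  "i \<in> I \<Longrightarrow> x \<in> V \<Longrightarrow> w \<in> V \<Longrightarrow> t \<ge> 0 \<Longrightarrow>
    continuous_map (fr_emb_space V I J) (top_of_set V) (\<lambda>e. snd (snd e) t ((i, x), w))"
proof -
  show "continuous_map (fr_emb_space V I J) (mfd V J) (\<lambda>e. fst e (i, x))" if "i \<in> I" "x \<in> V"
    using continuous_map_compose[OF continuous_map_compose[OF continuous_map_fr_emb_space_parts(1)[of V I J]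
        continuous_map_emb_space_parts(1)] continuous_map_map_space_eval[of "(i, x)"]] that
    by (simp add: o_def)
  show "continuous_map (fr_emb_space V I J) (top_of_set {0..}) (\<lambda>e. fst (snd e) i)" if "i \<in> I"
    using continuous_map_compose[OF continuous_map_fr_emb_space_parts(2)[of V I J] continuous_map_product_projection[OF that]]
    by (simp add: o_def)
  assume a: "i \<in> I" "x \<in> V" "w \<in> V" "t \<ge> 0"
  have "continuous_map (fr_emb_space V I J) (hom_space V I) (\<lambda>e. snd (snd e) t)"
    using continuous_map_compose[OF continuous_map_fr_emb_space_parts(3)[of V I J] continuous_map_map_space_eval[of t]] a
    by (simp add: o_def)
  moreover have "continuous_map (hom_space V I) (top_of_set V) (\<lambda>T. T ((i, x), w))"
    unfolding hom_space_def
    by (intro continuous_map_from_subtopology continuous_map_map_space_eval) (use a in simp)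
  ultimately show "continuous_map (fr_emb_space V I J) (top_of_set V) (\<lambda>e. snd (snd e) t ((i, x), w))"
    using continuous_map_compose[of "fr_emb_space V I J" "hom_space V I" "\<lambda>e. snd (snd e) t" "top_of_set V"
      "\<lambda>T. T ((i, x), w)"] by (simp add: o_def)
qed

lemma continuous_map_hom_space_reindex:
  assumes "s ` I' \<subseteq> I"
  shows "continuous_map (hom_space V I) (hom_space V I')
    (\<lambda>T. \<lambda>((p, x), w)\<in>(I' \<times> V) \<times> V. T ((s p, x), w))"
proof -
  have "continuous_map (tangent V I') (tangent V I) (\<lambda>((p, x), w). ((s p, x), w))"
  proof -
    have "continuous_map (mfd V I') (mfd V I) (\<lambda>(p, x). (s p, x))"
      unfolding mfd_def continuous_map_discrete_prod_iff using assms by (auto simp: continuous_map_pairwise o_def)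
    then have "continuous_map (tangent V I') (tangent V I) (\<lambda>(m, w). ((\<lambda>(p, x). (s p, x)) m, w))"
      unfolding tangent_def by (simp add: continuous_map_prod_top)
    then show ?thesis by (rule continuous_map_eq) auto
  qed
  from continuous_map_map_space_compose[OF this continuous_map_id, of "top_of_set V"]
  have "continuous_map (map_space (tangent V I) (top_of_set V)) (map_space (tangent V I') (top_of_set V))
     (\<lambda>T. \<lambda>z\<in>(I' \<times> V) \<times> V. T ((\<lambda>((p, x), w). ((s p, x), w)) z))"
    by (simp add: Hausdorff_space_subtopology)
  then have "continuous_map (hom_space V I) (map_space (tangent V I') (top_of_set V))
     (\<lambda>T. \<lambda>((p, x), w)\<in>(I' \<times> V) \<times> V. T ((s p, x), w))"
    unfolding hom_space_def
    by (intro continuous_map_from_subtopology) (simp add: case_prod_unfold)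
  moreover have "\<exists>L. linear L \<and> (\<forall>w\<in>V. (\<lambda>((p, x), w)\<in>(I' \<times> V) \<times> V. T ((s p, x), w)) (m, w) = L w) \<and> bij_betw L V V"
    if T: "T \<in> topspace (hom_space V I)" and m: "m \<in> I' \<times> V" for T m
  proof -
    obtain p x where px: "m = (p, x)" "p \<in> I'" "x \<in> V" using m by auto
    have "(s p, x) \<in> I \<times> V" using px assms by auto
    then obtain L where "linear L" "\<forall>w\<in>V. T ((s p, x), w) = L w" "bij_betw L V V"
      using T unfolding topspace_hom_space by blast
    then show ?thesis using px by (intro exI[of _ L]) simp
  qed
  ultimately show ?thesis
    unfolding hom_space_def[of V I'] continuous_map_in_subtopology by blast
qed

text \<open>
  The transfer is an embedding only for those framed embeddings with targets in a set on which \<open>\<phi>\<close> is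
  injective, so it is considered on an open and closed set \<open>P\<close> of framed embeddings.
\<close>

lemma continuous_map_fr_emb_transfer:
  assumes V: "subspace V" and s: "inj_on s I'" "s ` I' \<subseteq> I" and \<phi>: "J0 \<subseteq> J" "inj_on \<phi> J0" "\<phi> ` J \<subseteq> J'"
    and P: "openin (fr_emb_space V I J) P" "closedin (fr_emb_space V I J) P"
    and tgt: "\<And>e p. e \<in> P \<Longrightarrow> p \<in> I' \<Longrightarrow> comp_target (component V e (s p)) \<in> J0"
  shows "continuous_map (subtopology (fr_emb_space V I J) P) (fr_emb_space V I' J') (fr_emb_transfer V I' s \<phi>)"
proof -
  let ?S = "subtopology (fr_emb_space V I J) P"
  let ?t = "fr_emb_transfer V I' s \<phi>"
  define X0 where "X0 = subtopology
     (prod_topology (emb_space V I J)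
        (prod_topology (product_topology (\<lambda>_. top_of_set {0::real..}) I)
           (map_space (top_of_set {0..}) (hom_space V I))))
     {(f, l, \<alpha>). \<alpha> 0 = framing V I \<and>
        (\<forall>i\<in>I. \<forall>t\<ge>l i. \<forall>x\<in>V. \<forall>w\<in>V.
            \<alpha> t ((i, x), w) = framing V J (differential f ((i, x), w)))}"
  have E: "fr_emb_space V I J = kify X0" by (simp add: fr_emb_space_def X0_def)
  have lift: "continuous_map ?S (kify Z) h" if "continuous_map ?S Z h" "Hausdorff_space Z" for Z :: "'z topology" and h
    using continuous_map_into_kify_closed[of X0 P Z h] that P(2) Hausdorff_imp_k_Hausdorff unfolding E by blast
  have tS: "topspace ?S = P" using openin_subset[OF P(1)] by (simp add: inf_absorb2)
  have mem: "?t e \<in> topspace (fr_emb_space V I' J')" if "e \<in> P" for e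
    by (rule fr_emb_transfer_mem[OF V _ s \<phi>(1,2)]) (use \<phi> that tgt openin_subset[OF P(1)] in auto)
  let ?\<sigma> = "\<lambda>(p, x). (s p, x)"
  have c\<sigma>: "continuous_map (mfd V I') (mfd V I) ?\<sigma>"
    unfolding mfd_def continuous_map_discrete_prod_iff using s by (auto simp: continuous_map_pairwise o_def)
  have c\<phi>: "continuous_map (mfd V J) (mfd V J') (\<lambda>(j, x). (\<phi> j, x))"
    unfolding mfd_def continuous_map_discrete_prod_iff using \<phi> by (auto simp: continuous_map_pairwise o_def)
  have S: "continuous_map ?S Z h" if "continuous_map (fr_emb_space V I J) Z h" for Z :: "'z topology" and h
    using that by (rule continuous_map_from_subtopology)
  have te: "fst (?t e) = (\<lambda>z\<in>I' \<times> V. (\<lambda>(j, x). (\<phi> j, x)) (fst e (?\<sigma> z)))"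
    "fst (snd (?t e)) = (\<lambda>p\<in>I'. fst (snd e) (s p))"
    "snd (snd (?t e)) = (\<lambda>t\<in>{0..}. \<lambda>((p, x), w)\<in>(I' \<times> V) \<times> V. snd (snd e) t ((s p, x), w))" for e
    by (cases e; simp add: fr_emb_transfer_def case_prod_unfold)+
  let ?F = "\<lambda>f. (f, \<lambda>vs\<in>lists V. \<lambda>(i, x)\<in>I' \<times> V. fold dir_deriv vs (\<lambda>y. snd (f (i, y))) x)"
  have 1: "continuous_map ?S (map_space (mfd V I') (mfd V J')) (\<lambda>e. fst (?t e))"
    using continuous_map_compose[OF continuous_map_compose[OF continuous_map_fr_emb_space_parts(1)
        continuous_map_emb_space_parts(1)] continuous_map_map_space_compose[OF c\<sigma> c\<phi> Hausdorff_space_mfd]]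
    unfolding te by (intro S) (simp add: o_def)
  have 2: "continuous_map ?S (map_space (mfd V I') (top_of_set V))
      (\<lambda>e. \<lambda>(i, x)\<in>I' \<times> V. fold dir_deriv vs (\<lambda>y. snd (fst (?t e) (i, y))) x)" if vs: "vs \<in> lists V" for vs
  proof -
    have "continuous_map ?S (map_space (mfd V I') (top_of_set V))
      (\<lambda>e. \<lambda>z\<in>I' \<times> V. (\<lambda>(i, x)\<in>I \<times> V. fold dir_deriv vs (\<lambda>y. snd (fst e (i, y))) x) (?\<sigma> z))"
      using continuous_map_compose[OF continuous_map_compose[OF continuous_map_fr_emb_space_parts(1)
        continuous_map_emb_space_parts(2)[OF vs]] continuous_map_map_space_compose[OF c\<sigma> continuous_map_id]]
      by (intro S) (simp add: o_def Hausdorff_space_subtopology)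
    moreover have "(\<lambda>z\<in>I' \<times> V. (\<lambda>(i, x)\<in>I \<times> V. fold dir_deriv vs (\<lambda>y. snd (fst e (i, y))) x) (?\<sigma> z)) =
      (\<lambda>(i, x)\<in>I' \<times> V. fold dir_deriv vs (\<lambda>y. snd (fst (?t e) (i, y))) x)" for e
    proof (rule restrict_ext)
      fix z assume "z \<in> I' \<times> V"
      then obtain p x where z: "z = (p, x)" "p \<in> I'" "x \<in> V" by auto
      have "fold dir_deriv vs (\<lambda>y. snd (fst (?t e) (p, y))) x = fold dir_deriv vs (\<lambda>y. snd (fst e (s p, y))) x"
        by (rule fold_dir_deriv_cong[OF V vs _ z(3)]) (use z in \<open>simp add: te case_prod_unfold\<close>)
      then show "(\<lambda>(i, x)\<in>I \<times> V. fold dir_deriv vs (\<lambda>y. snd (fst e (i, y))) x) (?\<sigma> z) =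
        (case z of (i, x) \<Rightarrow> fold dir_deriv vs (\<lambda>y. snd (fst (?t e) (i, y))) x)"
        using z s by auto
    qed
    ultimately show ?thesis by simp
  qed
  have "continuous_map ?S (emb_space V I' J') (\<lambda>e. fst (?t e))"
    unfolding emb_space_def
  proof (rule lift)
    let ?T = "prod_topology (map_space (mfd V I') (mfd V J'))
        (product_topology (\<lambda>_. map_space (mfd V I') (top_of_set V)) (lists V))"
    let ?A = "{f \<in> extensional (I' \<times> V). smooth_embedding V I' J' f}"
    have "continuous_map ?S ?T (?F \<circ> (\<lambda>e. fst (?t e)))"
      using 1 2 by (auto simp: continuous_map_pairwise o_def continuous_map_componentwise)
    moreover have "topspace ?S \<subseteq> (\<lambda>e. fst (?t e)) -` ?A"
    proof
      fix e assume "e \<in> topspace ?S"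
      then have "?t e \<in> topspace (fr_emb_space V I' J')" using mem tS by blast
      then have "fst (?t e) \<in> topspace (emb_space V I' J')"
        using continuous_map_fr_emb_space_parts(1) by (auto simp: continuous_map_def)
      then show "e \<in> (\<lambda>e. fst (?t e)) -` ?A" by (simp add: topspace_emb_space[OF V])
    qed
    ultimately show "continuous_map ?S (pullback_topology ?A ?F ?T) (\<lambda>e. fst (?t e))"
      by (rule continuous_map_pullback')
    have "Hausdorff_space ?T"
      by (simp add: Hausdorff_space_prod_topology Hausdorff_space_product_topology Hausdorff_space_map_space
        Hausdorff_space_mfd Hausdorff_space_subtopology)
    moreover have "continuous_map (pullback_topology ?A ?F ?T) ?T (id \<circ> ?F)"
      by (rule continuous_map_pullback[OF continuous_map_id])
    ultimately show "Hausdorff_space (pullback_topology ?A ?F ?T)"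
      by (rule Hausdorff_space_injective_preimage) (auto intro!: inj_onI)
  qed
  moreover have "continuous_map ?S (product_topology (\<lambda>_. top_of_set {0..}) I') (\<lambda>e. fst (snd (?t e)))"
    unfolding te continuous_map_componentwise
    using continuous_map_fr_emb_eval(2)[of _ I V J] s by (auto intro!: S)
  moreover have "continuous_map ?S (map_space (top_of_set {0..}) (hom_space V I')) (\<lambda>e. snd (snd (?t e)))"
    using continuous_map_compose[OF continuous_map_fr_emb_space_parts(3)
        continuous_map_map_space_compose[OF continuous_map_id continuous_map_hom_space_reindex[OF s(2)] Hausdorff_space_hom_space]]
    unfolding te by (intro S) (simp add: o_def)
  ultimately have c: "continuous_map ?S (prod_topology (emb_space V I' J')
        (prod_topology (product_topology (\<lambda>_. top_of_set {0..}) I')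
           (map_space (top_of_set {0..}) (hom_space V I')))) ?t"
    by (simp add: continuous_map_pairwise o_def)
  show ?thesis
    unfolding fr_emb_space_def[of V I' J']
  proof (rule lift)
    show "continuous_map ?S (subtopology
     (prod_topology (emb_space V I' J')
        (prod_topology (product_topology (\<lambda>_. top_of_set {0..}) I')
           (map_space (top_of_set {0..}) (hom_space V I'))))
     {(f, l, \<alpha>). \<alpha> 0 = framing V I' \<and>
        (\<forall>i\<in>I'. \<forall>t\<ge>l i. \<forall>x\<in>V. \<forall>w\<in>V.
            \<alpha> t ((i, x), w) = framing V J' (differential f ((i, x), w)))}) ?t"
      unfolding continuous_map_in_subtopology tS
    proof (rule conjI[OF c], rule funcsetI)
      fix e assume "e \<in> P"
      from mem[OF this, unfolded fr_emb_space_def[of V I' J'] topspace_kify topspace_subtopology]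
      show "?t e \<in> {(f, l, \<alpha>). \<alpha> 0 = framing V I' \<and>
        (\<forall>i\<in>I'. \<forall>t\<ge>l i. \<forall>x\<in>V. \<forall>w\<in>V.
            \<alpha> t ((i, x), w) = framing V J' (differential f ((i, x), w)))}" by (rule IntD2)
    qed
  qed (simp add: Hausdorff_space_prod_topology Hausdorff_space_product_topology Hausdorff_space_map_space
        Hausdorff_space_emb_space Hausdorff_space_hom_space Hausdorff_space_subtopology)
qed


section \<open>Labelled configurations\<close>

abbreviation "Emb V k J \<equiv> fr_emb_space V {..<k::nat} J"

lemma equiv_hull_refl: "(x, x) \<in> equiv_hull R"
  by (simp add: equiv_hull_def)

lemma equiv_hull_sym: "(x, y) \<in> equiv_hull R \<Longrightarrow> (y, x) \<in> equiv_hull R"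
proof -
  have "sym ((R \<union> R\<inverse>)\<^sup>*)" by (rule sym_rtrancl) (auto simp: sym_def)
  then show "(x, y) \<in> equiv_hull R \<Longrightarrow> (y, x) \<in> equiv_hull R" by (auto simp: equiv_hull_def sym_def)
qed

lemma equiv_hull_trans: "(x, y) \<in> equiv_hull R \<Longrightarrow> (y, z) \<in> equiv_hull R \<Longrightarrow> (x, z) \<in> equiv_hull R"
  unfolding equiv_hull_def by (rule rtrancl_trans)

lemma equiv_hull_base: "(x, y) \<in> R \<Longrightarrow> (x, y) \<in> equiv_hull R"
  by (auto simp: equiv_hull_def)

lemma equiv_hull_invariant:
  assumes "(x, y) \<in> equiv_hull R" and "\<And>x y. (x, y) \<in> R \<Longrightarrow> F x = F y"
  shows "F x = F y"
  using assms(1) unfolding equiv_hull_def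
  by (induction rule: rtrancl_induct) (auto dest: assms(2))

lemma class_rep_equiv: "(x, class_rep R x) \<in> equiv_hull R"
proof -
  have "x \<in> equiv_hull R `` {x}" using equiv_hull_refl by auto
  then have "class_rep R x \<in> equiv_hull R `` {x}" unfolding class_rep_def by (rule someI)
  then show ?thesis by simp
qed

lemma class_rep_eq: "(x, y) \<in> equiv_hull R \<Longrightarrow> class_rep R x = class_rep R y"
proof -
  assume "(x, y) \<in> equiv_hull R"
  then have "equiv_hull R `` {x} = equiv_hull R `` {y}"
    by (auto intro: equiv_hull_trans equiv_hull_sym)
  then show ?thesis by (simp add: class_rep_def)
qed

lemma class_rep_invariant: "(\<And>x y. (x, y) \<in> R \<Longrightarrow> F x = F y) \<Longrightarrow> F (class_rep R x) = F x"
  using equiv_hull_invariant[OF class_rep_equiv] by metis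

lemma class_rep_idem: "class_rep R (class_rep R x) = class_rep R x"
  by (rule class_rep_eq[symmetric]) (rule class_rep_equiv)

text \<open>
  The configuration underlying a point: its components with their labels, for the labels other than
  the base point.  It is a complete invariant of the equivalence class, by \<open>D_rel_invariant\<close> and
  \<open>D_rel_complete\<close>.
\<close>

definition config :: "'v::euclidean_space set \<Rightarrow> 'x \<Rightarrow> ('v, 'j, 'x) D_point \<Rightarrow> (('v, 'j) fr_comp \<times> 'x) set" where
  "config V b = (\<lambda>(k, e, x). {(component V e i, x i) | i. i < k \<and> x i \<noteq> b})"

lemma D_relI:
  "(k, e, x) \<in> topspace (D_pre V J X) \<Longrightarrow> inj_on s {..<l} \<Longrightarrow> s ` {..<l} \<subseteq> {..<k} \<Longrightarrow>
    \<forall>i \<in> {..<k} - s ` {..<l}. x i = b \<Longrightarrow>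
    ((k, e, x), (l, fr_emb_reindex V l s e, restrict (x \<circ> s) {..<l})) \<in> D_rel V J b X"
  unfolding D_rel_def by blast

lemma topspace_D_pre: "(k, e, x) \<in> topspace (D_pre V J X) \<longleftrightarrow>
    e \<in> topspace (Emb V k J) \<and> x \<in> {..<k} \<rightarrow>\<^sub>E topspace X"
  by (simp add: D_pre_def kprod_def kpower_def)

lemma comp_relabel_id: "framed V J c \<Longrightarrow> comp_relabel V id c = c"
  by (cases c) (auto simp: comp_relabel_def framed_def extensional_restrict)

lemma topspace_D_space: "topspace (D_space V J b X) = D_class V J b X ` topspace (D_pre V J X)"
  by (simp add: D_space_def quotient_space_def)

lemma continuous_map_from_D_space:
  assumes "\<And>k. continuous_map (kprod (Emb V k J) (kpower X k)) Z (\<lambda>(e, x). h (D_class V J b X (k, e, x)))"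
  shows "continuous_map (D_space V J b X) Z h"
  unfolding D_space_def quotient_space_def
proof (rule continuous_map_from_final_topology)
  show "continuous_map (D_pre V J X) Z (h \<circ> D_class V J b X)"
    unfolding continuous_map_def
  proof (intro conjI allI impI funcsetI)
    fix z assume "z \<in> topspace (D_pre V J X)"
    then obtain k e x where z: "z = (k, e, x)" "(e, x) \<in> topspace (kprod (Emb V k J) (kpower X k))"
      by (auto simp: D_pre_def)
    then show "(h \<circ> D_class V J b X) z \<in> topspace Z"
      using assms[of k] by (auto simp: continuous_map_def Pi_iff)
  next
    fix U assume U: "openin Z U"
    have "openin (kprod (Emb V k J) (kpower X k))
       {y. (k, y) \<in> {z \<in> topspace (D_pre V J X). (h \<circ> D_class V J b X) z \<in> U}}" for k
    proof -
      have "{y. (k, y) \<in> {z \<in> topspace (D_pre V J X). (h \<circ> D_class V J b X) z \<in> U}} =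
        {y \<in> topspace (kprod (Emb V k J) (kpower X k)). (\<lambda>(e, x). h (D_class V J b X (k, e, x))) y \<in> U}"
        by (auto simp: D_pre_def)
      then show ?thesis using openin_continuous_map_preimage[OF assms U] by simp
    qed
    moreover have "{z \<in> topspace (D_pre V J X). (h \<circ> D_class V J b X) z \<in> U} \<subseteq> topspace (D_pre V J X)" by blast
    ultimately show "openin (D_pre V J X) {z \<in> topspace (D_pre V J X). (h \<circ> D_class V J b X) z \<in> U}"
      unfolding D_pre_def openin_sum_topology by simp
  qed
qed

lemma continuous_map_D_class:
  "continuous_map (kprod (Emb V k J) (kpower X k)) (D_space V J b X) (\<lambda>(e, x). D_class V J b X (k, e, x))"
proof -
  have "continuous_map (kprod (Emb V k J) (kpower X k)) (D_pre V J X) (\<lambda>y. (k, y))"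
    unfolding D_pre_def by (rule continuous_map_component_injection) simp
  moreover have "continuous_map (D_pre V J X) (D_space V J b X) (D_class V J b X)"
    unfolding D_space_def quotient_space_def by (rule continuous_map_final_topology)
  ultimately show ?thesis
    using continuous_map_compose by (fastforce simp: o_def case_prod_unfold)
qed

lemma comp_compose_relabel:
  assumes "subspace V" and "framed V K c'"
  shows "comp_compose V c (comp_relabel V \<phi> c') = comp_compose V c c'"
proof -
  obtain f l \<alpha> g m \<beta> where d: "c' = (f, l, \<alpha>)" "c = (g, m, \<beta>)" by (metis prod.collapse)
  have "dir_deriv w (\<lambda>y. snd ((\<lambda>x\<in>V. (\<phi> (fst (f x)), snd (f x))) y)) x = dir_deriv w (\<lambda>y. snd (f y)) x"
    if "x \<in> V" "w \<in> V" for x w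
    by (rule dir_deriv_cong[OF assms(1) that]) simp
  then show ?thesis
    unfolding d comp_compose_def comp_relabel_def prod.case prod.inject
    by (intro conjI refl restrict_ext) (auto cong: restrict_cong)
qed

lemma comp_compose_std:
  assumes V: "subspace V" and c: "framed V J c"
  shows "comp_compose V (comp_std V (comp_target c)) c = c"
proof -
  obtain f l \<alpha> where d: "c = (f, l, \<alpha>)" by (metis prod.collapse)
  have c': "f \<in> extensional V" "\<And>x. x \<in> V \<Longrightarrow> fst (f x) = fst (f 0)" "\<And>x. x \<in> V \<Longrightarrow> snd (f x) \<in> V"
      "smooth_on_subspace V (\<lambda>x. snd (f x))" "0 \<le> l" "\<alpha> \<in> extensional {0..}" "\<And>t. 0 \<le> t \<Longrightarrow> \<alpha> t \<in> extensional (V \<times> V)"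
    and en: "\<And>t x w. l \<le> t \<Longrightarrow> x \<in> V \<Longrightarrow> w \<in> V \<Longrightarrow> \<alpha> t (x, w) = dir_deriv w (\<lambda>y. snd (f y)) x"
    using c by (auto simp: framed_def d)
  have dV: "dir_deriv w (\<lambda>y. snd (f y)) x \<in> V" if "x \<in> V" "w \<in> V" for x w
    by (rule dir_deriv_mem_subspace[OF V c'(4) _ that]) (use c'(3) in auto)
  have 1: "(\<lambda>x\<in>V. (\<lambda>x\<in>V. (fst (f 0), x)) (snd (f x))) = f"
  proof (rule extensionalityI[of _ V])
    fix x assume x: "x \<in> V"
    then have "(\<lambda>x\<in>V. (\<lambda>x\<in>V. (fst (f 0), x)) (snd (f x))) x = (fst (f 0), snd (f x))" using c'(3) by simp
    also have "\<dots> = f x" using c'(2)[OF x] by (simp add: prod_eq_iff)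
    finally show "(\<lambda>x\<in>V. (\<lambda>x\<in>V. (fst (f 0), x)) (snd (f x))) x = f x" .
  qed (use c' in auto)
  have 2: "(\<lambda>t\<in>{0..}. \<lambda>(x, w)\<in>V \<times> V. if t \<le> l then \<alpha> t (x, w)
     else (\<lambda>t\<in>{0..}. \<lambda>(x, w)\<in>V \<times> V. w) (t - l) (snd (f x), dir_deriv w (\<lambda>y. snd (f y)) x)) = \<alpha>"
  proof (rule extensionalityI[of _ "{0..}"])
    fix t assume t: "t \<in> {0::real..}"
    have "(\<lambda>(x, w)\<in>V \<times> V. if t \<le> l then \<alpha> t (x, w)
     else (\<lambda>t\<in>{0..}. \<lambda>(x, w)\<in>V \<times> V. w) (t - l) (snd (f x), dir_deriv w (\<lambda>y. snd (f y)) x)) = \<alpha> t"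
    proof (rule extensionalityI[of _ "V \<times> V"])
      fix z assume "z \<in> V \<times> V"
      then obtain x w where z: "z = (x, w)" "x \<in> V" "w \<in> V" by auto
      show "(\<lambda>(x, w)\<in>V \<times> V. if t \<le> l then \<alpha> t (x, w)
        else (\<lambda>t\<in>{0..}. \<lambda>(x, w)\<in>V \<times> V. w) (t - l) (snd (f x), dir_deriv w (\<lambda>y. snd (f y)) x)) z = \<alpha> t z"
        using z c'(3)[OF z(2)] dV[OF z(2,3)] en[of t x w] by simp
    qed (use c' t in auto)
    then show "(\<lambda>t\<in>{0..}. \<lambda>(x, w)\<in>V \<times> V. if t \<le> l then \<alpha> t (x, w)
     else (\<lambda>t\<in>{0..}. \<lambda>(x, w)\<in>V \<times> V. w) (t - l) (snd (f x), dir_deriv w (\<lambda>y. snd (f y)) x)) t = \<alpha> t"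
      using t by (simp only: restrict_apply')
  qed (use c' in auto)
  show ?thesis
    unfolding d comp_compose_def comp_std_def comp_target_def prod.case 1 2 by simp
qed

text \<open>An enumeration of a finite set.\<close>

definition enum :: "'i set \<Rightarrow> nat \<Rightarrow> 'i" where
  "enum K = (SOME s. bij_betw s {..<card K} K)"

lemma enum: "finite K \<Longrightarrow> bij_betw (enum K) {..<card K} K"
  unfolding enum_def using ex_bij_betw_nat_finite[of K] by (intro someI_ex[of "\<lambda>s. bij_betw s {..<card K} K"]) (auto simp: atLeast0LessThan)

lemma enum_image: "finite K \<Longrightarrow> enum K ` {..<card K} = K"
  using enum by (auto simp: bij_betw_def)

text \<open>The part of a configuration in \<open>J \<times> V\<close> that lies in the copy of \<open>V\<close> with index \<open>j\<close>.\<close>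

definition strip ::
    "'v::euclidean_space set \<Rightarrow> 'x \<Rightarrow> 'x topology \<Rightarrow> 'j \<Rightarrow> ('v, 'j, 'x) D_point \<Rightarrow> ('v, unit, 'x) D_point" where
  "strip V b X j = (\<lambda>(k, e, x).
     let K = {i. i < k \<and> comp_target (component V e i) = j} in
     D_class V {()} b X (card K, fr_emb_transfer V {..<card K} (enum K) (\<lambda>_. ()) e,
       \<lambda>p\<in>{..<card K}. x (enum K p)))"

text \<open>The standard configuration with one copy of \<open>V\<close> for each \<open>j\<close>, labelled by \<open>y j\<close>.\<close>

definition glue ::
    "'v::euclidean_space set \<Rightarrow> 'j set \<Rightarrow> 'x \<Rightarrow> 'x topology \<Rightarrow> ('j \<Rightarrow> 'x) \<Rightarrow> ('v, 'j, 'x) D_point" where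
  "glue V J b X y = D_class V J b X
     (card J, fr_emb_std V {..<card J} (enum J), \<lambda>i\<in>{..<card J}. y (enum J i))"

lemma comp_relabel_std: "comp_relabel V \<phi> (comp_std V j) = comp_std V (\<phi> j)"
  by (auto simp: comp_relabel_def comp_std_def fun_eq_iff restrict_def)

lemma comp_target_std: "subspace V \<Longrightarrow> comp_target (comp_std V j) = j"
  by (simp add: comp_target_def comp_std_def subspace_0)

lemma comp_target_compose:
  assumes "subspace V" "framed V J c" "framed V K c'"
  shows "comp_target (comp_compose V c c') = comp_target c"
proof -
  obtain f l \<alpha> g m \<beta> where d: "c' = (f, l, \<alpha>)" "c = (g, m, \<beta>)" by (metis prod.collapse)
  have 0: "0 \<in> V" using assms(1) by (rule subspace_0)
  then have "snd (f 0) \<in> V" using assms(3) unfolding d framed_def by blast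
  then have "fst (g (snd (f 0))) = fst (g 0)" using assms(2) unfolding d framed_def by blast
  then show ?thesis using 0 by (simp add: d comp_target_def comp_compose_def)
qed

lemma comp_relabel_compose:
  assumes "subspace V" "framed V K c'"
  shows "comp_relabel V \<phi> (comp_compose V c c') = comp_compose V (comp_relabel V \<phi> c) c'"
  using assms by (cases c, cases c') (auto simp: comp_relabel_def comp_compose_def framed_def intro!: restrict_ext)

context
  fixes V :: "'v::euclidean_space set"
  assumes V: "subspace V"
begin

lemma component_inj:
  assumes "e \<in> topspace (fr_emb_space V I J)"
  shows "inj_on (component V e) I"
proof (rule inj_onI)
  fix i j assume ij: "i \<in> I" "j \<in> I" "component V e i = component V e j"
  obtain f l \<alpha> where d: "e = (f, l, \<alpha>)" by (metis prod.collapse)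
  have "inj_on f (I \<times> V)"
    using assms by (auto simp: d mem_fr_emb_space_iff[OF V] embedding_map_def homeomorphic_map_def)
  moreover have "f (i, 0) = f (j, 0)"
    using ij(3) subspace_0[OF V] by (auto simp: d component_def dest: fun_cong[where x = 0])
  ultimately show "i = j" using ij subspace_0[OF V] by (auto dest: inj_onD)
qed

lemma component_reindex:
  assumes "e \<in> topspace (fr_emb_space V I J)" "p < l" "s p \<in> I"
  shows "component V (fr_emb_reindex V l s e) p = component V e (s p)"
  using assms by (simp add: fr_emb_reindex_eq component_transfer comp_relabel_id[OF fr_emb_framed[OF V]])

lemma fr_emb_reindex_mem:
  assumes "e \<in> topspace (Emb V k J)" "inj_on s {..<l}" "s ` {..<l} \<subseteq> {..<k}"
  shows "fr_emb_reindex V l s e \<in> topspace (Emb V l J)"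
  unfolding fr_emb_reindex_eq
proof (rule fr_emb_transfer_mem[OF V assms(1-3) order_refl])
  fix p assume "p \<in> {..<l}"
  then have "framed V J (component V e (s p))" using assms by (intro fr_emb_framed[OF V assms(1)]) auto
  then show "comp_target (component V e (s p)) \<in> J" by (auto simp: framed_def comp_target_def)
qed auto

lemma D_rel_invariant:
  assumes "(z, z') \<in> D_rel V J b X"
  shows "z \<in> topspace (D_pre V J X)" "z' \<in> topspace (D_pre V J X)" "config V b z = config V b z'"
proof -
  obtain k e x l s where z: "z = (k, e, x)" "z' = (l, fr_emb_reindex V l s e, restrict (x \<circ> s) {..<l})"
    and m: "(k, e, x) \<in> topspace (D_pre V J X)" and s: "inj_on s {..<l}" "s ` {..<l} \<subseteq> {..<k}"
    and b: "\<forall>i \<in> {..<k} - s ` {..<l}. x i = b"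
    using assms unfolding D_rel_def by blast
  have e: "e \<in> topspace (Emb V k J)" and x: "x \<in> {..<k} \<rightarrow>\<^sub>E topspace X"
    using m by (auto simp: topspace_D_pre)
  show "z \<in> topspace (D_pre V J X)" using m z by simp
  show "z' \<in> topspace (D_pre V J X)"
    unfolding z topspace_D_pre using fr_emb_reindex_mem[OF e s] x s by (auto simp: PiE_iff image_subset_iff)
  have "component V (fr_emb_reindex V l s e) p = component V e (s p)" if "p < l" for p
    by (rule component_reindex[OF e]) (use that s in auto)
  then have "config V b z' = {(component V e (s p), x (s p)) | p. p < l \<and> x (s p) \<noteq> b}"
    by (fastforce simp: z config_def)
  also have "\<dots> = config V b z" using s b by (fastforce simp: z config_def)
  finally show "config V b z = config V b z'" by simp
qed

lemma D_rel_complete: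
  assumes z: "z \<in> topspace (D_pre V J X)" and z': "z' \<in> topspace (D_pre V J X)"
    and c: "config V b z = config V b z'"
  shows "(z, z') \<in> equiv_hull (D_rel V J b X)"
proof -
  obtain k e x k' e' x' where d: "z = (k, e, x)" "z' = (k', e', x')" by (metis prod.collapse)
  have e: "e \<in> topspace (Emb V k J)" "e' \<in> topspace (fr_emb_space V {..<k'} J)"
    using z z' by (auto simp: topspace_D_pre d)
  \<comment> \<open>Forget the copies labelled by the base point; the remaining ones are matched by a bijection.\<close>
  define K where "K = {i. i < k \<and> x i \<noteq> b}"
  define l where "l = card K"
  define s where "s = enum K"
  have fK: "finite K" by (simp add: K_def)
  have s: "bij_betw s {..<l} K" unfolding s_def l_def by (rule enum[OF fK])
  have "\<exists>i'. i' < k' \<and> x' i' = x i \<and> component V e' i' = component V e i" if "i \<in> K" for i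
  proof -
    have "(component V e i, x i) \<in> config V b z" using that by (auto simp: config_def d K_def)
    then show ?thesis unfolding c by (auto simp: config_def d)
  qed
  then have "\<forall>i\<in>K. \<exists>i'. i' < k' \<and> x' i' = x i \<and> component V e' i' = component V e i" by blast
  from bchoice[OF this]
  obtain \<pi> where \<pi>: "\<And>i. i \<in> K \<Longrightarrow> \<pi> i < k' \<and> x' (\<pi> i) = x i \<and> component V e' (\<pi> i) = component V e i" by blast
  have inj\<pi>: "inj_on \<pi> K"
  proof (rule inj_onI)
    fix i j assume ij: "i \<in> K" "j \<in> K" "\<pi> i = \<pi> j"
    then have "component V e i = component V e j" using \<pi> by metis
    then show "i = j" using component_inj[OF e(1)] ij by (auto simp: K_def dest: inj_onD)
  qed
  define s' where "s' = \<pi> \<circ> s"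
  have sK: "s p \<in> K" if "p < l" for p using s that by (auto simp: bij_betw_def)
  have s': "inj_on s' {..<l}" "s' ` {..<l} \<subseteq> {..<k'}"
    using s inj\<pi> \<pi> sK by (auto simp: s'_def bij_betw_def intro!: comp_inj_on)
  have b: "x i = b" if "i \<in> {..<k} - s ` {..<l}" for i
    using that s by (auto simp: bij_betw_def K_def)
  have b': "x' i' = b" if i': "i' \<in> {..<k'} - s' ` {..<l}" for i'
  proof (rule ccontr)
    assume ne: "x' i' \<noteq> b"
    then have "(component V e' i', x' i') \<in> config V b z'" using i' by (auto simp: config_def d)
    then obtain i where i: "i < k" "x i \<noteq> b" "component V e i = component V e' i'"
      unfolding c[symmetric] by (auto simp: config_def d)
    then have iK: "i \<in> K" by (simp add: K_def)
    then have "component V e' (\<pi> i) = component V e' i'" using \<pi> i by simp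
    then have "\<pi> i = i'" using component_inj[OF e(2)] \<pi>[OF iK] i' by (auto dest: inj_onD)
    moreover obtain p where "p < l" "s p = i" using s iK by (auto simp: bij_betw_def)
    ultimately show False using i' by (auto simp: s'_def)
  qed
  have sk: "s ` {..<l} \<subseteq> {..<k}" "inj_on s {..<l}" using s by (auto simp: bij_betw_def K_def)
  have 1: "(z, (l, fr_emb_reindex V l s e, restrict (x \<circ> s) {..<l})) \<in> D_rel V J b X"
    unfolding d by (rule D_relI) (use z sk b in \<open>simp_all add: d\<close>)
  have 2: "(z', (l, fr_emb_reindex V l s' e', restrict (x' \<circ> s') {..<l})) \<in> D_rel V J b X"
    unfolding d by (rule D_relI) (use z' s' b' in \<open>simp_all add: d\<close>)
  have 3: "fr_emb_reindex V l s' e' = fr_emb_reindex V l s e"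
  proof (rule fr_emb_eqI[OF V fr_emb_reindex_mem[OF e(2) s'] fr_emb_reindex_mem[OF e(1) sk(2,1)]])
    fix p assume "p \<in> {..<l}"
    then show "component V (fr_emb_reindex V l s' e') p = component V (fr_emb_reindex V l s e) p"
      using component_reindex[OF e(2), of p l s'] component_reindex[OF e(1), of p l s] s' sk \<pi>[OF sK]
      by (auto simp: s'_def)
  qed
  have 4: "restrict (x' \<circ> s') {..<l} = restrict (x \<circ> s) {..<l}"
    by (rule restrict_ext) (use \<pi> sK in \<open>auto simp: s'_def\<close>)
  show ?thesis
    using equiv_hull_base[OF 1] equiv_hull_sym[OF equiv_hull_base[OF 2]] unfolding 3 4 by (rule equiv_hull_trans)
qed

lemma D_class_pre:
  assumes "z \<in> topspace (D_pre V J X)"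
  shows "D_class V J b X z \<in> topspace (D_pre V J X)"
proof -
  have "(x \<in> topspace (D_pre V J X)) = (y \<in> topspace (D_pre V J X))" if "(x, y) \<in> D_rel V J b X" for x y
    using D_rel_invariant(1,2)[OF that] by simp
  from class_rep_invariant[of "D_rel V J b X" "\<lambda>z. z \<in> topspace (D_pre V J X)", OF this] show ?thesis
    using assms by simp
qed

lemma config_D_class: "config V b (D_class V J b X z) = config V b z"
  by (rule class_rep_invariant) (rule D_rel_invariant(3))

lemma D_class_eqI:
  "z \<in> topspace (D_pre V J X) \<Longrightarrow> z' \<in> topspace (D_pre V J X) \<Longrightarrow> config V b z = config V b z' \<Longrightarrow>
    D_class V J b X z = D_class V J b X z'"
  by (intro class_rep_eq D_rel_complete)

lemma D_class_mem: "z \<in> topspace (D_pre V J X) \<Longrightarrow> D_class V J b X z \<in> topspace (D_space V J b X)"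
  by (simp add: topspace_D_space)

lemma D_space_pre: "z \<in> topspace (D_space V J b X) \<Longrightarrow> z \<in> topspace (D_pre V J X)"
  using D_class_pre by (auto simp: topspace_D_space)

lemma D_space_eqI:
  assumes "z \<in> topspace (D_space V J b X)" "z' \<in> topspace (D_space V J b X)" "config V b z = config V b z'"
  shows "z = z'"
proof -
  have "D_class V J b X z = z" "D_class V J b X z' = z'"
    using assms(1,2) by (auto simp: topspace_D_space class_rep_idem)
  then show ?thesis using D_class_eqI[OF D_space_pre[OF assms(1)] D_space_pre[OF assms(2)] assms(3)] by metis
qed

lemma config_framed: "z \<in> topspace (D_pre V J X) \<Longrightarrow> (c, x) \<in> config V b z \<Longrightarrow> framed V J c \<and> x \<in> topspace X \<and> x \<noteq> b"
proof -
  assume z: "z \<in> topspace (D_pre V J X)" and c: "(c, x) \<in> config V b z"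
  obtain k e y where d: "z = (k, e, y)" by (metis prod.collapse)
  obtain i where "i < k" "c = component V e i" "x = y i" "x \<noteq> b" using c by (auto simp: d config_def)
  then show ?thesis using z fr_emb_framed[OF V, of e "{..<k}" J i] by (auto simp: d topspace_D_pre PiE_iff)
qed

lemma D_map_mem:
  assumes "z \<in> topspace (D_pre V J X)" "h \<in> topspace X \<rightarrow> topspace Y"
  shows "D_map V J c Y h z \<in> topspace (D_space V J c Y)"
proof -
  obtain k e x where z: "z = (k, e, x)" by (metis prod.collapse)
  show ?thesis unfolding D_map_def z prod.case
    by (rule D_class_mem) (use assms in \<open>auto simp: z topspace_D_pre PiE_iff\<close>)
qed

lemma config_D_map:
  assumes "h b = c"
  shows "config V c (D_map V J c Y h z) = {(\<xi>, h x) | \<xi> x. (\<xi>, x) \<in> config V b z \<and> h x \<noteq> c}"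
proof -
  obtain k e x where z: "z = (k, e, x)" by (metis prod.collapse)
  show ?thesis unfolding D_map_def z prod.case config_D_class using assms by (fastforce simp: config_def)
qed

lemma
  fixes J :: "'j set"
  shows D_base_mem: "D_base V J b X \<in> topspace (D_space V J b X)"
  and config_D_base: "config V b (D_base V J b X) = {}"
proof -
  have eq: "(restrict undefined {}, restrict undefined {}, \<lambda>t\<in>{0..}. framing V {}) = fr_emb_std V {..<0::nat} s" for s :: "nat \<Rightarrow> 'j"
    by (auto simp: fr_emb_std_def restrict_def fun_eq_iff)
  have "fr_emb_std V {..<0::nat} s \<in> topspace (Emb V 0 J)" for s :: "nat \<Rightarrow> 'j"
    by (rule fr_emb_std_mem[OF V]) auto
  then have "(restrict undefined {}, restrict undefined {}, \<lambda>t\<in>{0..}. framing V {}) \<in> topspace (fr_emb_space V {..<0::nat} J)"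
    unfolding eq[of undefined] by this
  moreover have "restrict undefined {} \<in> {..<0::nat} \<rightarrow>\<^sub>E topspace X" by (simp add: restrict_def)
  ultimately show "D_base V J b X \<in> topspace (D_space V J b X)"
    unfolding D_base_def by (intro D_class_mem topspace_D_pre[THEN iffD2] conjI)
  show "config V b (D_base V J b X) = {}"
    unfolding D_base_def config_D_class by (simp add: config_def)
qed

lemma D_unit_mem:
  assumes "x \<in> topspace X"
  shows "D_unit V b X x \<in> topspace (D_space V {()} b X)"
  unfolding D_unit_def fr_emb_id_eq
  by (intro D_class_mem) (use assms in \<open>auto simp: topspace_D_pre inj_on_def intro!: fr_emb_std_mem[OF V]\<close>)

lemma config_D_unit: "config V b (D_unit V b X x) = (if x = b then {} else {(comp_std V (), x)})"
  unfolding D_unit_def fr_emb_id_eq config_D_class using component_std[of "0::nat" "{..<1}" V "\<lambda>_. ()"]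
  by (auto simp: config_def)

lemma strip_mem:
  assumes "z \<in> topspace (D_pre V J X)"
  shows "strip V b X j z \<in> topspace (D_space V {()} b X)"
proof -
  obtain k e x where z: "z = (k, e, x)" by (metis prod.collapse)
  define K where "K = {i. i < k \<and> comp_target (component V e i) = j}"
  have K: "finite K" "K \<subseteq> {..<k}" by (auto simp: K_def)
  have e: "e \<in> topspace (Emb V k J)" and x: "x \<in> {..<k} \<rightarrow>\<^sub>E topspace X"
    using assms by (auto simp: z topspace_D_pre)
  have s: "inj_on (enum K) {..<card K}" "enum K ` {..<card K} = K" using enum[OF K(1)] by (auto simp: bij_betw_def)
  have sK: "enum K p \<in> K" if "p < card K" for p using s(2) that by auto
  have "fr_emb_transfer V {..<card K} (enum K) (\<lambda>_. ()) e \<in> topspace (fr_emb_space V {..<card K} {()})"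
  proof (rule fr_emb_transfer_mem[OF V e s(1)])
    show "enum K ` {..<card K} \<subseteq> {..<k}" using s K by auto
    show "J \<inter> {j} \<subseteq> J" "inj_on (\<lambda>_. ()) (J \<inter> {j})" by (auto simp: inj_on_def)
    fix p assume p: "p \<in> {..<card K}"
    then have "framed V J (component V e (enum K p))" using sK K by (intro fr_emb_framed[OF V e]) auto
    then show "comp_target (component V e (enum K p)) \<in> J \<inter> {j}"
      using sK[of p] p by (auto simp: K_def framed_def comp_target_def)
  qed auto
  moreover have "(\<lambda>p\<in>{..<card K}. x (enum K p)) \<in> {..<card K} \<rightarrow>\<^sub>E topspace X"
    using x sK K by (auto simp: PiE_iff subset_iff)
  ultimately show ?thesis
    unfolding strip_def z prod.case Let_def K_def[symmetric] by (intro D_class_mem) (simp add: topspace_D_pre)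
qed

lemma config_strip:
  "config V b (strip V b X j z) =
    {(comp_relabel V (\<lambda>_. ()) \<xi>, x) | \<xi> x. (\<xi>, x) \<in> config V b z \<and> comp_target \<xi> = j}"
proof -
  obtain k e x where z: "z = (k, e, x)" by (metis prod.collapse)
  define K where "K = {i. i < k \<and> comp_target (component V e i) = j}"
  have "finite K" by (simp add: K_def)
  note s = enum_image[OF this]
  have "config V b (strip V b X j z) =
     {(comp_relabel V (\<lambda>_. ()) (component V e (enum K p)), x (enum K p)) | p. p < card K \<and> x (enum K p) \<noteq> b}"
    unfolding strip_def z prod.case Let_def K_def[symmetric] config_D_class
    by (fastforce simp: config_def component_transfer)
  also have "\<dots> = {(comp_relabel V (\<lambda>_. ()) (component V e i), x i) | i. i \<in> enum K ` {..<card K} \<and> x i \<noteq> b}"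
    by auto
  also have "\<dots> = {(comp_relabel V (\<lambda>_. ()) (component V e i), x i) | i. i \<in> K \<and> x i \<noteq> b}"
    by (simp only: s)
  also have "\<dots> = {(comp_relabel V (\<lambda>_. ()) \<xi>, x) | \<xi> x. (\<xi>, x) \<in> config V b z \<and> comp_target \<xi> = j}"
    unfolding config_def z prod.case K_def by blast
  finally show ?thesis .
qed

lemma glue_mem:
  assumes "finite J" "y \<in> J \<rightarrow> topspace X"
  shows "glue V J b X y \<in> topspace (D_space V J b X)"
proof -
  have "bij_betw (enum J) {..<card J} J" by (rule enum[OF assms(1)])
  then have "fr_emb_std V {..<card J} (enum J) \<in> topspace (fr_emb_space V {..<card J} J)"
    by (intro fr_emb_std_mem[OF V]) (auto simp: bij_betw_def)
  moreover have "(\<lambda>i\<in>{..<card J}. y (enum J i)) \<in> {..<card J} \<rightarrow>\<^sub>E topspace X"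
    using assms enum_image[OF assms(1)] by (auto simp: Pi_iff)
  ultimately show ?thesis unfolding glue_def by (intro D_class_mem) (simp add: topspace_D_pre)
qed

lemma config_glue:
  assumes "finite J"
  shows "config V b (glue V J b X y) = {(comp_std V j, y j) | j. j \<in> J \<and> y j \<noteq> b}"
proof -
  have "config V b (glue V J b X y) = {(comp_std V (enum J i), y (enum J i)) | i. i < card J \<and> y (enum J i) \<noteq> b}"
    unfolding glue_def config_D_class by (fastforce simp: config_def component_std)
  also have "\<dots> = {(comp_std V j, y j) | j. j \<in> enum J ` {..<card J} \<and> y j \<noteq> b}" by auto
  finally show ?thesis unfolding enum_image[OF assms] .
qed

lemma D_mult_mem_config:
  assumes e: "e \<in> topspace (Emb V k J)" and y: "\<And>i. i < k \<Longrightarrow> y i \<in> topspace (D_pre V {()} X)"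
  shows "D_mult V J b X (k, e, y) \<in> topspace (D_space V J b X)" (is ?A)
    and "config V b (D_mult V J b X (k, e, y)) =
      {(comp_compose V (component V e i) \<xi>, x) | i \<xi> x. i < k \<and> (\<xi>, x) \<in> config V b (y i)}" (is ?B)
proof -
  define j where "j i = fst (y i)" for i
  define es where "es i = fst (snd (y i))" for i
  define xs where "xs i = snd (snd (y i))" for i
  have yi: "y i = (j i, es i, xs i)" for i by (simp add: j_def es_def xs_def)
  have es: "es i \<in> topspace (fr_emb_space V {..<j i} {()})" and xs: "xs i \<in> {..<j i} \<rightarrow>\<^sub>E topspace X" if "i < k" for i
    using y[OF that] by (auto simp: yi topspace_D_pre)
  define N where "N = (\<Sum>i<k. j i)"
  define c where "c = fr_emb_comp V {..<N} e (fr_emb_sum V k j es)"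
  define l where "l = (\<lambda>p\<in>{..<N}. xs (block j p) (in_block j p))"
  have m: "D_mult V J b X (k, e, y) = D_class V J b X (N, c, l)"
    by (simp add: D_mult_def Let_def c_def l_def N_def j_def[abs_def] es_def[abs_def] xs_def[abs_def])
  have sum: "fr_emb_sum V k j es \<in> topspace (fr_emb_space V {..<N} {..<k})"
    unfolding N_def by (rule fr_emb_sum_mem[OF V es])
  have cE: "c \<in> topspace (Emb V N J)" unfolding c_def by (rule fr_emb_comp_mem[OF V sum e])
  have bl: "block j p < k" "in_block j p < j (block j p)" "block_index j (block j p) (in_block j p) = p" if "p < N" for p
    using block_less[of p j k] that by (auto simp: N_def)
  have lE: "l \<in> {..<N} \<rightarrow>\<^sub>E topspace X"
    unfolding l_def
  proof (rule restrict_PiE_iff[THEN iffD2], rule ballI)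
    fix p assume "p \<in> {..<N}"
    then show "xs (block j p) (in_block j p) \<in> topspace X" using xs[of "block j p"] bl[of p] by auto
  qed
  show ?A unfolding m by (intro D_class_mem) (simp add: topspace_D_pre cE lE)
  have comp: "component V c p = comp_compose V (component V e (block j p)) (component V (es (block j p)) (in_block j p))"
    if p: "p < N" for p
  proof -
    have fr: "framed V {()} (component V (es (block j p)) (in_block j p))"
      using bl[OF p] by (intro fr_emb_framed[OF V es]) auto
    have cs: "component V (fr_emb_sum V k j es) p = comp_relabel V (\<lambda>_. block j p) (component V (es (block j p)) (in_block j p))"
      using p by (intro component_sum) (simp add: N_def)
    have "comp_target (component V (fr_emb_sum V k j es) p) = block j p"
      unfolding cs using subspace_0[OF V]
      by (cases "component V (es (block j p)) (in_block j p)") (simp add: comp_target_def comp_relabel_def)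
    then show ?thesis
      unfolding c_def component_comp[OF V sum lessThan_iff[THEN iffD2, OF p]] cs
      using comp_compose_relabel[OF V fr] by simp
  qed
  have "config V b (D_mult V J b X (k, e, y)) =
     {(comp_compose V (component V e (block j p)) (component V (es (block j p)) (in_block j p)), xs (block j p) (in_block j p)) |
        p. p < N \<and> xs (block j p) (in_block j p) \<noteq> b}"
    unfolding m config_D_class using comp by (fastforce simp: config_def l_def)
  also have "\<dots> = {(comp_compose V (component V e i) (component V (es i) r), xs i r) | i r. i < k \<and> r < j i \<and> xs i r \<noteq> b}"
  proof (intro equalityI subsetI)
    fix w assume "w \<in> {(comp_compose V (component V e i) (component V (es i) r), xs i r) | i r. i < k \<and> r < j i \<and> xs i r \<noteq> b}"
    then obtain i r where ir: "w = (comp_compose V (component V e i) (component V (es i) r), xs i r)" "i < k" "r < j i" "xs i r \<noteq> b"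
      by blast
    then show "w \<in> {(comp_compose V (component V e (block j p)) (component V (es (block j p)) (in_block j p)), xs (block j p) (in_block j p)) |
        p. p < N \<and> xs (block j p) (in_block j p) \<noteq> b}"
      using block_index[of r j i] block_index_less[of i k r j]
      by (intro CollectI exI[of _ "block_index j i r"]) (auto simp: N_def)
  next
    fix w assume "w \<in> {(comp_compose V (component V e (block j p)) (component V (es (block j p)) (in_block j p)), xs (block j p) (in_block j p)) |
        p. p < N \<and> xs (block j p) (in_block j p) \<noteq> b}"
    then show "w \<in> {(comp_compose V (component V e i) (component V (es i) r), xs i r) | i r. i < k \<and> r < j i \<and> xs i r \<noteq> b}"
      using bl by blast
  qed
  also have "\<dots> = {(comp_compose V (component V e i) \<xi>, x) | i \<xi> x. i < k \<and> (\<xi>, x) \<in> config V b (y i)}"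
    unfolding config_def yi prod.case by blast
  finally show ?B .
qed

lemma D_mult_mem:
  assumes "z \<in> topspace (D_pre V J (D_space V {()} b X))"
  shows "D_mult V J b X z \<in> topspace (D_space V J b X)"
proof -
  obtain k e y where z: "z = (k, e, y)" by (metis prod.collapse)
  show ?thesis unfolding z
    by (rule D_mult_mem_config(1)) (use assms in \<open>auto simp: z topspace_D_pre PiE_iff intro: D_space_pre\<close>)
qed

lemma config_D_mult:
  assumes "z \<in> topspace (D_pre V J (D_space V {()} b X))" and b': "config V b b' = {}"
  shows "config V b (D_mult V J b X z) =
    {(comp_compose V \<xi> \<xi>', x) | \<xi> y \<xi>' x. (\<xi>, y) \<in> config V b' z \<and> (\<xi>', x) \<in> config V b y}"
proof -
  obtain k e y where z: "z = (k, e, y)" by (metis prod.collapse)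
  have "config V b (D_mult V J b X (k, e, y)) =
      {(comp_compose V (component V e i) \<xi>, x) | i \<xi> x. i < k \<and> (\<xi>, x) \<in> config V b (y i)}"
    by (rule D_mult_mem_config(2)) (use assms in \<open>auto simp: z topspace_D_pre PiE_iff intro: D_space_pre\<close>)
  also have "\<dots> = {(comp_compose V (component V e i) \<xi>, x) | i \<xi> x. i < k \<and> y i \<noteq> b' \<and> (\<xi>, x) \<in> config V b (y i)}"
    using b' by blast
  also have "\<dots> = {(comp_compose V \<xi> \<xi>', x) | \<xi> y \<xi>' x. (\<xi>, y) \<in> config V b' z \<and> (\<xi>', x) \<in> config V b y}"
    unfolding z config_def[of V b'] prod.case by blast
  finally show ?thesis by (simp add: z)
qed

end


section \<open>Continuous functionals on configuration spaces\<close>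

lemma continuous_map_open_cover:
  assumes "\<And>x. x \<in> topspace X \<Longrightarrow> \<exists>P. openin X P \<and> x \<in> P \<and> continuous_map (subtopology X P) Y f"
  shows "continuous_map X Y f"
  unfolding continuous_map_def
proof (intro conjI allI impI funcsetI)
  fix x assume x: "x \<in> topspace X"
  then obtain P where "openin X P" "x \<in> P" "continuous_map (subtopology X P) Y f" using assms by blast
  then show "f x \<in> topspace Y" using x by (auto simp: continuous_map_def)
next
  fix U assume U: "openin Y U"
  show "openin X {x \<in> topspace X. f x \<in> U}"
  proof (subst openin_subopen, intro ballI)
    fix x assume x: "x \<in> {x \<in> topspace X. f x \<in> U}"
    then obtain P where P: "openin X P" "x \<in> P" "continuous_map (subtopology X P) Y f" using assms by blast
    have "openin (subtopology X P) {x \<in> topspace (subtopology X P). f x \<in> U}"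
      by (rule openin_continuous_map_preimage[OF P(3) U])
    then have "openin X {x \<in> topspace (subtopology X P). f x \<in> U}"
      using P(1) by (simp add: openin_open_subtopology)
    then show "\<exists>T. openin X T \<and> x \<in> T \<and> T \<subseteq> {x \<in> topspace X. f x \<in> U}"
      using x P(2) by (intro exI[of _ "{x \<in> topspace (subtopology X P). f x \<in> U}"]) auto
  qed
qed

text \<open>The summand \<open>\<D>\<^sub>M(k) \<times> X\<^sup>k\<close>.\<close>

abbreviation D_slice ::
    "'v::euclidean_space set \<Rightarrow> 'j set \<Rightarrow> 'x topology \<Rightarrow> nat \<Rightarrow> ((nat, 'v, 'j) fr_emb \<times> (nat \<Rightarrow> 'x)) topology" where
  "D_slice V J X k \<equiv> kprod (Emb V k J) (kpower X k)"

lemma topspace_D_slice: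
  "topspace (D_slice V J X k) = topspace (Emb V k J) \<times> ({..<k} \<rightarrow>\<^sub>E topspace X)"
  by (simp add: kprod_def kpower_def)

lemma D_pre_slice: "(k, p) \<in> topspace (D_pre V J X) \<longleftrightarrow> p \<in> topspace (D_slice V J X k)"
  by (simp add: D_pre_def)

lemma continuous_map_D_slice:
  "continuous_map (D_slice V J X k) (Emb V k J) fst"
  "i < k \<Longrightarrow> continuous_map (D_slice V J X k) X (\<lambda>p. snd p i)"
proof -
  show "continuous_map (D_slice V J X k) (Emb V k J) fst"
    unfolding kprod_def by (intro continuous_map_from_kify continuous_map_fst)
  assume i: "i < k"
  have "continuous_map (kpower X k) X (\<lambda>x. x i)"
    unfolding kpower_def by (intro continuous_map_from_kify continuous_map_product_projection) (use i in simp)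
  from continuous_map_compose[OF continuous_map_snd this]
  show "continuous_map (D_slice V J X k) X (\<lambda>p. snd p i)"
    unfolding kprod_def by (intro continuous_map_from_kify) (simp add: o_def)
qed

lemma openin_D_space:
  assumes "W \<subseteq> topspace (D_space V J b X)"
    and "\<And>k. openin (D_slice V J X k) {p \<in> topspace (D_slice V J X k). D_class V J b X (k, p) \<in> W}"
  shows "openin (D_space V J b X) W"
proof -
  have "openin (D_pre V J X) {z \<in> topspace (D_pre V J X). D_class V J b X z \<in> W}"
    unfolding D_pre_def openin_sum_topology
  proof (intro conjI ballI)
    fix k :: nat
    have "{x. (k, x) \<in> {z \<in> topspace (sum_topology (D_slice V J X) UNIV). D_class V J b X z \<in> W}} =
      {p \<in> topspace (D_slice V J X k). D_class V J b X (k, p) \<in> W}" by auto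
    then show "openin (D_slice V J X k) {x. (k, x) \<in> {z \<in> topspace (sum_topology (D_slice V J X) UNIV). D_class V J b X z \<in> W}}"
      using assms(2)[of k] by simp
  qed auto
  then show ?thesis
    using assms(1) unfolding D_space_def quotient_space_def openin_final_topology by simp
qed

text \<open>A real function of components that is continuous on each component of a framed embedding.\<close>

definition comp_continuous :: "'v::euclidean_space set \<Rightarrow> 'j set \<Rightarrow> (('v, 'j) fr_comp \<Rightarrow> real) \<Rightarrow> bool" where
  "comp_continuous V J \<phi> \<longleftrightarrow> (\<forall>k::nat. \<forall>i<k. continuous_map (Emb V k J) euclideanreal (\<lambda>e. \<phi> (component V e i)))"

lemma comp_continuous_compose:
  assumes "comp_continuous V J \<phi>" "continuous_on UNIV g"
  shows "comp_continuous V J (\<lambda>c. g (\<phi> c))"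
  unfolding comp_continuous_def
proof (intro allI impI)
  fix k i :: nat assume "i < k"
  then have "continuous_map (Emb V k J) euclideanreal (\<lambda>e. \<phi> (component V e i))"
    using assms(1) by (simp add: comp_continuous_def)
  from continuous_map_compose[OF this, of euclideanreal g]
  show "continuous_map (Emb V k J) euclideanreal (\<lambda>e. g (\<phi> (component V e i)))"
    using assms(2) by (simp add: o_def)
qed

lemma comp_continuous_mult:
  "comp_continuous V J \<phi> \<Longrightarrow> comp_continuous V J \<psi> \<Longrightarrow> comp_continuous V J (\<lambda>c. \<phi> c * \<psi> c)"
  by (simp add: comp_continuous_def continuous_map_real_mult)

text \<open>
  Distinct components are separated by a coordinate of the embedding, by the length, or by a
  coordinate of the Moore path.
\<close>

lemma comp_continuous_separate:
  assumes V: "subspace V" and c: "framed V J c" "framed V J c'" "c \<noteq> c'"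
  shows "\<exists>\<phi>. comp_continuous V J \<phi> \<and> \<phi> c \<noteq> \<phi> c'"
proof -
  obtain f l \<alpha> f' l' \<alpha>' where d: "c = (f, l, \<alpha>)" "c' = (f', l', \<alpha>')" by (metis prod.collapse)
  have ext: "f \<in> extensional V" "f' \<in> extensional V" "\<alpha> \<in> extensional {0..}" "\<alpha>' \<in> extensional {0..}"
    "\<And>t. 0 \<le> t \<Longrightarrow> \<alpha> t \<in> extensional (V \<times> V)" "\<And>t. 0 \<le> t \<Longrightarrow> \<alpha>' t \<in> extensional (V \<times> V)"
    using c(1,2) unfolding d framed_def prod.case by blast+
  consider x where "x \<in> V" "f x \<noteq> f' x" | "l \<noteq> l'" | t x w where "0 \<le> t" "x \<in> V" "w \<in> V" "\<alpha> t (x, w) \<noteq> \<alpha>' t (x, w)"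
  proof -
    have "f = f'" if "\<And>x. x \<in> V \<Longrightarrow> f x = f' x" using ext that by (intro extensionalityI[of f V f'])
    moreover have "\<alpha> = \<alpha>'" if "\<And>t x w. 0 \<le> t \<Longrightarrow> x \<in> V \<Longrightarrow> w \<in> V \<Longrightarrow> \<alpha> t (x, w) = \<alpha>' t (x, w)"
    proof (rule extensionalityI[OF ext(3,4)])
      fix t :: real assume t: "t \<in> {0..}"
      show "\<alpha> t = \<alpha>' t"
        by (rule extensionalityI[OF ext(5,6)]) (use t that in auto)
    qed
    ultimately show ?thesis using c(3) that unfolding d by blast
  qed
  then show ?thesis
  proof cases
    case 1
    have ev: "continuous_map (Emb V k J) (mfd V J) (\<lambda>e. fst (component V e i) x)" if "i < k" for i k
      using continuous_map_fr_emb_eval(1)[of i "{..<k}" x V J] that 1(1)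
      by (rule_tac continuous_map_eq[where f = "\<lambda>e. fst e (i, x)"]) (auto simp: component_def)
    show ?thesis
    proof (cases "fst (f x) = fst (f' x)")
      case False
      let ?g = "\<lambda>j. if j = fst (f x) then 1 else (0::real)"
      have "comp_continuous V J (\<lambda>c. ?g (fst (fst c x)))"
        unfolding comp_continuous_def
      proof (intro allI impI)
        fix k i :: nat assume "i < k"
        have "continuous_map (mfd V J) euclideanreal (?g \<circ> fst)"
          unfolding mfd_def by (rule continuous_map_compose[OF continuous_map_fst]) simp
        from continuous_map_compose[OF ev[OF \<open>i < k\<close>] this]
        show "continuous_map (Emb V k J) euclideanreal (\<lambda>e. ?g (fst (fst (component V e i) x)))"
          by (simp add: o_def)
      qed
      then show ?thesis using False by (intro exI conjI) (auto simp: d)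
    next
      case True
      then have "snd (f x) \<noteq> snd (f' x)" using 1(2) by (metis prod.collapse)
      then obtain b where b: "b \<in> Basis" "snd (f x) \<bullet> b \<noteq> snd (f' x) \<bullet> b" using euclidean_eqI by blast
      have "comp_continuous V J (\<lambda>c. snd (fst c x) \<bullet> b)"
        unfolding comp_continuous_def
      proof (intro allI impI)
        fix k i :: nat assume "i < k"
        have "continuous_map (top_of_set V) euclideanreal (\<lambda>v. v \<bullet> b)" by (auto intro!: continuous_intros)
        from continuous_map_compose[OF continuous_map_snd this]
        have "continuous_map (mfd V J) euclideanreal ((\<lambda>v. v \<bullet> b) \<circ> snd)" unfolding mfd_def .
        from continuous_map_compose[OF ev[OF \<open>i < k\<close>] this]
        show "continuous_map (Emb V k J) euclideanreal (\<lambda>e. snd (fst (component V e i) x) \<bullet> b)"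
          by (simp add: o_def)
      qed
      then show ?thesis using b by (intro exI conjI) (auto simp: d)
    qed
  next
    case 2
    have "comp_continuous V J (\<lambda>c. fst (snd c))"
      unfolding comp_continuous_def
    proof (intro allI impI)
      fix k i :: nat assume "i < k"
      then have "continuous_map (Emb V k J) euclideanreal (\<lambda>e. fst (snd e) i)"
        using continuous_map_fr_emb_eval(2)[of i "{..<k}" V J] continuous_map_into_fulltopology by fastforce
      then show "continuous_map (Emb V k J) euclideanreal (\<lambda>e. fst (snd (component V e i)))"
        by (rule continuous_map_eq) (auto simp: component_def)
    qed
    then show ?thesis using 2 by (intro exI conjI) (auto simp: d)
  next
    case 3
    then obtain b where b: "b \<in> Basis" "\<alpha> t (x, w) \<bullet> b \<noteq> \<alpha>' t (x, w) \<bullet> b" using euclidean_eqI by blast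
    have "comp_continuous V J (\<lambda>c. snd (snd c) t (x, w) \<bullet> b)"
      unfolding comp_continuous_def
    proof (intro allI impI)
      fix k i :: nat assume "i < k"
      then have 1: "continuous_map (Emb V k J) (top_of_set V) (\<lambda>e. snd (snd e) t ((i, x), w))"
        using continuous_map_fr_emb_eval(3)[of i "{..<k}" x V w t J] 3 by simp
      have "continuous_map (top_of_set V) euclideanreal (\<lambda>v. v \<bullet> b)" by (auto intro!: continuous_intros)
      from continuous_map_compose[OF 1 this]
      show "continuous_map (Emb V k J) euclideanreal (\<lambda>e. snd (snd (component V e i)) t (x, w) \<bullet> b)"
        by (rule continuous_map_eq) (use 3 in \<open>auto simp: component_def\<close>)
    qed
    then show ?thesis using b by (intro exI conjI) (auto simp: d)
  qed
qed

lemma comp_continuous_bump: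
  assumes V: "subspace V" and c: "framed V J c" and "finite S" "\<And>c'. c' \<in> S \<Longrightarrow> framed V J c' \<and> c' \<noteq> c"
  shows "\<exists>\<phi>. comp_continuous V J \<phi> \<and> \<phi> c = 1 \<and> (\<forall>c'\<in>S. \<phi> c' = 0) \<and> (\<forall>c'. 0 \<le> \<phi> c')"
  using assms(3,4)
proof (induction S rule: finite_induct)
  case empty
  have "comp_continuous V J (\<lambda>c. 1)" by (simp add: comp_continuous_def)
  then show ?case by auto
next
  case (insert c' S)
  then obtain \<phi> where \<phi>: "comp_continuous V J \<phi>" "\<phi> c = 1" "\<forall>c'\<in>S. \<phi> c' = 0" "\<forall>c'. 0 \<le> \<phi> c'" by blast
  obtain \<psi> where \<psi>: "comp_continuous V J \<psi>" "\<psi> c \<noteq> \<psi> c'"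
    using comp_continuous_separate[OF V c] insert.prems[of c'] by blast
  let ?g = "\<lambda>r. \<bar>(r - \<psi> c') / (\<psi> c - \<psi> c')\<bar>"
  have "comp_continuous V J (\<lambda>d. \<phi> d * ?g (\<psi> d))"
    using \<psi>(2) by (intro comp_continuous_mult \<phi> comp_continuous_compose[OF \<psi>(1), of ?g]) (auto intro!: continuous_intros)
  moreover have "\<phi> c * ?g (\<psi> c) = 1" using \<phi> \<psi> by simp
  moreover have "\<forall>d\<in>insert c' S. \<phi> d * ?g (\<psi> d) = 0" using \<phi> by auto
  moreover have "\<forall>d. 0 \<le> \<phi> d * ?g (\<psi> d)" using \<phi> by simp
  ultimately show ?case by blast
qed

context
  fixes V :: "'v::euclidean_space set"
  assumes V: "subspace V"
begin

lemma config_sum: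
  assumes "(k, e, x) \<in> topspace (D_pre V J X)" and "\<And>c. F c b = (0::real)"
  shows "(\<Sum>(c, y)\<in>config V b (k, e, x). F c y) = (\<Sum>i<k. F (component V e i) (x i))"
proof -
  let ?K = "{i. i < k \<and> x i \<noteq> b}"
  have e: "e \<in> topspace (Emb V k J)" using assms(1) by (simp add: topspace_D_pre)
  have "inj_on (\<lambda>i. (component V e i, x i)) ?K"
    using component_inj[OF V e] by (auto simp: inj_on_def)
  moreover have "config V b (k, e, x) = (\<lambda>i. (component V e i, x i)) ` ?K" by (auto simp: config_def)
  ultimately have "(\<Sum>(c, y)\<in>config V b (k, e, x). F c y) = (\<Sum>i\<in>?K. F (component V e i) (x i))"
    by (simp add: sum.reindex)
  also have "\<dots> = (\<Sum>i<k. F (component V e i) (x i))"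
    by (rule sum.mono_neutral_left) (auto simp: assms(2))
  finally show ?thesis .
qed

lemma finite_config: "finite (config V b z)"
  by (cases z) (simp add: config_def)

lemma config_functional:
  assumes z: "z \<in> topspace (D_pre V J X)" and "(c, x) \<in> config V b z" "(c, x') \<in> config V b z"
  shows "x = x'"
proof -
  obtain k e y where d: "z = (k, e, y)" by (metis prod.collapse)
  have e: "e \<in> topspace (Emb V k J)" using z by (simp add: topspace_D_pre d)
  obtain i i' where "i < k" "i' < k" "component V e i = component V e i'" "x = y i" "x' = y i'"
    using assms(2,3) by (auto simp: d config_def)
  then show ?thesis using component_inj[OF V e] by (auto dest: inj_onD)
qed

lemma continuous_map_config_sum:
  assumes "\<And>c. F c b = (0::real)"
    and "\<And>k i. i < k \<Longrightarrow> continuous_map (D_slice V J X k) euclideanreal (\<lambda>(e, x). F (component V e i) (x i))"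
  shows "continuous_map (D_space V J b X) euclideanreal (\<lambda>z. \<Sum>(c, y)\<in>config V b z. F c y)"
proof (rule continuous_map_from_D_space)
  fix k
  have "continuous_map (D_slice V J X k) euclideanreal (\<lambda>p. \<Sum>i<k. F (component V (fst p) i) (snd p i))"
    using assms(2) by (intro continuous_map_sum) (auto simp: case_prod_unfold)
  then show "continuous_map (D_slice V J X k) euclideanreal
     (\<lambda>(e, x). \<Sum>(c, y)\<in>config V b (D_class V J b X (k, e, x)). F c y)"
  proof (rule continuous_map_eq)
    fix p assume "p \<in> topspace (D_slice V J X k)"
    then obtain e x where p: "p = (e, x)" "(k, e, x) \<in> topspace (D_pre V J X)" by (cases p) (auto simp: D_pre_slice)
    show "(\<Sum>i<k. F (component V (fst p) i) (snd p i)) =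
      (case p of (e, x) \<Rightarrow> \<Sum>(c, y)\<in>config V b (D_class V J b X (k, e, x)). F c y)"
      using config_sum[OF p(2), of F b] assms(1) by (simp add: p(1) config_D_class[OF V])
  qed
qed

lemma openin_config_exists:
  fixes J :: "'a set" and b :: 'b
  assumes "\<And>c. \<not> Q c b"
    and "\<And>k i. i < k \<Longrightarrow> openin (D_slice V J X k) {p \<in> topspace (D_slice V J X k). Q (component V (fst p) i) (snd p i)}"
  shows "openin (D_space V J b X) {z \<in> topspace (D_space V J b X). \<exists>(c, y)\<in>config V b z. Q c y}"
proof (rule openin_D_space)
  fix k
  have "{p \<in> topspace (D_slice V J X k). D_class V J b X (k, p) \<in> {z \<in> topspace (D_space V J b X). \<exists>(c, y)\<in>config V b z. Q c y}} =
    (\<Union>i<k. {p \<in> topspace (D_slice V J X k). Q (component V (fst p) i) (snd p i)})"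
  proof -
    have "(\<exists>(c, y)\<in>config V b (k, p). Q c y) \<longleftrightarrow> (\<exists>i<k. Q (component V (fst p) i) (snd p i))"
      for p :: "(nat, 'v, 'a) fr_emb \<times> (nat \<Rightarrow> 'b)"
    proof
      assume "\<exists>(c, y)\<in>config V b (k, p). Q c y"
      then obtain q where q: "q \<in> config V b (k, p)" "Q (fst q) (snd q)" by force
      then obtain i where "i < k" "q = (component V (fst p) i, snd p i)" by (cases p) (auto simp: config_def)
      then show "\<exists>i<k. Q (component V (fst p) i) (snd p i)" using q(2) by auto
    next
      assume "\<exists>i<k. Q (component V (fst p) i) (snd p i)"
      then obtain i where i: "i < k" "Q (component V (fst p) i) (snd p i)" by blast
      then have "snd p i \<noteq> b" using assms(1) by metis
      then have "(component V (fst p) i, snd p i) \<in> config V b (k, p)" using i(1) by (cases p) (auto simp: config_def)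
      then show "\<exists>(c, y)\<in>config V b (k, p). Q c y" using i(2) by blast
    qed
    moreover have "D_class V J b X (k, p) \<in> topspace (D_space V J b X)" if "p \<in> topspace (D_slice V J X k)" for p
      by (rule D_class_mem[OF V]) (use that in \<open>simp add: D_pre_slice\<close>)
    ultimately show ?thesis by (auto simp: config_D_class[OF V])
  qed
  then show "openin (D_slice V J X k) {p \<in> topspace (D_slice V J X k). D_class V J b X (k, p) \<in>
     {z \<in> topspace (D_space V J b X). \<exists>(c, y)\<in>config V b z. Q c y}}"
    using assms(2) by (simp only:) (intro openin_Union, auto)
qed auto

text \<open>
  Two distinct configurations are separated as follows.  Suppose that a component \<open>c\<close> carries a label
  in one of them that it does not carry in the other.  Take a function \<open>\<phi>\<close> of the components that
  is \<open>1\<close> at \<open>c\<close> and vanishes at the other components involved.  The total weight \<open>\<Sum> \<phi> u\<close>, with \<open>u\<close> a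
  function on the labels that vanishes exactly at the base point, separates unless \<open>c\<close> carries labels
  of the same weight in both.  In that case both configurations lie in a closed set on which exactly
  one label has large weight, and this label is a continuous function on the preimage of the closed
  set in the test space.
\<close>

lemma k_Hausdorff_D_space_aux:
  fixes u :: "'x \<Rightarrow> real" and K :: "'k topology"
  assumes X: "k_Hausdorff X" and u: "continuous_map X euclideanreal u"
    and u0: "\<And>x. x \<in> topspace X \<Longrightarrow> 0 \<le> u x" "\<And>x. x \<in> topspace X \<Longrightarrow> u x = 0 \<longleftrightarrow> x = b" and b: "b \<in> topspace X"
    and K: "compact_space K" "Hausdorff_space K" and w: "continuous_map K (D_space V J b X) w"
    and z: "z \<in> w ` topspace K" "z' \<in> w ` topspace K" and cx: "(c, x) \<in> config V b z" "(c, x) \<notin> config V b z'"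
  shows "\<exists>A A'. openin (D_space V J b X) A \<and> openin (D_space V J b X) A' \<and> z \<in> A \<and> z' \<in> A' \<and>
    A \<inter> A' \<inter> w ` topspace K = {}"
proof -
  let ?D = "D_space V J b X"
  have wD: "w ` topspace K \<subseteq> topspace ?D" using w by (auto simp: continuous_map_def)
  have zD: "z \<in> topspace ?D" "z' \<in> topspace ?D" using z wD by auto
  have pre: "v \<in> topspace ?D \<Longrightarrow> v \<in> topspace (D_pre V J X)" for v by (rule D_space_pre[OF V])
  have fr: "framed V J \<xi> \<and> y \<in> topspace X \<and> y \<noteq> b" if "v \<in> topspace ?D" "(\<xi>, y) \<in> config V b v" for v \<xi> y
    by (rule config_framed[OF V pre[OF that(1)] that(2)])
  define S where "S = fst ` config V b z \<union> fst ` config V b z' - {c}"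
  have "finite S" unfolding S_def by (simp add: finite_config)
  moreover have "framed V J c' \<and> c' \<noteq> c" if c': "c' \<in> S" for c'
  proof -
    obtain p where p: "p \<in> config V b z \<or> p \<in> config V b z'" "c' = fst p" "c' \<noteq> c"
      using c' unfolding S_def by blast
    then have "(c', snd p) \<in> config V b z \<or> (c', snd p) \<in> config V b z'" by simp
    then show ?thesis using fr[OF zD(1), of c' "snd p"] fr[OF zD(2), of c' "snd p"] p(3) by blast
  qed
  ultimately obtain \<phi> where \<phi>: "comp_continuous V J \<phi>" "\<phi> c = 1" "\<forall>c'\<in>S. \<phi> c' = 0" "\<forall>c'. 0 \<le> \<phi> c'"
    using comp_continuous_bump[OF V conjunct1[OF fr[OF zD(1) cx(1)]]] by metis
  define W where "W \<xi> y = \<phi> \<xi> * u y" for \<xi> y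
  have ub: "u b = 0" using u0(2)[OF b] by simp
  have Wb: "W \<xi> b = 0" for \<xi> by (simp add: W_def ub)
  have contW: "continuous_map (D_slice V J X k) euclideanreal (\<lambda>p. W (component V (fst p) i) (snd p i))" if "i < k" for i k
  proof -
    have "continuous_map (D_slice V J X k) euclideanreal (\<lambda>p. \<phi> (component V (fst p) i))"
      using continuous_map_compose[OF continuous_map_D_slice(1), of V k J euclideanreal "\<lambda>e. \<phi> (component V e i)"] \<phi>(1) that
      by (simp add: comp_continuous_def o_def)
    moreover have "continuous_map (D_slice V J X k) euclideanreal (\<lambda>p. u (snd p i))"
      using continuous_map_compose[OF continuous_map_D_slice(2)[OF that] u] by (simp add: o_def)
    ultimately show ?thesis unfolding W_def by (rule continuous_map_real_mult)
  qed
  define \<Sigma> where "\<Sigma> g v = (\<Sum>(\<xi>, y)\<in>config V b v. g (W \<xi> y))" for g :: "real \<Rightarrow> real" and v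
  have cont\<Sigma>: "continuous_map ?D euclideanreal (\<Sigma> g)" if g: "continuous_on UNIV g" "g 0 = 0" for g
    unfolding \<Sigma>_def
  proof (rule continuous_map_config_sum)
    show "g (W \<xi> b) = 0" for \<xi> by (simp add: Wb g)
    show "continuous_map (D_slice V J X k) euclideanreal (\<lambda>(e, x). g (W (component V e i) (x i)))" if "i < k" for k i
      using continuous_map_compose[OF contW[OF that], of euclideanreal g] g by (simp add: o_def case_prod_unfold)
  qed
  have W0: "W \<xi> y = 0" if "v = z \<or> v = z'" "(\<xi>, y) \<in> config V b v" "\<xi> \<noteq> c" for v \<xi> y
    using that \<phi>(3) by (force simp: W_def S_def)
  have \<Sigma>1: "\<Sigma> g v = g (u y)" if g: "g 0 = 0" and v: "v = z \<or> v = z'" and y: "(c, y) \<in> config V b v" for g v y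
  proof -
    have "\<Sigma> g v = (\<Sum>(\<xi>, y)\<in>{(c, y)}. g (W \<xi> y))"
      unfolding \<Sigma>_def
    proof (rule sum.mono_neutral_right)
      show "\<forall>p\<in>config V b v - {(c, y)}. (case p of (\<xi>, y) \<Rightarrow> g (W \<xi> y)) = 0"
      proof
        fix p assume p: "p \<in> config V b v - {(c, y)}"
        obtain \<xi> y' where p': "p = (\<xi>, y')" by (cases p)
        have "\<xi> \<noteq> c" using config_functional[OF pre, of v c y b y'] p p' y v zD by auto
        then show "(case p of (\<xi>, y) \<Rightarrow> g (W \<xi> y)) = 0" using W0[OF v, of \<xi> y'] p p' g by simp
      qed
    qed (use y in \<open>auto simp: finite_config\<close>)
    then show ?thesis by (simp add: W_def \<phi>(2))
  qed
  define r where "r = u x"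
  have r: "r > 0" using u0[of x] fr[OF zD(1) cx(1)] by (force simp: r_def)
  show ?thesis
  proof (cases "\<exists>x'. (c, x') \<in> config V b z' \<and> u x' = r")
    case False
    have "\<Sigma> (\<lambda>s. s) z = r" using \<Sigma>1[of "\<lambda>s. s" z x] cx by (simp add: r_def)
    moreover have "\<Sigma> (\<lambda>s. s) z' \<noteq> r"
    proof (cases "\<exists>x'. (c, x') \<in> config V b z'")
      case True
      then obtain x' where "(c, x') \<in> config V b z'" by blast
      then show ?thesis using \<Sigma>1[of "\<lambda>s. s" z' x'] False by auto
    next
      case nc: False
      have "\<Sigma> (\<lambda>s. s) z' = 0"
        unfolding \<Sigma>_def
      proof (rule sum.neutral, rule ballI)
        fix p assume p: "p \<in> config V b z'"
        obtain \<xi> y where p': "p = (\<xi>, y)" by (cases p)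
        have "\<xi> \<noteq> c" using nc p p' by blast
        then show "(case p of (\<xi>, y) \<Rightarrow> W \<xi> y) = 0" using W0[of z' \<xi> y] p p' by simp
      qed
      then show ?thesis using r by simp
    qed
    ultimately have "\<Sigma> (\<lambda>s. s) z \<noteq> \<Sigma> (\<lambda>s. s) z'" by simp
    from Hausdorff_space_separate[OF cont\<Sigma>[of "\<lambda>s. s"] Hausdorff_space_euclidean zD this]
    obtain A A' where "openin ?D A" "openin ?D A'" "z \<in> A" "z' \<in> A'" "A \<inter> A' \<inter> topspace ?D = {}"
      by (auto simp: continuous_on_id)
    then show ?thesis using wD by blast
  next
    case True
    then obtain x' where x': "(c, x') \<in> config V b z'" "u x' = r" by blast
    have xx': "x \<noteq> x'" using x' cx(2) by auto
    \<comment> \<open>If \<open>\<Sigma> g2 v > 0\<close>, some label of \<open>v\<close> has weight above \<open>r/2\<close>; if \<open>\<Sigma> g1 v < 2\<close>, there is at most one.\<close>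
    define g1 where "g1 s = max 0 (min 1 ((s - r/4) / (r/4)))" for s :: real
    define g2 where "g2 s = max 0 (min 1 ((s - r/2) / (r/4)))" for s :: real
    have g: "continuous_on UNIV g1" "g1 0 = 0" "continuous_on UNIV g2" "g2 0 = 0" "g1 r = 1" "g2 r = 1"
      using r by (auto simp: g1_def[abs_def] g2_def[abs_def] intro!: continuous_intros)
    have g1pos: "0 \<le> g1 s" and g1one: "r/2 < s \<Longrightarrow> g1 s = 1" and g2zero: "s \<le> r/2 \<Longrightarrow> g2 s = 0" for s
      using r by (auto simp: g1_def g2_def field_simps max_def min_def)
    have val: "\<Sigma> g1 z = 1" "\<Sigma> g2 z = 1" "\<Sigma> g1 z' = 1" "\<Sigma> g2 z' = 1"
      using \<Sigma>1[of g1 z x] \<Sigma>1[of g2 z x] \<Sigma>1[of g1 z' x'] \<Sigma>1[of g2 z' x'] cx(1) x' g(2,4,5,6)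
      by (simp_all add: r_def)
    define big where "big v \<xi> y \<longleftrightarrow> (\<xi>, y) \<in> config V b v \<and> r/2 < W \<xi> y" for v \<xi> y
    have ex: "\<exists>\<xi> y. big v \<xi> y" if "\<Sigma> g2 v > 0" for v
    proof (rule ccontr)
      assume "\<nexists>\<xi> y. big v \<xi> y"
      then have "\<Sigma> g2 v = 0" unfolding \<Sigma>_def
        by (intro sum.neutral) (auto simp: big_def not_less intro: g2zero)
      then show False using that by simp
    qed
    have uniq: "y = y'" if v: "v \<in> topspace ?D" "\<Sigma> g1 v < 2" and y: "big v \<xi> y" "big v \<xi>' y'" for v \<xi> y \<xi>' y'
    proof (rule ccontr)
      assume ne: "y \<noteq> y'"
      have "(\<Sum>(\<xi>, y)\<in>{(\<xi>, y), (\<xi>', y')}. g1 (W \<xi> y)) \<le> \<Sigma> g1 v"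
        unfolding \<Sigma>_def by (rule sum_mono2) (use y in \<open>auto simp: big_def finite_config g1pos\<close>)
      moreover have "(\<Sum>(\<xi>, y)\<in>{(\<xi>, y), (\<xi>', y')}. g1 (W \<xi> y)) = 2"
        using ne y g1one by (simp add: big_def)
      ultimately show False using v(2) by simp
    qed
    define lab where "lab v = (SOME y. \<exists>\<xi>. big v \<xi> y)" for v
    have lab: "lab v = y" if "v \<in> topspace ?D" "\<Sigma> g1 v < 2" "big v \<xi> y" for v \<xi> y
    proof -
      have "\<exists>\<xi>. big v \<xi> (lab v)" unfolding lab_def by (rule someI_ex) (use that in blast)
      then show ?thesis using uniq[OF that(1,2) _ that(3)] by blast
    qed
    define U2 where "U2 U = {v \<in> topspace ?D. \<exists>(\<xi>, y)\<in>config V b v. r/2 < W \<xi> y \<and> y \<in> U}" for U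
    have U2: "openin ?D (U2 U)" if U: "openin X U" for U
      unfolding U2_def
    proof (rule openin_config_exists)
      show "\<not> (r/2 < W \<xi> b \<and> b \<in> U)" for \<xi> using r by (simp add: Wb)
      fix k i :: nat assume i: "i < k"
      have "openin (D_slice V J X k) ({p \<in> topspace (D_slice V J X k). W (component V (fst p) i) (snd p i) \<in> {r/2<..}} \<inter>
         {p \<in> topspace (D_slice V J X k). snd p i \<in> U})"
        by (intro openin_Int openin_continuous_map_preimage[OF contW[OF i]]
            openin_continuous_map_preimage[OF continuous_map_D_slice(2)[OF i] U]) (simp add: open_openin[symmetric])
      moreover have "{p \<in> topspace (D_slice V J X k). W (component V (fst p) i) (snd p i) \<in> {r/2<..}} \<inter>
         {p \<in> topspace (D_slice V J X k). snd p i \<in> U} =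
         {p \<in> topspace (D_slice V J X k). r/2 < W (component V (fst p) i) (snd p i) \<and> snd p i \<in> U}" by auto
      ultimately show "openin (D_slice V J X k) {p \<in> topspace (D_slice V J X k). r/2 < W (component V (fst p) i) (snd p i) \<and> snd p i \<in> U}"
        by simp
    qed
    have U2_lab: "v \<in> U2 U \<longleftrightarrow> lab v \<in> U" if v: "v \<in> topspace ?D" "\<Sigma> g2 v > 0" "\<Sigma> g1 v < 2" for v U
    proof -
      obtain \<xi> y where y: "big v \<xi> y" using ex[OF v(2)] by blast
      then have l: "lab v = y" by (rule lab[OF v(1,3)])
      show ?thesis
      proof
        assume "v \<in> U2 U"
        then obtain \<xi>' y' where y': "(\<xi>', y') \<in> config V b v" "r/2 < W \<xi>' y'" "y' \<in> U" unfolding U2_def by blast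
        then have "big v \<xi>' y'" by (simp add: big_def)
        then have "y' = y" using uniq[OF v(1,3) _ y] by blast
        then show "lab v \<in> U" using l y'(3) by simp
      next
        assume "lab v \<in> U"
        then show "v \<in> U2 U" using y v(1) l unfolding U2_def big_def by blast
      qed
    qed
    define C where "C = {k \<in> topspace K. w k \<in> {v \<in> topspace ?D. \<Sigma> g2 v \<in> {1/2..}} \<inter> {v \<in> topspace ?D. \<Sigma> g1 v \<in> {..3/2}}}"
    have "closedin K C"
      unfolding C_def
      by (intro closedin_continuous_map_preimage[OF w] closedin_Int
          closedin_continuous_map_preimage[OF cont\<Sigma>[OF g(1,2)]] closedin_continuous_map_preimage[OF cont\<Sigma>[OF g(3,4)]])
         (simp_all add: closed_closedin[symmetric])
    then have C: "compact_space (subtopology K C)" "Hausdorff_space (subtopology K C)" "topspace (subtopology K C) = C"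
      using K closedin_compact_space[OF K(1)] closedin_subset
      by (auto simp: Hausdorff_space_subtopology inf_absorb2 compactin_subspace)
    have inC: "w k \<in> topspace ?D \<and> \<Sigma> g2 (w k) > 0 \<and> \<Sigma> g1 (w k) < 2" if "k \<in> C" for k
      using that by (auto simp: C_def)
    have "continuous_map (subtopology K C) X (lab \<circ> w)"
      unfolding continuous_map_def C(3)
    proof (intro conjI allI impI funcsetI)
      fix k assume k: "k \<in> C"
      obtain \<xi> y where y: "big (w k) \<xi> y" using ex inC[OF k] by blast
      then show "(lab \<circ> w) k \<in> topspace X"
        using lab[of "w k" \<xi> y] inC[OF k] fr[of "w k" \<xi> y] by (auto simp: big_def)
    next
      fix U assume "openin X U"
      then have "openin K {k \<in> topspace K. w k \<in> U2 U}" by (rule openin_continuous_map_preimage[OF w U2])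
      moreover have "{k \<in> C. (lab \<circ> w) k \<in> U} = {k \<in> topspace K. w k \<in> U2 U} \<inter> C"
      proof -
        have "(lab \<circ> w) k \<in> U \<longleftrightarrow> w k \<in> U2 U" if "k \<in> C" for k
          using U2_lab[of "w k" U] inC[OF that] by simp
        then show ?thesis unfolding C_def by blast
      qed
      ultimately show "openin (subtopology K C) {k \<in> C. (lab \<circ> w) k \<in> U}" by (auto simp: openin_subtopology)
    qed
    from k_HausdorffD[OF X C(1,2) this]
    have L: "Hausdorff_space (subtopology X ((lab \<circ> w) ` C))" unfolding C(3) .
    have labz: "lab z = x" "lab z' = x'"
      using lab[OF zD(1), of c x] lab[OF zD(2), of c x'] val cx x' r
      by (auto simp: big_def W_def \<phi>(2) r_def)
    have "z \<in> w ` C" "z' \<in> w ` C" using z val zD by (auto simp: C_def)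
    then have "x \<in> (lab \<circ> w) ` C" "x' \<in> (lab \<circ> w) ` C" using labz by (auto simp: image_comp[symmetric])
    moreover have "x \<in> topspace X" "x' \<in> topspace X" using fr zD cx x' by blast+
    ultimately obtain T T' where T: "openin (subtopology X ((lab \<circ> w) ` C)) T" "openin (subtopology X ((lab \<circ> w) ` C)) T'"
      "x \<in> T" "x' \<in> T'" "disjnt T T'"
      using L xx' unfolding Hausdorff_space_def by (metis IntI topspace_subtopology)
    then obtain U U' where U: "openin X U" "openin X U'" "T = U \<inter> (lab \<circ> w) ` C" "T' = U' \<inter> (lab \<circ> w) ` C"
      by (auto simp: openin_subtopology)
    let ?B = "{v \<in> topspace ?D. \<Sigma> g2 v \<in> {1/2<..}} \<inter> {v \<in> topspace ?D. \<Sigma> g1 v \<in> {..<3/2}}"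
    have B: "openin ?D ?B"
      by (intro openin_Int openin_continuous_map_preimage[OF cont\<Sigma>[OF g(1,2)]] openin_continuous_map_preimage[OF cont\<Sigma>[OF g(3,4)]])
         (simp_all add: open_openin[symmetric])
    show ?thesis
    proof (intro exI conjI)
      show "openin ?D (U2 U \<inter> ?B)" "openin ?D (U2 U' \<inter> ?B)" using U2 U(1,2) B by (auto intro: openin_Int)
      show "z \<in> U2 U \<inter> ?B" "z' \<in> U2 U' \<inter> ?B"
        using U2_lab[of z U] U2_lab[of z' U'] labz T(3,4) U(3,4) val zD by auto
      show "(U2 U \<inter> ?B) \<inter> (U2 U' \<inter> ?B) \<inter> w ` topspace K = {}"
      proof (rule ccontr)
        assume "(U2 U \<inter> ?B) \<inter> (U2 U' \<inter> ?B) \<inter> w ` topspace K \<noteq> {}"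
        then obtain k where k: "k \<in> topspace K" "w k \<in> U2 U" "w k \<in> U2 U'" "w k \<in> ?B" by blast
        then have "k \<in> C" by (auto simp: C_def)
        moreover have "lab (w k) \<in> U" "lab (w k) \<in> U'" using U2_lab[of "w k" U] U2_lab[of "w k" U'] k by auto
        ultimately have "lab (w k) \<in> T \<inter> T'" using U(3,4) by auto
        then show False using T(5) by (auto simp: disjnt_def)
      qed
    qed
  qed
qed

lemma k_Hausdorff_D_space:
  fixes u :: "'x \<Rightarrow> real"
  assumes X: "k_Hausdorff X" and u: "continuous_map X euclideanreal u"
    and u0: "\<And>x. x \<in> topspace X \<Longrightarrow> 0 \<le> u x" "\<And>x. x \<in> topspace X \<Longrightarrow> u x = 0 \<longleftrightarrow> x = b" and b: "b \<in> topspace X"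
  shows "k_Hausdorff (D_space V J b X)"
  unfolding k_Hausdorff_def
proof (intro allI impI, elim conjE)
  fix K :: "(nat \<times> (nat, 'v, 'a) fr_emb \<times> (nat \<Rightarrow> 'x)) set set topology" and w
  assume K: "compact_space K" "Hausdorff_space K" and w: "continuous_map K (D_space V J b X) w"
  let ?D = "D_space V J b X"
  let ?S = "subtopology ?D (w ` topspace K)"
  show "Hausdorff_space ?S"
  proof (rule Hausdorff_space_separating_maps)
    fix z z' assume z: "z \<in> topspace ?S" "z' \<in> topspace ?S" "z \<noteq> z'"
    then have zw: "z \<in> w ` topspace K" "z' \<in> w ` topspace K" and zD: "z \<in> topspace ?D" "z' \<in> topspace ?D" by auto
    have "config V b z \<noteq> config V b z'" using D_space_eqI[OF V zD] z(3) by blast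
    then obtain p where "p \<in> config V b z \<and> p \<notin> config V b z' \<or> p \<in> config V b z' \<and> p \<notin> config V b z" by blast
    then consider c x where "(c, x) \<in> config V b z" "(c, x) \<notin> config V b z'"
      | c x where "(c, x) \<in> config V b z'" "(c, x) \<notin> config V b z" by (cases p) blast
    then obtain A A' where A: "openin ?D A" "openin ?D A'" "z \<in> A" "z' \<in> A'" "A \<inter> A' \<inter> w ` topspace K = {}"
    proof cases
      case 1
      from k_Hausdorff_D_space_aux[OF X u u0 b K w zw 1] show ?thesis using that by blast
    next
      case 2
      from k_Hausdorff_D_space_aux[OF X u u0 b K w zw(2,1) 2] show ?thesis using that by blast
    qed
    show "\<exists>A A'. openin ?S A \<and> openin ?S A' \<and> z \<in> A \<and> z' \<in> A' \<and> A \<inter> A' \<inter> topspace ?S = {}"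
    proof (intro exI conjI)
      show "openin ?S (A \<inter> w ` topspace K)" "openin ?S (A' \<inter> w ` topspace K)"
        using A by (auto simp: openin_subtopology)
    qed (use A zw in auto)
  qed
qed

text \<open>The base point of the configuration space is the zero set of the total weight.\<close>

lemma D_space_weight:
  fixes u :: "'x \<Rightarrow> real"
  assumes u: "continuous_map X euclideanreal u"
    and u0: "\<And>x. x \<in> topspace X \<Longrightarrow> 0 \<le> u x" "\<And>x. x \<in> topspace X \<Longrightarrow> u x = 0 \<longleftrightarrow> x = b" and b: "b \<in> topspace X"
  shows "\<exists>u'. continuous_map (D_space V J b X) euclideanreal u' \<and>
    (\<forall>z\<in>topspace (D_space V J b X). 0 \<le> u' z \<and> (u' z = 0 \<longleftrightarrow> z = D_base V J b X))"
proof (intro exI conjI ballI)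
  let ?u = "\<lambda>z. \<Sum>(c, y)\<in>config V b z. u y"
  show "continuous_map (D_space V J b X) euclideanreal ?u"
  proof (rule continuous_map_config_sum)
    show "u b = 0" using u0(2)[OF b] by simp
    show "continuous_map (D_slice V J X k) euclideanreal (\<lambda>(e, x). u (x i))" if "i < k" for k i
      using continuous_map_compose[OF continuous_map_D_slice(2)[OF that] u] by (simp add: o_def case_prod_unfold)
  qed
  fix z assume z: "z \<in> topspace (D_space V J b X)"
  have pos: "0 < u y" if "(c, y) \<in> config V b z" for c y
    using config_framed[OF V D_space_pre[OF V z] that] u0 by force
  show "0 \<le> ?u z" by (rule sum_nonneg) (use pos in \<open>force intro: less_imp_le\<close>)
  show "?u z = 0 \<longleftrightarrow> z = D_base V J b X"
  proof
    assume "?u z = 0"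
    then have "\<forall>p\<in>config V b z. (case p of (c, y) \<Rightarrow> u y) = 0"
      using sum_nonneg_eq_0_iff[OF finite_config, of b z "\<lambda>(c, y). u y"] pos by (force intro: less_imp_le)
    then have "config V b z = {}" using pos by fastforce
    then show "z = D_base V J b X"
      by (intro D_space_eqI[OF V z D_base_mem[OF V]]) (simp add: config_D_base[OF V])
  qed (simp add: config_D_base[OF V])
qed

end


section \<open>Continuous maps between configuration spaces\<close>

lemma continuous_map_into_D_slice:
  assumes P: "closedin (kify S) P" and X: "k_Hausdorff X"
    and e: "continuous_map (subtopology (kify S) P) (Emb V k J) e"
    and x: "\<And>i. i < k \<Longrightarrow> continuous_map (subtopology (kify S) P) X (\<lambda>p. x p i)"
  shows "continuous_map (subtopology (kify S) P) (D_slice V J X k) (\<lambda>p. (e p, \<lambda>i\<in>{..<k}. x p i))"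
  unfolding kprod_def
proof (rule continuous_map_into_kify_closed[OF _ _ P])
  have kX: "k_Hausdorff (product_topology (\<lambda>_. X) {..<k})" by (rule k_Hausdorff_product) (rule X)
  have "continuous_map (subtopology (kify S) P) (kpower X k) (\<lambda>p. \<lambda>i\<in>{..<k}. x p i)"
    unfolding kpower_def
    by (rule continuous_map_into_kify_closed[OF _ kX P]) (use x in \<open>auto simp: continuous_map_componentwise\<close>)
  then show "continuous_map (subtopology (kify S) P) (prod_topology (Emb V k J) (kpower X k))
      (\<lambda>p. (e p, \<lambda>i\<in>{..<k}. x p i))"
    using e by (simp add: continuous_map_pairwise o_def)
  show "k_Hausdorff (prod_topology (Emb V k J) (kpower X k))"
    unfolding kpower_def
    by (intro k_Hausdorff_prod k_Hausdorff_kify kX Hausdorff_imp_k_Hausdorff Hausdorff_space_fr_emb_space)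
qed

lemma continuous_map_into_D_space:
  assumes "closedin (kify S) P" "k_Hausdorff X"
    "continuous_map (subtopology (kify S) P) (Emb V k J) e"
    "\<And>i. i < k \<Longrightarrow> continuous_map (subtopology (kify S) P) X (\<lambda>p. x p i)"
  shows "continuous_map (subtopology (kify S) P) (D_space V J b X) (\<lambda>p. D_class V J b X (k, e p, \<lambda>i\<in>{..<k}. x p i))"
  using continuous_map_compose[OF continuous_map_into_D_slice[OF assms] continuous_map_D_class[where b = b]] by (simp add: o_def)

lemma closedin_kify_UNIV: "closedin (kify S) (topspace S)" "subtopology (kify S) (topspace S) = kify S"
  by (metis closedin_topspace topspace_kify, metis subtopology_topspace topspace_kify)

context
  fixes V :: "'v::euclidean_space set"
  assumes V: "subspace V"
begin

lemma D_map_D_class: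
  assumes z: "z \<in> topspace (D_pre V J X)" and h: "h \<in> topspace X \<rightarrow> topspace Y" "h b = c"
  shows "D_map V J c Y h (D_class V J b X z) = D_map V J c Y h z"
  by (rule D_space_eqI[OF V D_map_mem[OF V D_class_pre[OF V z] h(1)] D_map_mem[OF V z h(1)]])
     (simp add: config_D_map[OF V, of h b c] h(2) config_D_class[OF V])

lemma strip_D_class:
  assumes z: "z \<in> topspace (D_pre V J X)"
  shows "strip V b X j (D_class V J b X z) = strip V b X j z"
  by (rule D_space_eqI[OF V strip_mem[OF V D_class_pre[OF V z]] strip_mem[OF V z]])
     (simp add: config_strip[OF V] config_D_class[OF V])

lemma continuous_map_D_map:
  assumes h: "continuous_map X Y h" "h b = c" and Y: "k_Hausdorff Y"
  shows "continuous_map (D_space V J b X) (D_space V J c Y) (D_map V J c Y h)"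
proof (rule continuous_map_from_D_space)
  fix k
  have hf: "h \<in> topspace X \<rightarrow> topspace Y" using h by (auto simp: continuous_map_def)
  let ?S = "prod_topology (Emb V k J) (kpower X k)"
  have "continuous_map (D_slice V J X k) (D_space V J c Y) (\<lambda>p. D_class V J c Y (k, fst p, \<lambda>i\<in>{..<k}. h (snd p i)))"
    using continuous_map_into_D_space[OF closedin_kify_UNIV(1) Y, of ?S V k J fst "\<lambda>p i. h (snd p i)" c]
      continuous_map_D_slice(1)[of V k J X] continuous_map_compose[OF continuous_map_D_slice(2) h(1), of _ k V J]
    unfolding closedin_kify_UNIV(2) unfolding kprod_def[symmetric] by (simp add: o_def)
  then show "continuous_map (D_slice V J X k) (D_space V J c Y) (\<lambda>(e, x). D_map V J c Y h (D_class V J b X (k, e, x)))"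
  proof (rule continuous_map_eq)
    fix p assume "p \<in> topspace (D_slice V J X k)"
    then have p: "(k, fst p, snd p) \<in> topspace (D_pre V J X)" by (simp add: D_pre_slice)
    show "D_class V J c Y (k, fst p, \<lambda>i\<in>{..<k}. h (snd p i)) = (case p of (e, x) \<Rightarrow> D_map V J c Y h (D_class V J b X (k, e, x)))"
      using D_map_D_class[OF p hf h(2)] by (simp add: case_prod_unfold D_map_def o_def)
  qed
qed

lemma continuous_map_glue:
  assumes "finite J" and P: "closedin (kify S) P" and X: "k_Hausdorff X"
    and g: "\<And>j. j \<in> J \<Longrightarrow> continuous_map (subtopology (kify S) P) X (g j)"
  shows "continuous_map (subtopology (kify S) P) (D_space V J b X) (\<lambda>p. glue V J b X (\<lambda>j. g j p))"
  unfolding glue_def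
proof (rule continuous_map_into_D_space[OF P X])
  have "bij_betw (enum J) {..<card J} J" by (rule enum[OF assms(1)])
  then show "continuous_map (subtopology (kify S) P) (fr_emb_space V {..<card J} J) (\<lambda>p. fr_emb_std V {..<card J} (enum J))"
    using fr_emb_std_mem[OF V, of "enum J" "{..<card J}" J] by (simp add: bij_betw_def)
  show "continuous_map (subtopology (kify S) P) X (\<lambda>p. g (enum J i) p)" if "i < card J" for i
    using enum_image[OF assms(1)] that by (intro g) auto
qed

lemma continuous_map_glue_D_space:
  assumes "finite J" and X: "k_Hausdorff X"
    and g: "\<And>j. j \<in> J \<Longrightarrow> continuous_map (D_space V J c Y) X (g j)"
  shows "continuous_map (D_space V J c Y) (D_space V J b X) (\<lambda>z. glue V J b X (\<lambda>j. g j z))"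
proof (rule continuous_map_from_D_space)
  fix k
  let ?S = "prod_topology (Emb V k J) (kpower Y k)"
  have "continuous_map (D_slice V J Y k) X (\<lambda>p. g j (D_class V J c Y (k, p)))" if "j \<in> J" for j
    using continuous_map_compose[OF continuous_map_D_class g[OF that], of k] by (simp add: o_def case_prod_unfold)
  then have "continuous_map (D_slice V J Y k) (D_space V J b X) (\<lambda>p. glue V J b X (\<lambda>j. g j (D_class V J c Y (k, p))))"
    using continuous_map_glue[OF assms(1) closedin_kify_UNIV(1) X, of ?S "\<lambda>j p. g j (D_class V J c Y (k, p))" b]
    unfolding closedin_kify_UNIV(2) unfolding kprod_def[symmetric] by blast
  then show "continuous_map (D_slice V J Y k) (D_space V J b X) (\<lambda>(e, x). glue V J b X (\<lambda>j. g j (D_class V J c Y (k, e, x))))"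
    by (simp add: case_prod_unfold)
qed

lemma openin_comp_target:
  assumes "i < k"
  shows "openin (Emb V k J) {e \<in> topspace (Emb V k J). comp_target (component V e i) = j \<longleftrightarrow> B}"
proof -
  have "continuous_map (Emb V k J) (mfd V J) (\<lambda>e. fst e (i, 0))"
    by (rule continuous_map_fr_emb_eval(1)) (use assms subspace_0[OF V] in auto)
  from continuous_map_compose[OF this[unfolded mfd_def] continuous_map_fst]
  have c: "continuous_map (Emb V k J) (discrete_topology J) (\<lambda>e. comp_target (component V e i))"
    by (simp add: o_def comp_target_component[OF V])
  have "openin (Emb V k J) {e \<in> topspace (Emb V k J). comp_target (component V e i) \<in> {j' \<in> J. j' = j \<longleftrightarrow> B}}"
    by (rule openin_continuous_map_preimage[OF c]) auto
  moreover have "{e \<in> topspace (Emb V k J). comp_target (component V e i) \<in> {j' \<in> J. j' = j \<longleftrightarrow> B}} =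
    {e \<in> topspace (Emb V k J). comp_target (component V e i) = j \<longleftrightarrow> B}"
    using c by (auto simp: continuous_map_def)
  ultimately show ?thesis by simp
qed

text \<open>
  The framed embeddings for which \<open>K\<close> is the set of copies that land in the copy of \<open>V\<close> with index \<open>j\<close>.  This
  set is open and closed, and on it \<^const>\<open>strip\<close> is given by a fixed transfer.
\<close>

definition target_set :: "'j set \<Rightarrow> nat \<Rightarrow> 'j \<Rightarrow> nat set \<Rightarrow> (nat, 'v, 'j) fr_emb set" where
  "target_set J k j K = {e \<in> topspace (Emb V k J). {i. i < k \<and> comp_target (component V e i) = j} = K}"

lemma openin_target_set: "openin (Emb V k J) (target_set J k j K)"
proof (cases "K \<subseteq> {..<k}")
  case True
  let ?E = "Emb V k J"
  have "target_set J k j K = topspace ?E \<inter> (\<Inter>i<k. {e \<in> topspace ?E. comp_target (component V e i) = j \<longleftrightarrow> i \<in> K})"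
  proof -
    have "{i. i < k \<and> Q i} = K \<longleftrightarrow> (\<forall>i<k. Q i \<longleftrightarrow> i \<in> K)" for Q using True by blast
    then have "target_set J k j K = {e \<in> topspace ?E. \<forall>i<k. comp_target (component V e i) = j \<longleftrightarrow> i \<in> K}"
      unfolding target_set_def by simp
    then show ?thesis by blast
  qed
  moreover have "openin ?E (topspace ?E \<inter> (\<Inter>i<k. {e \<in> topspace ?E. comp_target (component V e i) = j \<longleftrightarrow> i \<in> K}))"
  proof (cases "k = 0")
    case False
    then show ?thesis by (intro openin_Int openin_topspace openin_INT2) (auto intro: openin_comp_target)
  qed simp
  ultimately show ?thesis by simp
next
  case False
  then have "target_set J k j K = {}" unfolding target_set_def by auto
  then show ?thesis by simp
qed

lemma closedin_target_set: "closedin (Emb V k J) (target_set J k j K)"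
proof -
  have "topspace (Emb V k J) - target_set J k j K = (\<Union>K'\<in>UNIV - {K}. target_set J k j K')"
    unfolding target_set_def by auto
  moreover have "openin (Emb V k J) (\<Union>K'\<in>UNIV - {K}. target_set J k j K')"
    by (intro openin_Union) (auto intro: openin_target_set)
  moreover have "target_set J k j K \<subseteq> topspace (Emb V k J)" unfolding target_set_def by blast
  ultimately show ?thesis by (simp add: closedin_def)
qed

lemma continuous_map_strip:
  fixes J :: "'j set"
  assumes X: "k_Hausdorff X" and j: "j \<in> J"
  shows "continuous_map (D_space V J b X) (D_space V {()} b X) (strip V b X j)"
proof (rule continuous_map_from_D_space)
  fix k
  let ?S = "prod_topology (Emb V k J) (kpower X k)"
  have "continuous_map (D_slice V J X k) (D_space V {()} b X) (\<lambda>p. strip V b X j (k, p))"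
  proof (rule continuous_map_open_cover)
    fix p assume p: "p \<in> topspace (D_slice V J X k)"
    define K where "K = {i. i < k \<and> comp_target (component V (fst p) i) = j}"
    have fK: "finite K" and Kk: "K \<subseteq> {..<k}" by (auto simp: K_def)
    let ?Q = "target_set J k j K"
    define P where "P = {p \<in> topspace (D_slice V J X k). fst p \<in> ?Q}"
    have oP: "openin (D_slice V J X k) P" and cP: "closedin (D_slice V J X k) P"
      unfolding P_def
      by (rule openin_continuous_map_preimage[OF continuous_map_D_slice(1) openin_target_set],
          rule closedin_continuous_map_preimage[OF continuous_map_D_slice(1) closedin_target_set])
    have "fst p \<in> topspace (Emb V k J)" using p by (simp add: topspace_D_slice mem_Times_iff)
    then have pP: "p \<in> P" using p unfolding P_def target_set_def K_def by simp
    have s: "inj_on (enum K) {..<card K}" "enum K ` {..<card K} = K" using enum[OF fK] by (auto simp: bij_betw_def)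
    have sK: "enum K i \<in> K" if "i < card K" for i using s(2) that by auto
    have "continuous_map (subtopology (Emb V k J) ?Q) (fr_emb_space V {..<card K} {()})
        (fr_emb_transfer V {..<card K} (enum K) (\<lambda>_. ()))"
    proof (rule continuous_map_fr_emb_transfer[OF V s(1)])
      show "openin (Emb V k J) ?Q" "closedin (Emb V k J) ?Q"
        by (rule openin_target_set, rule closedin_target_set)
      show "{j} \<subseteq> J" using j by simp
      show "enum K ` {..<card K} \<subseteq> {..<k}" using s(2) Kk by simp
      show "comp_target (component V e (enum K i)) \<in> {j}" if "e \<in> ?Q" "i \<in> {..<card K}" for e i
      proof -
        have "enum K i \<in> {i. i < k \<and> comp_target (component V e i) = j}"
          using that sK[of i] unfolding target_set_def by auto
        then show ?thesis by simp
      qed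
    qed (use j in \<open>auto simp: inj_on_def\<close>)
    moreover have "continuous_map (subtopology (D_slice V J X k) P) (subtopology (Emb V k J) ?Q) fst"
      by (auto simp: continuous_map_in_subtopology P_def intro: continuous_map_from_subtopology continuous_map_D_slice(1))
    ultimately have e: "continuous_map (subtopology (D_slice V J X k) P) (fr_emb_space V {..<card K} {()})
        (\<lambda>p. fr_emb_transfer V {..<card K} (enum K) (\<lambda>_. ()) (fst p))"
      using continuous_map_compose[of "subtopology (D_slice V J X k) P" _ fst] by (fastforce simp: o_def)
    have x: "continuous_map (subtopology (D_slice V J X k) P) X (\<lambda>p. snd p (enum K i))" if "i < card K" for i
      using sK[OF that] Kk by (intro continuous_map_from_subtopology continuous_map_D_slice(2)) auto
    have "continuous_map (subtopology (D_slice V J X k) P) (D_space V {()} b X)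
      (\<lambda>p. D_class V {()} b X (card K, fr_emb_transfer V {..<card K} (enum K) (\<lambda>_. ()) (fst p), \<lambda>i\<in>{..<card K}. snd p (enum K i)))"
      using continuous_map_into_D_space[OF cP[unfolded kprod_def] X e[unfolded kprod_def] x[unfolded kprod_def], where b = b]
      unfolding kprod_def[symmetric] .
    then have "continuous_map (subtopology (D_slice V J X k) P) (D_space V {()} b X) (\<lambda>p. strip V b X j (k, p))"
    proof (rule continuous_map_eq)
      fix p' assume "p' \<in> topspace (subtopology (D_slice V J X k) P)"
      then have "{i. i < k \<and> comp_target (component V (fst p') i) = j} = K" by (simp add: P_def target_set_def)
      then show "D_class V {()} b X (card K, fr_emb_transfer V {..<card K} (enum K) (\<lambda>_. ()) (fst p'), \<lambda>i\<in>{..<card K}. snd p' (enum K i)) =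
        strip V b X j (k, p')" by (simp add: strip_def case_prod_unfold Let_def)
    qed
    then show "\<exists>P. openin (D_slice V J X k) P \<and> p \<in> P \<and>
       continuous_map (subtopology (D_slice V J X k) P) (D_space V {()} b X) (\<lambda>p. strip V b X j (k, p))"
      using oP pP by blast
  qed
  then show "continuous_map (D_slice V J X k) (D_space V {()} b X) (\<lambda>(e, x). strip V b X j (D_class V J b X (k, e, x)))"
    by (rule continuous_map_eq) (auto simp: strip_D_class D_pre_slice)
qed

end


section \<open>The conjugation action\<close>

lemma comp_conj_std:
  assumes V: "subspace V" and inv: "linear_inverses V T T'"
  shows "comp_conj T T' V a (comp_std V j) = comp_std V (a j)"
  using linear_inversesD[OF inv] by (auto simp: comp_conj_def comp_std_def fun_eq_iff restrict_def)

lemma comp_relabel_conj: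
  assumes "framed V J c" and inv: "linear_inverses V T T'"
  shows "comp_relabel V (\<lambda>_. ()) (comp_conj T T' V a c) = comp_conj T T' V a' (comp_relabel V (\<lambda>_. ()) c)"
  using linear_inversesD(2)[OF inv] by (cases c) (auto simp: comp_conj_def comp_relabel_def fun_eq_iff restrict_def)

lemma comp_target_conj:
  "subspace V \<Longrightarrow> linear_inverses V T T' \<Longrightarrow> comp_target (comp_conj T T' V a c) = a (comp_target c)"
  by (cases c) (simp add: comp_conj_def comp_target_def subspace_0 fst_map_prod linear_inverses_0)

text \<open>
  On the second factor the action on the indices is trivial, as its target is the disjoint union of
  the sources of the first factor.  The end points of the paths match by the chain rule.
\<close>

lemma comp_conj_compose:
  fixes V :: "'v::euclidean_space set" and c :: "('v, 'j) fr_comp" and c' :: "('v, 'k) fr_comp"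
  assumes V: "subspace V" and c: "framed V J c" and c': "framed V K c'"
    and inv: "linear_inverses V T T'"
  shows "comp_conj T T' V a (comp_compose V c c') = comp_compose V (comp_conj T T' V a c) (comp_conj T T' V (\<lambda>j. j) c')"
proof -
  note T = linear_inversesD[OF inv]
  obtain g m \<beta> f l \<alpha> where d: "c = (g, m, \<beta>)" "c' = (f, l, \<alpha>)" by (metis prod.collapse)
  have f: "\<And>x. x \<in> V \<Longrightarrow> snd (f x) \<in> V" "smooth_on_subspace V (\<lambda>x. snd (f x))" "0 \<le> l"
    and fe: "\<And>t x w. t \<ge> l \<Longrightarrow> x \<in> V \<Longrightarrow> w \<in> V \<Longrightarrow> \<alpha> t (x, w) = dir_deriv w (\<lambda>y. snd (f y)) x"
    using c' unfolding d framed_def prod.case by blast+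
  let ?f = "\<lambda>x\<in>V. map_prod (\<lambda>j. j) T (f (T' x))"
  have "framed V UNIV (comp_conj T T' V (\<lambda>j. j) c')"
    by (rule framed_conj[OF V c' _ inv]) auto
  then have fe': "(\<lambda>t\<in>{0..}. \<lambda>(x, w)\<in>V \<times> V. T (\<alpha> t (T' x, T' w))) t (x, w) = dir_deriv w (\<lambda>y. snd (?f y)) x"
    if "t \<ge> l" "x \<in> V" "w \<in> V" for t x w
    using that unfolding d comp_conj_def framed_def prod.case by blast
  have dd: "dir_deriv w (\<lambda>y. snd (?f y)) x = T (dir_deriv (T' w) (\<lambda>y. snd (f y)) (T' x))" if "x \<in> V" "w \<in> V" for x w
    using fe'[OF order_refl that] fe[OF order_refl T(2)[OF that(1)] T(2)[OF that(2)]] f(3) that by simp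
  have dV: "dir_deriv w (\<lambda>y. snd (f y)) x \<in> V" if "x \<in> V" "w \<in> V" for x w
    by (rule dir_deriv_mem_subspace[OF V f(2) _ that]) (use f(1) in auto)
  have 1: "(\<lambda>x\<in>V. map_prod a T ((\<lambda>x\<in>V. g (snd (f x))) (T' x))) =
     (\<lambda>x\<in>V. (\<lambda>x\<in>V. map_prod a T (g (T' x))) (snd (?f x)))"
    by (rule restrict_ext) (use T f(1) in \<open>simp add: snd_map_prod\<close>)
  have 2: "(\<lambda>(x, w)\<in>V \<times> V. T ((\<lambda>(x, w)\<in>V \<times> V. if t \<le> l then \<alpha> t (x, w)
        else \<beta> (t - l) (snd (f x), dir_deriv w (\<lambda>y. snd (f y)) x)) (T' x, T' w))) =
     (\<lambda>(x, w)\<in>V \<times> V. if t \<le> l then (\<lambda>(x, w)\<in>V \<times> V. T (\<alpha> t (T' x, T' w))) (x, w)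
        else (\<lambda>t\<in>{0..}. \<lambda>(x, w)\<in>V \<times> V. T (\<beta> t (T' x, T' w))) (t - l) (snd (?f x), dir_deriv w (\<lambda>y. snd (?f y)) x))"
    if t: "t \<in> {0..}" for t
  proof (rule restrict_ext)
    fix z assume "z \<in> V \<times> V"
    then obtain x w where z: "z = (x, w)" "x \<in> V" "w \<in> V" by auto
    note D = dd[OF z(2,3)] and E = dV[OF T(2)[OF z(2)] T(2)[OF z(3)]] and F = f(1)[OF T(2)[OF z(2)]]
    show "(case z of (x, w) \<Rightarrow> T ((\<lambda>(x, w)\<in>V \<times> V. if t \<le> l then \<alpha> t (x, w)
        else \<beta> (t - l) (snd (f x), dir_deriv w (\<lambda>y. snd (f y)) x)) (T' x, T' w))) =
      (case z of (x, w) \<Rightarrow> if t \<le> l then (\<lambda>(x, w)\<in>V \<times> V. T (\<alpha> t (T' x, T' w))) (x, w)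
        else (\<lambda>t\<in>{0..}. \<lambda>(x, w)\<in>V \<times> V. T (\<beta> t (T' x, T' w))) (t - l) (snd (?f x), dir_deriv w (\<lambda>y. snd (?f y)) x))"
    proof (cases "t \<le> l")
      case True
      then show ?thesis using z T by simp
    next
      case False
      have H: "(\<lambda>t\<in>{0..}. \<lambda>(x, w)\<in>V \<times> V. T (\<beta> t (T' x, T' w))) (t - l) (snd (?f x), dir_deriv w (\<lambda>y. snd (?f y)) x) =
         T (\<beta> (t - l) (snd (f (T' x)), dir_deriv (T' w) (\<lambda>y. snd (f y)) (T' x)))"
        unfolding D using False z(2) T(1,4)[OF E] T(1,4)[OF F] by (simp add: snd_map_prod)
      have L: "(\<lambda>(x, w)\<in>V \<times> V. if t \<le> l then \<alpha> t (x, w)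
        else \<beta> (t - l) (snd (f x), dir_deriv w (\<lambda>y. snd (f y)) x)) (T' x, T' w) =
        \<beta> (t - l) (snd (f (T' x)), dir_deriv (T' w) (\<lambda>y. snd (f y)) (T' x))"
        using False z T by simp
      show ?thesis unfolding z(1) prod.case L by (simp only: H False if_False)
    qed
  qed
  show ?thesis
    unfolding d comp_compose_def comp_conj_def prod.case prod.inject
    apply (intro conjI)
    subgoal by (rule 1)
    subgoal by (rule refl)
    subgoal
      apply (rule restrict_ext)
      subgoal premises t for t using 2[OF t] unfolding restrict_apply'[OF t] .
      done
    done
qed

lemma orthogonal_rep_inverses:
  assumes G: "group G" and rep: "orthogonal_rep G V \<rho>" and g: "g \<in> carrier G"
  shows "linear_inverses V (\<rho> g) (\<rho> (inv\<^bsub>G\<^esub> g))"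
proof -
  interpret group G by (rule G)
  interpret A: group_action G V "\<lambda>g. restrict (\<rho> g) V" using rep by (simp add: orthogonal_rep_def)
  have ex: "\<exists>T. linear T \<and> (\<forall>v\<in>V. \<rho> h v = T v)" if "h \<in> carrier G" for h
    using rep that orthogonal_transformation_linear unfolding orthogonal_rep_def by blast
  obtain S where S: "linear S" "\<forall>v\<in>V. \<rho> g v = S v" using ex[OF g] by blast
  obtain S' where S': "linear S'" "\<forall>v\<in>V. \<rho> (inv\<^bsub>G\<^esub> g) v = S' v" using ex[OF inv_closed[OF g]] by blast
  have m: "\<rho> h x \<in> V" if "h \<in> carrier G" "x \<in> V" for h x
    using A.element_image[OF that refl] that by simp
  have i: "\<rho> (inv\<^bsub>G\<^esub> h) (\<rho> h x) = x" if "h \<in> carrier G" "x \<in> V" for h x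
    using A.orbit_sym_aux[OF that refl] m[OF that] that by simp
  show ?thesis
    unfolding linear_inverses_def
    by (intro exI[of _ S] exI[of _ S'] conjI ballI)
       (use S S' m[OF g] m[OF inv_closed[OF g]] i[OF g] i[OF inv_closed[OF g]] g in auto)
qed

context
  fixes G :: "('g, 'm) monoid_scheme" and V :: "'v::euclidean_space set" and \<rho>
  assumes G: "group G" and rep: "orthogonal_rep G V \<rho>"
begin

lemma rep_subspace: "subspace V"
  using rep by (simp add: orthogonal_rep_def)

lemma D_conj_mem_config:
  assumes z: "z \<in> topspace (D_pre V J X)" and g: "g \<in> carrier G"
    and a: "inj_on (actJ g) J" "actJ g ` J \<subseteq> J" and x: "actX g \<in> topspace X \<rightarrow> topspace X" "actX g b = b"
  shows "D_conj G V \<rho> J actJ b X actX g z \<in> topspace (D_space V J b X)"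
    and "config V b (D_conj G V \<rho> J actJ b X actX g z) =
      {(comp_conj (\<rho> g) (\<rho> (inv\<^bsub>G\<^esub> g)) V (actJ g) \<xi>, actX g x) | \<xi> x. (\<xi>, x) \<in> config V b z \<and> actX g x \<noteq> b}"
proof -
  obtain k e y where d: "z = (k, e, y)" by (metis prod.collapse)
  have e: "e \<in> topspace (Emb V k J)" and y: "y \<in> {..<k} \<rightarrow>\<^sub>E topspace X" using z by (auto simp: d topspace_D_pre)
  note inv = orthogonal_rep_inverses[OF G rep g]
  note T = linear_inversesD[OF inv]
  have "fr_emb_conj G V \<rho> {..<k} actJ g e \<in> topspace (Emb V k J)"
    by (rule fr_emb_conj_mem[where actJ = actJ and \<rho> = \<rho> and G = G and g = g, OF rep_subspace e inv a])
  then show "D_conj G V \<rho> J actJ b X actX g z \<in> topspace (D_space V J b X)"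
    unfolding D_conj_def d prod.case
    by (intro D_class_mem[OF rep_subspace]) (use x y in \<open>auto simp: topspace_D_pre PiE_iff\<close>)
  have "config V b (D_conj G V \<rho> J actJ b X actX g z) =
     {(comp_conj (\<rho> g) (\<rho> (inv\<^bsub>G\<^esub> g)) V (actJ g) (component V e i), actX g (y i)) | i. i < k \<and> actX g (y i) \<noteq> b}"
    unfolding D_conj_def d prod.case config_D_class[OF rep_subspace]
    using component_conj[of _ "{..<k}" V \<rho> G g actJ e] T(2) by (fastforce simp: config_def)
  also have "\<dots> = {(comp_conj (\<rho> g) (\<rho> (inv\<^bsub>G\<^esub> g)) V (actJ g) \<xi>, actX g x) | \<xi> x. (\<xi>, x) \<in> config V b z \<and> actX g x \<noteq> b}"
    unfolding config_def d prod.case using x(2) by blast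
  finally show "config V b (D_conj G V \<rho> J actJ b X actX g z) =
      {(comp_conj (\<rho> g) (\<rho> (inv\<^bsub>G\<^esub> g)) V (actJ g) \<xi>, actX g x) | \<xi> x. (\<xi>, x) \<in> config V b z \<and> actX g x \<noteq> b}" .
qed

end


section \<open>Identities between operations on configurations\<close>

lemma D_map_cong:
  assumes "z \<in> topspace (D_pre V J X)" "\<And>x. x \<in> topspace X \<Longrightarrow> h x = h' x"
  shows "D_map V J c Y h z = D_map V J c Y h' z"
proof -
  obtain k e x where z: "z = (k, e, x)" by (metis prod.collapse)
  have "restrict (h \<circ> x) {..<k} = restrict (h' \<circ> x) {..<k}"
    by (rule restrict_ext) (use assms in \<open>auto simp: z topspace_D_pre PiE_iff\<close>)
  then show ?thesis by (simp add: z D_map_def)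
qed

context
  fixes V :: "'v::euclidean_space set"
  assumes V: "subspace V"
begin

lemma D_map_D_map:
  assumes z: "z \<in> topspace (D_pre V J X)" and h: "h \<in> topspace X \<rightarrow> topspace Y" "h b = c"
    and h': "h' \<in> topspace Y \<rightarrow> topspace Z" "h' c = d"
  shows "D_map V J d Z h' (D_map V J c Y h z) = D_map V J d Z (h' \<circ> h) z"
proof (rule D_space_eqI[OF V])
  show "D_map V J d Z h' (D_map V J c Y h z) \<in> topspace (D_space V J d Z)"
    by (rule D_map_mem[OF V D_space_pre[OF V D_map_mem[OF V z h(1)]] h'(1)])
  show "D_map V J d Z (h' \<circ> h) z \<in> topspace (D_space V J d Z)"
    by (rule D_map_mem[OF V z]) (use h h' in auto)
  have "config V d (D_map V J d Z (h' \<circ> h) z) = {(\<xi>, h' (h x)) | \<xi> x. (\<xi>, x) \<in> config V b z \<and> h' (h x) \<noteq> d}"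
    using config_D_map[OF V, of "h' \<circ> h" b d J Z z] h(2) h'(2) by simp
  then show "config V d (D_map V J d Z h' (D_map V J c Y h z)) = config V d (D_map V J d Z (h' \<circ> h) z)"
    unfolding config_D_map[where h = h' and b = c and c = d, OF V h'(2)] config_D_map[where h = h and b = b and c = c, OF V h(2)] using h'(2) by blast
qed

lemma D_map_unit:
  assumes "h \<in> topspace X \<rightarrow> topspace Y" "h b = c" "x \<in> topspace X"
  shows "D_map V {()} c Y h (D_unit V b X x) = D_unit V c Y (h x)"
proof (rule D_space_eqI[OF V])
  show "D_map V {()} c Y h (D_unit V b X x) \<in> topspace (D_space V {()} c Y)"
    by (rule D_map_mem[OF V D_space_pre[OF V D_unit_mem[OF V assms(3)]] assms(1)])
  show "D_unit V c Y (h x) \<in> topspace (D_space V {()} c Y)"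
    by (rule D_unit_mem[OF V]) (use assms in auto)
  show "config V c (D_map V {()} c Y h (D_unit V b X x)) = config V c (D_unit V c Y (h x))"
    unfolding config_D_map[where h = h and b = b and c = c, OF V assms(2)] config_D_unit[OF V] using assms(2) by auto
qed

lemma D_map_base:
  assumes "h \<in> topspace X \<rightarrow> topspace Y" "h b = c"
  shows "D_map V J c Y h (D_base V J b X) = D_base V J c Y"
  by (rule D_space_eqI[OF V D_map_mem[OF V D_space_pre[OF V D_base_mem[OF V]] assms(1)] D_base_mem[OF V]])
     (simp add: config_D_map[where h = h and b = b and c = c, OF V assms(2)] config_D_base[OF V])

lemma strip_D_map:
  assumes z: "z \<in> topspace (D_pre V J X)" and h: "h \<in> topspace X \<rightarrow> topspace Y" "h b = c"
  shows "strip V c Y j (D_map V J c Y h z) = D_map V {()} c Y h (strip V b X j z)"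
proof (rule D_space_eqI[OF V])
  show "strip V c Y j (D_map V J c Y h z) \<in> topspace (D_space V {()} c Y)"
    by (rule strip_mem[OF V D_space_pre[OF V D_map_mem[OF V z h(1)]]])
  show "D_map V {()} c Y h (strip V b X j z) \<in> topspace (D_space V {()} c Y)"
    by (rule D_map_mem[OF V D_space_pre[OF V strip_mem[OF V z]] h(1)])
  show "config V c (strip V c Y j (D_map V J c Y h z)) = config V c (D_map V {()} c Y h (strip V b X j z))"
    unfolding config_strip[OF V] config_D_map[where h = h and b = b and c = c, OF V h(2)] by blast
qed

lemma D_map_glue:
  assumes J: "finite J" and y: "y \<in> J \<rightarrow> topspace X" and h: "h \<in> topspace X \<rightarrow> topspace Y" "h b = c"
  shows "D_map V J c Y h (glue V J b X y) = glue V J c Y (\<lambda>j. h (y j))"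
proof (rule D_space_eqI[OF V])
  show "D_map V J c Y h (glue V J b X y) \<in> topspace (D_space V J c Y)"
    by (rule D_map_mem[OF V D_space_pre[OF V glue_mem[OF V J y]] h(1)])
  show "glue V J c Y (\<lambda>j. h (y j)) \<in> topspace (D_space V J c Y)"
    by (rule glue_mem[OF V J]) (use y h in auto)
  show "config V c (D_map V J c Y h (glue V J b X y)) = config V c (glue V J c Y (\<lambda>j. h (y j)))"
    unfolding config_D_map[where h = h and b = b and c = c, OF V h(2)] config_glue[OF V J] using h(2) by blast
qed

lemma strip_glue:
  assumes J: "finite J" and y: "y \<in> J \<rightarrow> topspace X" and j: "j \<in> J"
  shows "strip V b X j (glue V J b X y) = D_unit V b X (y j)"
proof (rule D_space_eqI[OF V])
  show "strip V b X j (glue V J b X y) \<in> topspace (D_space V {()} b X)"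
    by (rule strip_mem[OF V D_space_pre[OF V glue_mem[OF V J y]]])
  show "D_unit V b X (y j) \<in> topspace (D_space V {()} b X)"
    by (rule D_unit_mem[OF V]) (use y j in auto)
  show "config V b (strip V b X j (glue V J b X y)) = config V b (D_unit V b X (y j))"
    unfolding config_strip[OF V] config_glue[OF V J] config_D_unit[OF V]
    using j by (auto simp: comp_relabel_std comp_target_std[OF V] simp del: split_paired_Ex)
       (metis comp_relabel_std comp_target_std[OF V])
qed

end


lemma glue_cong:
  assumes J: "finite J" and "\<And>j. j \<in> J \<Longrightarrow> y j = y' j"
  shows "glue V J b X y = glue V J b X y'"
proof -
  have "(\<lambda>i\<in>{..<card J}. y (enum J i)) = (\<lambda>i\<in>{..<card J}. y' (enum J i))"
    by (rule restrict_ext) (use assms(2) enum_image[OF J] in auto)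
  then show ?thesis by (simp add: glue_def)
qed


section \<open>The bar construction\<close>

lemma iter_simps:
  "iter_base V a A 0 = Leaf a" "iter_top V a A 0 = final_topology A Leaf"
  "iter_base V a A (Suc q) = Node (D_base V {()} (iter_base V a A q) (iter_top V a A q))"
  "iter_top V a A (Suc q) = final_topology (D_space V {()} (iter_base V a A q) (iter_top V a A q)) Node"
  by (simp_all add: Let_def case_prod_unfold)

lemma iter_face_Suc: "iter_face V a A \<theta> (Suc q) i (Node y) = Node (bar_face V {()} a A \<theta> q i y)"
  by (cases i) (simp_all add: bar_face_def)

lemma iter_degen_Suc: "iter_degen V a A (Suc q) (Suc i) (Node y) = Node (bar_degen V {()} a A q i y)"
  by (simp add: bar_degen_def del: iter_space.simps)

text \<open>The iterated structure map \<open>D\<^sub>V\<^sup>q A \<rightarrow> A\<close>.\<close>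

primrec iter_ev ::
    "'v::euclidean_space set \<Rightarrow> 'a \<Rightarrow> 'a topology \<Rightarrow> (('v, unit, 'a) D_point \<Rightarrow> 'a) \<Rightarrow> nat \<Rightarrow> ('v, 'a) tree \<Rightarrow> 'a" where
  "iter_ev V a A \<theta> 0 = un_Leaf"
| "iter_ev V a A \<theta> (Suc q) = (\<lambda>z. \<theta> (D_map V {()} a A (iter_ev V a A \<theta> q) (un_Node z)))"

text \<open>The augmentation of the bar construction, from \<open>D\<^sub>M D\<^sub>V\<^sup>q A\<close> to families of points of \<open>A\<close>.\<close>

definition bar_ev ::
    "'v::euclidean_space set \<Rightarrow> 'a \<Rightarrow> 'a topology \<Rightarrow> (('v, unit, 'a) D_point \<Rightarrow> 'a) \<Rightarrow> nat
      \<Rightarrow> ('v, 'j, ('v, 'a) tree) D_point \<Rightarrow> 'j \<Rightarrow> 'a" where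
  "bar_ev V a A \<theta> q z j = iter_ev V a A \<theta> (Suc q) (Node (strip V (iter_base V a A q) (iter_top V a A q) j z))"

text \<open>The extra degeneracy, from \<open>D\<^sub>M D\<^sub>V\<^sup>q A\<close> to \<open>D\<^sub>M D\<^sub>V\<^bsup>q+1\<^esup> A\<close>.\<close>

definition bar_extra ::
    "'v::euclidean_space set \<Rightarrow> 'j set \<Rightarrow> 'a \<Rightarrow> 'a topology \<Rightarrow> nat
      \<Rightarrow> ('v, 'j, ('v, 'a) tree) D_point \<Rightarrow> ('v, 'j, ('v, 'a) tree) D_point" where
  "bar_extra V J a A q z = glue V J (iter_base V a A (Suc q)) (iter_top V a A (Suc q))
     (\<lambda>j. Node (strip V (iter_base V a A q) (iter_top V a A q) j z))"

text \<open>The extra degeneracy in degree \<open>-1\<close>, from families of points of \<open>A\<close> to \<open>D\<^sub>M A\<close>.\<close>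

definition bar_unit ::
    "'v::euclidean_space set \<Rightarrow> 'j set \<Rightarrow> 'a \<Rightarrow> 'a topology \<Rightarrow> ('j \<Rightarrow> 'a) \<Rightarrow> ('v, 'j, ('v, 'a) tree) D_point" where
  "bar_unit V J a A y = glue V J (iter_base V a A 0) (iter_top V a A 0) (\<lambda>j. Leaf (y j))"

text \<open>
  An algebra, without the group action.  The function \<open>u\<close>, which vanishes exactly at the base point,
  makes the spaces \<open>D\<^sub>M D\<^sub>V\<^sup>q A\<close> \<^const>\<open>k_Hausdorff\<close>.
\<close>

locale algebra =
  fixes V :: "'v::euclidean_space set" and A :: "'a topology" and a :: 'a
    and \<theta> :: "('v, unit, 'a) D_point \<Rightarrow> 'a" and u :: "'a \<Rightarrow> real"
  assumes V: "subspace V" and kA: "k_Hausdorff A" and aA: "a \<in> topspace A"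
    and u: "continuous_map A euclideanreal u" "\<And>x. x \<in> topspace A \<Longrightarrow> 0 \<le> u x"
      "\<And>x. x \<in> topspace A \<Longrightarrow> u x = 0 \<longleftrightarrow> x = a"
    and \<theta>: "continuous_map (D_space V {()} a A) A \<theta>"
    and \<theta>_base: "\<theta> (D_base V {()} a A) = a"
    and \<theta>_unit: "\<And>x. x \<in> topspace A \<Longrightarrow> \<theta> (D_unit V a A x) = x"
    and \<theta>_mult: "\<And>z. z \<in> topspace (D_space V {()} (D_base V {()} a A) (D_space V {()} a A)) \<Longrightarrow>
        \<theta> (D_mult V {()} a A z) = \<theta> (D_map V {()} a A \<theta> z)"
begin

text \<open>
  The space \<open>T q\<close> is \<open>D\<^sub>V\<^sup>q A\<close>, with base point \<open>b q\<close>, and \<open>B J q\<close> is \<open>D\<^sub>M D\<^sub>V\<^sup>q A\<close> for \<open>M = J \<times> V\<close>.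
\<close>

abbreviation "T \<equiv> iter_top V a A"
abbreviation "b \<equiv> iter_base V a A"
abbreviation "B J q \<equiv> D_space V J (b q) (T q)"
abbreviation "ev \<equiv> iter_ev V a A \<theta>"
abbreviation "face \<equiv> iter_face V a A \<theta>"
abbreviation "degen \<equiv> iter_degen V a A"
abbreviation "bface J \<equiv> bar_face V J a A \<theta>"
abbreviation "bdegen J \<equiv> bar_degen V J a A"
abbreviation "extra J \<equiv> bar_extra V J a A"
abbreviation "bunit J \<equiv> bar_unit V J a A"
abbreviation "bev \<equiv> bar_ev V a A \<theta>"
abbreviation "imult J \<equiv> iter_mult V J a A"
abbreviation "unit \<equiv> iter_unit V a A"

declare iter_space.simps [simp del]

lemma T_Suc: "topspace (T (Suc q)) = Node ` topspace (B {()} q)"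
  by (simp add: iter_simps)

lemma continuous_map_Node: "continuous_map (B {()} q) (T (Suc q)) Node"
  by (simp add: iter_simps continuous_map_final_topology)

lemma continuous_map_un_Node: "continuous_map (T (Suc q)) (B {()} q) un_Node"
  unfolding iter_simps by (rule continuous_map_from_final_topology) (simp add: o_def)

lemma iter_top_props:
  "k_Hausdorff (T q) \<and> b q \<in> topspace (T q) \<and>
   (\<exists>u. continuous_map (T q) euclideanreal u \<and> (\<forall>x\<in>topspace (T q). 0 \<le> u x \<and> (u x = (0::real) \<longleftrightarrow> x = b q)))"
proof (induction q)
  case 0
  have un: "continuous_map (T 0) A un_Leaf"
    unfolding iter_simps by (rule continuous_map_from_final_topology) (simp add: o_def)
  have "k_Hausdorff (T 0)"
    by (rule k_Hausdorff_injection[OF kA un]) (auto simp: iter_simps inj_on_def)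
  moreover have "continuous_map (T 0) euclideanreal (u \<circ> un_Leaf)"
    by (rule continuous_map_compose[OF un u(1)])
  moreover have "\<forall>x\<in>topspace (T 0). 0 \<le> (u \<circ> un_Leaf) x \<and> ((u \<circ> un_Leaf) x = 0 \<longleftrightarrow> x = b 0)"
    using u by (auto simp: iter_simps)
  ultimately show ?case using aA by (auto simp: iter_simps)
next
  case (Suc q)
  then obtain w where w: "k_Hausdorff (T q)" "continuous_map (T q) euclideanreal w"
      "\<And>x. x \<in> topspace (T q) \<Longrightarrow> 0 \<le> w x" "\<And>x. x \<in> topspace (T q) \<Longrightarrow> w x = (0::real) \<longleftrightarrow> x = b q" "b q \<in> topspace (T q)"
    by blast
  have "k_Hausdorff (B {()} q)" by (rule k_Hausdorff_D_space[OF V w])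
  then have "k_Hausdorff (T (Suc q))"
    by (rule k_Hausdorff_injection[OF _ continuous_map_un_Node]) (auto simp: T_Suc inj_on_def)
  moreover obtain w' where w': "continuous_map (B {()} q) euclideanreal w'"
    "\<forall>z\<in>topspace (B {()} q). 0 \<le> w' z \<and> (w' z = 0 \<longleftrightarrow> z = D_base V {()} (b q) (T q))"
    using D_space_weight[OF V w(2-5), of "{()}"] by blast
  have "continuous_map (T (Suc q)) euclideanreal (w' \<circ> un_Node)"
    by (rule continuous_map_compose[OF continuous_map_un_Node w'(1)])
  moreover have "\<forall>x\<in>topspace (T (Suc q)). 0 \<le> (w' \<circ> un_Node) x \<and> ((w' \<circ> un_Node) x = 0 \<longleftrightarrow> x = b (Suc q))"
    using w'(2) unfolding T_Suc iter_simps(3) by simp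
  moreover have "b (Suc q) \<in> topspace (T (Suc q))"
    unfolding T_Suc iter_simps(3) by (rule imageI) (rule D_base_mem[OF V])
  ultimately show ?case by blast
qed

lemma k_Hausdorff_T: "k_Hausdorff (T q)" and base_T: "b q \<in> topspace (T q)"
  using iter_top_props by blast+

lemma k_Hausdorff_B: "k_Hausdorff (B J q)"
proof -
  obtain w where w: "continuous_map (T q) euclideanreal w"
      "\<forall>x\<in>topspace (T q). 0 \<le> w x \<and> (w x = (0::real) \<longleftrightarrow> x = b q)"
    using iter_top_props[of q] by (elim conjE exE) simp
  show ?thesis by (rule k_Hausdorff_D_space[OF V k_Hausdorff_T w(1) _ _ base_T]) (use w(2) in simp_all)
qed

lemma config_un_Node_base: "config V (b q) (un_Node (b (Suc q))) = {}"
  by (simp add: iter_simps(3) config_D_base[OF V])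

lemma un_Node_T: "y \<in> topspace (T (Suc q)) \<Longrightarrow> un_Node y \<in> topspace (B {()} q)" "y \<in> topspace (T (Suc q)) \<Longrightarrow> Node (un_Node y) = y"
  by (auto simp: T_Suc)

lemma iter_mult_mem_config:
  assumes z: "z \<in> topspace (D_pre V J (T (Suc q)))"
  shows "imult J q z \<in> topspace (B J q)"
    and "config V (b q) (imult J q z) =
      {(comp_compose V \<xi> \<xi>', x) | \<xi> y \<xi>' x. (\<xi>, y) \<in> config V (b (Suc q)) z \<and> (\<xi>', x) \<in> config V (b q) (un_Node y)}"
proof -
  obtain k e y where d: "z = (k, e, y)" by (metis prod.collapse)
  have e: "e \<in> topspace (Emb V k J)" and y: "y i \<in> topspace (T (Suc q))" if "i < k" for i
    using z that by (auto simp: d topspace_D_pre)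
  have e: "e \<in> topspace (Emb V k J)" using z by (simp add: d topspace_D_pre)
  have y': "(un_Node \<circ> y) i \<in> topspace (D_pre V {()} (T q))" if "i < k" for i
    using D_space_pre[OF V un_Node_T(1)[OF y[OF that]]] by simp
  have m: "imult J q z = D_mult V J (b q) (T q) (k, e, un_Node \<circ> y)" by (simp add: d iter_mult_def)
  show "imult J q z \<in> topspace (B J q)" unfolding m by (rule D_mult_mem_config(1)[OF V e y'])
  have "config V (b q) (imult J q z) =
     {(comp_compose V (component V e i) \<xi>', x) | i \<xi>' x. i < k \<and> (\<xi>', x) \<in> config V (b q) (un_Node (y i))}"
    unfolding m by (subst D_mult_mem_config(2)[OF V e y']) (simp_all add: o_def)
  also have "\<dots> = {(comp_compose V (component V e i) \<xi>', x) | i \<xi>' x. i < k \<and> y i \<noteq> b (Suc q) \<and> (\<xi>', x) \<in> config V (b q) (un_Node (y i))}"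
    using config_un_Node_base by (metis (no_types, opaque_lifting) empty_iff)
  also have "\<dots> = {(comp_compose V \<xi> \<xi>', x) | \<xi> y \<xi>' x. (\<xi>, y) \<in> config V (b (Suc q)) z \<and> (\<xi>', x) \<in> config V (b q) (un_Node y)}"
    unfolding d config_def[of V "b (Suc q)"] prod.case by blast
  finally show "config V (b q) (imult J q z) =
      {(comp_compose V \<xi> \<xi>', x) | \<xi> y \<xi>' x. (\<xi>, y) \<in> config V (b (Suc q)) z \<and> (\<xi>', x) \<in> config V (b q) (un_Node y)}" .
qed

lemma un_Leaf_T: "un_Leaf \<in> topspace (T 0) \<rightarrow> topspace A"
  by (auto simp: iter_simps)

lemma \<theta>_mem: "z \<in> topspace (D_space V {()} a A) \<Longrightarrow> \<theta> z \<in> topspace A"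
  using \<theta> by (auto simp: continuous_map_def)

lemma iter_face_mem:
  "i \<le> q \<Longrightarrow> face q i \<in> topspace (T (Suc q)) \<rightarrow> topspace (T q) \<and> face q i (b (Suc q)) = b q"
proof (induction q arbitrary: i)
  case 0
  have "\<theta> (D_map V {()} a A un_Leaf y) \<in> topspace A" if "y \<in> topspace (B {()} 0)" for y
    by (intro \<theta>_mem D_map_mem[OF V D_space_pre[OF V that] un_Leaf_T])
  moreover have "\<theta> (D_map V {()} a A un_Leaf (D_base V {()} (b 0) (T 0))) = a"
    using D_map_base[where J = "{()}" and b = "b 0" and c = a, OF V un_Leaf_T] by (simp add: iter_simps \<theta>_base)
  ultimately show ?case by (auto simp: T_Suc iter_simps)
next
  case (Suc q)
  have *: "bface {()} q i y \<in> topspace (B {()} q) \<and>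
     (config V (b (Suc q)) y = {} \<longrightarrow> config V (b q) (bface {()} q i y) = {})" if y: "y \<in> topspace (B {()} (Suc q))" for y
  proof (cases i)
    case 0
    then show ?thesis using iter_mult_mem_config[OF D_space_pre[OF V y]] by (simp add: bar_face_def)
  next
    case (Suc i')
    then have i': "face q i' \<in> topspace (T (Suc q)) \<rightarrow> topspace (T q)" "face q i' (b (Suc q)) = b q"
      using Suc.IH[of i'] Suc.prems by auto
    then show ?thesis
      using D_map_mem[OF V D_space_pre[OF V y] i'(1)]
      unfolding bar_face_def Suc nat.case
      unfolding config_D_map[where h = "face q i'" and b = "b (Suc q)" and c = "b q", OF V i'(2)] by simp
  qed
  have "bface {()} q i (D_base V {()} (b (Suc q)) (T (Suc q))) = D_base V {()} (b q) (T q)"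
    using *[OF D_base_mem[OF V]] by (intro D_space_eqI[OF V _ D_base_mem[OF V]]) (auto simp: config_D_base[OF V])
  then have "face (Suc q) i (b (Suc (Suc q))) = b (Suc q)"
    by (simp only: iter_simps(3) iter_face_Suc)
  moreover have "face (Suc q) i \<in> topspace (T (Suc (Suc q))) \<rightarrow> topspace (T (Suc q))"
    unfolding T_Suc using * by (auto simp: iter_face_Suc simp del: iter_face.simps)
  ultimately show ?case by blast
qed

lemmas iter_face_memD = iter_face_mem[THEN conjunct1] iter_face_mem[THEN conjunct2]

lemma bar_face_mem:
  assumes "i \<le> Suc q" "z \<in> topspace (B J (Suc q))"
  shows "bface J q i z \<in> topspace (B J q)"
proof (cases i)
  case 0
  then show ?thesis using iter_mult_mem_config(1)[OF D_space_pre[OF V assms(2)]] by (simp add: bar_face_def)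
next
  case (Suc i')
  then have "face q i' \<in> topspace (T (Suc q)) \<rightarrow> topspace (T q)" using iter_face_mem assms(1) by simp
  from D_map_mem[OF V D_space_pre[OF V assms(2)] this] show ?thesis by (simp add: bar_face_def Suc)
qed

lemma unit_base: "D_unit V (b q) (T q) (b q) = D_base V {()} (b q) (T q)"
  by (rule D_space_eqI[OF V D_unit_mem[OF V base_T] D_base_mem[OF V]])
     (simp add: config_D_unit[OF V] config_D_base[OF V])

lemma iter_unit_mem: "unit q \<in> topspace (T q) \<rightarrow> topspace (T (Suc q))" "unit q (b q) = b (Suc q)"
  unfolding T_Suc iter_unit_def iter_simps(3) unit_base by (auto intro: D_unit_mem[OF V])

lemma iter_degen_mem:
  "i \<le> q \<Longrightarrow> degen q i \<in> topspace (T q) \<rightarrow> topspace (T (Suc q)) \<and> degen q i (b q) = b (Suc q)"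
proof (induction q arbitrary: i)
  case 0
  show ?case using iter_unit_mem[of 0] by simp
next
  case (Suc q)
  show ?case
  proof (cases i)
    case 0
    then show ?thesis using iter_unit_mem[of "Suc q"] by simp
  next
    case (Suc i')
    then have i': "degen q i' \<in> topspace (T q) \<rightarrow> topspace (T (Suc q))" "degen q i' (b q) = b (Suc q)"
      using Suc.IH[of i'] Suc.prems by auto
    have "bdegen {()} q i' y \<in> topspace (B {()} (Suc q))" if "y \<in> topspace (B {()} q)" for y
      unfolding bar_degen_def by (rule D_map_mem[OF V D_space_pre[OF V that] i'(1)])
    moreover have "bdegen {()} q i' (D_base V {()} (b q) (T q)) = D_base V {()} (b (Suc q)) (T (Suc q))"
      unfolding bar_degen_def by (rule D_map_base[where J = "{()}" and h = "degen q i'", OF V i'])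
    ultimately show ?thesis
      unfolding Suc T_Suc iter_simps(3) iter_degen_Suc by (auto simp: iter_degen_Suc simp del: iter_degen.simps)
  qed
qed

lemmas iter_degen_memD = iter_degen_mem[THEN conjunct1] iter_degen_mem[THEN conjunct2]

lemma bar_degen_mem:
  assumes "i \<le> q" "z \<in> topspace (B J q)"
  shows "bdegen J q i z \<in> topspace (B J (Suc q))"
  unfolding bar_degen_def
  using iter_degen_mem[OF assms(1)] by (intro D_map_mem[OF V D_space_pre[OF V assms(2)]]) blast

lemma iter_ev_base: "ev q (b q) = a" and continuous_map_iter_ev: "continuous_map (T q) A (ev q)"
proof (induction q)
  case 0
  show "ev 0 (b 0) = a" by (simp add: iter_simps)
  show "continuous_map (T 0) A (ev 0)"
    unfolding iter_simps by (rule continuous_map_from_final_topology) (simp add: o_def)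
next
  case (Suc q)
  have "ev q \<in> topspace (T q) \<rightarrow> topspace A" using Suc by (auto simp: continuous_map_def)
  then show "ev (Suc q) (b (Suc q)) = a"
    using D_map_base[where h = "ev q" and b = "b q" and J = "{()}" and X = "T q" and Y = A, OF V _ Suc(1)] by (simp add: iter_simps(3) \<theta>_base)
  have "continuous_map (B {()} q) A (\<lambda>z. \<theta> (D_map V {()} a A (ev q) z))"
    using continuous_map_compose[OF continuous_map_D_map[OF V Suc(2,1) kA] \<theta>] by (simp add: o_def)
  from continuous_map_compose[OF continuous_map_un_Node this]
  show "continuous_map (T (Suc q)) A (ev (Suc q))" by (simp add: o_def)
qed

lemma ev_mem: "ev q \<in> topspace (T q) \<rightarrow> topspace A"
  using continuous_map_iter_ev by (auto simp: continuous_map_def)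

lemma iter_ev_mult:
  assumes y: "y \<in> topspace (B {()} (Suc q))"
  shows "\<theta> (D_map V {()} a A (ev q) (imult {()} q y)) = \<theta> (D_map V {()} a A (ev (Suc q)) y)"
proof -
  let ?D = "D_space V {()} a A" and ?d = "D_base V {()} a A"
  define h where "h Y = D_map V {()} a A (ev q) (un_Node Y)" for Y
  have h: "h \<in> topspace (T (Suc q)) \<rightarrow> topspace ?D"
    unfolding h_def by (intro funcsetI D_map_mem[OF V D_space_pre[OF V un_Node_T(1)] ev_mem])
  have hb: "h (b (Suc q)) = ?d"
    unfolding h_def iter_simps(3) by (simp add: D_map_base[where h = "ev q" and b = "b q", OF V ev_mem iter_ev_base])
  define w where "w = D_map V {()} ?d ?D h y"
  have w: "w \<in> topspace (D_space V {()} ?d ?D)"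
    unfolding w_def by (rule D_map_mem[OF V D_space_pre[OF V y] h])
  have \<theta>m: "\<theta> \<in> topspace ?D \<rightarrow> topspace A" using \<theta>_mem by blast
  have "D_map V {()} a A \<theta> w = D_map V {()} a A (\<theta> \<circ> h) y"
    unfolding w_def by (rule D_map_D_map[OF V D_space_pre[OF V y] h hb \<theta>m \<theta>_base])
  also have "\<theta> \<circ> h = ev (Suc q)" by (simp add: h_def[abs_def] o_def)
  finally have 1: "D_map V {()} a A \<theta> w = D_map V {()} a A (ev (Suc q)) y" .
  note im = iter_mult_mem_config[OF D_space_pre[OF V y]]
  have 2: "D_mult V {()} a A w = D_map V {()} a A (ev q) (imult {()} q y)"
  proof (rule D_space_eqI[OF V])
    show "D_mult V {()} a A w \<in> topspace ?D" by (rule D_mult_mem[OF V D_space_pre[OF V w]])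
    show "D_map V {()} a A (ev q) (imult {()} q y) \<in> topspace ?D"
      by (rule D_map_mem[OF V D_space_pre[OF V im(1)] ev_mem])
    have ch: "config V a (h Y) = {(\<xi>, ev q x) | \<xi> x. (\<xi>, x) \<in> config V (b q) (un_Node Y) \<and> ev q x \<noteq> a}" for Y
      unfolding h_def by (rule config_D_map[where h = "ev q" and b = "b q", OF V iter_ev_base])
    have "config V a (D_mult V {()} a A w) =
       {(comp_compose V \<xi> \<xi>', x) | \<xi> Y \<xi>' x. (\<xi>, Y) \<in> config V ?d w \<and> (\<xi>', x) \<in> config V a Y}"
      by (rule config_D_mult[OF V D_space_pre[OF V w] config_D_base[OF V]])
    also have "\<dots> = {(comp_compose V \<xi> \<xi>', x) | \<xi> Y \<xi>' x. (\<xi>, Y) \<in> config V (b (Suc q)) y \<and> h Y \<noteq> ?d \<and> (\<xi>', x) \<in> config V a (h Y)}"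
      unfolding w_def config_D_map[where h = h and b = "b (Suc q)", OF V hb] by blast
    also have "\<dots> = {(comp_compose V \<xi> \<xi>', x) | \<xi> Y \<xi>' x. (\<xi>, Y) \<in> config V (b (Suc q)) y \<and> (\<xi>', x) \<in> config V a (h Y)}"
    proof -
      have "(\<xi>', x) \<in> config V a (h Y) \<Longrightarrow> h Y \<noteq> ?d" for \<xi>' x Y using config_D_base[OF V, of a "{()}" A] by auto
      then show ?thesis by blast
    qed
    also have "\<dots> = config V a (D_map V {()} a A (ev q) (imult {()} q y))"
      unfolding config_D_map[where h = "ev q" and b = "b q", OF V iter_ev_base] im(2) ch by blast
    finally show "config V a (D_mult V {()} a A w) = config V a (D_map V {()} a A (ev q) (imult {()} q y))" .
  qed
  show ?thesis using \<theta>_mult[OF w] unfolding 1 2 .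
qed

lemma iter_ev_face:
  assumes "i \<le> q" "z \<in> topspace (T (Suc q))"
  shows "ev q (face q i z) = ev (Suc q) z"
  using assms
proof (induction q arbitrary: i z)
  case 0
  then show ?case by simp
next
  case (Suc q)
  obtain y where y: "z = Node y" "y \<in> topspace (B {()} (Suc q))" using Suc.prems(2) unfolding T_Suc[of "Suc q"] by blast
  have "\<theta> (D_map V {()} a A (ev q) (bface {()} q i y)) = \<theta> (D_map V {()} a A (ev (Suc q)) y)"
  proof (cases i)
    case 0
    then show ?thesis using iter_ev_mult[OF y(2)] by (simp add: bar_face_def)
  next
    case (Suc i')
    then have i': "i' \<le> q" using Suc.prems by simp
    note m = iter_face_memD[OF i']
    have "D_map V {()} a A (ev q) (bface {()} q i y) = D_map V {()} a A (ev q \<circ> face q i') y"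
      unfolding Suc bar_face_def nat.case
      by (rule D_map_D_map[OF V D_space_pre[OF V y(2)] m ev_mem iter_ev_base])
    also have "\<dots> = D_map V {()} a A (ev (Suc q)) y"
      by (rule D_map_cong[OF D_space_pre[OF V y(2)]]) (use Suc.IH[OF i'] in \<open>simp only: comp_apply\<close>)
    finally show ?thesis by simp
  qed
  then show ?case unfolding y(1) iter_face_Suc by simp
qed

lemma iter_ev_unit:
  assumes "z \<in> topspace (T q)"
  shows "ev (Suc q) (unit q z) = ev q z"
proof -
  have "ev q z \<in> topspace A" using ev_mem assms by auto
  then show ?thesis
    using D_map_unit[OF V ev_mem iter_ev_base assms] by (simp add: iter_unit_def \<theta>_unit)
qed

lemma iter_ev_degen:
  assumes "i \<le> q" "z \<in> topspace (T q)"
  shows "ev (Suc q) (degen q i z) = ev q z"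
  using assms
proof (induction q arbitrary: i z)
  case 0
  then show ?case using iter_ev_unit[of z 0] by simp
next
  case (Suc q)
  show ?case
  proof (cases i)
    case 0
    then show ?thesis using iter_ev_unit[OF Suc.prems(2)] by simp
  next
    case (Suc i')
    then have i': "i' \<le> q" using Suc.prems by simp
    obtain y where y: "z = Node y" "y \<in> topspace (B {()} q)" using Suc.prems(2) unfolding T_Suc[of q] by blast
    note m = iter_degen_memD[OF i']
    have "D_map V {()} a A (ev (Suc q)) (bdegen {()} q i' y) = D_map V {()} a A (ev (Suc q) \<circ> degen q i') y"
      unfolding bar_degen_def by (rule D_map_D_map[OF V D_space_pre[OF V y(2)] m ev_mem iter_ev_base])
    also have "\<dots> = D_map V {()} a A (ev q) y"
      by (rule D_map_cong[OF D_space_pre[OF V y(2)]]) (use Suc.IH[OF i'] in \<open>simp only: comp_apply\<close>)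
    finally show ?thesis unfolding Suc y(1) iter_degen_Suc by simp
  qed
qed

lemma strip_bar_face:
  assumes i: "i \<le> Suc q" and z: "z \<in> topspace (B J (Suc q))"
  shows "strip V (b q) (T q) j (bface J q i z) = bface {()} q i (strip V (b (Suc q)) (T (Suc q)) j z)"
proof (cases i)
  case 0
  note zp = D_space_pre[OF V z]
  note sp = D_space_pre[OF V strip_mem[OF V zp, of "b (Suc q)" j]]
  note im = iter_mult_mem_config[OF zp] and im' = iter_mult_mem_config[OF sp]
  have key: "comp_relabel V (\<lambda>_. ()) (comp_compose V \<xi> \<xi>') = comp_compose V (comp_relabel V (\<lambda>_. ()) \<xi>) \<xi>'"
      "comp_target (comp_compose V \<xi> \<xi>') = comp_target \<xi>"
    if "(\<xi>, y) \<in> config V (b (Suc q)) z" "(\<xi>', x) \<in> config V (b q) (un_Node y)" for \<xi> y \<xi>' x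
  proof -
    have f: "framed V J \<xi>" "y \<in> topspace (T (Suc q))" using config_framed[OF V zp that(1)] by auto
    have f': "framed V {()} \<xi>'"
      using config_framed[OF V D_space_pre[OF V un_Node_T(1)[OF f(2)]] that(2)] by blast
    show "comp_relabel V (\<lambda>_. ()) (comp_compose V \<xi> \<xi>') = comp_compose V (comp_relabel V (\<lambda>_. ()) \<xi>) \<xi>'"
      by (rule comp_relabel_compose[OF V f'])
    show "comp_target (comp_compose V \<xi> \<xi>') = comp_target \<xi>"
      by (rule comp_target_compose[OF V f(1) f'])
  qed
  have "strip V (b q) (T q) j (imult J q z) = imult {()} q (strip V (b (Suc q)) (T (Suc q)) j z)"
  proof (rule D_space_eqI[OF V strip_mem[OF V D_space_pre[OF V im(1)]] im'(1)])
    have "config V (b q) (strip V (b q) (T q) j (imult J q z)) =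
       {(comp_relabel V (\<lambda>_. ()) (comp_compose V \<xi> \<xi>'), x) | \<xi> y \<xi>' x. (\<xi>, y) \<in> config V (b (Suc q)) z \<and>
          (\<xi>', x) \<in> config V (b q) (un_Node y) \<and> comp_target (comp_compose V \<xi> \<xi>') = j}"
      unfolding config_strip[OF V] im(2) by blast
    also have "\<dots> = {(comp_compose V (comp_relabel V (\<lambda>_. ()) \<xi>) \<xi>', x) | \<xi> y \<xi>' x. (\<xi>, y) \<in> config V (b (Suc q)) z \<and>
          (\<xi>', x) \<in> config V (b q) (un_Node y) \<and> comp_target \<xi> = j}"
      using key by (intro Collect_cong) metis
    also have "\<dots> = config V (b q) (imult {()} q (strip V (b (Suc q)) (T (Suc q)) j z))"
      unfolding im'(2) config_strip[OF V] by blast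
    finally show "config V (b q) (strip V (b q) (T q) j (imult J q z)) =
      config V (b q) (imult {()} q (strip V (b (Suc q)) (T (Suc q)) j z))" .
  qed
  then show ?thesis by (simp add: bar_face_def 0)
next
  case (Suc i')
  then have "i' \<le> q" using i by simp
  note m = iter_face_mem[OF this, THEN conjunct1] iter_face_mem[OF this, THEN conjunct2]
  show ?thesis unfolding Suc bar_face_def nat.case by (rule strip_D_map[OF V D_space_pre[OF V z] m])
qed

lemma strip_bar_degen:
  assumes i: "i \<le> q" and z: "z \<in> topspace (B J q)"
  shows "strip V (b (Suc q)) (T (Suc q)) j (bdegen J q i z) = bdegen {()} q i (strip V (b q) (T q) j z)"
proof -
  note m = iter_degen_memD[OF i]
  show ?thesis unfolding bar_degen_def by (rule strip_D_map[OF V D_space_pre[OF V z] m])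
qed

lemma Node_strip_T: "z \<in> topspace (B J q) \<Longrightarrow> Node (strip V (b q) (T q) j z) \<in> topspace (T (Suc q))"
  unfolding T_Suc by (intro imageI strip_mem[OF V D_space_pre[OF V]])

lemma bar_ev_face:
  assumes "i \<le> Suc q" "z \<in> topspace (B J (Suc q))"
  shows "bev q (bface J q i z) = bev (Suc q) z"
proof
  fix j
  show "bev q (bface J q i z) j = bev (Suc q) z j"
    unfolding bar_ev_def strip_bar_face[OF assms] iter_face_Suc[symmetric]
    by (rule iter_ev_face[OF assms(1) Node_strip_T[OF assms(2)]])
qed

lemma bar_ev_degen:
  assumes "i \<le> q" "z \<in> topspace (B J q)"
  shows "bev (Suc q) (bdegen J q i z) = bev q z"
proof
  fix j
  show "bev (Suc q) (bdegen J q i z) j = bev q z j"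
    unfolding bar_ev_def strip_bar_degen[OF assms] iter_degen_Suc[symmetric]
    by (rule iter_ev_degen[OF _ Node_strip_T[OF assms(2)]]) (use assms(1) in simp)
qed

context
  fixes J :: "'j set"
  assumes J: "finite J"
begin

lemma bar_extra_mem: "z \<in> topspace (B J q) \<Longrightarrow> extra J q z \<in> topspace (B J (Suc q))"
  unfolding bar_extra_def by (intro glue_mem[OF V J] funcsetI Node_strip_T)

lemma Leaf_T: "x \<in> topspace A \<Longrightarrow> Leaf x \<in> topspace (T 0)"
  by (simp add: iter_simps)

lemma bar_unit_mem: "y \<in> J \<rightarrow> topspace A \<Longrightarrow> bunit J y \<in> topspace (B J 0)"
  unfolding bar_unit_def by (intro glue_mem[OF V J] funcsetI Leaf_T) auto

text \<open>
  The identities of an extra degeneracy, for which the new face has index \<open>0\<close>.  The first one says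
  that a configuration is recovered from its strips by composing them with the standard embedding.
\<close>

lemma bar_face_0_extra:
  assumes z: "z \<in> topspace (B J q)"
  shows "bface J q 0 (extra J q z) = z"
proof -
  note zp = D_space_pre[OF V z]
  note im = iter_mult_mem_config[OF D_space_pre[OF V bar_extra_mem[OF z]]]
  have key: "comp_compose V (comp_std V (comp_target \<xi>)) (comp_relabel V (\<lambda>_. ()) \<xi>) = \<xi>" "comp_target \<xi> \<in> J"
    if "(\<xi>, x) \<in> config V (b q) z" for \<xi> x
  proof -
    have f: "framed V J \<xi>" using config_framed[OF V zp that] by blast
    show "comp_compose V (comp_std V (comp_target \<xi>)) (comp_relabel V (\<lambda>_. ()) \<xi>) = \<xi>"
      unfolding comp_compose_relabel[OF V f] by (rule comp_compose_std[OF V f])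
    show "comp_target \<xi> \<in> J" using f by (auto simp: framed_def comp_target_def)
  qed
  have ne: "Node (strip V (b q) (T q) (comp_target \<xi>) z) \<noteq> b (Suc q)" if "(\<xi>, x) \<in> config V (b q) z" for \<xi> x
  proof
    assume eq: "Node (strip V (b q) (T q) (comp_target \<xi>) z) = b (Suc q)"
    have "config V (b q) (strip V (b q) (T q) (comp_target \<xi>) z) = {}"
      using config_un_Node_base[of q] unfolding eq[symmetric] by simp
    then show False using that unfolding config_strip[OF V] by blast
  qed
  have str: "(\<xi>', x) \<in> config V (b q) (strip V (b q) (T q) j z) \<longleftrightarrow>
      (\<exists>\<xi>. \<xi>' = comp_relabel V (\<lambda>_. ()) \<xi> \<and> (\<xi>, x) \<in> config V (b q) z \<and> comp_target \<xi> = j)" for \<xi>' x j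
    unfolding config_strip[OF V] by blast
  have "imult J q (extra J q z) = z"
  proof (rule D_space_eqI[OF V im(1) z])
    have gl: "(\<xi>, y) \<in> config V (b (Suc q)) (extra J q z) \<longleftrightarrow>
        (\<exists>j. \<xi> = comp_std V j \<and> y = Node (strip V (b q) (T q) j z) \<and> j \<in> J \<and> Node (strip V (b q) (T q) j z) \<noteq> b (Suc q))" for \<xi> y
      unfolding bar_extra_def config_glue[OF V J] by blast
    show "config V (b q) (imult J q (extra J q z)) = config V (b q) z"
    proof (intro subset_antisym subrelI)
      fix \<xi> x assume "(\<xi>, x) \<in> config V (b q) z"
      with key[OF this] ne[OF this] show "(\<xi>, x) \<in> config V (b q) (imult J q (extra J q z))"
        unfolding im(2) mem_Collect_eq gl by (metis str tree.sel(2))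
    next
      fix \<xi> x assume "(\<xi>, x) \<in> config V (b q) (imult J q (extra J q z))"
      then obtain j \<xi>'' where "\<xi> = comp_compose V (comp_std V j) \<xi>''" "(\<xi>'', x) \<in> config V (b q) (strip V (b q) (T q) j z)"
        unfolding im(2) mem_Collect_eq gl by auto
      then obtain \<xi>' where "\<xi> = comp_compose V (comp_std V (comp_target \<xi>')) (comp_relabel V (\<lambda>_. ()) \<xi>')" and m: "(\<xi>', x) \<in> config V (b q) z"
        unfolding str by blast
      then show "(\<xi>, x) \<in> config V (b q) z" using key(1)[OF m] by simp
    qed
  qed
  then show ?thesis by (simp add: bar_face_def)
qed

lemma bar_face_Suc_extra:
  assumes i: "i \<le> Suc q" and z: "z \<in> topspace (B J (Suc q))"
  shows "bface J (Suc q) (Suc i) (extra J (Suc q) z) = extra J q (bface J q i z)"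
proof -
  note m = iter_face_memD[OF i]
  have "bface J (Suc q) (Suc i) (extra J (Suc q) z) =
     glue V J (b (Suc q)) (T (Suc q)) (\<lambda>j. face (Suc q) i (Node (strip V (b (Suc q)) (T (Suc q)) j z)))"
    unfolding bar_face_def nat.case bar_extra_def
    by (rule D_map_glue[OF V J _ m]) (use Node_strip_T[OF z] in blast)
  also have "\<dots> = extra J q (bface J q i z)"
    unfolding bar_extra_def iter_face_Suc strip_bar_face[OF i z] ..
  finally show ?thesis .
qed

lemma bar_face_1_extra:
  assumes z: "z \<in> topspace (B J 0)"
  shows "bface J 0 (Suc 0) (extra J 0 z) = bunit J (bev 0 z)"
proof -
  note m = iter_face_mem[of 0 0, OF order_refl, THEN conjunct1] iter_face_mem[of 0 0, OF order_refl, THEN conjunct2]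
  have "bface J 0 (Suc 0) (extra J 0 z) =
     glue V J (b 0) (T 0) (\<lambda>j. face 0 0 (Node (strip V (b 0) (T 0) j z)))"
    unfolding bar_face_def nat.case bar_extra_def
    by (rule D_map_glue[OF V J _ m]) (use Node_strip_T[OF z] in blast)
  then show ?thesis by (simp add: bar_unit_def bar_ev_def)
qed

lemma bar_degen_extra:
  assumes i: "i \<le> q" and z: "z \<in> topspace (B J q)"
  shows "bdegen J (Suc q) (Suc i) (extra J q z) = extra J (Suc q) (bdegen J q i z)"
proof -
  have i': "Suc i \<le> Suc q" using i by simp
  note m = iter_degen_memD[OF i']
  have "bdegen J (Suc q) (Suc i) (extra J q z) =
     glue V J (b (Suc (Suc q))) (T (Suc (Suc q))) (\<lambda>j. degen (Suc q) (Suc i) (Node (strip V (b q) (T q) j z)))"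
    unfolding bar_extra_def bar_degen_def[of V J a A "Suc q"]
    by (rule D_map_glue[OF V J _ m]) (use Node_strip_T[OF z] in blast)
  also have "\<dots> = extra J (Suc q) (bdegen J q i z)"
    unfolding bar_extra_def iter_degen_Suc strip_bar_degen[OF i z] ..
  finally show ?thesis .
qed

lemma bar_extra_unit:
  assumes y: "y \<in> J \<rightarrow> topspace A"
  shows "extra J 0 (bunit J y) = bdegen J 0 0 (bunit J y)"
proof -
  note m = iter_degen_mem[of 0 0, OF order_refl, THEN conjunct1] iter_degen_mem[of 0 0, OF order_refl, THEN conjunct2]
  have Ly: "(\<lambda>j. Leaf (y j)) \<in> J \<rightarrow> topspace (T 0)" using y Leaf_T by auto
  have "bdegen J 0 0 (bunit J y) = glue V J (b (Suc 0)) (T (Suc 0)) (\<lambda>j. degen 0 0 (Leaf (y j)))"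
    unfolding bar_degen_def bar_unit_def by (rule D_map_glue[OF V J Ly m])
  also have "\<dots> = extra J 0 (bunit J y)"
  proof -
    show ?thesis
      unfolding bar_extra_def bar_unit_def
      by (rule glue_cong[OF J]) (simp add: strip_glue[OF V J Ly] iter_unit_def)
  qed
  finally show ?thesis by simp
qed

lemma bar_ev_unit:
  assumes y: "y \<in> J \<rightarrow> topspace A" and j: "j \<in> J"
  shows "bev 0 (bunit J y) j = y j"
proof -
  have Ly: "(\<lambda>j. Leaf (y j)) \<in> J \<rightarrow> topspace (T 0)" using y Leaf_T by auto
  have "Node (strip V (b 0) (T 0) j (bunit J y)) = unit 0 (Leaf (y j))"
    unfolding bar_unit_def iter_unit_def using strip_glue[OF V J Ly j] by simp
  then show ?thesis
    unfolding bar_ev_def using iter_ev_unit[of "Leaf (y j)" 0] Ly j by auto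
qed

lemma continuous_map_bar_extra: "continuous_map (B J q) (B J (Suc q)) (extra J q)"
  unfolding bar_extra_def
proof (rule continuous_map_glue_D_space[OF V J k_Hausdorff_T])
  fix j assume "j \<in> J"
  from continuous_map_compose[OF continuous_map_strip[OF V k_Hausdorff_T this] continuous_map_Node]
  show "continuous_map (B J q) (T (Suc q)) (\<lambda>z. Node (strip V (b q) (T q) j z))" by (simp add: o_def)
qed

lemma continuous_map_bar_ev:
  assumes "j \<in> J"
  shows "continuous_map (B J q) A (\<lambda>z. bev q z j)"
  using continuous_map_compose[OF continuous_map_compose[OF continuous_map_strip[OF V k_Hausdorff_T assms] continuous_map_Node]
      continuous_map_iter_ev] unfolding bar_ev_def by (simp add: o_def)

end

end


section \<open>Equivariance of the bar construction\<close>

context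
  fixes G :: "('g, 'm) monoid_scheme" and V :: "'v::euclidean_space set" and \<rho> :: "'g \<Rightarrow> 'v \<Rightarrow> 'v" and g :: 'g
  assumes G: "group G" and rep: "orthogonal_rep G V \<rho>" and g: "g \<in> carrier G"
begin

abbreviation "cj \<equiv> comp_conj (\<rho> g) (\<rho> (inv\<^bsub>G\<^esub> g)) V"

lemma comp_conj_rep_std: "cj \<phi> (comp_std V j) = comp_std V (\<phi> j)"
  by (rule comp_conj_std[OF rep_subspace[OF G rep] orthogonal_rep_inverses[OF G rep g]])

lemma comp_relabel_conj_rep:
  "framed V J c \<Longrightarrow> comp_relabel V (\<lambda>_. ()) (cj \<phi> c) = cj (\<lambda>j. j) (comp_relabel V (\<lambda>_. ()) c)"
  by (rule comp_relabel_conj[OF _ orthogonal_rep_inverses[OF G rep g]])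

lemma comp_target_conj_rep: "comp_target (cj \<phi> c) = \<phi> (comp_target c)"
  by (rule comp_target_conj[OF rep_subspace[OF G rep] orthogonal_rep_inverses[OF G rep g]])

lemma comp_conj_rep_compose:
  "framed V J c \<Longrightarrow> framed V K c' \<Longrightarrow> cj \<phi> (comp_compose V c c') = comp_compose V (cj \<phi> c) (cj (\<lambda>j. j) c')"
  by (rule comp_conj_compose[OF rep_subspace[OF G rep] _ _ orthogonal_rep_inverses[OF G rep g]])

lemma D_map_conj:
  assumes z: "z \<in> topspace (D_pre V J X)" and a: "inj_on (actJ g) J" "actJ g ` J \<subseteq> J"
    and X: "actX g \<in> topspace X \<rightarrow> topspace X" "actX g b = b"
    and Y: "actY g \<in> topspace Y \<rightarrow> topspace Y" "actY g c = c"
    and h: "h \<in> topspace X \<rightarrow> topspace Y" "h b = c" "\<And>x. x \<in> topspace X \<Longrightarrow> h (actX g x) = actY g (h x)"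
  shows "D_map V J c Y h (D_conj G V \<rho> J actJ b X actX g z) = D_conj G V \<rho> J actJ c Y actY g (D_map V J c Y h z)"
proof (rule D_space_eqI)
  note V = rep_subspace[OF G rep]
  show "subspace V" by (rule V)
  note mz = D_space_pre[OF V D_map_mem[OF V z h(1), of c]]
  note cz = D_space_pre[OF V D_conj_mem_config(1)[where actJ = actJ and actX = actX and b = b, OF G rep z g a X]]
  show "D_map V J c Y h (D_conj G V \<rho> J actJ b X actX g z) \<in> topspace (D_space V J c Y)"
    by (rule D_map_mem[OF V cz h(1)])
  show "D_conj G V \<rho> J actJ c Y actY g (D_map V J c Y h z) \<in> topspace (D_space V J c Y)"
    by (rule D_conj_mem_config(1)[where actJ = actJ and actX = actY and b = c, OF G rep mz g a Y])
  note ch = config_D_map[where h = h and b = b and c = c, OF V h(2)]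
  have "config V c (D_map V J c Y h (D_conj G V \<rho> J actJ b X actX g z)) =
     {(cj (actJ g) \<xi>, h (actX g x)) | \<xi> x. (\<xi>, x) \<in> config V b z \<and> h (actX g x) \<noteq> c}"
    unfolding ch D_conj_mem_config(2)[where actJ = actJ and actX = actX and b = b, OF G rep z g a X] using h(2) by blast
  also have "\<dots> = {(cj (actJ g) \<xi>, actY g (h x)) | \<xi> x. (\<xi>, x) \<in> config V b z \<and> actY g (h x) \<noteq> c}"
    using h(3) config_framed[OF V z] by (intro Collect_cong) metis
  also have "\<dots> = config V c (D_conj G V \<rho> J actJ c Y actY g (D_map V J c Y h z))"
    unfolding D_conj_mem_config(2)[where actJ = actJ and actX = actY and b = c, OF G rep mz g a Y] ch using Y(2) by blast
  finally show "config V c (D_map V J c Y h (D_conj G V \<rho> J actJ b X actX g z)) =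
    config V c (D_conj G V \<rho> J actJ c Y actY g (D_map V J c Y h z))" .
qed

lemma D_unit_conj:
  assumes x: "x \<in> topspace X" and X: "actX g \<in> topspace X \<rightarrow> topspace X" "actX g b = b"
  shows "D_conj G V \<rho> {()} (\<lambda>_ j. j) b X actX g (D_unit V b X x) = D_unit V b X (actX g x)"
proof (rule D_space_eqI)
  note V = rep_subspace[OF G rep]
  show "subspace V" by (rule V)
  note uz = D_space_pre[OF V D_unit_mem[OF V x, of b]]
  have a: "inj_on (\<lambda>j. j) {()}" "(\<lambda>j. j) ` {()} \<subseteq> {()}" by auto
  note c = D_conj_mem_config[where actJ = "\<lambda>_ j. j" and actX = actX, OF G rep uz g a X]
  show "D_conj G V \<rho> {()} (\<lambda>_ j. j) b X actX g (D_unit V b X x) \<in> topspace (D_space V {()} b X)" by (rule c(1))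
  show "D_unit V b X (actX g x) \<in> topspace (D_space V {()} b X)" by (rule D_unit_mem[OF V]) (use x X in auto)
  show "config V b (D_conj G V \<rho> {()} (\<lambda>_ j. j) b X actX g (D_unit V b X x)) = config V b (D_unit V b X (actX g x))"
    unfolding c(2) unfolding config_D_unit[OF V] using X(2) by (auto simp: comp_conj_rep_std simp del: split_paired_Ex)
qed

lemma D_base_conj:
  assumes a: "inj_on (actJ g) J" "actJ g ` J \<subseteq> J" and X: "actX g \<in> topspace X \<rightarrow> topspace X" "actX g b = b"
  shows "D_conj G V \<rho> J actJ b X actX g (D_base V J b X) = D_base V J b X"
proof (rule D_space_eqI)
  note V = rep_subspace[OF G rep]
  show "subspace V" by (rule V)
  note c = D_conj_mem_config[where actJ = actJ and actX = actX and b = b, OF G rep D_space_pre[OF V D_base_mem[OF V]] g a X]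
  show "D_conj G V \<rho> J actJ b X actX g (D_base V J b X) \<in> topspace (D_space V J b X)" by (rule c(1))
  show "D_base V J b X \<in> topspace (D_space V J b X)" by (rule D_base_mem[OF V])
  show "config V b (D_conj G V \<rho> J actJ b X actX g (D_base V J b X)) = config V b (D_base V J b X)"
    unfolding c(2) unfolding config_D_base[OF V] by simp
qed

lemma strip_conj:
  assumes z: "z \<in> topspace (D_pre V J X)" and a: "inj_on (actJ g) J" "actJ g ` J \<subseteq> J"
    and X: "actX g \<in> topspace X \<rightarrow> topspace X" "actX g b = b" and j: "j \<in> J"
  shows "strip V b X (actJ g j) (D_conj G V \<rho> J actJ b X actX g z) =
    D_conj G V \<rho> {()} (\<lambda>_ j. j) b X actX g (strip V b X j z)"
proof (rule D_space_eqI)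
  note V = rep_subspace[OF G rep]
  show "subspace V" by (rule V)
  note c = D_conj_mem_config[where actJ = actJ and actX = actX and b = b, OF G rep z g a X]
  have a': "inj_on (\<lambda>j. j) {()}" "(\<lambda>j. j) ` {()} \<subseteq> {()}" by auto
  note c' = D_conj_mem_config[where actJ = "\<lambda>_ j. j" and actX = actX, OF G rep D_space_pre[OF V strip_mem[OF V z]] g a' X]
  show "strip V b X (actJ g j) (D_conj G V \<rho> J actJ b X actX g z) \<in> topspace (D_space V {()} b X)"
    by (rule strip_mem[OF V D_space_pre[OF V c(1)]])
  show "D_conj G V \<rho> {()} (\<lambda>_ j. j) b X actX g (strip V b X j z) \<in> topspace (D_space V {()} b X)" by (rule c'(1))
  have 1: "comp_relabel V (\<lambda>_. ()) (cj (actJ g) \<xi>) = cj (\<lambda>j. j) (comp_relabel V (\<lambda>_. ()) \<xi>)"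
    "comp_target (cj (actJ g) \<xi>) = actJ g j \<longleftrightarrow> comp_target \<xi> = j" if "(\<xi>, x) \<in> config V b z" for \<xi> x
  proof -
    have f: "framed V J \<xi>" using config_framed[OF V z that] by blast
    show "comp_relabel V (\<lambda>_. ()) (cj (actJ g) \<xi>) = cj (\<lambda>j. j) (comp_relabel V (\<lambda>_. ()) \<xi>)"
      by (rule comp_relabel_conj_rep[OF f])
    have "comp_target \<xi> \<in> J" using f by (auto simp: framed_def comp_target_def)
    then show "comp_target (cj (actJ g) \<xi>) = actJ g j \<longleftrightarrow> comp_target \<xi> = j"
      unfolding comp_target_conj_rep using inj_on_eq_iff[OF a(1) _ j] by blast
  qed
  have "config V b (strip V b X (actJ g j) (D_conj G V \<rho> J actJ b X actX g z)) =
     {(comp_relabel V (\<lambda>_. ()) (cj (actJ g) \<xi>), actX g x) | \<xi> x. (\<xi>, x) \<in> config V b z \<and> actX g x \<noteq> b \<and>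
        comp_target (cj (actJ g) \<xi>) = actJ g j}"
    unfolding config_strip[OF V] c(2) by blast
  also have "\<dots> = {(cj (\<lambda>j. j) (comp_relabel V (\<lambda>_. ()) \<xi>), actX g x) | \<xi> x. (\<xi>, x) \<in> config V b z \<and> actX g x \<noteq> b \<and>
        comp_target \<xi> = j}"
    using 1 by (intro Collect_cong) metis
  also have "\<dots> = config V b (D_conj G V \<rho> {()} (\<lambda>_ j. j) b X actX g (strip V b X j z))"
    unfolding c'(2) unfolding config_strip[OF V] by blast
  finally show "config V b (strip V b X (actJ g j) (D_conj G V \<rho> J actJ b X actX g z)) =
    config V b (D_conj G V \<rho> {()} (\<lambda>_ j. j) b X actX g (strip V b X j z))" .
qed

lemma glue_conj:
  assumes J: "finite J" and y: "y \<in> J \<rightarrow> topspace X" and a: "actJ g ` J \<subseteq> J" "actJ' ` J \<subseteq> J"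
    "\<And>j. j \<in> J \<Longrightarrow> actJ' (actJ g j) = j" "\<And>j. j \<in> J \<Longrightarrow> actJ g (actJ' j) = j"
    and X: "actX g \<in> topspace X \<rightarrow> topspace X" "actX g b = b"
  shows "D_conj G V \<rho> J actJ b X actX g (glue V J b X y) = glue V J b X (\<lambda>j. actX g (y (actJ' j)))"
proof (rule D_space_eqI)
  note V = rep_subspace[OF G rep]
  show "subspace V" by (rule V)
  have inj: "inj_on (actJ g) J" by (rule inj_on_inverseI[where g = actJ', OF a(3)])
  note c = D_conj_mem_config[where actJ = actJ and actX = actX and b = b, OF G rep D_space_pre[OF V glue_mem[OF V J y]] g inj a(1) X]
  show "D_conj G V \<rho> J actJ b X actX g (glue V J b X y) \<in> topspace (D_space V J b X)" by (rule c(1))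
  show "glue V J b X (\<lambda>j. actX g (y (actJ' j))) \<in> topspace (D_space V J b X)"
    by (rule glue_mem[OF V J]) (use y a(2) X in \<open>auto simp: image_subset_iff Pi_iff\<close>)
  have "config V b (D_conj G V \<rho> J actJ b X actX g (glue V J b X y)) =
     {(cj (actJ g) (comp_std V j), actX g (y j)) | j. j \<in> J \<and> y j \<noteq> b \<and> actX g (y j) \<noteq> b}"
    unfolding c(2) unfolding config_glue[OF V J] by blast
  also have "\<dots> = {(comp_std V (actJ g j), actX g (y j)) | j. j \<in> J \<and> y j \<noteq> b \<and> actX g (y j) \<noteq> b}"
    unfolding comp_conj_rep_std ..
  also have "\<dots> = {(comp_std V (actJ g j), actX g (y j)) | j. j \<in> J \<and> actX g (y j) \<noteq> b}" using X(2) by metis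
  also have "\<dots> = {(comp_std V j, actX g (y (actJ' j))) | j. j \<in> J \<and> actX g (y (actJ' j)) \<noteq> b}" (is "?A = ?B")
  proof (intro subset_antisym subsetI)
    fix p assume "p \<in> ?A"
    then obtain j where "p = (comp_std V (actJ g j), actX g (y j))" "j \<in> J" "actX g (y j) \<noteq> b" by blast
    then have "p = (comp_std V (actJ g j), actX g (y (actJ' (actJ g j)))) \<and> actJ g j \<in> J \<and> actX g (y (actJ' (actJ g j))) \<noteq> b"
      using a by auto
    then show "p \<in> ?B" by blast
  next
    fix p assume "p \<in> ?B"
    then obtain j where "p = (comp_std V j, actX g (y (actJ' j)))" "j \<in> J" "actX g (y (actJ' j)) \<noteq> b" by blast
    then have "p = (comp_std V (actJ g (actJ' j)), actX g (y (actJ' j))) \<and> actJ' j \<in> J \<and> actX g (y (actJ' j)) \<noteq> b"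
      using a by auto
    then show "p \<in> ?A" by blast
  qed
  also have "\<dots> = config V b (glue V J b X (\<lambda>j. actX g (y (actJ' j))))"
    unfolding config_glue[OF V J] by blast
  finally show "config V b (D_conj G V \<rho> J actJ b X actX g (glue V J b X y)) = config V b (glue V J b X (\<lambda>j. actX g (y (actJ' j))))" .
qed

end

text \<open>
  The group acts on the algebra and on the index set \<open>J\<close>; the assumption \<open>\<theta>_act\<close> is the equivariance of
  the structure map.
\<close>

locale equivariant_algebra = algebra V A a \<theta> u
  for V :: "'v::euclidean_space set" and A :: "'a topology" and a \<theta> u +
  fixes G :: "('g, 'm) monoid_scheme" and \<rho> :: "'g \<Rightarrow> 'v \<Rightarrow> 'v" and act :: "'g \<Rightarrow> 'a \<Rightarrow> 'a"
    and J :: "'j set" and actJ :: "'g \<Rightarrow> 'j \<Rightarrow> 'j"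
  assumes G: "group G" and rep: "orthogonal_rep G V \<rho>"
    and act: "\<And>g. g \<in> carrier G \<Longrightarrow> act g \<in> topspace A \<rightarrow> topspace A" "\<And>g. g \<in> carrier G \<Longrightarrow> act g a = a"
    and \<theta>_act: "\<And>g z. g \<in> carrier G \<Longrightarrow> z \<in> topspace (D_space V {()} a A) \<Longrightarrow>
      \<theta> (D_conj G V \<rho> {()} (\<lambda>_ j. j) a A act g z) = act g (\<theta> z)"
    and J: "finite J" and actJ: "\<And>g j. g \<in> carrier G \<Longrightarrow> j \<in> J \<Longrightarrow> actJ g j \<in> J"
    "\<And>g j. g \<in> carrier G \<Longrightarrow> j \<in> J \<Longrightarrow> actJ (inv\<^bsub>G\<^esub> g) (actJ g j) = j"
begin

abbreviation "ginv \<equiv> m_inv G"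
abbreviation "iact \<equiv> iter_act G V \<rho> a A act"
abbreviation "dconj q \<equiv> D_conj G V \<rho> {()} (\<lambda>_ j. j) (b q) (T q) (iact q)"
abbreviation "bconj q \<equiv> D_conj G V \<rho> J actJ (b q) (T q) (iact q)"

lemma inv_carrier: "g \<in> carrier G \<Longrightarrow> ginv g \<in> carrier G" and inv_inv: "g \<in> carrier G \<Longrightarrow> ginv (ginv g) = g"
  using G by (simp_all add: group.inv_closed group.inv_inv)

lemma actJ_props:
  assumes g: "g \<in> carrier G"
  shows "inj_on (actJ g) J" "actJ g ` J \<subseteq> J" "\<And>j. j \<in> J \<Longrightarrow> actJ g (actJ (ginv g) j) = j"
proof -
  show "inj_on (actJ g) J" by (rule inj_on_inverseI[where g = "actJ (ginv g)", OF actJ(2)[OF g]])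
  show "actJ g ` J \<subseteq> J" using actJ(1)[OF g] by blast
  show "actJ g (actJ (ginv g) j) = j" if "j \<in> J" for j
    using actJ(2)[OF inv_carrier[OF g] that] unfolding inv_inv[OF g] .
qed

lemma triv_props: "inj_on (\<lambda>j. j) {()}" "(\<lambda>j. j) ` {()} \<subseteq> {()}"
  by auto

lemma iter_act_mem: "g \<in> carrier G \<Longrightarrow> iact q g \<in> topspace (T q) \<rightarrow> topspace (T q) \<and> iact q g (b q) = b q"
proof (induction q)
  case 0
  then show ?case using act(1)[of g] act(2)[of g] by (auto simp: iter_simps Pi_iff)
next
  case (Suc q)
  note X = Suc.IH[OF Suc.prems, THEN conjunct1] Suc.IH[OF Suc.prems, THEN conjunct2]
  have "dconj q g z \<in> topspace (B {()} q)" if "z \<in> topspace (B {()} q)" for z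
    by (rule D_conj_mem_config(1)[where actJ = "\<lambda>_ j. j" and actX = "iact q", OF G rep D_space_pre[OF V that] Suc.prems triv_props X])
  moreover have "dconj q g (D_base V {()} (b q) (T q)) = D_base V {()} (b q) (T q)"
    by (rule D_base_conj[where actJ = "\<lambda>_ j. j" and actX = "iact q", OF G rep Suc.prems triv_props X])
  ultimately show ?case unfolding T_Suc iter_simps(3) by auto
qed

lemmas iact_mem = iter_act_mem[THEN conjunct1] and iact_base = iter_act_mem[THEN conjunct2]

lemma bconj_mem: "g \<in> carrier G \<Longrightarrow> z \<in> topspace (B J q) \<Longrightarrow> bconj q g z \<in> topspace (B J q)"
  by (rule D_conj_mem_config(1)[where actJ = actJ and actX = "iact q" and b = "b q", OF G rep D_space_pre[OF V] _ actJ_props(1,2) iact_mem iact_base])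

text \<open>
  The product is equivariant for \<open>M = K \<times> V\<close>.  Both \<open>K = J\<close>, for the bar construction, and \<open>K = {()}\<close>, for
  the iterates of the monad, occur below.
\<close>

lemma iter_mult_conj:
  fixes K :: "'k set"
  assumes z: "z \<in> topspace (B K (Suc q))" and g: "g \<in> carrier G" and a: "inj_on (actK g) K" "actK g ` K \<subseteq> K"
  shows "imult K q (D_conj G V \<rho> K actK (b (Suc q)) (T (Suc q)) (iact (Suc q)) g z) =
    D_conj G V \<rho> K actK (b q) (T q) (iact q) g (imult K q z)"
proof (rule D_space_eqI[OF V])
  let ?c = "comp_conj (\<rho> g) (\<rho> (ginv g)) V"
  note zp = D_space_pre[OF V z]
  note cz = D_conj_mem_config[where actJ = actK and actX = "iact (Suc q)" and b = "b (Suc q)", OF G rep zp g a iact_mem[OF g] iact_base[OF g]]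
  note m = iter_mult_mem_config[OF zp] and mc = iter_mult_mem_config[OF D_space_pre[OF V cz(1)]]
  note cm = D_conj_mem_config[where actJ = actK and actX = "iact q" and b = "b q", OF G rep D_space_pre[OF V m(1)] g a iact_mem[OF g] iact_base[OF g]]
  show "imult K q (D_conj G V \<rho> K actK (b (Suc q)) (T (Suc q)) (iact (Suc q)) g z) \<in> topspace (B K q)" by (rule mc(1))
  show "D_conj G V \<rho> K actK (b q) (T q) (iact q) g (imult K q z) \<in> topspace (B K q)" by (rule cm(1))
  have un: "(\<xi>', x) \<in> config V (b q) (un_Node (iact (Suc q) g y)) \<longleftrightarrow>
      (\<exists>\<xi> x'. \<xi>' = ?c (\<lambda>j. j) \<xi> \<and> x = iact q g x' \<and> (\<xi>, x') \<in> config V (b q) (un_Node y) \<and> iact q g x' \<noteq> b q)"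
    if "y \<in> topspace (T (Suc q))" for \<xi>' x y
    using D_conj_mem_config(2)[where actJ = "\<lambda>_ j. j" and actX = "iact q", OF G rep D_space_pre[OF V un_Node_T(1)[OF that]] g triv_props iact_mem[OF g] iact_base[OF g]]
    by auto
  have T': "y \<in> topspace (T (Suc q))" if "(\<xi>, y) \<in> config V (b (Suc q)) z" for \<xi> y
    using config_framed[OF V zp that] by blast
  have comp: "?c (actK g) (comp_compose V \<xi> \<xi>') = comp_compose V (?c (actK g) \<xi>) (?c (\<lambda>j. j) \<xi>')"
    if 1: "(\<xi>, y) \<in> config V (b (Suc q)) z" and 2: "(\<xi>', x) \<in> config V (b q) (un_Node y)" for \<xi> y \<xi>' x
    using comp_conj_rep_compose[OF G rep g] config_framed[OF V zp 1]
      config_framed[OF V D_space_pre[OF V un_Node_T(1)[OF T'[OF 1]]] 2] by blast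
  have ne: "iact (Suc q) g y \<noteq> b (Suc q)" if 1: "(\<xi>, y) \<in> config V (b (Suc q)) z"
    and 2: "(\<xi>', x) \<in> config V (b q) (un_Node y)" "iact q g x \<noteq> b q" for \<xi> y \<xi>' x
    using un[OF T'[OF 1], of "?c (\<lambda>j. j) \<xi>'" "iact q g x"] 2 config_un_Node_base by (metis empty_iff)
  show "config V (b q) (imult K q (D_conj G V \<rho> K actK (b (Suc q)) (T (Suc q)) (iact (Suc q)) g z)) =
    config V (b q) (D_conj G V \<rho> K actK (b q) (T q) (iact q) g (imult K q z))" (is "?L = ?R")
  proof (intro subset_antisym subrelI)
    fix \<xi> x assume "(\<xi>, x) \<in> ?L"
    then obtain \<xi>\<^sub>1 y \<xi>' where 1: "\<xi> = comp_compose V (?c (actK g) \<xi>\<^sub>1) \<xi>'" "(\<xi>\<^sub>1, y) \<in> config V (b (Suc q)) z"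
        "(\<xi>', x) \<in> config V (b q) (un_Node (iact (Suc q) g y))"
      unfolding mc(2) cz(2) by blast
    obtain \<xi>\<^sub>2 x' where 2: "\<xi>' = ?c (\<lambda>j. j) \<xi>\<^sub>2" "x = iact q g x'" "(\<xi>\<^sub>2, x') \<in> config V (b q) (un_Node y)" "iact q g x' \<noteq> b q"
      using 1(3) unfolding un[OF T'[OF 1(2)]] by blast
    have "(comp_compose V \<xi>\<^sub>1 \<xi>\<^sub>2, x') \<in> config V (b q) (imult K q z)"
      unfolding m(2) using 1(2) 2(3) by blast
    then show "(\<xi>, x) \<in> ?R"
      unfolding cm(2) 1(1) 2(1,2) comp[OF 1(2) 2(3), symmetric] using 2(4) by blast
  next
    fix \<xi> x assume "(\<xi>, x) \<in> ?R"
    then obtain \<xi>\<^sub>1 y \<xi>\<^sub>2 x' where 1: "\<xi> = ?c (actK g) (comp_compose V \<xi>\<^sub>1 \<xi>\<^sub>2)" "(\<xi>\<^sub>1, y) \<in> config V (b (Suc q)) z"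
        "(\<xi>\<^sub>2, x') \<in> config V (b q) (un_Node y)" "x = iact q g x'" "iact q g x' \<noteq> b q"
      unfolding cm(2) m(2) by blast
    have "(?c (actK g) \<xi>\<^sub>1, iact (Suc q) g y) \<in> config V (b (Suc q)) (D_conj G V \<rho> K actK (b (Suc q)) (T (Suc q)) (iact (Suc q)) g z)"
      unfolding cz(2) using 1(2) ne[OF 1(2,3,5)] by blast
    moreover have "(?c (\<lambda>j. j) \<xi>\<^sub>2, x) \<in> config V (b q) (un_Node (iact (Suc q) g y))"
      unfolding un[OF T'[OF 1(2)]] using 1 by blast
    ultimately show "(\<xi>, x) \<in> ?L" unfolding mc(2) 1(1) comp[OF 1(2,3)] by blast
  qed
qed

lemma iter_ev_act: "g \<in> carrier G \<Longrightarrow> z \<in> topspace (T q) \<Longrightarrow> ev q (iact q g z) = act g (ev q z)"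
proof (induction q arbitrary: z)
  case 0
  then show ?case by (simp add: iter_simps)
next
  case (Suc q)
  note g = Suc.prems(1)
  obtain y where y: "z = Node y" "y \<in> topspace (B {()} q)" using Suc.prems(2) unfolding T_Suc by blast
  have "D_map V {()} a A (ev q) (dconj q g y) = D_conj G V \<rho> {()} (\<lambda>_ j. j) a A act g (D_map V {()} a A (ev q) y)"
    by (rule D_map_conj[where actJ = "\<lambda>_ j. j" and actX = "iact q" and actY = act, OF G rep g D_space_pre[OF V y(2)] triv_props
          iact_mem[OF g] iact_base[OF g] act(1)[OF g] act(2)[OF g] ev_mem iter_ev_base Suc.IH[OF g]])
  then show ?case
    using \<theta>_act[OF g D_map_mem[OF V D_space_pre[OF V y(2)] ev_mem]] by (simp add: y(1))
qed

lemma iter_face_act: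
  "g \<in> carrier G \<Longrightarrow> i \<le> q \<Longrightarrow> z \<in> topspace (T (Suc q)) \<Longrightarrow> face q i (iact (Suc q) g z) = iact q g (face q i z)"
proof (induction q arbitrary: i z)
  case 0
  then show ?case using iter_ev_act[of g z "Suc 0"] by simp
next
  case (Suc q)
  note g = Suc.prems(1)
  obtain y where y: "z = Node y" "y \<in> topspace (B {()} (Suc q))" using Suc.prems(3) unfolding T_Suc[of "Suc q"] by blast
  have "bface {()} q i (dconj (Suc q) g y) = dconj q g (bface {()} q i y)"
  proof (cases i)
    case 0
    then show ?thesis using iter_mult_conj[where actK = "\<lambda>_ j. j", OF y(2) g triv_props] by (simp add: bar_face_def)
  next
    case (Suc i')
    then have i': "i' \<le> q" using Suc.prems by simp
    note m = iter_face_memD[OF i']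
    show ?thesis
      unfolding Suc bar_face_def nat.case
      by (rule D_map_conj[where actJ = "\<lambda>_ j. j" and actX = "iact (Suc q)" and actY = "iact q", OF G rep g D_space_pre[OF V y(2)] triv_props
          iact_mem[OF g] iact_base[OF g] iact_mem[OF g] iact_base[OF g] m Suc.IH[OF g i']])
  qed
  then show ?case unfolding y(1) by (simp only: iter_act.simps(2) tree.sel iter_face_Suc)
qed

lemma iter_unit_act:
  "g \<in> carrier G \<Longrightarrow> z \<in> topspace (T q) \<Longrightarrow> iact (Suc q) g (unit q z) = unit q (iact q g z)"
  using D_unit_conj[where actX = "iact q" and b = "b q", OF G rep _ _ iact_mem iact_base] by (simp add: iter_unit_def)

lemma iter_degen_act:
  "g \<in> carrier G \<Longrightarrow> i \<le> q \<Longrightarrow> z \<in> topspace (T q) \<Longrightarrow> degen q i (iact q g z) = iact (Suc q) g (degen q i z)"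
proof (induction q arbitrary: i z)
  case 0
  then show ?case using iter_unit_act[of g z 0] by simp
next
  case (Suc q)
  note g = Suc.prems(1)
  show ?case
  proof (cases i)
    case 0
    then show ?thesis using iter_unit_act[OF g Suc.prems(3)] by simp
  next
    case (Suc i')
    then have i': "i' \<le> q" using Suc.prems by simp
    note m = iter_degen_memD[OF i']
    obtain y where y: "z = Node y" "y \<in> topspace (B {()} q)" using Suc.prems(3) unfolding T_Suc[of q] by blast
    have "bdegen {()} q i' (dconj q g y) = dconj (Suc q) g (bdegen {()} q i' y)"
      unfolding bar_degen_def
      by (rule D_map_conj[where actJ = "\<lambda>_ j. j" and actX = "iact q" and actY = "iact (Suc q)", OF G rep g D_space_pre[OF V y(2)] triv_props
          iact_mem[OF g] iact_base[OF g] iact_mem[OF g] iact_base[OF g] m Suc.IH[OF g i']])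
    then show ?thesis unfolding y(1) Suc by (simp only: iter_act.simps(2) tree.sel iter_degen_Suc)
  qed
qed

lemma bar_face_act:
  assumes g: "g \<in> carrier G" and i: "i \<le> Suc q" and z: "z \<in> topspace (B J (Suc q))"
  shows "bface J q i (bconj (Suc q) g z) = bconj q g (bface J q i z)"
proof (cases i)
  case 0
  then show ?thesis using iter_mult_conj[where actK = actJ, OF z g actJ_props(1,2)[OF g]] by (simp add: bar_face_def)
next
  case (Suc i')
  then have i': "i' \<le> q" using i by simp
  note m = iter_face_memD[OF i']
  show ?thesis
    unfolding Suc bar_face_def nat.case
    by (rule D_map_conj[where actJ = actJ and actX = "iact (Suc q)" and actY = "iact q" and h = "face q i'", OF G rep g D_space_pre[OF V z] actJ_props(1,2)[OF g]
        iact_mem[OF g] iact_base[OF g] iact_mem[OF g] iact_base[OF g] m iter_face_act[OF g i']])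
qed

lemma bar_degen_act:
  assumes g: "g \<in> carrier G" and i: "i \<le> q" and z: "z \<in> topspace (B J q)"
  shows "bdegen J q i (bconj q g z) = bconj (Suc q) g (bdegen J q i z)"
proof -
  note m = iter_degen_memD[OF i]
  show ?thesis
    unfolding bar_degen_def
    by (rule D_map_conj[where actJ = actJ and actX = "iact q" and actY = "iact (Suc q)" and h = "degen q i", OF G rep g D_space_pre[OF V z] actJ_props(1,2)[OF g]
        iact_mem[OF g] iact_base[OF g] iact_mem[OF g] iact_base[OF g] m iter_degen_act[OF g i]])
qed

lemma Node_strip_conj:
  assumes g: "g \<in> carrier G" and z: "z \<in> topspace (B J q)" and j: "j \<in> J"
  shows "Node (strip V (b q) (T q) (actJ g j) (bconj q g z)) = iact (Suc q) g (Node (strip V (b q) (T q) j z))"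
  using strip_conj[where actJ = actJ and actX = "iact q" and b = "b q", OF G rep g D_space_pre[OF V z] actJ_props(1,2)[OF g] iact_mem[OF g] iact_base[OF g] j] by simp

lemma bar_ev_act:
  assumes g: "g \<in> carrier G" and z: "z \<in> topspace (B J q)" and j: "j \<in> J"
  shows "bev q (bconj q g z) (actJ g j) = act g (bev q z j)"
  unfolding bar_ev_def Node_strip_conj[OF assms] by (rule iter_ev_act[OF g Node_strip_T[OF z]])

lemma bar_extra_act:
  assumes g: "g \<in> carrier G" and z: "z \<in> topspace (B J q)"
  shows "extra J q (bconj q g z) = bconj (Suc q) g (extra J q z)"
proof -
  have y: "(\<lambda>j. Node (strip V (b q) (T q) j z)) \<in> J \<rightarrow> topspace (T (Suc q))" using Node_strip_T[OF z] by blast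
  have "bconj (Suc q) g (extra J q z) =
     glue V J (b (Suc q)) (T (Suc q)) (\<lambda>j. iact (Suc q) g (Node (strip V (b q) (T q) (actJ (ginv g) j) z)))"
    unfolding bar_extra_def
    by (rule glue_conj[where actJ = actJ and actJ' = "actJ (ginv g)" and actX = "iact (Suc q)" and b = "b (Suc q)", OF G rep g J y actJ_props(2)[OF g] actJ_props(2)[OF inv_carrier[OF g]]
        actJ(2)[OF g] actJ_props(3)[OF g] iact_mem[OF g] iact_base[OF g]])
  also have "\<dots> = extra J q (bconj q g z)"
    unfolding bar_extra_def
    by (rule glue_cong[OF J])
      (use Node_strip_conj[OF g z actJ(1)[OF inv_carrier[OF g]]] actJ_props(3)[OF g] in simp)
  finally show ?thesis by simp
qed

lemma bar_unit_act:
  assumes g: "g \<in> carrier G" and y: "y \<in> J \<rightarrow> topspace A"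
  shows "bconj 0 g (bunit J y) = bunit J (\<lambda>j. act g (y (actJ (ginv g) j)))"
proof -
  have "(\<lambda>j. Leaf (y j)) \<in> J \<rightarrow> topspace (T 0)" using y Leaf_T by auto
  from glue_conj[where actJ = actJ and actJ' = "actJ (ginv g)" and actX = "iact 0" and b = "b 0", OF G rep g J this actJ_props(2)[OF g] actJ_props(2)[OF inv_carrier[OF g]]
        actJ(2)[OF g] actJ_props(3)[OF g] iact_mem[OF g] iact_base[OF g]]
  show ?thesis unfolding bar_unit_def by simp
qed

end


section \<open>Continuity on realizations\<close>

lemma continuous_map_from_sum_topology:
  assumes "\<And>i. i \<in> I \<Longrightarrow> continuous_map (X i) Y (\<lambda>x. f (i, x))"
  shows "continuous_map (sum_topology X I) Y f"
  unfolding continuous_map_def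
proof (intro conjI allI impI funcsetI)
  fix z assume "z \<in> topspace (sum_topology X I)"
  then obtain i x where z: "z = (i, x)" "i \<in> I" "x \<in> topspace (X i)" by auto
  then show "f z \<in> topspace Y" using assms[OF z(2)] by (auto simp: continuous_map_def Pi_iff)
next
  fix U assume U: "openin Y U"
  have "{x. (i, x) \<in> {z \<in> topspace (sum_topology X I). f z \<in> U}} = {x \<in> topspace (X i). f (i, x) \<in> U}" if "i \<in> I" for i
    using that by auto
  then show "openin (sum_topology X I) {z \<in> topspace (sum_topology X I). f z \<in> U}"
    unfolding openin_sum_topology using openin_continuous_map_preimage[OF assms U] by auto
qed

lemma continuous_map_from_prod_sum_topology:
  assumes "\<And>i. i \<in> I \<Longrightarrow> continuous_map (prod_topology (X i) L) Y (\<lambda>(x, t). f ((i, x), t))"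
  shows "continuous_map (prod_topology (sum_topology X I) L) Y f"
proof (rule continuous_map_open_cover)
  fix z assume "z \<in> topspace (prod_topology (sum_topology X I) L)"
  then obtain i x t where z: "z = ((i, x), t)" "i \<in> I" "x \<in> topspace (X i)" "t \<in> topspace L" by auto
  let ?S = "Sigma I (\<lambda>k. if k = i then topspace (X i) else {})"
  have op: "openin (sum_topology X I) ?S" unfolding openin_disjoint_union by simp
  have S: "?S = {i} \<times> topspace (X i)" using z(2) by (auto split: if_splits)
  have snd: "continuous_map (subtopology (sum_topology X I) ?S) (X i) snd"
    unfolding continuous_map_def
  proof (intro conjI allI impI funcsetI)
    fix U assume U: "openin (X i) U"
    have "{x. (k, x) \<in> {i} \<times> U} = (if k = i then U else {})" for k by auto
    then have "openin (sum_topology X I) ({i} \<times> U)"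
      unfolding openin_sum_topology using U openin_subset[OF U] z(2) by auto
    moreover have "{x \<in> topspace (subtopology (sum_topology X I) ?S). snd x \<in> U} = ({i} \<times> U) \<inter> ?S"
      unfolding S using openin_subset[OF U] z(2) by auto
    ultimately show "openin (subtopology (sum_topology X I) ?S) {x \<in> topspace (subtopology (sum_topology X I) ?S). snd x \<in> U}"
      unfolding openin_subtopology by blast
  qed (auto split: if_splits)
  have "continuous_map (prod_topology (subtopology (sum_topology X I) ?S) L) (prod_topology (X i) L) (\<lambda>p. (snd (fst p), snd p))"
    using continuous_map_compose[OF continuous_map_fst[of _ L] snd] continuous_map_snd[of _ L]
    unfolding continuous_map_pairwise o_def fst_conv snd_conv by blast
  from continuous_map_compose[OF this assms[OF z(2)]]
  have "continuous_map (prod_topology (subtopology (sum_topology X I) ?S) L) Y (\<lambda>p. f ((i, snd (fst p)), snd p))"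
    by (simp add: o_def)
  then have "continuous_map (prod_topology (subtopology (sum_topology X I) ?S) L) Y f"
    by (rule continuous_map_eq) (auto split: if_splits)
  then have "continuous_map (subtopology (prod_topology (sum_topology X I) L) (?S \<times> topspace L)) Y f"
    by (simp add: subtopology_Times)
  moreover have "openin (prod_topology (sum_topology X I) L) (?S \<times> topspace L)"
    using op by (simp add: openin_prod_Times_iff)
  moreover have "z \<in> ?S \<times> topspace L" using z by simp
  ultimately show "\<exists>P. openin (prod_topology (sum_topology X I) L) P \<and> z \<in> P \<and>
      continuous_map (subtopology (prod_topology (sum_topology X I) L) P) Y f" by blast
qed

lemma continuous_map_compact_into_kify:
  assumes "continuous_map K Z f" "compact_space K" "Hausdorff_space K" "k_Hausdorff Z"
  shows "continuous_map K (kify Z) f"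
proof -
  have "kify K = K"
    using assms by (intro kify_locally_compact_Hausdorff compact_imp_locally_compact_space)
  then show ?thesis using continuous_map_into_kify[of K Z f] assms by simp
qed

lemma k_Hausdorff_compact_open:
  assumes "k_Hausdorff Y"
  shows "k_Hausdorff (compact_open X Y)"
proof (rule k_Hausdorff_injection)
  show "k_Hausdorff (product_topology (\<lambda>_. Y) (topspace X))" by (rule k_Hausdorff_product) (rule assms)
  have "continuous_map (compact_open X Y) (product_topology (\<lambda>_. Y) (topspace X)) (\<lambda>f. \<lambda>x\<in>topspace X. f x)"
    by (auto simp: continuous_map_componentwise continuous_map_compact_open_eval)
  then show "continuous_map (compact_open X Y) (product_topology (\<lambda>_. Y) (topspace X)) (\<lambda>f. restrict f (topspace X))" .
  show "inj_on (\<lambda>f. restrict f (topspace X)) (topspace (compact_open X Y))"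
    by (auto simp: inj_on_def topspace_compact_open extensional_restrict)
qed

lemma continuous_map_into_finite_map_space:
  assumes P: "finite P" and Y: "k_Hausdorff Y" and ext: "\<And>s. s \<in> topspace S \<Longrightarrow> F s \<in> extensional P"
    and F: "\<And>p. p \<in> P \<Longrightarrow> continuous_map (kify S) Y (\<lambda>s. F s p)"
  shows "continuous_map (kify S) (map_space (discrete_topology P) Y) F"
  unfolding map_space_eq
proof (rule continuous_map_into_kify[OF continuous_map_into_compact_open k_Hausdorff_compact_open[OF Y]])
  fix s assume s: "s \<in> topspace (kify S)"
  have "F s \<in> P \<rightarrow> topspace Y" using F s by (auto simp: continuous_map_def Pi_iff)
  then show "F s \<in> extensional (topspace (discrete_topology P)) \<and> continuous_map (discrete_topology P) Y (F s)"
    using ext s by simp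
next
  fix K U assume "compactin (discrete_topology P) K" and U: "openin Y U"
  then have K: "K \<subseteq> P" "finite K" by (auto simp: compactin_discrete_topology)
  have "openin (kify S) (topspace (kify S) \<inter> (\<Inter>p\<in>K. {s \<in> topspace (kify S). F s p \<in> U}))"
  proof (cases "K = {}")
    case False
    have "openin (kify S) (\<Inter>p\<in>K. {s \<in> topspace (kify S). F s p \<in> U})"
      using K by (intro openin_INT2 False openin_continuous_map_preimage[OF F U]) auto
    then show ?thesis by (intro openin_Int openin_topspace)
  qed (use openin_topspace[of "kify S"] in simp)
  moreover have "topspace (kify S) \<inter> (\<Inter>p\<in>K. {s \<in> topspace (kify S). F s p \<in> U}) = {s \<in> topspace (kify S). F s ` K \<subseteq> U}"
    by auto
  ultimately show "openin (kify S) {s \<in> topspace (kify S). F s ` K \<subseteq> U}" by simp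
qed

lemma simplex_space_props:
  "topspace (simplex_space q) = standard_simplex q" "compact_space (simplex_space q)" "Hausdorff_space (simplex_space q)"
proof -
  show "topspace (simplex_space q) = standard_simplex q" by (simp add: simplex_space_def)
  show "compact_space (simplex_space q)"
    unfolding simplex_space_def by (rule compact_space_subtopology[OF compactin_standard_simplex])
  show "Hausdorff_space (simplex_space q)"
    unfolding simplex_space_def by (intro Hausdorff_space_subtopology) (simp add: Hausdorff_space_product_topology)
qed

lemma continuous_map_into_simplex_space:
  "continuous_map S (simplex_space q) f \<longleftrightarrow>
    f \<in> topspace S \<rightarrow> standard_simplex q \<and> (\<forall>i. continuous_map S euclideanreal (\<lambda>s. f s i))"
  by (auto simp: simplex_space_def continuous_map_in_subtopology continuous_map_componentwise_UNIV)

lemma topspace_realization_pre: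
  "(q, x, t) \<in> topspace (realization_pre X) \<longleftrightarrow> x \<in> topspace (X q) \<and> t \<in> standard_simplex q"
  by (simp add: realization_pre_def kprod_def simplex_space_props)

lemma continuous_map_to_realization:
  "continuous_map (kprod (X q) (simplex_space q)) (quotient_space (realization_pre X) R) (\<lambda>p. class_rep R (q, p))"
proof -
  have "continuous_map (kprod (X q) (simplex_space q)) (realization_pre X) (\<lambda>p. (q, p))"
    unfolding realization_pre_def by (rule continuous_map_component_injection) simp
  from continuous_map_compose[OF this continuous_map_final_topology[of _ "class_rep R"]]
  show ?thesis by (simp add: quotient_space_def o_def)
qed

lemma continuous_map_from_realization:
  assumes "\<And>q. continuous_map (kprod (X q) (simplex_space q)) Y (\<lambda>(x, t). f (class_rep R (q, x, t)))"
  shows "continuous_map (quotient_space (realization_pre X) R) Y f"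
  unfolding quotient_space_def
proof (rule continuous_map_from_final_topology)
  show "continuous_map (realization_pre X) Y (f \<circ> class_rep R)"
    unfolding realization_pre_def
    by (rule continuous_map_from_sum_topology) (use assms in \<open>simp add: case_prod_unfold\<close>)
qed

text \<open>
  As \<open>L\<close> is locally compact, its product with a quotient map is a quotient map; as \<open>L\<close> is compact, the
  map can be tested on compact sets of simplices.
\<close>

lemma continuous_map_from_realization_prod:
  assumes L: "compact_space L" "Hausdorff_space L"
    and f: "\<And>q C. compactin (prod_topology (X q) (simplex_space q)) C \<Longrightarrow>
      Hausdorff_space (subtopology (prod_topology (X q) (simplex_space q)) C) \<Longrightarrow>
      continuous_map (prod_topology (subtopology (prod_topology (X q) (simplex_space q)) C) L) Y
        (\<lambda>((x, t), s). f (class_rep R (q, x, t), s))"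
    and m: "\<And>q x t s. x \<in> topspace (X q) \<Longrightarrow> t \<in> standard_simplex q \<Longrightarrow> s \<in> topspace L \<Longrightarrow> f (class_rep R (q, x, t), s) \<in> topspace Y"
  shows "continuous_map (prod_topology (quotient_space (realization_pre X) R) L) Y f"
proof -
  have 1: "continuous_map (prod_topology (kprod (X q) (simplex_space q)) L) Y (\<lambda>(p, s). f (class_rep R (q, p), s))" for q
    unfolding kprod_def
  proof (rule continuous_map_prod_kify_compact[OF L])
    fix C assume "compactin (prod_topology (X q) (simplex_space q)) C" "Hausdorff_space (subtopology (prod_topology (X q) (simplex_space q)) C)"
    from f[OF this] show "continuous_map (prod_topology (subtopology (prod_topology (X q) (simplex_space q)) C) L) Y
        (\<lambda>(p, s). f (class_rep R (q, p), s))" by (simp add: case_prod_unfold)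
  next
    show "(\<lambda>(p, s). f (class_rep R (q, p), s)) \<in> topspace (prod_topology (X q) (simplex_space q)) \<times> topspace L \<rightarrow> topspace Y"
      using m by (auto simp: simplex_space_props)
  qed
  have "continuous_map (prod_topology (realization_pre X) L) Y (\<lambda>(p, s). f (class_rep R p, s))"
    unfolding realization_pre_def by (rule continuous_map_from_prod_sum_topology) (use 1 in \<open>simp add: case_prod_unfold\<close>)
  moreover have "quotient_map (prod_topology (realization_pre X) L) (prod_topology (quotient_space (realization_pre X) R) L)
      (\<lambda>(p, s). (class_rep R p, s))"
    unfolding quotient_space_def
    by (rule quotient_map_prod_left[OF compact_imp_locally_compact_space[OF L(1)] disjI1[OF L(2)] quotient_map_final_topology])
  ultimately show ?thesis
    by (subst continuous_compose_quotient_map_eq[symmetric]) (auto simp: o_def case_prod_unfold)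
qed


section \<open>Cones on simplices\<close>

text \<open>The point of the join of a new vertex, numbered \<open>0\<close>, with a simplex.\<close>

definition cone :: "real \<Rightarrow> (nat \<Rightarrow> real) \<Rightarrow> nat \<Rightarrow> real" where
  "cone s t = (\<lambda>i. if i = 0 then s else (1 - s) * t (i - 1))"

text \<open>The vertex with index \<open>0\<close>, the cone point.\<close>

definition vertex :: "nat \<Rightarrow> real" where
  "vertex = (\<lambda>i. if i = 0 then 1 else 0)"

lemma cone_mem:
  assumes "t \<in> standard_simplex q" "s \<in> {0..1}"
  shows "cone s t \<in> standard_simplex (Suc q)"
proof -
  have t: "0 \<le> t i" "t i \<le> 1" "i > q \<Longrightarrow> t i = 0" "(\<Sum>i\<le>q. t i) = 1" for i
    using assms(1) by (auto simp: standard_simplex_def)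
  have "(\<Sum>i\<le>Suc q. cone s t i) = s + (\<Sum>i\<le>q. (1 - s) * t i)"
    by (subst sum.atMost_Suc_shift) (simp add: cone_def)
  also have "\<dots> = 1" unfolding sum_distrib_left[symmetric] t(4) by simp
  finally have "(\<Sum>i\<le>Suc q. cone s t i) = 1" .
  moreover have "0 \<le> cone s t i" "cone s t i \<le> 1" for i
    using t(1,2)[of "i - 1"] assms(2) by (auto simp: cone_def intro: mult_le_one)
  moreover have "cone s t i = 0" if "i > Suc q" for i
    using t(3)[of "i - 1"] that by (auto simp: cone_def)
  ultimately show ?thesis unfolding standard_simplex_def by blast
qed

lemma cone_face: "cone s (simplical_face i t) = simplical_face (Suc i) (cone s t)"
  by (auto simp: cone_def simplical_face_def fun_eq_iff)

lemma cone_degen: "cone s (simplex_degen i t) = simplex_degen (Suc i) (cone s t)"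
  by (auto simp: cone_def simplex_degen_def fun_eq_iff algebra_simps)

lemma cone_0: "cone 0 t = simplical_face 0 t"
  by (auto simp: cone_def simplical_face_def fun_eq_iff)

lemma cone_1: "cone 1 t = vertex"
  by (auto simp: cone_def vertex_def fun_eq_iff)

lemma face_vertex: "simplical_face (Suc i) vertex = vertex"
  by (auto simp: vertex_def simplical_face_def fun_eq_iff)

lemma vertex_mem: "vertex \<in> standard_simplex q"
  by (simp add: vertex_def)

lemma simplex_0: "t \<in> standard_simplex 0 \<Longrightarrow> t = vertex"
  by (simp add: standard_simplex_0 vertex_def)

lemma simplex_degen_mem:
  assumes t: "t \<in> standard_simplex (Suc q)" and i: "i \<le> q"
  shows "simplex_degen i t \<in> standard_simplex q"
proof -
  have t: "0 \<le> t i" "i > Suc q \<Longrightarrow> t i = 0" "(\<Sum>i\<le>Suc q. t i) = 1" for i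
    using assms(1) by (auto simp: standard_simplex_def)
  have "1 = (\<Sum>j\<le>Suc q. (if j \<le> i then t j else 0)) + (\<Sum>j\<le>Suc q. (if j \<le> i then 0 else t j))"
    unfolding t(3)[symmetric] sum.distrib[symmetric] by (rule sum.cong) auto
  also have "(\<Sum>j\<le>Suc q. (if j \<le> i then t j else 0)) = (\<Sum>j\<le>q. (if j \<le> i then t j else 0))"
    using i by simp
  also have "(\<Sum>j\<le>Suc q. (if j \<le> i then 0 else t j)) = (\<Sum>j\<le>q. (if Suc j \<le> i then 0 else t (Suc j)))"
    by (subst sum.atMost_Suc_shift) simp
  also have "(\<Sum>j\<le>q. (if j \<le> i then t j else 0)) + (\<Sum>j\<le>q. (if Suc j \<le> i then 0 else t (Suc j))) = (\<Sum>j\<le>q. simplex_degen i t j)"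
    unfolding sum.distrib[symmetric] by (rule sum.cong) (auto simp: simplex_degen_def)
  finally have s: "(\<Sum>j\<le>q. simplex_degen i t j) = 1" by simp
  have p: "0 \<le> simplex_degen i t j" for j using t(1) by (simp add: simplex_degen_def)
  have z: "simplex_degen i t j = 0" if "j > q" for j using t(2)[of "Suc j"] that i by (simp add: simplex_degen_def)
  have "simplex_degen i t j \<le> 1" for j
  proof (cases "j \<le> q")
    case True
    then show ?thesis unfolding s[symmetric] by (intro member_le_sum p) auto
  qed (use z in simp)
  then show ?thesis unfolding standard_simplex_def using p z s by blast
qed


section \<open>Equivariant deformation retracts\<close>

text \<open>An equivariant strong deformation retraction restricts to fixed points.\<close>

lemma weak_equivalence_fixed_points:
  assumes f: "continuous_map Z X f" and r: "continuous_map X Z r"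
    and rf: "\<And>z. z \<in> topspace Z \<Longrightarrow> r (f z) = z"
    and h: "continuous_map (prod_topology (top_of_set {0..1::real}) X) X h"
    and h0: "\<And>x. x \<in> topspace X \<Longrightarrow> h (0, x) = x"
    and h1: "\<And>x. x \<in> topspace X \<Longrightarrow> h (1, x) = f (r x)"
    and hf: "\<And>t z. t \<in> {0..1} \<Longrightarrow> z \<in> topspace Z \<Longrightarrow> h (t, f z) = f z"
    and fe: "\<And>g z. g \<in> K \<Longrightarrow> z \<in> topspace Z \<Longrightarrow> f (actZ g z) = actX g (f z)"
    and re: "\<And>g x. g \<in> K \<Longrightarrow> x \<in> topspace X \<Longrightarrow> r (actX g x) = actZ g (r x)"
    and he: "\<And>g t x. g \<in> K \<Longrightarrow> t \<in> {0..1} \<Longrightarrow> x \<in> topspace X \<Longrightarrow> h (t, actX g x) = actX g (h (t, x))"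
  shows "weak_equivalence (fixed_points K Z actZ) (fixed_points K X actX) f"
  unfolding fixed_points_def
proof (rule weak_equivalence_deformation_retract[where r = r and h = h])
  let ?SX = "{x \<in> topspace X. \<forall>g\<in>K. actX g x = x}" and ?SZ = "{x \<in> topspace Z. \<forall>g\<in>K. actZ g x = x}"
  have fm: "f z \<in> topspace X" if "z \<in> topspace Z" for z using f that by (auto simp: continuous_map_def)
  have rm: "r z \<in> topspace Z" if "z \<in> topspace X" for z using r that by (auto simp: continuous_map_def)
  have hm: "h (t, x) \<in> topspace X" if "t \<in> {0..1}" "x \<in> topspace X" for t x
    using h that by (auto simp: continuous_map_def Pi_iff)
  have "f z \<in> ?SX" if "z \<in> ?SZ" for z using that fm fe[of _ z, symmetric] by simp
  then show "continuous_map (subtopology Z ?SZ) (subtopology X ?SX) f"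
    using f by (auto simp: continuous_map_in_subtopology continuous_map_from_subtopology)
  have "r z \<in> ?SZ" if "z \<in> ?SX" for z using that rm re[of _ z, symmetric] by simp
  then show "continuous_map (subtopology X ?SX) (subtopology Z ?SZ) r"
    using r by (auto simp: continuous_map_in_subtopology continuous_map_from_subtopology)
  have "h (t, z) \<in> ?SX" if "t \<in> {0..1}" "z \<in> ?SX" for t z using that hm he[of _ t z, symmetric] by simp
  then have "h ` (topspace (prod_topology (top_of_set {0..1::real}) (subtopology X ?SX))) \<subseteq> ?SX" by auto
  then show "continuous_map (prod_topology (top_of_set {0..1::real}) (subtopology X ?SX)) (subtopology X ?SX) h"
    using h by (simp add: continuous_map_in_subtopology prod_topology_subtopology(2) continuous_map_from_subtopology image_subset_iff_funcset)
qed (use rf h0 h1 hf in auto)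

lemma group_actionI:
  assumes G: "group G" and m: "\<And>g x. g \<in> carrier G \<Longrightarrow> x \<in> E \<Longrightarrow> act g x \<in> E"
    and one: "\<And>x. x \<in> E \<Longrightarrow> act \<one>\<^bsub>G\<^esub> x = x"
    and mult: "\<And>g h x. g \<in> carrier G \<Longrightarrow> h \<in> carrier G \<Longrightarrow> x \<in> E \<Longrightarrow> act (g \<otimes>\<^bsub>G\<^esub> h) x = act g (act h x)"
  shows "group_action G E (\<lambda>g. restrict (act g) E)"
proof -
  interpret group G by (rule G)
  have i: "act (inv\<^bsub>G\<^esub> g) (act g x) = x" if "g \<in> carrier G" "x \<in> E" for g x
    using mult[of "inv\<^bsub>G\<^esub> g" g x] one that by simp
  have i': "act g (act (inv\<^bsub>G\<^esub> g) x) = x" if "g \<in> carrier G" "x \<in> E" for g x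
    using mult[of g "inv\<^bsub>G\<^esub> g" x] one that by simp
  have B: "restrict (act g) E \<in> Bij E" if "g \<in> carrier G" for g
  proof -
    have "bij_betw (act g) E E"
      by (rule bij_betw_byWitness[where f' = "act (inv\<^bsub>G\<^esub> g)"]) (use i i' m that in auto)
    then show ?thesis by (simp add: Bij_def)
  qed
  have "(\<lambda>g. restrict (act g) E) \<in> hom G (BijGroup E)"
    using B mult m by (auto simp: hom_def BijGroup_def compose_def fun_eq_iff restrict_def)
  then show ?thesis
    unfolding group_action_def group_hom_def group_hom_axioms_def using G group_BijGroup by blast
qed


section \<open>The deformation retraction\<close>

context equivariant_algebra
begin

abbreviation "Fh \<equiv> fact_homology V J a A \<theta>"
abbreviation "fhact \<equiv> fact_homology_act G V \<rho> J actJ a A act \<theta>"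
abbreviation "rep \<equiv> class_rep (bar_rel V J a A \<theta>)"
abbreviation "Pre \<equiv> realization_pre (bar_simplices V J a A)"
abbreviation "Jplus \<equiv> insert None (Some ` J)"
abbreviation "Maps \<equiv> based_maps (discrete_topology Jplus) None A a"
abbreviation "mact \<equiv> map_conj G (discrete_topology Jplus) (\<lambda>g. map_option (actJ g)) act"

lemma Pre_mem: "(q, z, t) \<in> topspace Pre \<longleftrightarrow> z \<in> topspace (B J q) \<and> t \<in> standard_simplex q"
  by (simp add: topspace_realization_pre bar_simplices_def)

lemma rep_invariant:
  assumes face: "\<And>q i z t. i \<le> Suc q \<Longrightarrow> z \<in> topspace (B J (Suc q)) \<Longrightarrow> t \<in> standard_simplex q \<Longrightarrow>
      f (q, bface J q i z, t) = f (Suc q, z, simplical_face i t)"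
    and degen: "\<And>q i z t. i \<le> q \<Longrightarrow> z \<in> topspace (B J q) \<Longrightarrow> t \<in> standard_simplex (Suc q) \<Longrightarrow>
      f (Suc q, bdegen J q i z, t) = f (q, z, simplex_degen i t)"
  shows "f (rep p) = f p"
proof (rule class_rep_invariant)
  fix x y assume "(x, y) \<in> bar_rel V J a A \<theta>"
  then consider q i z t where "x = (q, bface J q i z, t)" "y = (Suc q, z, simplical_face i t)"
      "i \<le> Suc q" "z \<in> topspace (B J (Suc q))" "t \<in> standard_simplex q"
    | q i z t where "x = (Suc q, bdegen J q i z, t)" "y = (q, z, simplex_degen i t)"
      "i \<le> q" "z \<in> topspace (B J q)" "t \<in> standard_simplex (Suc q)"
    unfolding realization_rel_def bar_simplices_def by blast
  then show "f x = f y" by cases (use face degen in simp_all)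
qed

lemma rep_face:
  assumes "i \<le> Suc q" "z \<in> topspace (B J (Suc q))" "t \<in> standard_simplex q"
  shows "rep (q, bface J q i z, t) = rep (Suc q, z, simplical_face i t)"
  by (rule class_rep_eq[OF equiv_hull_base])
     (use assms in \<open>unfold realization_rel_def bar_simplices_def, blast\<close>)

lemma rep_degen:
  assumes "i \<le> q" "z \<in> topspace (B J q)" "t \<in> standard_simplex (Suc q)"
  shows "rep (Suc q, bdegen J q i z, t) = rep (q, z, simplex_degen i t)"
  by (rule class_rep_eq[OF equiv_hull_base])
     (use assms in \<open>unfold realization_rel_def bar_simplices_def, blast\<close>)

lemma face_mem: "i \<le> Suc q \<Longrightarrow> t \<in> standard_simplex q \<Longrightarrow> simplical_face i t \<in> standard_simplex (Suc q)"
  using simplical_face_in_standard_simplex[of "Suc q" i t] by simp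

lemma rep_mem: "p \<in> topspace Pre \<Longrightarrow> rep p \<in> topspace Pre"
  using rep_invariant[of "\<lambda>p. p \<in> topspace Pre" p]
  by (simp add: Pre_mem face_mem simplex_degen_mem bar_face_mem bar_degen_mem)

lemma topspace_Fh: "topspace Fh = rep ` topspace Pre"
  by (simp add: fact_homology_def quotient_space_def)

lemma Fh_point:
  assumes "x \<in> topspace Fh"
  obtains q z t where "x = (q, z, t)" "z \<in> topspace (B J q)" "t \<in> standard_simplex q" "rep (q, z, t) = (q, z, t)"
proof -
  obtain p where p: "p \<in> topspace Pre" "x = rep p" using assms unfolding topspace_Fh by blast
  obtain q z t where x: "x = (q, z, t)" by (metis prod.collapse)
  have "rep x = x" unfolding p(2) by (rule class_rep_idem)
  moreover have "x \<in> topspace Pre" unfolding p(2) by (rule rep_mem[OF p(1)])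
  ultimately show ?thesis using that x unfolding x Pre_mem by blast
qed

lemma rep_Fh: "z \<in> topspace (B J q) \<Longrightarrow> t \<in> standard_simplex q \<Longrightarrow> rep (q, z, t) \<in> topspace Fh"
  unfolding topspace_Fh by (rule imageI) (simp add: Pre_mem)

text \<open>
  The retraction onto the space of based maps, its section, and the homotopy, on representatives of
  points of the realization.
\<close>

definition real_ev where
  "real_ev = (\<lambda>(q, z, t :: nat \<Rightarrow> real). \<lambda>x\<in>Jplus. case x of None \<Rightarrow> a | Some j \<Rightarrow> bev q z j)"

definition real_unit where
  "real_unit f = rep (0, bunit J (\<lambda>j. f (Some j)), vertex)"

definition real_htpy where
  "real_htpy = (\<lambda>(s, q, z, t). rep (Suc q, extra J q z, cone s t))"

lemma real_ev_rep: "real_ev (rep p) = real_ev p"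
  by (rule rep_invariant) (simp_all add: real_ev_def bar_ev_face bar_ev_degen)

lemma real_htpy_rep:
  assumes s: "s \<in> {0..1}"
  shows "real_htpy (s, rep p) = real_htpy (s, p)"
proof (rule rep_invariant)
  fix q i z t assume *: "i \<le> Suc q" "z \<in> topspace (B J (Suc q))" "t \<in> standard_simplex q"
  have "rep (Suc q, extra J q (bface J q i z), cone s t) =
      rep (Suc q, bface J (Suc q) (Suc i) (extra J (Suc q) z), cone s t)"
    by (simp only: bar_face_Suc_extra[OF J *(1,2)])
  also have "\<dots> = rep (Suc (Suc q), extra J (Suc q) z, cone s (simplical_face i t))"
    unfolding cone_face by (rule rep_face) (use *(1) bar_extra_mem[OF J *(2)] cone_mem[OF *(3) s] in auto)
  finally show "real_htpy (s, q, bface J q i z, t) = real_htpy (s, Suc q, z, simplical_face i t)"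
    by (simp add: real_htpy_def)
next
  fix q i z t assume *: "i \<le> q" "z \<in> topspace (B J q)" "t \<in> standard_simplex (Suc q)"
  have "rep (Suc (Suc q), extra J (Suc q) (bdegen J q i z), cone s t) =
      rep (Suc (Suc q), bdegen J (Suc q) (Suc i) (extra J q z), cone s t)"
    by (simp only: bar_degen_extra[OF J *(1,2)])
  also have "\<dots> = rep (Suc q, extra J q z, cone s (simplex_degen i t))"
    unfolding cone_degen by (rule rep_degen) (use *(1) bar_extra_mem[OF J *(2)] cone_mem[OF *(3) s] in auto)
  finally show "real_htpy (s, Suc q, bdegen J q i z, t) = real_htpy (s, q, z, simplex_degen i t)"
    by (simp add: real_htpy_def)
qed

lemma topspace_Maps: "f \<in> topspace Maps \<longleftrightarrow> f \<in> extensional Jplus \<and> f None = a \<and> (\<forall>j\<in>J. f (Some j) \<in> topspace A)"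
  using aA by (auto simp: based_maps_def topspace_map_space Pi_iff)

lemma Maps_fun: "f \<in> topspace Maps \<Longrightarrow> (\<lambda>j. f (Some j)) \<in> J \<rightarrow> topspace A"
  by (simp add: topspace_Maps)

lemma real_ev_unit:
  assumes "f \<in> topspace Maps"
  shows "real_ev (real_unit f) = f"
proof -
  have "real_ev (real_unit f) x = f x" for x
  proof (cases "x \<in> Jplus")
    case True
    then show ?thesis using assms bar_ev_unit[OF J Maps_fun[OF assms]]
      unfolding real_unit_def real_ev_rep by (auto simp: real_ev_def topspace_Maps)
  next
    case False
    then have "f x = undefined" using assms by (simp add: topspace_Maps extensional_def)
    with False show ?thesis unfolding real_unit_def real_ev_rep by (auto simp: real_ev_def)
  qed
  then show ?thesis by blast
qed

lemma real_htpy_0: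
  assumes "x \<in> topspace Fh"
  shows "real_htpy (0, x) = x"
proof -
  obtain q z t where x: "x = (q, z, t)" "z \<in> topspace (B J q)" "t \<in> standard_simplex q" "rep (q, z, t) = (q, z, t)"
    by (rule Fh_point[OF assms])
  have "real_htpy (0, x) = rep (q, bface J q 0 (extra J q z), t)"
    unfolding x(1) real_htpy_def prod.case cone_0
    by (rule rep_face[symmetric]) (use x bar_extra_mem[OF J] in auto)
  then show ?thesis unfolding bar_face_0_extra[OF J x(2)] x(4) x(1) .
qed

text \<open>
  At the cone point only the last faces matter.  Taking the last face repeatedly evaluates all the
  configurations.
\<close>

lemma extra_vertex:
  "z \<in> topspace (B J q) \<Longrightarrow> rep (Suc q, extra J q z, vertex) = rep (0, bunit J (bev q z), vertex)"
proof (induction q arbitrary: z)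
  case 0
  have "rep (0, bface J 0 (Suc 0) (extra J 0 z), vertex) = rep (Suc 0, extra J 0 z, simplical_face (Suc 0) vertex)"
    by (rule rep_face) (use bar_extra_mem[OF J 0] vertex_mem in auto)
  then show ?case unfolding face_vertex bar_face_1_extra[OF J 0] by simp
next
  case (Suc q)
  let ?z = "bface J q (Suc q) z"
  have z: "?z \<in> topspace (B J q)" by (rule bar_face_mem[OF order_refl Suc.prems])
  have "rep (Suc q, bface J (Suc q) (Suc (Suc q)) (extra J (Suc q) z), vertex) =
     rep (Suc (Suc q), extra J (Suc q) z, simplical_face (Suc (Suc q)) vertex)"
    by (rule rep_face) (use bar_extra_mem[OF J Suc.prems] vertex_mem in auto)
  then have "rep (Suc (Suc q), extra J (Suc q) z, vertex) = rep (Suc q, extra J q ?z, vertex)"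
    unfolding face_vertex bar_face_Suc_extra[OF J order_refl Suc.prems] by simp
  also have "\<dots> = rep (0, bunit J (bev q ?z), vertex)" by (rule Suc.IH[OF z])
  finally show ?case unfolding bar_ev_face[OF order_refl Suc.prems] .
qed

lemma bar_unit_cong: "(\<And>j. j \<in> J \<Longrightarrow> y j = y' j) \<Longrightarrow> bunit J y = bunit J y'"
  unfolding bar_unit_def by (rule glue_cong[OF J]) simp

lemma real_htpy_1:
  assumes "x \<in> topspace Fh"
  shows "real_htpy (1, x) = real_unit (real_ev x)"
proof -
  obtain q z t where x: "x = (q, z, t)" "z \<in> topspace (B J q)" "t \<in> standard_simplex q"
    by (rule Fh_point[OF assms])
  have "bunit J (bev q z) = bunit J (\<lambda>j. real_ev x (Some j))"
    by (rule bar_unit_cong) (simp add: x(1) real_ev_def)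
  then show ?thesis
    unfolding real_unit_def using extra_vertex[OF x(2)] by (simp add: x(1) real_htpy_def cone_1)
qed

lemma real_htpy_unit:
  assumes s: "s \<in> {0..1}" and f: "f \<in> topspace Maps"
  shows "real_htpy (s, real_unit f) = real_unit f"
proof -
  let ?z = "bunit J (\<lambda>j. f (Some j))"
  note z = bar_unit_mem[OF J Maps_fun[OF f]]
  have c: "cone s vertex \<in> standard_simplex (Suc 0)" by (rule cone_mem[OF vertex_mem s])
  have "real_htpy (s, real_unit f) = rep (Suc 0, bdegen J 0 0 ?z, cone s vertex)"
    unfolding real_unit_def real_htpy_rep[OF s] by (simp add: real_htpy_def bar_extra_unit[OF J Maps_fun[OF f]])
  also have "\<dots> = rep (0, ?z, simplex_degen 0 (cone s vertex))"
    by (rule rep_degen[OF order_refl z c])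
  also have "simplex_degen 0 (cone s vertex) = vertex"
    by (rule simplex_0[OF simplex_degen_mem[OF c order_refl]])
  finally show ?thesis unfolding real_unit_def .
qed

lemma continuous_map_real_ev: "continuous_map Fh Maps real_ev"
  unfolding fact_homology_def
proof (rule continuous_map_from_realization)
  fix q
  let ?S = "prod_topology (B J q) (simplex_space q)"
  have "continuous_map (kify ?S) (map_space (discrete_topology Jplus) A) (\<lambda>p. real_ev (q, p))"
  proof (rule continuous_map_into_finite_map_space)
    show "finite Jplus" using J by simp
    show "k_Hausdorff A" by (rule kA)
    show "real_ev (q, p) \<in> extensional Jplus" for p by (cases p) (simp add: real_ev_def)
    fix x assume x: "x \<in> Jplus"
    show "continuous_map (kify ?S) A (\<lambda>p. real_ev (q, p) x)"
    proof (cases x)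
      case None
      then show ?thesis using aA by (simp add: real_ev_def case_prod_unfold)
    next
      case (Some j)
      then have j: "j \<in> J" using x by auto
      have "continuous_map (kify ?S) A ((\<lambda>z. bev q z j) \<circ> fst)"
        by (intro continuous_map_from_kify continuous_map_compose[OF continuous_map_fst continuous_map_bar_ev[OF J j]])
      then show ?thesis using j Some by (simp add: real_ev_def case_prod_unfold o_def)
    qed
  qed
  moreover have "real_ev (q, p) None = a" for p by (cases p) (simp add: real_ev_def)
  ultimately show "continuous_map (kprod (bar_simplices V J a A q) (simplex_space q)) Maps (\<lambda>(x, t). real_ev (rep (q, x, t)))"
    unfolding real_ev_rep based_maps_def kprod_def bar_simplices_def
    by (simp add: continuous_map_in_subtopology case_prod_unfold)
qed

lemma continuous_map_real_unit: "continuous_map Maps Fh real_unit"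
proof -
  let ?C = "compact_open (discrete_topology Jplus) A"
  define P where "P = {f \<in> topspace (kify ?C). u (f None) \<in> {0}}"
  have ev: "continuous_map (kify ?C) A (\<lambda>f. f x)" if "x \<in> Jplus" for x
    using continuous_map_map_space_eval[of x "discrete_topology Jplus" A] that unfolding map_space_eq by simp
  have "continuous_map (kify ?C) euclideanreal (\<lambda>f. u (f None))"
    using continuous_map_compose[OF ev u(1)] by (simp add: o_def)
  then have P: "closedin (kify ?C) P"
    unfolding P_def by (rule closedin_continuous_map_preimage) simp
  have "topspace (kify ?C) \<inter> {f. f None = a} = P"
    unfolding P_def using u(3) ev[of None] by (auto simp: continuous_map_def Pi_iff)
  then have M: "Maps = subtopology (kify ?C) P"
    unfolding based_maps_def map_space_eq by (metis subtopology_restrict)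
  have "continuous_map (subtopology (kify ?C) P) (B J 0) (\<lambda>f. bunit J (\<lambda>j. f (Some j)))"
    unfolding bar_unit_def
  proof (rule continuous_map_glue[OF V J P k_Hausdorff_T])
    fix j assume "j \<in> J"
    then have "continuous_map (kify ?C) (T 0) (Leaf \<circ> (\<lambda>f. f (Some j)))"
      unfolding iter_simps by (intro continuous_map_compose[OF ev continuous_map_final_topology]) simp
    then show "continuous_map (subtopology (kify ?C) P) (T 0) (\<lambda>f. Leaf (f (Some j)))"
      by (simp add: o_def continuous_map_from_subtopology)
  qed
  then have "continuous_map (subtopology (kify ?C) P) (prod_topology (B J 0) (simplex_space 0))
      (\<lambda>f. (bunit J (\<lambda>j. f (Some j)), vertex))"
    unfolding continuous_map_pairwise using vertex_mem by (simp add: o_def simplex_space_props)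
  then have "continuous_map Maps (kprod (B J 0) (simplex_space 0)) (\<lambda>f. (bunit J (\<lambda>j. f (Some j)), vertex))"
    unfolding M kprod_def
    by (rule continuous_map_into_kify_closed[OF _ _ P])
       (intro k_Hausdorff_prod k_Hausdorff_B Hausdorff_imp_k_Hausdorff simplex_space_props)
  from continuous_map_compose[OF this[unfolded bar_simplices_def[symmetric]] continuous_map_to_realization[where X = "bar_simplices V J a A" and R = "bar_rel V J a A \<theta>"]]
  show ?thesis unfolding fact_homology_def real_unit_def by (simp add: o_def)
qed

lemma continuous_map_real_htpy: "continuous_map (prod_topology (top_of_set {0..1}) Fh) Fh real_htpy"
proof -
  have swapped: "continuous_map (prod_topology Fh (top_of_set {0..1})) Fh (\<lambda>(x, s). real_htpy (s, x))"
    unfolding fact_homology_def[of V J a A \<theta>]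
  proof (rule continuous_map_from_realization_prod)
    show "compact_space (top_of_set {0..1::real})" by (simp add: compact_space_subtopology)
    show "Hausdorff_space (top_of_set {0..1::real})" by (simp add: Hausdorff_space_subtopology)
    show "(case (rep (q, x, t), s) of (x, s) \<Rightarrow> real_htpy (s, x)) \<in> topspace (quotient_space Pre (bar_rel V J a A \<theta>))"
      if "x \<in> topspace (bar_simplices V J a A q)" "t \<in> standard_simplex q" "s \<in> topspace (top_of_set {0..1})" for q x t s
    proof -
      have "s \<in> {0..1}" "x \<in> topspace (B J q)" using that by (simp_all add: bar_simplices_def)
      then show ?thesis
        unfolding prod.case real_htpy_rep[OF \<open>s \<in> {0..1}\<close>] unfolding real_htpy_def prod.case fact_homology_def[symmetric]
        by (intro rep_Fh bar_extra_mem[OF J] cone_mem that(2))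
    qed
  next
    fix q C
    let ?S = "prod_topology (bar_simplices V J a A q) (simplex_space q)"
    let ?K = "prod_topology (subtopology ?S C) (top_of_set {0..1::real})"
    assume C: "compactin ?S C" "Hausdorff_space (subtopology ?S C)"
    have K: "compact_space ?K" "Hausdorff_space ?K"
      using C by (auto simp: compact_space_prod_topology Hausdorff_space_prod_topology compact_space_subtopology Hausdorff_space_subtopology)
    have p1: "continuous_map ?K (B J q) (\<lambda>p. fst (fst p))" and p2: "continuous_map ?K (simplex_space q) (\<lambda>p. snd (fst p))"
    proof -
      have "continuous_map (subtopology ?S C) (B J q) fst" "continuous_map (subtopology ?S C) (simplex_space q) snd"
        by (auto intro!: continuous_map_from_subtopology continuous_map_fst continuous_map_snd simp: bar_simplices_def)
      then show "continuous_map ?K (B J q) (\<lambda>p. fst (fst p))" "continuous_map ?K (simplex_space q) (\<lambda>p. snd (fst p))"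
        using continuous_map_compose[OF continuous_map_fst[of "subtopology ?S C" "top_of_set {0..1::real}"]]
        by (auto simp: o_def)
    qed
    have e: "continuous_map ?K (B J (Suc q)) (\<lambda>p. extra J q (fst (fst p)))"
      using continuous_map_compose[OF p1 continuous_map_bar_extra[OF J]] by (simp add: o_def)
    have t: "continuous_map ?K euclideanreal (\<lambda>p. snd (fst p) i)" and tm: "(\<lambda>p. snd (fst p)) \<in> topspace ?K \<rightarrow> standard_simplex q" for i
      using p2 unfolding continuous_map_into_simplex_space by auto
    have s: "continuous_map ?K euclideanreal snd"
      using continuous_map_snd[of "subtopology ?S C" "top_of_set {0..1::real}"] by (simp add: continuous_map_in_subtopology)
    have c: "continuous_map ?K (simplex_space (Suc q)) (\<lambda>p. cone (snd p) (snd (fst p)))"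
      unfolding continuous_map_into_simplex_space
    proof (intro conjI allI funcsetI)
      fix p assume p: "p \<in> topspace ?K"
      then have "snd p \<in> {0..1}" by auto
      then show "cone (snd p) (snd (fst p)) \<in> standard_simplex (Suc q)" using cone_mem tm p by blast
    next
      fix i
      show "continuous_map ?K euclideanreal (\<lambda>p. cone (snd p) (snd (fst p)) i)"
        unfolding cone_def using s t[of "i - 1"] by (cases "i = 0") (auto intro!: continuous_intros)
    qed
    have "continuous_map ?K (prod_topology (B J (Suc q)) (simplex_space (Suc q)))
        (\<lambda>p. (extra J q (fst (fst p)), cone (snd p) (snd (fst p))))"
      using e c by (simp add: continuous_map_pairwise o_def)
    then have "continuous_map ?K (kprod (B J (Suc q)) (simplex_space (Suc q)))
        (\<lambda>p. (extra J q (fst (fst p)), cone (snd p) (snd (fst p))))"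
      unfolding kprod_def
      by (rule continuous_map_compact_into_kify[OF _ K])
         (intro k_Hausdorff_prod k_Hausdorff_B Hausdorff_imp_k_Hausdorff simplex_space_props)
    from continuous_map_compose[OF this[unfolded bar_simplices_def[symmetric]] continuous_map_to_realization[where X = "bar_simplices V J a A" and R = "bar_rel V J a A \<theta>"]]
    have "continuous_map ?K (quotient_space Pre (bar_rel V J a A \<theta>))
        (\<lambda>p. rep (Suc q, extra J q (fst (fst p)), cone (snd p) (snd (fst p))))" by (simp add: o_def)
    then show "continuous_map ?K (quotient_space Pre (bar_rel V J a A \<theta>))
        (\<lambda>((x, t), s). case (rep (q, x, t), s) of (x, s) \<Rightarrow> real_htpy (s, x))"
    proof (rule continuous_map_eq)
      fix p assume p: "p \<in> topspace ?K"
      have "snd p \<in> {0..1}" using p by auto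
      then show "rep (Suc q, extra J q (fst (fst p)), cone (snd p) (snd (fst p))) =
          (case p of (z, s) \<Rightarrow> (case z of (x, t) \<Rightarrow> \<lambda>s. case (rep (q, x, t), s) of (x, s) \<Rightarrow> real_htpy (s, x)) s)"
        by (simp add: case_prod_unfold real_htpy_rep) (simp add: real_htpy_def case_prod_unfold)
    qed
  qed
  have "continuous_map (prod_topology (top_of_set {0..1::real}) Fh) (prod_topology Fh (top_of_set {0..1})) (\<lambda>p. (snd p, fst p))"
    by (simp add: continuous_map_pairwise o_def continuous_map_fst continuous_map_snd)
  from continuous_map_compose[OF this swapped] show ?thesis by (simp add: o_def)
qed

lemma fact_rep:
  assumes g: "g \<in> carrier G"
  shows "fhact g (rep p) = fhact g p"
proof (rule rep_invariant)
  fix q i z t assume *: "i \<le> Suc q" "z \<in> topspace (B J (Suc q))" "t \<in> standard_simplex q"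
  show "fhact g (q, bface J q i z, t) = fhact g (Suc q, z, simplical_face i t)"
    unfolding fact_homology_act_def prod.case bar_face_act[OF g *(1,2), symmetric]
    by (rule rep_face[OF *(1) bconj_mem[OF g *(2)] *(3)])
next
  fix q i z t assume *: "i \<le> q" "z \<in> topspace (B J q)" "t \<in> standard_simplex (Suc q)"
  show "fhact g (Suc q, bdegen J q i z, t) = fhact g (q, z, simplex_degen i t)"
    unfolding fact_homology_act_def prod.case bar_degen_act[OF g *(1,2), symmetric]
    by (rule rep_degen[OF *(1) bconj_mem[OF g *(2)] *(3)])
qed

lemma real_ev_act:
  assumes g: "g \<in> carrier G" and x: "x \<in> topspace Fh"
  shows "real_ev (fhact g x) = mact g (real_ev x)"
proof -
  obtain q z t where x: "x = (q, z, t)" "z \<in> topspace (B J q)" "t \<in> standard_simplex q"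
    by (rule Fh_point[OF assms(2)])
  have *: "bev q (bconj q g z) j = act g (bev q z (actJ (ginv g) j))" if "j \<in> J" for j
    using bar_ev_act[OF g x(2) actJ(1)[OF inv_carrier[OF g] that]] actJ_props(3)[OF g that] by simp
  have "real_ev (fhact g x) = real_ev (q, bconj q g z, t)"
    unfolding x(1) fact_homology_act_def prod.case by (rule real_ev_rep)
  then have "real_ev (fhact g x) y = mact g (real_ev x) y" for y
    using * act(2)[OF g] actJ(1)[OF inv_carrier[OF g]]
    by (cases y) (simp_all add: x(1) real_ev_def map_conj_def image_iff)
  then show ?thesis by blast
qed

lemma real_unit_act:
  assumes g: "g \<in> carrier G" and f: "f \<in> topspace Maps"
  shows "real_unit (mact g f) = fhact g (real_unit f)"
proof -
  have "bunit J (\<lambda>j. mact g f (Some j)) = bconj 0 g (bunit J (\<lambda>j. f (Some j)))"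
    unfolding bar_unit_act[OF g Maps_fun[OF f]] by (rule bar_unit_cong) (simp add: map_conj_def)
  then show ?thesis unfolding real_unit_def fact_rep[OF g] by (simp add: fact_homology_act_def)
qed

lemma real_htpy_act:
  assumes g: "g \<in> carrier G" and s: "s \<in> {0..1}" and x: "x \<in> topspace Fh"
  shows "real_htpy (s, fhact g x) = fhact g (real_htpy (s, x))"
proof -
  obtain q z t where x: "x = (q, z, t)" "z \<in> topspace (B J q)" "t \<in> standard_simplex q"
    by (rule Fh_point[OF assms(3)])
  have "real_htpy (s, fhact g x) = rep (Suc q, extra J q (bconj q g z), cone s t)"
    using real_htpy_rep[OF s] by (simp add: x(1) fact_homology_act_def real_htpy_def)
  also have "\<dots> = fhact g (Suc q, extra J q z, cone s t)"
    unfolding bar_extra_act[OF g x(2)] by (simp add: fact_homology_act_def)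
  also have "\<dots> = fhact g (real_htpy (s, x))"
    by (simp add: x(1) real_htpy_def fact_rep[OF g])
  finally show ?thesis .
qed

end


section \<open>The weak equivalences\<close>

text \<open>
  Now \<open>A\<close> is a compactly generated \<open>G\<close>-space, and \<open>J\<close> is a \<open>G\<close>-set.
\<close>

locale equivariant_algebra_space = equivariant_algebra V A a \<theta> u G \<rho> act J actJ
  for V :: "'v::euclidean_space set" and A :: "'a topology" and a \<theta> u and G :: "('g, 'm) monoid_scheme" and \<rho> act
    and J :: "'j set" and actJ +
  assumes kify_A: "kify A = A"
    and act_cont: "\<And>g. g \<in> carrier G \<Longrightarrow> continuous_map A A (act g)"
    and act_one: "\<And>x. x \<in> topspace A \<Longrightarrow> act \<one>\<^bsub>G\<^esub> x = x"
    and act_mult: "\<And>g h x. g \<in> carrier G \<Longrightarrow> h \<in> carrier G \<Longrightarrow> x \<in> topspace A \<Longrightarrow> act (g \<otimes>\<^bsub>G\<^esub> h) x = act g (act h x)"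
    and actJ_one: "\<And>j. j \<in> J \<Longrightarrow> actJ \<one>\<^bsub>G\<^esub> j = j"
    and actJ_mult: "\<And>g h j. g \<in> carrier G \<Longrightarrow> h \<in> carrier G \<Longrightarrow> j \<in> J \<Longrightarrow> actJ (g \<otimes>\<^bsub>G\<^esub> h) j = actJ g (actJ h j)"
begin

text \<open>
  The span of weak equivalences starts from a copy of the space of based maps, transported to the
  required type: a based map is encoded by the constant singular simplex at its image in the
  realization.
\<close>

definition real_code where
  "real_code f = (0::nat, \<lambda>_::nat \<Rightarrow> real. real_unit f, \<lambda>_::nat. 0::real)"

definition "Zsp = final_topology Maps real_code"

definition real_point where
  "real_point = (\<lambda>(n::nat, \<sigma> :: (nat \<Rightarrow> real) \<Rightarrow> _, t :: nat \<Rightarrow> real). \<sigma> t)"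

definition "Zact g z = real_code (mact g (real_ev (real_point z)))"

lemma real_point_code: "real_point (real_code f) = real_unit f"
  by (simp add: real_point_def real_code_def)

lemma decode: "f \<in> topspace Maps \<Longrightarrow> real_ev (real_point (real_code f)) = f"
  by (simp add: real_point_code real_ev_unit)

lemma topspace_Zsp: "topspace Zsp = real_code ` topspace Maps"
  by (simp add: Zsp_def)

lemma continuous_map_real_code: "continuous_map Maps Zsp real_code"
  unfolding Zsp_def by (rule continuous_map_final_topology)

lemma continuous_map_real_point: "continuous_map Zsp Fh real_point"
  unfolding Zsp_def
  by (rule continuous_map_from_final_topology) (simp add: o_def real_point_code continuous_map_real_unit)

lemma continuous_map_decode: "continuous_map Zsp Maps (\<lambda>z. real_ev (real_point z))"
  using continuous_map_compose[OF continuous_map_real_point continuous_map_real_ev] by (simp add: o_def)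

lemma mact_mem: "g \<in> carrier G \<Longrightarrow> f \<in> topspace Maps \<Longrightarrow> mact g f \<in> topspace Maps"
  using act(1)[of g] act(2)[of g] actJ(1)[OF inv_carrier[of g]]
  by (auto simp: topspace_Maps map_conj_def)

lemma real_ev_mem: "x \<in> topspace Fh \<Longrightarrow> real_ev x \<in> topspace Maps"
  using continuous_map_real_ev by (auto simp: continuous_map_def)

lemma Maps_eqI: "f \<in> topspace Maps \<Longrightarrow> f' \<in> topspace Maps \<Longrightarrow> (\<And>j. j \<in> J \<Longrightarrow> f (Some j) = f' (Some j)) \<Longrightarrow> f = f'"
  unfolding topspace_Maps by (rule extensionalityI[of _ Jplus]) auto

lemma mact_Some: "j \<in> J \<Longrightarrow> mact g f (Some j) = act g (f (Some (actJ (ginv g) j)))"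
  by (simp add: map_conj_def)

lemma continuous_map_Maps_eval: "j \<in> J \<Longrightarrow> continuous_map Maps A (\<lambda>f. f (Some j))"
  unfolding based_maps_def by (intro continuous_map_from_subtopology continuous_map_map_space_eval) simp

lemma continuous_map_into_Maps:
  assumes "\<And>s. s \<in> topspace S \<Longrightarrow> F s \<in> topspace Maps"
    and "\<And>j. j \<in> J \<Longrightarrow> continuous_map (kify S) A (\<lambda>s. F s (Some j))"
  shows "continuous_map (kify S) Maps F"
  unfolding based_maps_def continuous_map_in_subtopology
proof (intro conjI)
  show "continuous_map (kify S) (map_space (discrete_topology Jplus) A) F"
  proof (rule continuous_map_into_finite_map_space[OF _ kA])
    show "finite Jplus" using J by simp
    show "F s \<in> extensional Jplus" if "s \<in> topspace S" for s using assms(1)[OF that] by (simp add: topspace_Maps)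
    fix x assume "x \<in> Jplus"
    then consider "x = None" | j where "x = Some j" "j \<in> J" by blast
    then show "continuous_map (kify S) A (\<lambda>s. F s x)"
    proof cases
      case 1
      have "continuous_map (kify S) A (\<lambda>_. a)" using aA by simp
      then show ?thesis by (rule continuous_map_eq) (use assms(1) in \<open>simp add: 1 topspace_Maps\<close>)
    qed (use assms(2) in simp)
  qed
  show "F \<in> topspace (kify S) \<rightarrow> {f. f None = a}" using assms(1) by (auto simp: topspace_Maps)
qed

lemma continuous_map_mact:
  assumes g: "g \<in> carrier G"
  shows "continuous_map Maps Maps (mact g)"
proof -
  let ?M = "map_space (discrete_topology Jplus) A"
  have "continuous_map Maps ?M (mact g)"
  proof -
    have "continuous_map ?M ?M (mact g)"
      unfolding map_space_eq
    proof (rule continuous_map_into_finite_map_space[OF _ kA, unfolded map_space_eq])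
      show "finite Jplus" using J by simp
      show "mact g f \<in> extensional Jplus" for f by (simp add: map_conj_def)
      fix x assume x: "x \<in> Jplus"
      then have "map_option (actJ (ginv g)) x \<in> Jplus" using actJ(1)[OF inv_carrier[OF g]] by auto
      then have "continuous_map (kify (compact_open (discrete_topology Jplus) A)) A (\<lambda>f. f (map_option (actJ (ginv g)) x))"
        using continuous_map_map_space_eval[of _ "discrete_topology Jplus" A] unfolding map_space_eq by simp
      from continuous_map_compose[OF this act_cont[OF g]]
      show "continuous_map (kify (compact_open (discrete_topology Jplus) A)) A (\<lambda>f. mact g f x)"
        using x by (simp add: map_conj_def o_def)
    qed
    then show ?thesis unfolding based_maps_def by (rule continuous_map_from_subtopology)
  qed
  moreover have "mact g \<in> topspace Maps \<rightarrow> {f. f None = a}" using mact_mem[OF g] by (auto simp: topspace_Maps)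
  ultimately show ?thesis unfolding based_maps_def[of _ _ A a] continuous_map_in_subtopology by simp
qed

lemma mact_one: "f \<in> topspace Maps \<Longrightarrow> mact \<one>\<^bsub>G\<^esub> f = f"
proof -
  assume f: "f \<in> topspace Maps"
  interpret group G by (rule G)
  show ?thesis
    by (rule Maps_eqI[OF mact_mem[OF one_closed f] f])
       (use f in \<open>simp add: mact_Some actJ_one act_one topspace_Maps\<close>)
qed

lemma mact_mult:
  assumes "g \<in> carrier G" "h \<in> carrier G" "f \<in> topspace Maps"
  shows "mact (g \<otimes>\<^bsub>G\<^esub> h) f = mact g (mact h f)"
proof -
  interpret group G by (rule G)
  show ?thesis
  proof (rule Maps_eqI[OF mact_mem[OF m_closed[OF assms(1,2)] assms(3)] mact_mem[OF assms(1) mact_mem[OF assms(2,3)]]])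
    fix j assume j: "j \<in> J"
    have gj: "actJ (ginv g) j \<in> J" by (rule actJ(1)[OF inv_carrier[OF assms(1)] j])
    have hj: "actJ (ginv h) (actJ (ginv g) j) \<in> J" by (rule actJ(1)[OF inv_carrier[OF assms(2)] gj])
    have "actJ (ginv (g \<otimes>\<^bsub>G\<^esub> h)) j = actJ (ginv h) (actJ (ginv g) j)"
      using actJ_mult[of "ginv h" "ginv g" j] assms j by (simp add: inv_mult_group)
    then show "mact (g \<otimes>\<^bsub>G\<^esub> h) f (Some j) = mact g (mact h f) (Some j)"
      using act_mult[OF assms(1,2), of "f (Some (actJ (ginv h) (actJ (ginv g) j)))"] assms(3) hj
      by (simp add: mact_Some[OF j] mact_Some[OF gj] topspace_Maps)
  qed
qed

lemma Zact_code: "f \<in> topspace Maps \<Longrightarrow> Zact g (real_code f) = real_code (mact g f)"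
  by (simp add: Zact_def decode)

lemma G_space_Zsp: "G_space G Zsp Zact"
  unfolding G_space_def
proof (intro conjI ballI)
  interpret group G by (rule G)
  show "group_action G (topspace Zsp) (\<lambda>g. restrict (Zact g) (topspace Zsp))"
    by (rule group_actionI[OF G])
       (auto simp: topspace_Zsp Zact_code mact_mem mact_one mact_mult)
  fix g assume g: "g \<in> carrier G"
  show "continuous_map Zsp Zsp (Zact g)"
    using continuous_map_compose[OF continuous_map_compose[OF continuous_map_decode continuous_map_mact[OF g]] continuous_map_real_code]
    by (simp add: Zact_def[abs_def] o_def)
qed

lemma real_point_act:
  assumes "g \<in> carrier G" "z \<in> topspace Zsp"
  shows "real_point (Zact g z) = fhact g (real_point z)"
proof -
  obtain f where f: "z = real_code f" "f \<in> topspace Maps" using assms(2) unfolding topspace_Zsp by blast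
  show ?thesis unfolding f(1) Zact_code[OF f(2)] real_point_code by (rule real_unit_act[OF assms(1) f(2)])
qed

lemma decode_act:
  assumes "g \<in> carrier G" "z \<in> topspace Zsp"
  shows "real_ev (real_point (Zact g z)) = mact g (real_ev (real_point z))"
proof -
  obtain f where f: "z = real_code f" "f \<in> topspace Maps" using assms(2) unfolding topspace_Zsp by blast
  show ?thesis unfolding f(1) Zact_code[OF f(2)] by (simp add: decode f(2) mact_mem[OF assms(1) f(2)])
qed

lemma weak_equivalence_real_point:
  assumes K: "K \<subseteq> carrier G"
  shows "weak_equivalence (fixed_points K Zsp Zact) (fixed_points K Fh fhact) real_point"
proof (rule weak_equivalence_fixed_points[where r = "real_code \<circ> real_ev" and h = real_htpy])
  show "continuous_map Fh Zsp (real_code \<circ> real_ev)"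
    by (rule continuous_map_compose[OF continuous_map_real_ev continuous_map_real_code])
  show "(real_code \<circ> real_ev) (real_point z) = z" if "z \<in> topspace Zsp" for z
    using that by (auto simp: topspace_Zsp decode)
  show "real_htpy (1, x) = real_point ((real_code \<circ> real_ev) x)" if "x \<in> topspace Fh" for x
    using real_htpy_1[OF that] by (simp add: real_point_code)
  show "real_htpy (t, real_point z) = real_point z" if "t \<in> {0..1}" "z \<in> topspace Zsp" for t z
    using that real_htpy_unit by (auto simp: topspace_Zsp real_point_code)
  show "real_point (Zact g z) = fhact g (real_point z)" if "g \<in> K" "z \<in> topspace Zsp" for g z
    using that K real_point_act by blast
  show "(real_code \<circ> real_ev) (fhact g x) = Zact g ((real_code \<circ> real_ev) x)" if "g \<in> K" "x \<in> topspace Fh" for g x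
    using that K real_ev_act[of g x] by (auto simp: Zact_code real_ev_mem)
  show "real_htpy (t, fhact g x) = fhact g (real_htpy (t, x))" if "g \<in> K" "t \<in> {0..1}" "x \<in> topspace Fh" for g t x
    using that K real_htpy_act by blast
qed (rule continuous_map_real_point continuous_map_real_htpy real_htpy_0, assumption?)+

lemma weak_equivalence_decode:
  assumes K: "K \<subseteq> carrier G"
  shows "weak_equivalence (fixed_points K Zsp Zact) (fixed_points K Maps mact) (\<lambda>z. real_ev (real_point z))"
proof (rule weak_equivalence_fixed_points[where r = real_code and h = snd])
  show "continuous_map (prod_topology (top_of_set {0..1::real}) Maps) Maps snd" by (rule continuous_map_snd)
  show "real_code (real_ev (real_point z)) = z" if "z \<in> topspace Zsp" for z
    using that by (auto simp: topspace_Zsp decode)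
  show "real_ev (real_point (Zact g z)) = mact g (real_ev (real_point z))" if "g \<in> K" "z \<in> topspace Zsp" for g z
    using that K decode_act by blast
  show "real_code (mact g f) = Zact g (real_code f)" if "g \<in> K" "f \<in> topspace Maps" for g f
    using that by (simp add: Zact_code)
qed (simp_all add: continuous_map_decode continuous_map_real_code decode)

theorem weakly_G_equivalent_Maps: "weakly_G_equivalent G Fh fhact Maps mact"
  unfolding weakly_G_equivalent_def
proof (intro exI conjI)
  show "G_space G Zsp Zact" by (rule G_space_Zsp)
  show "weak_G_equivalence G Zsp Zact Fh fhact real_point"
    unfolding weak_G_equivalence_def equivariant_on_def
    using continuous_map_real_point real_point_act weak_equivalence_real_point[OF subgroup.subset] by blast
  show "weak_G_equivalence G Zsp Zact Maps mact (\<lambda>z. real_ev (real_point z))"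
    unfolding weak_G_equivalence_def equivariant_on_def
    using continuous_map_decode decode_act weak_equivalence_decode[OF subgroup.subset] by blast
qed

text \<open>
  If \<open>J\<close> is transitive and \<open>H\<close> is the stabilizer of \<open>j0\<close>, then an equivariant family of points of \<open>A\<close> is
  determined by its value at \<open>j0\<close>, which is fixed by \<open>H\<close>; \<open>k j\<close> is an element that moves \<open>j0\<close> to \<open>j\<close>.
\<close>

lemma weakly_equivalent_fixed_points:
  assumes H: "H \<subseteq> carrier G" and j0: "j0 \<in> J" "\<And>h. h \<in> H \<Longrightarrow> actJ h j0 = j0"
    and k: "\<And>j. j \<in> J \<Longrightarrow> k j \<in> carrier G \<and> actJ (k j) j0 = j"
    and stab: "\<And>g. g \<in> carrier G \<Longrightarrow> actJ g j0 = j0 \<Longrightarrow> g \<in> H"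
  shows "weakly_equivalent (fixed_points (carrier G) Fh fhact) (fixed_points H A act)"
proof -
  interpret group G by (rule G)
  let ?ZG = "{z \<in> topspace Zsp. \<forall>g\<in>carrier G. Zact g z = z}" and ?AH = "{x \<in> topspace A. \<forall>h\<in>H. act h x = x}"
  define r where "r x = (\<lambda>y\<in>Jplus. case y of None \<Rightarrow> a | Some j \<Rightarrow> act (k j) x)" for x
  have r: "r x \<in> topspace Maps" if "x \<in> topspace A" for x
    using that k act(1) by (auto simp: topspace_Maps r_def Pi_iff)
  have rS: "r x (Some j) = act (k j) x" if "j \<in> J" for x j using that by (simp add: r_def)
  have "continuous_map (kify A) Maps r"
  proof (rule continuous_map_into_Maps[OF r])
    fix j assume j: "j \<in> J"
    then show "continuous_map (kify A) A (\<lambda>x. r x (Some j))" unfolding kify_A rS[OF j] using act_cont k by blast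
  qed
  then have cr: "continuous_map A Zsp (real_code \<circ> r)"
    unfolding kify_A by (rule continuous_map_compose[OF _ continuous_map_real_code])
  have same: "act g x = act g' x" if "g \<in> carrier G" "g' \<in> carrier G" "actJ g j0 = actJ g' j0" "x \<in> ?AH" for g g' x
  proof -
    have "actJ (ginv g' \<otimes>\<^bsub>G\<^esub> g) j0 = j0" using actJ_mult[of "ginv g'" g j0] actJ(2)[of g' j0] that j0(1) by simp
    then have "ginv g' \<otimes>\<^bsub>G\<^esub> g \<in> H" using stab that by simp
    then have "act (ginv g' \<otimes>\<^bsub>G\<^esub> g) x = x" using that(4) by blast
    then have "act g' x = act (g' \<otimes>\<^bsub>G\<^esub> (ginv g' \<otimes>\<^bsub>G\<^esub> g)) x" using act_mult[of g' "ginv g' \<otimes>\<^bsub>G\<^esub> g" x] that by simp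
    also have "g' \<otimes>\<^bsub>G\<^esub> (ginv g' \<otimes>\<^bsub>G\<^esub> g) = g" using that by (simp add: m_assoc[symmetric])
    finally show ?thesis by simp
  qed
  have rfix: "mact g (r x) = r x" if g: "g \<in> carrier G" and x: "x \<in> ?AH" for g x
  proof (rule Maps_eqI[OF mact_mem[OF g r] r])
    fix j assume j: "j \<in> J"
    note gj = actJ(1)[OF inv_carrier[OF g] j]
    have "mact g (r x) (Some j) = act (g \<otimes>\<^bsub>G\<^esub> k (actJ (ginv g) j)) x"
      unfolding mact_Some[OF j] rS[OF gj] using act_mult[OF g] k[OF gj] x by simp
    also have "\<dots> = act (k j) x"
    proof (rule same[OF _ _ _ x])
      show "actJ (g \<otimes>\<^bsub>G\<^esub> k (actJ (ginv g) j)) j0 = actJ (k j) j0"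
        using actJ_mult[OF g _ j0(1), of "k (actJ (ginv g) j)"] k[OF gj] k[OF j] actJ_props(3)[OF g j] by simp
    qed (use g k[OF gj] k[OF j] in auto)
    finally show "mact g (r x) (Some j) = r x (Some j)" by (simp add: rS[OF j])
  qed (use x in auto)
  have fixed: "act g (f (Some j0)) = f (Some (actJ g j0))" if g: "g \<in> carrier G" and f: "mact g f = f" for g f
    using mact_Some[OF actJ(1)[OF g j0(1)], of g f] unfolding f actJ(2)[OF g j0(1)] by simp
  have code_fix: "mact g f = f" if "real_code f \<in> ?ZG" "f \<in> topspace Maps" "g \<in> carrier G" for f g
  proof -
    have "real_code (mact g f) = real_code f" using that Zact_code[OF that(2), of g] by simp
    from arg_cong[OF this, of "\<lambda>z. real_ev (real_point z)"]
    show ?thesis by (simp add: decode that(2) mact_mem[OF that(3,2)])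
  qed
  have "weak_equivalence (fixed_points (carrier G) Zsp Zact) (fixed_points H A act) (\<lambda>z. real_ev (real_point z) (Some j0))"
    unfolding fixed_points_def
  proof (rule weak_equivalence_deformation_retract[where r = "real_code \<circ> r" and h = snd])
    have m: "real_ev (real_point z) (Some j0) \<in> ?AH" if "z \<in> ?ZG" for z
    proof -
      obtain f where f: "z = real_code f" "f \<in> topspace Maps" using \<open>z \<in> ?ZG\<close> unfolding topspace_Zsp by blast
      have "act h (f (Some j0)) = f (Some j0)" if h: "h \<in> H" for h
        using fixed[OF _ code_fix[OF \<open>z \<in> ?ZG\<close>[unfolded f(1)] f(2)], of h] H h j0(2)[OF h] by auto
      then show ?thesis using f(2) j0(1) unfolding f(1) decode[OF f(2)] by (simp add: topspace_Maps)
    qed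
    have "continuous_map Zsp A (\<lambda>z. real_ev (real_point z) (Some j0))"
      using continuous_map_compose[OF continuous_map_decode continuous_map_Maps_eval[OF j0(1)]] by (simp add: o_def)
    then show "continuous_map (subtopology Zsp ?ZG) (subtopology A ?AH) (\<lambda>z. real_ev (real_point z) (Some j0))"
      using m by (auto simp: continuous_map_in_subtopology continuous_map_from_subtopology)
    have "(real_code \<circ> r) x \<in> ?ZG" if x: "x \<in> ?AH" for x
      using r[of x] rfix[OF _ x] x by (auto simp: topspace_Zsp Zact_code)
    then show "continuous_map (subtopology A ?AH) (subtopology Zsp ?ZG) (real_code \<circ> r)"
      using cr by (auto simp: continuous_map_in_subtopology continuous_map_from_subtopology)
    show "(real_code \<circ> r) (real_ev (real_point z) (Some j0)) = z" if "z \<in> topspace (subtopology Zsp ?ZG)" for z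
    proof -
      have z: "z \<in> ?ZG" using that by simp
      then obtain f where f: "z = real_code f" "f \<in> topspace Maps" unfolding topspace_Zsp by blast
      have fx: "f (Some j0) \<in> topspace A" using f(2) j0(1) by (simp add: topspace_Maps)
      have "r (f (Some j0)) = f"
      proof (rule Maps_eqI[OF r[OF fx] f(2)])
        fix j assume j: "j \<in> J"
        show "r (f (Some j0)) (Some j) = f (Some j)"
          using fixed[of "k j" f] code_fix[OF z[unfolded f(1)] f(2)] k[OF j] by (simp add: rS[OF j])
      qed
      then show ?thesis unfolding f(1) decode[OF f(2)] by simp
    qed
    show "snd (1::real, x) = real_ev (real_point ((real_code \<circ> r) x)) (Some j0)" if "x \<in> topspace (subtopology A ?AH)" for x
    proof -
      have x: "x \<in> ?AH" using that by simp
      have "act (k j0) x = act \<one>\<^bsub>G\<^esub> x" by (rule same[OF _ _ _ x]) (use k[OF j0(1)] actJ_one[OF j0(1)] in auto)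
      then show ?thesis using x by (simp add: decode r rS[OF j0(1)] act_one)
    qed
    show "continuous_map (prod_topology (top_of_set {0..1::real}) (subtopology A ?AH)) (subtopology A ?AH) snd"
      by (rule continuous_map_snd)
  qed simp_all
  moreover have "weak_equivalence (fixed_points (carrier G) Zsp Zact) (fixed_points (carrier G) Fh fhact) real_point"
    by (rule weak_equivalence_real_point[OF subset_refl])
  ultimately show ?thesis unfolding weakly_equivalent_def by blast
qed

end

theorem corollary1p7:
  fixes G :: "'g monoid" and H :: "'g set"
    and V :: "'v::euclidean_space set" and \<rho> :: "'g \<Rightarrow> 'v \<Rightarrow> 'v" and n :: nat
    and A :: "'a topology" and act :: "'g \<Rightarrow> 'a \<Rightarrow> 'a" and a :: 'a
    and \<theta> :: "('v, unit, 'a) D_point \<Rightarrow> 'a"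
  assumes "group G" and "finite (carrier G)" and "subgroup H G"
    and "orthogonal_rep G V \<rho>" and "dim V = n"
    and "CGWH A" and "G_space G A act"
    and "D_algebra G V \<rho> a A act \<theta>"
    and "nondegenerate_base G A act a"
    and "G_connected G A act"
  shows "weakly_G_equivalent G
           (fact_homology V (lcosets\<^bsub>G\<^esub> H) a A \<theta>)
           (fact_homology_act G V \<rho> (lcosets\<^bsub>G\<^esub> H) (orbit_act G) a A act \<theta>)
           (based_maps (orbit_plus G H) None A a)
           (map_conj G (orbit_plus G H) (\<lambda>g. map_option (orbit_act G g)) act)
       \<and> weakly_equivalent
           (fixed_points (carrier G)
              (fact_homology V (lcosets\<^bsub>G\<^esub> H) a A \<theta>)
              (fact_homology_act G V \<rho> (lcosets\<^bsub>G\<^esub> H) (orbit_act G) a A act \<theta>))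
           (fixed_points H A act)"
proof -
  interpret group G by fact
  interpret S: subgroup H G by fact
  let ?J = "lcosets\<^bsub>G\<^esub> H"
  obtain u :: "'a \<Rightarrow> real" where u: "continuous_map A (top_of_set {0..1}) u" "{x \<in> topspace A. u x = 0} = {a}"
    using \<open>nondegenerate_base G A act a\<close> unfolding nondegenerate_base_def by blast
  interpret A: group_action G "topspace A" "\<lambda>g. restrict (act g) (topspace A)"
    using \<open>G_space G A act\<close> by (simp add: G_space_def)
  have actm: "act g x \<in> topspace A" if "g \<in> carrier G" "x \<in> topspace A" for g x
    using A.element_image[OF that refl] that(2) by simp
  have act1: "act \<one>\<^bsub>G\<^esub> x = x" if "x \<in> topspace A" for x
    using fun_cong[OF A.id_eq_one, of x] that by simp
  have act2: "act (g \<otimes>\<^bsub>G\<^esub> h) x = act g (act h x)" if "g \<in> carrier G" "h \<in> carrier G" "x \<in> topspace A" for g h x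
    using A.composition_rule[OF that(3,1,2)] that(3) actm[OF that(2,3)] by simp
  note alg = \<open>D_algebra G V \<rho> a A act \<theta>\<close>[unfolded D_algebra_def equivariant_on_def]
  have H: "H \<in> ?J" unfolding LCOSETS_def using lcos_mult_one[OF S.subset] by force
  have o1: "orbit_act G g c \<in> ?J" if g: "g \<in> carrier G" and c: "c \<in> ?J" for g c
    using g c lcos_m_assoc[OF S.subset g] by (auto simp: LCOSETS_def orbit_act_def)
  have o2: "orbit_act G (g \<otimes>\<^bsub>G\<^esub> h) c = orbit_act G g (orbit_act G h c)" if "g \<in> carrier G" "h \<in> carrier G" "c \<in> ?J" for g h c
    using lcos_m_assoc[OF S.lcosets_carrier[OF group_axioms that(3)] that(1,2)] by (simp add: orbit_act_def)
  have o3: "orbit_act G \<one>\<^bsub>G\<^esub> c = c" if "c \<in> ?J" for c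
    using lcos_mult_one[OF S.lcosets_carrier[OF group_axioms that]] by (simp add: orbit_act_def)
  have \<theta>: "continuous_map (D_space V {()} a A) A \<theta>" using alg by blast
  interpret equivariant_algebra_space V A a \<theta> u G \<rho> act ?J "orbit_act G"
  proof (unfold_locales, goal_cases)
    case 1 then show ?case using \<open>orthogonal_rep G V \<rho>\<close> by (simp add: orthogonal_rep_def)
  next
    case 2 then show ?case using \<open>CGWH A\<close> by (intro weak_Hausdorff_imp_k_Hausdorff) (simp add: CGWH_def)
  next
    case 3 then show ?case using u(2) by blast
  next
    case 4 then show ?case using u(1) by (simp add: continuous_map_in_subtopology)
  next
    case (5 x) then show ?case using u(1) by (auto simp: continuous_map_in_subtopology)
  next
    case (6 x) then show ?case using u(2) by blast
  next
    case (17 g c) then show ?case using o2[of "inv\<^bsub>G\<^esub> g" g c, symmetric] o3 by simp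
  next
    case 18 then show ?case using \<open>CGWH A\<close> by (simp add: CGWH_def)
  next
    case 15 then show ?case using \<open>finite (carrier G)\<close> by (simp add: LCOSETS_def)
  qed (use alg actm act1 act2 o1 o2 o3 \<open>orthogonal_rep G V \<rho>\<close> \<open>G_space G A act\<close> group_axioms in \<open>auto simp: G_space_def\<close>)
  have "weakly_equivalent (fixed_points (carrier G) Fh fhact) (fixed_points H A act)"
  proof (rule weakly_equivalent_fixed_points[OF S.subset H])
    fix h assume "h \<in> H"
    then show "orbit_act G h H = H"
      unfolding orbit_act_def using coset_join3[OF S.mem_carrier \<open>subgroup H G\<close>] by blast
  next
    fix c assume "c \<in> ?J"
    then have "\<exists>g. g \<in> carrier G \<and> orbit_act G g H = c" by (auto simp: LCOSETS_def orbit_act_def)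
    then show "(SOME g. g \<in> carrier G \<and> orbit_act G g H = c) \<in> carrier G \<and>
        orbit_act G (SOME g. g \<in> carrier G \<and> orbit_act G g H = c) H = c" by (rule someI_ex)
  next
    fix g assume g: "g \<in> carrier G" "orbit_act G g H = H"
    then show "g \<in> H" using lcos_self[OF g(1) \<open>subgroup H G\<close>] by (simp add: orbit_act_def)
  qed
  with weakly_G_equivalent_Maps show ?thesis unfolding orbit_plus_def by blast
qed


end
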